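(* Let $U\subset\mathbb{R}^d$ be open and bounded, let $\mathcal{A}(\lambda)=\{A_k(\lambda)\}_{k=1}^N$ be a parametrized family of non-singular real $2\times2$ matrices with $\|A_k(\lambda)\|<1$, and let $\Phi(\lambda)=\{x\mapsto A_k(\lambda)x+t_k(\lambda)\}_{k=1}^N$ be a parametrized family of affine iterated function systems on the plane such that (i) for every $\lambda\in U$ the system $\Phi(\lambda)$ satisfies the strong separation condition; (ii) $\mathcal{A}(\lambda)$ satisfies the strong-stable transversality on $U$. Let $\{\mu_\lambda\}_{\lambda\in U}$ be a parametrized family of $\sigma_-$-invariant ergodic Gibbs measures on $\Sigma^-$ such that the family of the corresponding Hölder continuous potential functions $\{\phi_\lambda\}_{\lambda\in U}$ is uniformly continuously parametrized, and moreover (iii) for every $\lambda\in U$, either $$\frac{h_{\mu_\lambda}}{\chi^{ss}_{\mu_\lambda}(\lambda)-\chi^s_{\mu_\lambda}(\lambda)}\ge\min\left\{1,\frac{h_{\mu_\lambda}}{\chi^s_{\mu_\lambda}(\lambda)}\right\}\quad\text{or}\quad\frac{h_{\mu_\lambda}}{\chi^{ss}_{\mu_\lambda}(\lambda)-\chi^s_{\mu_\lambda}(\lambda)}+2\,\frac{h_{\mu_\lambda}}{\chi^{ss}_{\mu_\lambda}(\lambda)}>2.$$ Then $$\dim_H(\pi^-_\lambda)_*\mu_\lambda=\min\left\{\frac{h_{\mu_\lambda}}{\chi^s_{\mu_\lambda}(\lambda)},\,1+\frac{h_{\mu_\lambda}-\chi^s_{\mu_\lambda}(\lambda)}{\chi^{ss}_{\mu_\lambda}(\lambda)}\right\}\quad\text{for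 }\mathcal{L}_d\text{-a.e. }\lambda\in U.$$
   Context: $\mathcal{L}_d$ is Lebesgue measure on $\mathbb{R}^d$. Symbolic spaces: $\Sigma=\{1,\dots,N\}^{\mathbb{Z}}$; $\Sigma^+$ is the set of right-infinite words $(i_0i_1\dots)$; $\Sigma^-$ is the set of left-infinite words $\mathbf{i}_-=(\dots i_{-2}i_{-1})$. $\sigma$ is the left shift on $\Sigma,\Sigma^+$; $\sigma_-$ is the right shift on $\Sigma$, $\Sigma^-$ ($\sigma_-(\dots i_{-2}i_{-1})=(\dots i_{-3}i_{-2})$ on $\Sigma^-$). $[\mathbf{i}|_m^n]=\{\mathbf{j}:j_k=i_k,\ m\le k\le n\}$. Gibbs measure of a Hölder continuous potential $\phi:\Sigma^-\to\mathbb{R}$: a $\sigma_-$-invariant Borel probability measure $\mu$ on $\Sigma^-$ for which there are $C>0$, $P\in\mathbb{R}$ with $C^{-1}\le\mu([\mathbf{i}_-|_{-n}^{-1}])/e^{-nP+\sum_{k=0}^{n-1}\phi(\sigma_-^k\mathbf{i}_-)}\le C$ for all $\mathbf{i}_-\in\Sigma^-$, $n\ge1$. It exists and is unique and ergodic. $h_\mu$ is its entropy. The family $\{\phi_\lambda\}$ is uniformly continuously parametrized if for every $\lambda_0\in U$ and $\varepsilon>0$ there is $\delta>0$ such that $\|\lambda-\lambda_0\|<\delta$ implies $|\phi_\lambda(\mathbf{i}_-)-\phi_{\lambda_0}(\mathbf{i}_-)|<\varepsilon$ for all $\mathbf{i}_-\in\Sigma^-$. $\alpha_1(A)\ge\alpha_2(A)$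 are the singular values of $A$. A finite set $\{A_i\}_{i=1}^N$ of non-singular matrices satisfies the dominated splitting if there are $C,\beta>0$ with $\alpha_1(A_{i_0}\cdots A_{i_{n-1}})/\alpha_2(A_{i_0}\cdots A_{i_{n-1}})\ge Ce^{n\beta}$ for all $n\ge1$ and $i_0,\dots,i_{n-1}$. Put $A^{(n)}(\mathbf{i})=A_{i_{n-1}}\cdots A_{i_0}$ and, for a line $\theta$ through $0$, $\|A|\theta\|=\|Av\|/\|v\|$ for $0\ne v\in\theta$. Under dominated splitting there are unique families of lines $e^s(\mathbf{i}),e^{ss}(\mathbf{i})$, $\mathbf{i}\in\Sigma$, with $A_{i_0}e^j(\mathbf{i})=e^j(\sigma\mathbf{i})$ ($j=s,ss$) and, for some $K\ge1$ and all $n,\mathbf{i}$, $K^{-1}\alpha_1(A^{(n)}(\mathbf{i}))\le\|A^{(n)}(\mathbf{i})|e^s(\mathbf{i})\|\le K\alpha_1(A^{(n)}(\mathbf{i}))$, $K^{-1}\alpha_2(A^{(n)}(\mathbf{i}))\le\|A^{(n)}(\mathbf{i})|e^{ss}(\mathbf{i})\|\le K\alpha_2(A^{(n)}(\mathbf{i}))$. The line $e^{ss}(\mathbf{i})$ depends only on $\mathbf{i}_+=(i_0i_1\dots)\in\Sigma^+$. For $\mathcal{A}(\lambda)$ write $e^{ss}_\lambda:\Sigma^+\to\mathbf{P}^1$, where $\mathbf{P}^1$ is the projective line (lines through $0$ in $\mathbb{R}^2$) with metric $\sphericalangle(x,y)$ = angle between the lines $x,y$. Strong-stable transversality on $U$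 means: $\lambda\mapsto A_i(\lambda)$ is continuous on an open neighbourhood of $\overline U$ for each $i$; $\mathcal{A}(\lambda)$ satisfies the dominated splitting for every $\lambda\in\overline U$; and there is $C>0$ such that for all $\mathbf{i},\mathbf{j}\in\Sigma^+$ with $i_0\ne j_0$ and all $r>0$, $\mathcal{L}_d\{\lambda\in U:\sphericalangle(e^{ss}_\lambda(\mathbf{i}),e^{ss}_\lambda(\mathbf{j}))<r\}\le Cr$. Lyapunov exponents: $\chi^s_{\mu_\lambda}(\lambda)\le\chi^{ss}_{\mu_\lambda}(\lambda)$ are the constants with $-\frac1n\log\alpha_1(A_{i_{-1}}(\lambda)\cdots A_{i_{-n}}(\lambda))\to\chi^s_{\mu_\lambda}(\lambda)$ and $-\frac1n\log\alpha_2(A_{i_{-1}}(\lambda)\cdots A_{i_{-n}}(\lambda))\to\chi^{ss}_{\mu_\lambda}(\lambda)$ for $\mu_\lambda$-a.e. $\mathbf{i}_-\in\Sigma^-$. The attractor $\Lambda$ of an iterated function system $\{f_i\}$ of contractions is the unique non-empty compact set with $\Lambda=\bigcup_if_i(\Lambda)$; strong separation condition: $f_i(\Lambda)\cap f_j(\Lambda)=\emptyset$ for $i\ne j$. With $f_k^\lambda(x)=A_k(\lambda)x+t_k(\lambda)$, the natural projection is $\pi^-_\lambda(\dots i_{-2}i_{-1})=\lim_{n\to\infty}f^\lambda_{i_{-1}}\circ\cdots\circ f^\lambda_{i_{-n}}(0)$. For a Borel probability measure $m$, $\dim_Hm=\inf\{\dim_HE:m(E)=1\}$. *)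

theory Defs
  imports "HOL-Probability.Probability"
begin

text \<open>The alphabet \<open>{1,\<dots>,N}\<close> is a finite type \<open>'k\<close>. A two-sided word is a function
  \<open>int \<Rightarrow> 'k\<close> and a right-infinite word \<open>i\<^sub>0 i\<^sub>1 \<dots>\<close> a function \<open>nat \<Rightarrow> 'k\<close>. A left-infinite word
  \<open>\<dots> i\<^sub>-\<^sub>2 i\<^sub>-\<^sub>1\<close> is also a function \<open>nat \<Rightarrow> 'k\<close>, read away from the origin: its value at \<open>n\<close> is the
  letter with index \<open>- (n + 1)\<close>.\<close>

type_synonym 'k two_sided = "int \<Rightarrow> 'k"
type_synonym 'k right_word = "nat \<Rightarrow> 'k"
type_synonym 'k left_word = "nat \<Rightarrow> 'k"

definition shift :: "'k two_sided \<Rightarrow> 'k two_sided" where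
  "shift i = (\<lambda>n. i (n + 1))"

text \<open>The right shift \<open>\<sigma>\<^sub>-\<close> on left-infinite words drops the letter with index \<open>-1\<close>.\<close>

definition right_shift :: "'k left_word \<Rightarrow> 'k left_word" where
  "right_shift i = (\<lambda>n. i (Suc n))"

text \<open>The set of left-infinite words agreeing with \<open>i\<close> at the indices \<open>-n, \<dots>, -1\<close>.\<close>

definition cylinder :: "'k left_word \<Rightarrow> nat \<Rightarrow> 'k left_word set" where
  "cylinder i n = {j. \<forall>k<n. j k = i k}"

text \<open>Since the alphabet is finite and discrete and the index set is countable, the product
  sigma-algebra is the Borel sigma-algebra of the product topology.\<close>

definition left_words :: "('k::finite) left_word measure" where
  "left_words = (\<Pi>\<^sub>M n\<in>UNIV. count_space UNIV)"

definition invariant_measure :: "'a measure \<Rightarrow> ('a \<Rightarrow> 'a) \<Rightarrow> bool" where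
  "invariant_measure M T \<longleftrightarrow> T \<in> measurable M M \<and> distr M M T = M"

definition ergodic_measure :: "'a measure \<Rightarrow> ('a \<Rightarrow> 'a) \<Rightarrow> bool" where
  "ergodic_measure M T \<longleftrightarrow>
     (\<forall>B\<in>sets M. T -` B \<inter> space M = B \<longrightarrow> measure M B = 0 \<or> measure M B = 1)"

definition finite_partition :: "'a measure \<Rightarrow> 'a set set \<Rightarrow> bool" where
  "finite_partition M P \<longleftrightarrow> finite P \<and> P \<subseteq> sets M \<and> partition_on (space M) P"

text \<open>The join of the preimages of the partition \<open>P\<close> under \<open>T^0, \<dots>, T^(n-1)\<close>. It may contain the
  empty set, which contributes nothing to the entropy because \<open>0 * ln 0 = 0\<close>.\<close>

definition partition_join ::
    "'a measure \<Rightarrow> ('a \<Rightarrow> 'a) \<Rightarrow> 'a set set \<Rightarrow> nat \<Rightarrow> 'a set set" where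
  "partition_join M T P n =
     {{x \<in> space M. \<forall>k<n. (T ^^ k) x \<in> c k} | c. \<forall>k. c k \<in> P}"

definition partition_entropy :: "'a measure \<Rightarrow> 'a set set \<Rightarrow> real" where
  "partition_entropy M P = - (\<Sum>B\<in>P. measure M B * ln (measure M B))"

text \<open>Kolmogorov--Sinai entropy. For a shift over a finite alphabet the supremum is at most the
  logarithm of the number of letters, so that the conversion to a real number loses nothing.\<close>

definition ks_entropy :: "'a measure \<Rightarrow> ('a \<Rightarrow> 'a) \<Rightarrow> ereal" where
  "ks_entropy M T =
     (SUP P\<in>{P. finite_partition M P}.
        ereal (lim (\<lambda>n. partition_entropy M (partition_join M T P n) / real n)))"

definition shift_entropy :: "('k::finite) left_word measure \<Rightarrow> real" where
  "shift_entropy \<mu> = real_of_ereal (ks_entropy \<mu> right_shift)"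

text \<open>The usual metric on words, \<open>2^(-m)\<close> with \<open>m\<close> the length of the longest common initial block
  (read away from the origin). The class of Hoelder continuous functions is the same for every
  base greater than 1.\<close>

definition word_dist :: "'k left_word \<Rightarrow> 'k left_word \<Rightarrow> real" where
  "word_dist i j = (if i = j then 0 else (1/2) ^ (LEAST n. i n \<noteq> j n))"

definition hoelder_continuous :: "('k left_word \<Rightarrow> real) \<Rightarrow> bool" where
  "hoelder_continuous \<phi> \<longleftrightarrow>
     (\<exists>c. \<exists>a>0. \<forall>i j. \<bar>\<phi> i - \<phi> j\<bar> \<le> c * word_dist i j powr a)"

definition gibbs_measure :: "('k::finite left_word \<Rightarrow> real) \<Rightarrow> 'k left_word measure \<Rightarrow> bool" where
  "gibbs_measure \<phi> \<mu> \<longleftrightarrow>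
     prob_space \<mu> \<and> sets \<mu> = sets left_words \<and> invariant_measure \<mu> right_shift \<and>
     (\<exists>C>0. \<exists>P. \<forall>i. \<forall>n\<ge>1.
        (let q = measure \<mu> (cylinder i n)
                 / exp (- real n * P + (\<Sum>k<n. \<phi> ((right_shift ^^ k) i)))
         in inverse C \<le> q \<and> q \<le> C))"

definition uniformly_continuously_parametrized ::
    "(real^'d) set \<Rightarrow> (real^'d \<Rightarrow> 'k left_word \<Rightarrow> real) \<Rightarrow> bool" where
  "uniformly_continuously_parametrized U \<phi> \<longleftrightarrow>
     (\<forall>p\<^sub>0\<in>U. \<forall>\<epsilon>>0. \<exists>\<delta>>0. \<forall>p\<in>U. norm (p - p\<^sub>0) < \<delta> \<longrightarrow> (\<forall>i. \<bar>\<phi> p i - \<phi> p\<^sub>0 i\<bar> < \<epsilon>))"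

text \<open>Singular values are the square roots of the eigenvalues of \<open>A\<^sup>T A\<close>. This symmetric
  2-by-2 matrix has at least one and at most two distinct eigenvalues, so the largest and the
  smallest one list them all with multiplicity.\<close>

definition gram_eigenvalues :: "real^2^2 \<Rightarrow> real set" where
  "gram_eigenvalues A = {c. \<exists>v. v \<noteq> 0 \<and> (transpose A ** A) *v v = c *\<^sub>R v}"

definition sing_val1 :: "real^2^2 \<Rightarrow> real" where
  "sing_val1 A = sqrt (Max (gram_eigenvalues A))"

definition sing_val2 :: "real^2^2 \<Rightarrow> real" where
  "sing_val2 A = sqrt (Min (gram_eigenvalues A))"

text \<open>The product of the matrices in the order of the list: \<open>[a, b, c]\<close> gives
  \<open>A a ** A b ** A c\<close>.\<close>

definition word_prod :: "('k \<Rightarrow> real^2^2) \<Rightarrow> 'k list \<Rightarrow> real^2^2" where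
  "word_prod A w = foldr (\<lambda>k B. A k ** B) w (mat 1)"

definition dominated_splitting :: "('k \<Rightarrow> real^2^2) \<Rightarrow> bool" where
  "dominated_splitting A \<longleftrightarrow>
     (\<forall>k. invertible (A k)) \<and>
     (\<exists>C>0. \<exists>\<beta>>0. \<forall>w. w \<noteq> [] \<longrightarrow>
        sing_val1 (word_prod A w) / sing_val2 (word_prod A w) \<ge> C * exp (real (length w) * \<beta>))"

text \<open>The product \<open>A(i\<^sub>n\<^sub>-\<^sub>1) \<cdots> A(i\<^sub>0)\<close>.\<close>

definition forward_prod :: "('k \<Rightarrow> real^2^2) \<Rightarrow> 'k two_sided \<Rightarrow> nat \<Rightarrow> real^2^2" where
  "forward_prod A i n = word_prod A (map (\<lambda>m. i (int m)) (rev [0..<n]))"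

definition proj_line :: "(real^2) set set" where
  "proj_line = {L. subspace L \<and> dim L = 1}"

definition norm_on_line :: "real^2^2 \<Rightarrow> (real^2) set \<Rightarrow> real" where
  "norm_on_line A L = (THE c. \<forall>v\<in>L - {0}. norm (A *v v) / norm v = c)"

definition line_angle :: "(real^2) set \<Rightarrow> (real^2) set \<Rightarrow> real" where
  "line_angle L L' =
     (THE a. \<forall>u\<in>L - {0}. \<forall>v\<in>L' - {0}. arccos (\<bar>u \<bullet> v\<bar> / (norm u * norm v)) = a)"

definition invariant_lines ::
    "('k \<Rightarrow> real^2^2) \<Rightarrow> ('k two_sided \<Rightarrow> (real^2) set) \<Rightarrow> bool" where
  "invariant_lines A e \<longleftrightarrow>
     (\<forall>i. e i \<in> proj_line) \<and> (\<forall>i. (\<lambda>v. A (i 0) *v v) ` e i = e (shift i))"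

definition stable_splitting ::
    "('k \<Rightarrow> real^2^2) \<Rightarrow> ('k two_sided \<Rightarrow> (real^2) set) \<Rightarrow> ('k two_sided \<Rightarrow> (real^2) set) \<Rightarrow> bool"
  where
  "stable_splitting A es ess \<longleftrightarrow>
     invariant_lines A es \<and> invariant_lines A ess \<and>
     (\<exists>K\<ge>1. \<forall>n i.
        sing_val1 (forward_prod A i n) / K \<le> norm_on_line (forward_prod A i n) (es i) \<and>
        norm_on_line (forward_prod A i n) (es i) \<le> K * sing_val1 (forward_prod A i n) \<and>
        sing_val2 (forward_prod A i n) / K \<le> norm_on_line (forward_prod A i n) (ess i) \<and>
        norm_on_line (forward_prod A i n) (ess i) \<le> K * sing_val2 (forward_prod A i n))"

definition two_sided_ess :: "('k \<Rightarrow> real^2^2) \<Rightarrow> 'k two_sided \<Rightarrow> (real^2) set" where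
  "two_sided_ess A = (THE ess. \<exists>es. stable_splitting A es ess)"

text \<open>The strong stable line depends only on the letters with nonnegative index; this is its
  common value on all two-sided words extending \<open>i\<close>.\<close>

definition ess_line :: "('k \<Rightarrow> real^2^2) \<Rightarrow> 'k right_word \<Rightarrow> (real^2) set" where
  "ess_line A i = (THE L. \<forall>j. (\<forall>n. j (int n) = i n) \<longrightarrow> two_sided_ess A j = L)"

text \<open>The parameter sets in the last condition are relatively open in \<open>U\<close> when the first two
  conditions hold and \<open>U\<close> is open, since the strong stable lines then vary continuously.\<close>

definition strong_stable_transversality ::
    "(real^'d) set \<Rightarrow> (real^'d \<Rightarrow> 'k \<Rightarrow> real^2^2) \<Rightarrow> bool" where
  "strong_stable_transversality U A \<longleftrightarrow>
     (\<exists>V. open V \<and> closure U \<subseteq> V \<and> (\<forall>k. continuous_on V (\<lambda>p. A p k))) \<and>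
     (\<forall>p\<in>closure U. dominated_splitting (A p)) \<and>
     (\<exists>C>0. \<forall>i j :: 'k right_word. i 0 \<noteq> j 0 \<longrightarrow> (\<forall>r>0.
        emeasure lebesgue {p\<in>U. line_angle (ess_line (A p) i) (ess_line (A p) j) < r}
          \<le> ennreal (C * r)))"

text \<open>For a left-infinite word \<open>i\<close> in the above encoding, \<open>word_prod A (map i [0..<n])\<close> is
  \<open>A(i\<^sub>-\<^sub>1) \<cdots> A(i\<^sub>-\<^sub>n)\<close>.\<close>

definition chi_s :: "('k \<Rightarrow> real^2^2) \<Rightarrow> 'k left_word measure \<Rightarrow> real" where
  "chi_s A \<mu> = (THE c. AE i in \<mu>.
     (\<lambda>n. - (1 / real n) * ln (sing_val1 (word_prod A (map i [0..<n])))) \<longlonglongrightarrow> c)"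

definition chi_ss :: "('k \<Rightarrow> real^2^2) \<Rightarrow> 'k left_word measure \<Rightarrow> real" where
  "chi_ss A \<mu> = (THE c. AE i in \<mu>.
     (\<lambda>n. - (1 / real n) * ln (sing_val2 (word_prod A (map i [0..<n])))) \<longlonglongrightarrow> c)"

definition affine_ifs :: "('k \<Rightarrow> real^2^2) \<Rightarrow> ('k \<Rightarrow> real^2) \<Rightarrow> 'k \<Rightarrow> real^2 \<Rightarrow> real^2" where
  "affine_ifs A t k x = A k *v x + t k"

definition attractor :: "('k \<Rightarrow> real^2 \<Rightarrow> real^2) \<Rightarrow> (real^2) set" where
  "attractor f = (THE K. K \<noteq> {} \<and> compact K \<and> K = (\<Union>k. f k ` K))"

definition strong_separation :: "('k \<Rightarrow> real^2 \<Rightarrow> real^2) \<Rightarrow> bool" where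
  "strong_separation f \<longleftrightarrow>
     (\<forall>k l. k \<noteq> l \<longrightarrow> f k ` attractor f \<inter> f l ` attractor f = {})"

definition natural_projection :: "('k \<Rightarrow> real^2 \<Rightarrow> real^2) \<Rightarrow> 'k left_word \<Rightarrow> real^2" where
  "natural_projection f i = lim (\<lambda>n. foldr f (map i [0..<n]) 0)"

definition hausdorff_measure :: "real \<Rightarrow> 'a::metric_space set \<Rightarrow> ennreal" where
  "hausdorff_measure s E =
     (SUP \<delta>\<in>{0<..}. INF V\<in>{V :: nat \<Rightarrow> 'a set. E \<subseteq> (\<Union>n. V n) \<and>
                                (\<forall>n. bounded (V n) \<and> diameter (V n) \<le> \<delta>)}.
        \<Sum>n. ennreal (diameter (V n) powr s))"

text \<open>Only \<open>s > 0\<close> is used, because \<open>0 powr 0 = 0\<close> makes the above formula differ from counting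
  measure at \<open>s = 0\<close>. The infimum is unaffected.\<close>

definition hausdorff_dim :: "'a::metric_space set \<Rightarrow> ereal" where
  "hausdorff_dim E = (INF s\<in>{s. 0 < s \<and> hausdorff_measure s E = 0}. ereal s)"

definition hausdorff_dim_measure :: "'a::metric_space measure \<Rightarrow> ereal" where
  "hausdorff_dim_measure m = (INF E\<in>{E\<in>sets m. emeasure m E = 1}. hausdorff_dim E)"

end

theory Submission
 imports Defs "HOL-Real_Asymp.Real_Asymp"
begin

text \<open>The upper bound comes from covering the attractor by cylinders, and by pieces of cylinders of the
size of their smaller axis. For the lower bound, transversality and the continuity of the potentials
show that for almost every parameter the distribution of the strong stable directions has dimension
\<open>min 1 (h / (xss - xs))\<close>. The preimage of a small ball under the affine map of a cylinder lies in a
strip in such a direction, so the measure of the ball is an average of projected measures, which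
Kaufman's estimate (first alternative of the hypothesis) or Falconer's (second alternative) controls
by the dimension of the measure itself. A lower bound \<open>D\<close> for that dimension thus improves to
\<open>(h + (xss - xs) * min 1 D) / xss\<close>, and iterating gives the claimed value.\<close>

text \<open>The averaging over directions works because direction and position decouple. For a point
  in the cylinder of \<open>w\<close> the tube direction is read off \<open>w\<close>, while its
  place inside the cylinder is read off the shifted word; the quasi-Bernoulli bounds make this pair
  behave, up to a constant, like a sample of the product measure. A ball of radius about
  \<open>exp (- xss * n)\<close> lies in a cylinder of mass about \<open>exp (- h * n)\<close> and
  there in a tube of relative width about \<open>exp (- chi * n)\<close>, whence the recursion for
  \<open>D\<close>. The obstacle is that the measure moves with the parameter, so the second moment
  of the direction distribution cannot be integrated over parameters directly. It is computed with
  the measure frozen at one parameter and then transported to nearby parameters, at the price of a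
  factor with small exponential rate. This is why exceptional sets are made exponentially small
  throughout: such bounds survive the change of measure, sums over scales and Borel-Cantelli. The
  rates come from large deviations for the measure and both singular values, all of which are
  quasi-multiplicative along words.\<close>

abbreviation (input) Ev (binder "EV " 10) where "Ev P \<equiv> eventually P sequentially"
abbreviation (input) tends_to (infix "---->" 60) where "X ----> l \<equiv> X \<longlonglongrightarrow> l"
abbreviation (input) len where "len w \<equiv> real (length w)"
abbreviation (input) pre where "pre i n \<equiv> map i [0..<n]"

abbreviation (input) dec where "dec c n \<equiv> exp (- c * real n)"

lemmas b_integral_sum = Bochner_Integration.integral_sum
 and b_integrable_sum = Bochner_Integration.integrable_sum
 and b_integral_add = Bochner_Integration.integral_add
 and b_integral_diff = Bochner_Integration.integral_diff
 and b_integrable_add = Bochner_Integration.integrable_add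
 and b_integrable_diff = Bochner_Integration.integrable_diff
 and b_integral_cong = Bochner_Integration.integral_cong

section \<open>Words, cylinders and shift-invariant measures\<close>

definition cyl :: "'k list => 'k left_word set" where
 "cyl w = {i. pre i (length w) = w}"

definition words :: "nat => 'k list set" where
 "words n = {w. length w = n}"

definition conc :: "'k list => 'k left_word => 'k left_word" where
 "conc w j = (%n. if n < length w then w ! n else j (n - length w))"

definition shl :: "nat => 'k left_word => 'k left_word" where
 "shl n i = (%k. i (n + k))"

lemma right_shift_funpow: "(right_shift ^^ n) i = shl n i"
 by (induction n arbitrary: i) (auto simp: shl_def right_shift_def funpow_swap1)

lemma finite_words [simp]: "finite (words n :: 'k::finite list set)"
 using finite_lists_length_eq[of "UNIV :: 'k set" n] by (simp add: words_def)

lemma in_words [simp]: "w \<in> words n \<longleftrightarrow> length w = n"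
 by (simp add: words_def)

lemma map_conc [simp]: "pre (conc w j) (length w) = w"
 by (auto simp: conc_def intro: nth_equalityI)

lemma drop_conc [simp]: "shl (length w) (conc w j) = j"
 by (auto simp: conc_def shl_def)

lemma conc_drop: "conc (pre i n) (shl n i) = i"
 by (auto simp: conc_def shl_def)

lemma conc_append: "conc (u @ v) j = conc u (conc v j)"
 by (auto simp: conc_def nth_append fun_eq_iff)

lemma map_upt_add: "pre i (n + m) = pre i n @ pre (shl n i) m"
 by (rule nth_equalityI) (auto simp: nth_append shl_def)

lemma take_map_upt: "k <= n ==> take k (pre i n) = pre i k"
 by (simp add: take_map)

lemma cyl_conc [simp]: "conc w j \<in> cyl w"
 by (simp add: cyl_def)

lemma cyl_append: "cyl (u @ v) = {i \<in> cyl u. shl (length u) i \<in> cyl v}"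
proof -
 have "pre i (length u + length v) = u @ v \<longleftrightarrow>
   pre i (length u) = u \<and> map (shl (length u) i) [0..<length v] = v" for i
  unfolding map_upt_add by simp
 thus ?thesis by (simp add: cyl_def)
qed

lemma in_cyl_append: "i \<in> cyl (u @ v) \<longleftrightarrow> i \<in> cyl u \<and> shl (length u) i \<in> cyl v"
 by (simp add: cyl_append)

lemma in_cyl: "i \<in> cyl w \<longleftrightarrow> pre i (length w) = w"
 by (simp add: cyl_def)

lemma cyl_disjoint: "i \<in> cyl u ==> i \<in> cyl v ==> length u = length v ==> u = v"
 by (simp add: in_cyl)

lemma shifted_prefix_eq_UN:
 "{i \<in> cyl u. map (shl (length u) i) [0..<n] \<in> S} = (\<Union>v\<in>S \<inter> words n. cyl (u @ v))"
proof -
 have "i \<in> cyl v \<longleftrightarrow> pre i n = v" if "v \<in> words n" for v and i :: "'a left_word"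
  using that by (auto simp: in_cyl)
 thus ?thesis by (auto simp: in_cyl_append)
qed

lemma shifted_cyl_eq_UN: "{i. shl n i \<in> cyl v} = (\<Union>u\<in>words n. cyl (u @ v))"
proof -
 have "i \<in> cyl u \<longleftrightarrow> pre i n = u" if "u \<in> words n" for u and i :: "'a left_word"
  using that by (auto simp: in_cyl)
 thus ?thesis by (auto simp: in_cyl_append)
qed

lemma disjoint_family_cyl_append:
 "disjoint_family_on (%v. cyl (u @ v)) (words n)" "disjoint_family_on (%u. cyl (u @ v)) (words n)"
 by (auto simp: disjoint_family_on_def in_cyl_append dest: cyl_disjoint)

lemma cylinder_eq_cyl: "cylinder i n = cyl (pre i n)"
 by (auto simp: cylinder_def cyl_def)

lemma space_left_words [simp]: "space left_words = UNIV"
 by (simp add: left_words_def space_PiM)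

lemma letter_measurable [measurable]: "(%i. i n) \<in> measurable left_words (count_space UNIV)"
 unfolding left_words_def by simp

lemma prefix_measurable [measurable]:
 "(%i. pre i n) \<in> measurable (left_words :: ('k::finite) left_word measure) (count_space UNIV)"
proof -
 have "{i :: 'k left_word. pre i n = w} \<in> sets left_words" for w
 proof (cases "length w = n")
  case True
  have "{i :: 'k left_word. pre i n = w} = {i \<in> space left_words. \<forall>k<n. i k = w ! k}"
   using True by (auto simp: list_eq_iff_nth_eq)
  also have "... \<in> sets left_words" by measurable
  finally show ?thesis .
 next
  case False
  hence "{i :: 'k left_word. pre i n = w} = {}" by auto
  thus ?thesis by simp
 qed
 hence "(\<Union>w\<in>S \<inter> words n. {i :: 'k left_word. pre i n = w}) \<in> sets left_words" for S
  by (intro sets.finite_UN) auto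
 moreover have "(%i. pre i n) -` S \<inter> space left_words =
   (\<Union>w\<in>S \<inter> words n. {i :: 'k left_word. pre i n = w})" for S
  by auto
 ultimately show ?thesis by (intro measurableI) simp_all
qed

lemma sets_prefix [measurable]: "{i. P (pre i n)} \<in> sets (left_words :: ('k::finite) left_word measure)"
 using measurable_sets[OF prefix_measurable[of n], of "{w. P w}"] by (simp add: vimage_def)

lemma sets_cyl [measurable]: "cyl w \<in> sets (left_words :: ('k::finite) left_word measure)"
 unfolding cyl_def by (rule sets_prefix)

lemma shl_measurable [measurable]: "shl n \<in> measurable left_words left_words"
 unfolding shl_def left_words_def
 by (rule measurable_PiM_single') (auto simp: space_PiM)

lemma sets_left_words_cylinders:
 "sets (left_words :: ('k::finite) left_word measure) =
   sigma_sets UNIV {{i. pre i n \<in> S} | n S. True}"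
proof (rule antisym)
 have "sets (left_words :: 'k left_word measure) =
  sigma_sets UNIV {{f \<in> UNIV. f i \<in> B} | i B. True}"
  unfolding left_words_def sets_PiM_single by (simp add: PiE_def)
 also have "... \<subseteq> sigma_sets UNIV {{i. pre i n \<in> S} | n S. True}"
 proof (rule sigma_sets_mono, clarify)
  fix k :: nat and B :: "'k set"
  have "{f \<in> UNIV. f k \<in> B} = {i :: 'k left_word. pre i (Suc k) \<in> {w. w ! k \<in> B}}"
   by (auto simp del: upt_Suc)
  thus "{f \<in> UNIV. f k \<in> B} \<in> sigma_sets UNIV {{i. pre i n \<in> S} |n S. True}"
   by (intro sigma_sets.Basic) blast
 qed
 finally show "sets (left_words :: 'k left_word measure)
   \<subseteq> sigma_sets UNIV {{i. pre i n \<in> S} | n S. True}" .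
 show "sigma_sets UNIV {{i. pre i n \<in> S} | n S. True} \<subseteq> sets (left_words :: 'k left_word measure)"
  using sets.sigma_sets_subset[of "{{i. pre i n \<in> S} | n S. True}" "left_words :: 'k left_word measure"]
   sets_prefix by fastforce
qed

text \<open>The sets approximable by events on finitely many letters form a sigma-algebra, so
  induction over its generation suffices. For a union, a finite subunion is chosen first, and the
  errors of its members share the remaining half of \<open>e\<close>.\<close>

lemma cylinder_approximation:
 fixes \<nu> :: "('k::finite) left_word measure"
 assumes "finite_measure \<nu>" and s: "sets \<nu> = sets left_words" and E: "E \<in> sets left_words" and e: "e > 0"
 shows "\<exists>n S. measure \<nu> (sym_diff E {i. pre i n \<in> S}) < e"
proof -
 interpret finite_measure \<nu> by fact
 note s[simp]
 have pre[simp]: "{i. pre i n \<in> S} \<in> sets (left_words :: 'k left_word measure)" for n S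
  by (rule sets_prefix)
 from E have "E \<in> sigma_sets UNIV {{i. pre i n \<in> S} | n S. True}"
  by (simp add: sets_left_words_cylinders)
 thus ?thesis using e
 proof (induction arbitrary: e)
  case (Basic a)
  then obtain n S where "a = {i. pre i n \<in> S}" by auto
  with Basic show ?case by (intro exI[of _ n] exI[of _ S]) simp
 next
  case Empty
  thus ?case by (intro exI[of _ 0] exI[of _ "{}"]) simp
 next
  case (Compl a)
  then obtain n S where *: "measure \<nu> (sym_diff a {i. pre i n \<in> S}) < e" by blast
  have "sym_diff (UNIV - a) {i. pre i n \<in> - S} = sym_diff a {i. pre i n \<in> S}" by auto
  with * show ?case by metis
 next
  case (Union a)
  have a: "a k \<in> sets left_words" for k
   using Union(1) by (simp add: sets_left_words_cylinders)
  let ?B = "%m. \<Union>k<m. a k"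
  have "(%m. measure \<nu> (?B m)) ----> measure \<nu> (\<Union>m. ?B m)"
   by (rule finite_Lim_measure_incseq) (use a in \<open>auto simp: incseq_def, force\<close>)
  moreover have "(\<Union>m. ?B m) = (\<Union>k. a k)" by auto
  ultimately have "(%m. measure \<nu> (?B m)) ----> measure \<nu> (\<Union>k. a k)" by simp
  from LIMSEQ_D[OF this, of "e/2"] \<open>e > 0\<close> obtain m where
   m: "\<bar>measure \<nu> (?B m) - measure \<nu> (\<Union>k. a k)\<bar> < e/2" by auto
  have "\<forall>k. \<exists>n S. measure \<nu> (sym_diff (a k) {i. pre i n \<in> S}) < e / (2 * (real m + 1))"
   using Union(2) \<open>e > 0\<close> by simp
  then obtain n S where nS:
   "\<And>k. measure \<nu> (sym_diff (a k) {i. pre i (n k) \<in> S k}) < e / (2 * (real m + 1))" by metis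
  define N where "N = Max (insert 0 (n ` {..<m}))"
  have N: "n k <= N" if "k < m" for k using that by (auto simp: N_def)
  define T where "T = {w. \<exists>k<m. take (n k) w \<in> S k}"
  have T: "{i. pre i N \<in> T} = (\<Union>k<m. {i. pre i (n k) \<in> S k})"
   using N by (auto simp: T_def take_map)
  have "sym_diff (\<Union>k. a k) {i. pre i N \<in> T} \<subseteq>
    ((\<Union>k. a k) - ?B m) \<union> (\<Union>k<m. sym_diff (a k) {i. pre i (n k) \<in> S k})"
   unfolding T by auto
  hence "measure \<nu> (sym_diff (\<Union>k. a k) {i. pre i N \<in> T}) <=
    measure \<nu> (((\<Union>k. a k) - ?B m) \<union> (\<Union>k<m. sym_diff (a k) {i. pre i (n k) \<in> S k}))"
   using a by (intro finite_measure_mono) auto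
  also have "... <= measure \<nu> ((\<Union>k. a k) - ?B m) + measure \<nu> (\<Union>k<m. sym_diff (a k) {i. pre i (n k) \<in> S k})"
   using a by (intro measure_Un_le) auto
  also have "measure \<nu> (\<Union>k<m. sym_diff (a k) {i. pre i (n k) \<in> S k}) <=
    (\<Sum>k<m. measure \<nu> (sym_diff (a k) {i. pre i (n k) \<in> S k}))"
   using a by (intro measure_UNION_le) auto
  also have "... <= (\<Sum>k<m. e / (2 * (real m + 1)))"
   by (intro sum_mono less_imp_le nS)
  also have "... < e / 2" using \<open>e > 0\<close> by (simp add: field_simps)
  also have "measure \<nu> ((\<Union>k. a k) - ?B m) = measure \<nu> (\<Union>k. a k) - measure \<nu> (?B m)"
   using a by (intro finite_measure_Diff) auto
  also have "... < e/2" using m by linarith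
  finally show ?case by (intro exI[of _ N] exI[of _ T]) simp
 qed
qed

locale word_measure = prob_space mu for mu :: "('k::finite) left_word measure" +
 assumes sets_mu [measurable_cong, simp]: "sets mu = sets left_words"
  and invariant: "invariant_measure mu right_shift"
begin

lemma space_mu [simp]: "space mu = UNIV"
 using sets_eq_imp_space_eq[OF sets_mu] by simp

definition m :: "'k list => real" where "m w = prob (cyl w)"

lemma m_nonneg [simp]: "m w >= 0" by (simp add: m_def)

lemma m_le_1 [simp]: "m w <= 1" by (simp add: m_def)

lemma distr_shift: "distr mu mu (shl n) = mu"
proof (induction n)
 case 0
 have "shl 0 = (%i :: 'k left_word. i)" by (auto simp: shl_def)
 thus ?case by (simp add: distr_id)
next
 case (Suc n)
 have "shl (Suc n) = right_shift \<circ> (shl n :: 'k left_word => _)"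
  by (auto simp: shl_def right_shift_def)
 moreover have "shl n \<in> measurable mu mu" by measurable
 ultimately have "distr mu mu (shl (Suc n)) = distr (distr mu mu (shl n)) mu right_shift"
  using invariant by (simp add: distr_distr invariant_measure_def)
 thus ?case using Suc invariant by (simp add: invariant_measure_def)
qed

lemma measure_shift:
 assumes "E \<in> sets left_words"
 shows "prob {i. shl n i \<in> E} = prob E"
proof -
 have "prob E = measure (distr mu mu (shl n)) E" by (simp add: distr_shift)
 also have "... = prob (shl n -` E \<inter> space mu)"
  using assms by (intro measure_distr) auto
 finally show ?thesis by (simp add: vimage_def)
qed

lemma integral_shift:
 assumes "f \<in> borel_measurable left_words"
 shows "(\<integral>i. f (shl n i) \<partial>mu) = (\<integral>i. (f i :: real) \<partial>mu)"
proof -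
 have "(\<integral>i. f i \<partial>mu) = (\<integral>i. f i \<partial>(distr mu mu (shl n)))" by (simp add: distr_shift)
 also have "... = (\<integral>i. f (shl n i) \<partial>mu)"
  using assms by (intro integral_distr) auto
 finally show ?thesis by simp
qed

lemma measure_prefix: "prob {i. pre i n \<in> S} = sum m (S \<inter> words n)"
proof -
 have "{i. pre i n \<in> S} = (\<Union>w\<in>S \<inter> words n. cyl w)"
  by (auto simp: cyl_def)
 thus ?thesis
  unfolding m_def by (simp only:, intro finite_measure_finite_Union) (auto simp: cyl_def disjoint_family_on_def)
qed

lemma sum_m_words [simp]: "sum m (words n) = 1"
 using measure_prefix[of n UNIV] prob_space by simp

lemma sum_m_append: "(\<Sum>v\<in>S \<inter> words n. m (u @ v)) =
  prob {i \<in> cyl u. map (shl (length u) i) [0..<n] \<in> S}"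
 unfolding m_def shifted_prefix_eq_UN
 using disjoint_family_cyl_append(1) by (intro finite_measure_finite_Union[symmetric])
  (auto intro: disjoint_family_on_mono[of "S \<inter> words n" "words n"])

lemma sum_m_right: "(\<Sum>v\<in>words n. m (u @ v)) = m u"
 using sum_m_append[of u UNIV n] by (simp add: m_def)

text \<open>Prepending letters costs shift invariance, whereas \<open>sum_m_right\<close> is
  additivity over subcylinders.\<close>

lemma sum_m_left: "(\<Sum>u\<in>words n. m (u @ v)) = m v"
proof -
 have "prob {i. shl n i \<in> cyl v} = (\<Sum>u\<in>words n. m (u @ v))"
  unfolding m_def shifted_cyl_eq_UN
  using disjoint_family_cyl_append(2) by (intro finite_measure_finite_Union) auto
 thus ?thesis using measure_shift[of "cyl v" n] by (simp add: m_def)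
qed

end

lemma sum_words_append:
 fixes f :: "'k::finite list => real"
 shows "(\<Sum>w\<in>words (n + k). f w) = (\<Sum>u\<in>words n. \<Sum>v\<in>words k. f (u @ v))"
proof -
 have "bij_betw (%(u, v). u @ v) (words n \<times> words k) (words (n + k) :: 'k list set)"
  by (rule bij_betw_byWitness[where f' = "%w. (take n w, drop n w)"]) auto
 hence "(\<Sum>w\<in>words (n + k). f w) = (\<Sum>p\<in>words n \<times> words k. f (case p of (u, v) => u @ v))"
  by (rule sum.reindex_bij_betw[symmetric])
 thus ?thesis by (simp add: sum.cartesian_product case_prod_unfold)
qed

text \<open>\<open>C\<close> is the price of treating adjacent blocks as independent. The two
  product inequalities stand in for the potential in everything that concerns a single
  parameter.\<close>

locale quasi_bernoulli = word_measure +
 fixes C :: real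
 assumes m_pos: "m w > 0"
  and m_append_le: "m (u @ v) <= C * m u * m v"
  and m_append_ge: "m u * m v <= C * m (u @ v)"
  and ergodic: "ergodic_measure mu right_shift"
begin

lemma m_Nil: "m [] = 1"
 using prob_space by (simp add: m_def cyl_def)

lemma C_ge_1: "C >= 1"
 using m_append_le[of "[]" "[]"] by (simp add: m_Nil)

text \<open>The product bound passes from words to measurable \<open>E\<close> by replacing
  \<open>E\<close> with an event on finitely many letters; the symmetric difference has the same
  measure before and after the shift. It serves later for exceptional sets that are not
  cylinders.\<close>

lemma measure_cyl_shift_le:
 assumes E: "E \<in> sets left_words"
 shows "prob {i \<in> cyl u. shl (length u) i \<in> E} <= C * m u * prob E"
proof (rule field_le_epsilon)
 fix e :: real assume "e > 0"
 have C: "C * m u > 0" using C_ge_1 m_pos[of u] by simp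
 \<comment> \<open>The error \<open>d\<close> enters once through the shifted symmetric difference
   and \<open>C * m u\<close> times through enlarging \<open>E\<close>.\<close>
 define d where "d = e / (C * m u + 1)"
 have "d > 0" using C \<open>e > 0\<close> by (simp add: d_def)
 let ?l = "length u"
 obtain n S where nS: "prob (sym_diff E {i. pre i n \<in> S}) < d"
  using cylinder_approximation[of mu E d] E \<open>d > 0\<close> finite_measure_axioms by auto
 let ?F = "{i. pre i n \<in> S}"
 have F[measurable]: "?F \<in> sets left_words" by (rule sets_prefix)
 note E[measurable]
 have D: "{i. shl ?l i \<in> sym_diff E ?F} \<in> sets left_words"
  using measurable_sets[OF shl_measurable, of "sym_diff E ?F" ?l] by (simp add: vimage_def)
 have D': "{i \<in> cyl u. shl ?l i \<in> B} \<in> sets left_words" if "B \<in> sets left_words" for B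
  using measurable_sets[OF shl_measurable that, of ?l] sets_cyl[of u]
  by (simp add: vimage_def Collect_conj_eq)
 have "prob {i \<in> cyl u. shl ?l i \<in> ?F} = (\<Sum>v\<in>S \<inter> words n. m (u @ v))"
  by (simp add: sum_m_append)
 also have "... <= (\<Sum>v\<in>S \<inter> words n. C * m u * m v)"
  by (intro sum_mono m_append_le)
 also have "... = C * m u * prob ?F" by (simp add: measure_prefix sum_distrib_left)
 finally have 1: "prob {i \<in> cyl u. shl ?l i \<in> ?F} <= C * m u * prob ?F" .
 have "prob {i \<in> cyl u. shl ?l i \<in> E} <=
   prob ({i \<in> cyl u. shl ?l i \<in> ?F} \<union> {i. shl ?l i \<in> sym_diff E ?F})"
  using D D'[OF F] by (intro finite_measure_mono) auto
 also have "... <= prob {i \<in> cyl u. shl ?l i \<in> ?F} + prob {i. shl ?l i \<in> sym_diff E ?F}"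
  using D D'[OF F] by (intro measure_Un_le) auto
 also have "prob {i. shl ?l i \<in> sym_diff E ?F} = prob (sym_diff E ?F)"
  by (rule measure_shift) auto
 also have "prob {i \<in> cyl u. shl ?l i \<in> ?F} + prob (sym_diff E ?F) <=
   C * m u * prob ?F + d"
  using 1 nS by linarith
 also have "prob ?F <= prob (E \<union> sym_diff E ?F)"
  by (intro finite_measure_mono) auto
 also have "... <= prob E + prob (sym_diff E ?F)"
  by (intro measure_Un_le) auto
 also have "... <= prob E + d" using nS by simp
 finally have "prob {i \<in> cyl u. shl ?l i \<in> E} <= C * m u * (prob E + d) + d"
  using C by (simp add: mult_left_mono)
 also have "... = C * m u * prob E + (C * m u + 1) * d"
  by (simp add: algebra_simps)
 also have "(C * m u + 1) * d = e" using C by (simp add: d_def)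
 finally show "prob {i \<in> cyl u. shl ?l i \<in> E} <= C * m u * prob E + e" .
qed

end


section \<open>Exponentially small sequences and Birkhoff's theorem\<close>

definition expsmall :: "(nat => real) => bool" where
 "expsmall f \<longleftrightarrow> (\<exists>c>0. EV n. f n <= dec c n)"

text \<open>Halving the rate absorbs the linear factor, which counting scales or lengths always
  produces.\<close>

lemma expsmallI:
 assumes "c > 0" and "EV n. f n <= (a + b * real n) * dec c n"
 shows "expsmall f"
 unfolding expsmall_def
proof (intro exI conjI)
 show "c / 2 > 0" using assms by simp
 have "EV n. (a + b * real n) * dec c n <= dec (c/2) n"
  using \<open>c > 0\<close> by real_asymp
 with assms(2) show "EV n. f n <= dec (c/2) n"
  by eventually_elim linarith
qed

lemma expsmall_mono:
 assumes "expsmall f" and "EV n. g n <= f n"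
 shows "expsmall g"
proof -
 obtain c where "c > 0" "EV n. f n <= dec c n"
  using assms(1) by (auto simp: expsmall_def)
 moreover from this(2) assms(2) have "EV n. g n <= dec c n"
  by eventually_elim linarith
 ultimately show ?thesis by (auto simp: expsmall_def)
qed

lemma expsmall_add:
 assumes "expsmall f" and "expsmall g"
 shows "expsmall (%n. f n + g n)"
proof -
 obtain c d where c: "c > 0" "EV n. f n <= dec c n"
  and d: "d > 0" "EV n. g n <= dec d n"
  using assms by (auto simp: expsmall_def)
 show ?thesis
 proof (rule expsmallI[of "min c d" _ 2 0])
  show "EV n. f n + g n <= (2 + 0 * real n) * exp (- min c d * real n)"
   using c(2) d(2)
  proof eventually_elim
   case (elim n)
   have "dec c n <= exp (- min c d * real n)" "dec d n <= exp (- min c d * real n)"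
    by (auto intro: mult_right_mono)
   with elim have "f n + g n <= 2 * exp (- min c d * real n)" by linarith
   thus ?case by simp
  qed
 qed (use c d in auto)
qed

lemma expsmall_cmult:
 assumes "expsmall f" and "C >= 0"
 shows "expsmall (%n. C * f n)"
proof -
 obtain c where c: "c > 0" "EV n. f n <= dec c n"
  using assms by (auto simp: expsmall_def)
 show ?thesis
  by (rule expsmallI[of c _ C 0]) (use c \<open>C >= 0\<close> in \<open>auto elim!: eventually_mono intro: mult_left_mono\<close>)
qed

text \<open>A bad event may be tested at all lengths between \<open>eta * n\<close> and
  \<open>n\<close> at once: the shortest length fixes the rate \<open>c * eta\<close>, and there are
  at most \<open>n + 1\<close> lengths.\<close>

lemma expsmall_tail_sum:
 assumes "expsmall f" and "eta > 0"
 shows "expsmall (%n. \<Sum>k | k <= n \<and> eta * real n <= real k. f k)"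
proof -
 obtain c N where c: "c > 0" "\<And>n. n >= N ==> f n <= dec c n"
  using assms by (auto simp: expsmall_def eventually_sequentially)
 have "EV n. real N <= eta * real n" using \<open>eta > 0\<close> by real_asymp
 hence "EV n. (\<Sum>k | k <= n \<and> eta * real n <= real k. f k) <= (1 + 1 * real n) * dec (c * eta) n"
 proof eventually_elim
  case (elim n)
  have "(\<Sum>k | k <= n \<and> eta * real n <= real k. f k) <= (\<Sum>k | k <= n \<and> eta * real n <= real k. dec (c * eta) n)"
  proof (rule sum_mono, clarify)
   fix k assume k: "k <= n" "eta * real n <= real k"
   hence "f k <= dec c k" using elim by (intro c(2)) linarith
   also have "... <= dec (c * eta) n" using k \<open>c > 0\<close> by simp
   finally show "f k <= dec (c * eta) n" .
  qed
  also have "... <= (\<Sum>k\<in>{..n}. dec (c * eta) n)"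
   by (intro sum_mono2) auto
  finally show ?case by (simp add: algebra_simps)
 qed
 from expsmallI[OF _ this] show ?thesis using c \<open>eta > 0\<close> by simp
qed

lemma expsmall_reindex:
 assumes "expsmall f" and "a > 0"
  and g: "EV n. real (g n) >= a * real n - b"
 shows "expsmall (%n. f (g n))"
proof -
 obtain c N where c: "c > 0" "\<And>n. n >= N ==> f n <= dec c n"
  using assms by (auto simp: expsmall_def eventually_sequentially)
 have "EV n. real N <= a * real n - b" using \<open>a > 0\<close> by real_asymp
 with g have "EV n. f (g n) <= (exp (c * b) + 0 * real n) * dec (c * a) n"
 proof eventually_elim
  case (elim n)
  hence "f (g n) <= dec c (g n)" by (intro c(2)) linarith
  also have "... <= exp (- c * (a * real n - b))" using elim c by (intro exp_le_cancel_iff[THEN iffD2]) simp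
  also have "... = (exp (c * b) + 0 * real n) * dec (c * a) n"
   by (simp add: exp_add[symmetric] algebra_simps)
  finally show ?case .
 qed
 from expsmallI[OF _ this] show ?thesis using c \<open>a > 0\<close> by simp
qed

lemma expsmall_tendsto_0:
 assumes "expsmall f" and "\<And>n. f n >= 0"
 shows "f ----> 0"
proof -
 obtain c where c: "c > 0" "EV n. f n <= dec c n"
  using assms by (auto simp: expsmall_def)
 have "(%n. dec c n) ----> 0" using \<open>c > 0\<close> by real_asymp
 thus ?thesis
  by (rule tendsto_sandwich[rotated 3, OF _ ]) (use c assms(2) in auto)
qed

lemma expsmall_summable:
 assumes "expsmall f" and "\<And>n. f n >= 0"
 shows "summable f"
proof -
 obtain c where c: "c > 0" "EV n. f n <= dec c n"
  using assms by (auto simp: expsmall_def)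
 have "summable (%n. exp (- c) ^ n)" using \<open>c > 0\<close> by (intro summable_geometric) simp
 hence "summable (%n. dec c n)"
  by (simp add: exp_of_nat_mult[symmetric] mult.commute)
 thus ?thesis
  using c(2) assms(2) by (elim summable_comparison_test_ev[rotated]) (auto elim!: eventually_mono)
qed

context quasi_bernoulli
begin

text \<open>Stopping-time proof. If the limsup exceeds \<open>c\<close> with positive probability,
  then almost surely, by ergodicity. Outside a small set every orbit has an average of at least
  \<open>c\<close> by a bounded time \<open>M\<close>; raising \<open>f\<close> on that small set
  lets every orbit be cut into pieces with average at least \<open>c\<close>, and integration
  contradicts the choice of \<open>c\<close>.\<close>

lemma birkhoff_upper:
 assumes f[measurable]: "f \<in> borel_measurable left_words" and L: "\<And>i. \<bar>f i\<bar> <= L"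
  and c: "c > (\<integral>i. f i \<partial>mu)"
 shows "AE i in mu. limsup (%n. ereal ((\<Sum>k<n. f (shl k i)) / real n)) <= ereal c"
proof (rule ccontr)
 assume neg: "\<not> ?thesis"
 define A where "A n i = (\<Sum>k<n. f (shl k i)) / real n" for n i
 have [measurable]: "A n \<in> borel_measurable left_words" for n
  unfolding A_def by measurable
 define l where "l i = limsup (%n. ereal (A n i))" for i
 have [measurable]: "l \<in> borel_measurable left_words" unfolding l_def by measurable
 have L0: "L >= 0" using L[of undefined] by linarith
 have int: "integrable mu g" if "g \<in> borel_measurable left_words" "\<And>i. \<bar>g i\<bar> <= B" for g :: "'a left_word => real" and B
  using that by (intro integrable_const_bound[of _ B]) auto
 have A_shift: "(%n. A n (right_shift i) - A n i) ----> 0" for i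
 proof (rule tendsto_0_le[where K = 1])
  show "(%n. 2 * L / real n) ----> 0" by real_asymp
  show "EV n. norm (A n (right_shift i) - A n i) <= norm (2 * L / real n) * 1"
  proof (intro always_eventually allI)
   fix n
   have 1: "shl k (right_shift i) = shl (Suc k) i" for k
    by (simp add: shl_def right_shift_def)
   have "(\<Sum>k<n. f (shl k (right_shift i))) - (\<Sum>k<n. f (shl k i)) =
    f (shl n i) - f (shl 0 i)"
    unfolding 1 sum_subtractf[symmetric] by (rule sum_lessThan_telescope)
   moreover have "\<bar>f (shl n i) - f (shl 0 i)\<bar> <= 2 * L"
    using L[of "shl n i"] L[of "shl 0 i"] by linarith
   ultimately show "norm (A n (right_shift i) - A n i) <= norm (2 * L / real n) * 1"
    using L0 by (simp add: A_def diff_divide_distrib[symmetric] divide_right_mono)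
  qed
 qed
 have l_shift: "l (right_shift i) = l i" for i
 proof -
  have "(%n. ereal (A n (right_shift i) - A n i)) ----> ereal 0" using A_shift[of i] by (simp only: lim_ereal)
  hence "limsup (%n. ereal (A n (right_shift i) - A n i) + ereal (A n i)) = ereal 0 + limsup (%n. ereal (A n i))"
   by (intro ereal_limsup_lim_add) auto
  thus ?thesis by (simp add: l_def)
 qed
 let ?B = "{i. l i > ereal c}"
 have "{i \<in> space left_words. l i > ereal c} \<in> sets left_words" by measurable
 hence B: "?B \<in> sets mu" by simp
 have "right_shift -` ?B \<inter> space mu = ?B" by (simp add: vimage_def l_shift)
 with ergodic B have "prob ?B = 0 \<or> prob ?B = 1"
  unfolding ergodic_measure_def by blast
 moreover have "prob ?B \<noteq> 0"
 proof
  assume "prob ?B = 0"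
  hence "AE i in mu. i \<notin> ?B" using B by (simp add: AE_iff_measurable[OF B] emeasure_eq_measure)
  hence "AE i in mu. l i <= ereal c" by eventually_elim auto
  with neg show False by (simp add: l_def A_def)
 qed
 ultimately have B1: "prob ?B = 1" by simp
 define N where "N M = {i. \<exists>n\<in>{1..M}. A n i >= c}" for M
 have N[measurable]: "N M \<in> sets left_words" for M
 proof -
  have "{i \<in> space left_words. \<exists>n\<in>{1..M}. A n i >= c} \<in> sets left_words" by measurable
  thus ?thesis by (simp add: N_def)
 qed
 have sub: "?B \<subseteq> (\<Union>M. N M)"
 proof safe
  fix i assume "ereal c < l i"
  hence "\<not> (EV n. ereal (A n i) <= ereal c)"
   using Limsup_bounded[of "%n. ereal (A n i)" "ereal c" sequentially] by (auto simp: l_def)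
  hence "\<exists>\<^sub>F n in sequentially. c < A n i"
   by (simp add: frequently_def not_less)
  hence "\<exists>n\<ge>1. c < A n i" by (simp add: frequently_def eventually_sequentially not_le)
  then obtain n where "n >= 1" "c < A n i" by blast
  thus "i \<in> (\<Union>M. N M)" by (auto simp: N_def intro!: exI[of _ n] bexI[of _ n])
 qed
 have "N M \<subseteq> N M'" if "M <= M'" for M M'
 proof
  fix i assume "i \<in> N M"
  then obtain n where "n \<in> {1..M}" "A n i >= c" unfolding N_def by blast
  moreover from this(1) that have "n \<in> {1..M'}" by simp
  ultimately show "i \<in> N M'" unfolding N_def by blast
 qed
 hence "(%M. prob (N M)) ----> prob (\<Union>M. N M)"
  by (intro finite_Lim_measure_incseq) (simp_all add: image_subset_iff incseq_def)
 moreover have "prob (\<Union>M. N M) = 1"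
  using finite_measure_mono[OF sub] B1 by (intro antisym prob_le_1) simp
 ultimately have lim: "(%M. prob (N M)) ----> 1" by simp
 \<comment> \<open>Large enough for the raised function to be at least \<open>c\<close> outside
   \<open>N M\<close>, so that a piece of length one can be cut off there.\<close>
 define K where "K = \<bar>c\<bar> + L"
 have K: "K >= 0" using L0 by (simp add: K_def)
 define e where "e = (c - (\<integral>i. f i \<partial>mu)) / (K + 1)"
 have e: "e > 0" using c K by (simp add: e_def)
 obtain M where M: "prob (N M) > 1 - e"
  using LIMSEQ_D[OF lim e] by (metis abs_diff_less_iff order_refl real_norm_def)
 define g where "g i = f i + K * indicator (- N M) i" for i
 have [measurable]: "g \<in> borel_measurable left_words" unfolding g_def by measurable
 have g: "f i <= g i" "g i >= c - K" "\<bar>g i\<bar> <= L + K" for i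
  using L[of i] K by (auto simp: g_def K_def indicator_def)
 \<comment> \<open>The last, incomplete piece has length below \<open>M\<close> and costs at most
   \<open>K * M\<close>.\<close>
 have low: "(\<Sum>k<n. g (shl k i)) >= c * real n - K * real M" for n i
 proof (induction n arbitrary: i rule: less_induct)
  case (less n)
  show ?case
  proof (cases "n < M")
   case True
   have "(\<Sum>k<n. g (shl k i)) >= (\<Sum>k<n. c - K)" by (intro sum_mono g)
   moreover have "K * real n <= K * real M" using True K by (intro mult_left_mono) auto
   ultimately show ?thesis by (simp add: algebra_simps)
  next
   case False
   obtain p where p: "p >= 1" "p <= max 1 M" "(\<Sum>k<p. g (shl k i)) >= c * real p"
   proof (cases "i \<in> N M")
    case True
    then obtain p where p: "p \<in> {1..M}" "A p i >= c" by (auto simp: N_def)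
    hence "(\<Sum>k<p. f (shl k i)) >= c * real p" by (simp add: A_def field_simps)
    moreover have "(\<Sum>k<p. f (shl k i)) <= (\<Sum>k<p. g (shl k i))"
     by (intro sum_mono g)
    ultimately show ?thesis using p by (intro that[of p]) auto
   next
    case False
    have "shl 0 i = i" by (simp add: shl_def)
    moreover have "g i >= c" using False L[of i] by (simp add: g_def K_def)
    ultimately show ?thesis by (intro that[of 1]) auto
   qed
   show ?thesis
   proof (cases "n = 0")
    case True thus ?thesis using K by simp
   next
    case False
    hence pn: "p <= n" using p \<open>\<not> n < M\<close> by auto
    have "(\<Sum>k<n. g (shl k i)) = (\<Sum>k<p. g (shl k i)) + (\<Sum>k=p..<n. g (shl k i))"
     using sum.atLeastLessThan_concat[of 0 p n "%k. g (shl k i)"] pn by (simp add: lessThan_atLeast0)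
    also have "(\<Sum>k=p..<n. g (shl k i)) = (\<Sum>k<n-p. g (shl (k + p) i))"
     using pn sum.shift_bounds_nat_ivl[of "%k. g (shl k i)" 0 p "n - p"] by (simp add: lessThan_atLeast0)
    also have "... = (\<Sum>k<n-p. g (shl k (shl p i)))"
     by (simp add: shl_def add_ac)
    finally have "(\<Sum>k<n. g (shl k i)) =
     (\<Sum>k<p. g (shl k i)) + (\<Sum>k<n-p. g (shl k (shl p i)))" .
    moreover have "(\<Sum>k<n-p. g (shl k (shl p i))) >= c * real (n - p) - K * real M"
     using less.IH[of "n - p" "shl p i"] p pn by simp
    ultimately show ?thesis using p pn by (simp add: of_nat_diff algebra_simps)
   qed
  qed
 qed
 have "c <= (\<integral>i. g i \<partial>mu)"
 proof -
  have "c * real n - K * real M <= real n * (\<integral>i. g i \<partial>mu)" for n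
  proof -
   have intk: "integrable mu (%i. g (shl k i))" for k by (intro int[of _ "L + K"] g) measurable
   have "c * real n - K * real M = (\<integral>i. c * real n - K * real M \<partial>mu)" using prob_space by simp
   also have "... <= (\<integral>i. (\<Sum>k<n. g (shl k i)) \<partial>mu)"
    by (intro integral_mono low) (auto intro: intk)
   also have "... = (\<Sum>k<n. (\<integral>i. g (shl k i) \<partial>mu))"
    by (intro b_integral_sum intk)
   also have "... = real n * (\<integral>i. g i \<partial>mu)" by (simp add: integral_shift)
   finally show ?thesis .
  qed
  hence "EV n. c - K * real M / real n <= (\<integral>i. g i \<partial>mu)"
   by (intro eventually_sequentiallyI[of 1]) (simp add: field_simps)
  moreover have "(%n. c - K * real M / real n) ----> c" by real_asymp
  ultimately show ?thesis by (intro tendsto_upperbound) auto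
 qed
 also have "(\<integral>i. g i \<partial>mu) = (\<integral>i. f i \<partial>mu) + K * prob (- N M)"
 proof -
  have "- N M \<in> sets mu" using N[of M] sets.compl_sets[of "N M" mu] by (simp add: Compl_eq_Diff_UNIV)
  hence "integrable mu (indicator (- N M) :: _ => real)" by (simp add: emeasure_eq_measure)
  with \<open>- N M \<in> sets mu\<close> show ?thesis unfolding g_def
   by (subst b_integral_add[OF int[OF f L]]) simp_all
 qed
 also have "prob (- N M) = 1 - prob (N M)"
  using prob_compl[of "N M"] by (simp add: Compl_eq_Diff_UNIV)
 also have "K * (1 - prob (N M)) <= K * e" using M K by (intro mult_left_mono) auto
 also have "K * e < (K + 1) * e" using e by (simp add: algebra_simps)
 also have "(K + 1) * e = c - (\<integral>i. f i \<partial>mu)" using K by (simp add: e_def)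
 finally show False by simp
qed

lemma birkhoff_eventually_less:
 assumes "f \<in> borel_measurable left_words" "\<And>i. \<bar>f i\<bar> <= L" "c > (\<integral>i. f i \<partial>mu)"
 shows "AE i in mu. EV n. (\<Sum>k<n. f (shl k i)) / real n < c"
proof -
 obtain c' where "c' < c" "c' > (\<integral>i. f i \<partial>mu)" using assms(3) dense by blast
 from birkhoff_upper[OF assms(1,2) this(2)] show ?thesis
 proof eventually_elim
  case (elim i)
  hence "limsup (%n. ereal ((\<Sum>k<n. f (shl k i)) / real n)) < ereal c"
   using \<open>c' < c\<close> by (meson ereal_less(2) le_less_trans less_ereal.simps(1))
  from Limsup_lessD[OF this] show ?case by simp
 qed
qed

theorem birkhoff:
 assumes f: "f \<in> borel_measurable left_words" and L: "\<And>i. \<bar>f i\<bar> <= L"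
 shows "AE i in mu. (%n. (\<Sum>k<n. f (shl k i)) / real n) ----> (\<integral>i. f i \<partial>mu)"
proof -
 let ?I = "\<integral>i. f i \<partial>mu"
 have 1: "AE i in mu. \<forall>j. EV n. (\<Sum>k<n. f (shl k i)) / real n < ?I + inverse (real (Suc j))"
  unfolding AE_all_countable by (intro allI birkhoff_eventually_less[OF f L]) simp
 have 2: "AE i in mu. \<forall>j. EV n. (\<Sum>k<n. - f (shl k i)) / real n < - ?I + inverse (real (Suc j))"
  unfolding AE_all_countable
  by (intro allI birkhoff_eventually_less[of "%i. - f i"]) (use f L in auto)
 from 1 2 show ?thesis
 proof eventually_elim
  case (elim i)
  show ?case
  proof (rule tendstoI)
   fix e :: real assume "e > 0"
   then obtain j where j: "inverse (real (Suc j)) < e" using reals_Archimedean by blast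
   from elim(1)[rule_format, of j] elim(2)[rule_format, of j]
   show "EV n. dist ((\<Sum>k<n. f (shl k i)) / real n) ?I < e"
    by eventually_elim (use j in \<open>auto simp: dist_real_def sum_negf abs_less_iff\<close>)
  qed
 qed
qed

end


section \<open>Almost additive functions of words: limits and large deviations\<close>

definition almost_additive :: "('k list => real) => bool" where
 "almost_additive S \<longleftrightarrow> (\<exists>K. \<forall>u v. \<bar>S (u @ v) - S u - S v\<bar> <= K)"

lemma almost_additive_ln:
 assumes pos: "\<And>w. f w > 0" and c: "c >= 1"
  and le: "\<And>u v. f (u @ v) <= c * f u * f v" and ge: "\<And>u v. f u * f v <= c * f (u @ v)"
 shows "almost_additive (%w. ln (f w :: real))"
 unfolding almost_additive_def
proof (intro exI allI)
 fix u v
 have "ln (f (u @ v)) <= ln (c * f u * f v)" "ln (f u * f v) <= ln (c * f (u @ v))"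
  using le[of u v] ge[of u v] pos c by (intro ln_mono; simp)+
 thus "\<bar>ln (f (u @ v)) - ln (f u) - ln (f v)\<bar> <= ln c"
  using pos[of u] pos[of v] pos[of "u @ v"] c by (simp add: ln_mult abs_le_iff)
qed

lemma almost_additive_linear_bound:
 fixes S :: "'k::finite list => real"
 assumes "almost_additive S"
 shows "\<exists>L\<ge>0. \<forall>w. \<bar>S w\<bar> <= L * len w + L"
proof -
 obtain K where K: "\<And>u v. \<bar>S (u @ v) - S u - S v\<bar> <= K"
  using assms by (auto simp: almost_additive_def)
 define B where "B = Max (range (%k. \<bar>S [k]\<bar>))"
 have B: "\<bar>S [k]\<bar> <= B" for k unfolding B_def by (rule Max_ge) auto
 have B0: "B >= 0" using B[of undefined] by linarith
 have K0: "K >= 0" using K[of "[]" "[]"] by linarith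
 have "\<bar>S w\<bar> <= (B + K) * len w + K" for w
 proof (induction w)
  case Nil
  thus ?case using K[of "[]" "[]"] by simp
 next
  case (Cons k w)
  thus ?case using K[of "[k]" w] B[of k] by (simp add: algebra_simps)
 qed
 hence "\<bar>S w\<bar> <= (B + K) * len w + (B + K)" for w
  using B0 by (smt (verit))
 thus ?thesis using B0 K0 by (intro exI[of _ "B + K"]) auto
qed

context quasi_bernoulli
begin

lemma sum_m_eq_integral:
 "(\<Sum>w\<in>words n. m w * S w) = (\<integral>i. S (pre i n) \<partial>mu)"
proof -
 have ind: "S (pre i n) = (\<Sum>w\<in>words n. indicator (cyl w) i * S w)" for i
 proof -
  have "(\<Sum>w\<in>words n. indicator (cyl w) i * S w) = (\<Sum>w\<in>words n. if w = pre i n then S w else 0)"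
   by (rule sum.cong) (auto simp: indicator_def in_cyl)
  thus ?thesis by simp
 qed
 have "(\<integral>i. S (pre i n) \<partial>mu) = (\<Sum>w\<in>words n. \<integral>i. indicator (cyl w) i * S w \<partial>mu)"
  unfolding ind by (rule b_integral_sum) (auto simp: emeasure_eq_measure)
 thus ?thesis by (simp add: m_def mult.commute)
qed

lemma measure_prefix_eq: "prob {i. P (pre i n)} = (\<Sum>w | w \<in> words n \<and> P w. m w)"
 using measure_prefix[of n "Collect P"] by (simp add: Collect_conj_eq Int_commute words_def)

text \<open>Summing \<open>S\<close> over all shifts of a block of length \<open>p\<close> telescopes up to an error of \<open>K\<close> per
 letter.\<close>

lemma almost_additive_blocks:
 fixes S :: "'a list => real"
 assumes K: "\<And>u v. \<bar>S (u @ v) - S u - S v\<bar> <= K"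
 shows "\<exists>D. \<forall>n i. \<bar>(\<Sum>k<n. S (pre (shl k i) p)) - real p * S (pre i n)\<bar>
      <= K * real n + (D :: real)"
proof -
 obtain L where L: "L >= 0" "\<And>w. \<bar>S w\<bar> <= L * len w + L"
  using almost_additive_linear_bound[of S] K by (auto simp: almost_additive_def)
 define s where "s n i = S (pre i n)" for n i
 have s_add: "\<bar>s (n + k) i - s n i - s k (shl n i)\<bar> <= K" for n k i
  using K[of "pre i n"] by (simp add: s_def map_upt_add)
 have s_bd: "\<bar>s j i\<bar> <= L * real p + L" if "j <= p" for j i
 proof -
  have "\<bar>s j i\<bar> <= L * real j + L" using L(2)[of "pre i j"] by (simp add: s_def)
  moreover have "L * real j <= L * real p" using that L by (intro mult_left_mono) auto
  ultimately show ?thesis by linarith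
 qed
 have tele: "(\<Sum>k<n. s (k + p) i - s k i) = (\<Sum>j<p. s (n + j) i - s j i)" for n i
 proof -
  have *: "(\<Sum>k<n. f (k + p)) + (\<Sum>j<p. f j) = (\<Sum>j<p. f (n + j)) + (\<Sum>k<n. f k)" for f :: "nat => real"
  proof -
   have "(\<Sum>k<n. f (k + p)) + (\<Sum>j<p. f j) = sum f {0..<n + p}"
    using sum.atLeastLessThan_concat[of 0 p "n + p" f] sum.shift_bounds_nat_ivl[of f 0 p n]
    by (simp add: lessThan_atLeast0)
   also have "... = (\<Sum>j<p. f (n + j)) + (\<Sum>k<n. f k)"
    using sum.atLeastLessThan_concat[of 0 n "n + p" f] sum.shift_bounds_nat_ivl[of f 0 n p]
    by (simp add: lessThan_atLeast0 add.commute)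
   finally show ?thesis .
  qed
  from *[of "%k. s k i"] show ?thesis by (simp add: sum_subtractf)
 qed
 have "\<bar>(\<Sum>k<n. s p (shl k i)) - real p * s n i\<bar> <= K * real n + (real p * K + 2 * real p * (L * real p + L))"
  for n i
 proof -
  have "\<bar>(\<Sum>k<n. s p (shl k i)) - (\<Sum>k<n. s (k + p) i - s k i)\<bar> <= (\<Sum>k<n. K)"
   unfolding sum_subtractf[symmetric]
  proof (rule order_trans[OF sum_abs sum_mono])
   fix k
   show "\<bar>s p (shl k i) - (s (k + p) i - s k i)\<bar> <= K"
    using s_add[of k p i] by (simp add: abs_le_iff)
  qed
  moreover have "\<bar>(\<Sum>j<p. s (n + j) i - s j i) - (\<Sum>j<p. s n i)\<bar> <= (\<Sum>j<p. K + 2 * (L * real p + L))"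
   unfolding sum_subtractf[symmetric]
  proof (rule order_trans[OF sum_abs sum_mono])
   fix j assume "j \<in> {..<p}"
   thus "\<bar>s (n + j) i - s j i - s n i\<bar> <= K + 2 * (L * real p + L)"
    using s_add[of n j i] s_bd[of j i] s_bd[of j "shl n i"] by (auto simp: abs_le_iff)
  qed
  ultimately show ?thesis unfolding tele by (simp add: algebra_simps abs_le_iff)
 qed
 thus ?thesis unfolding s_def by blast
qed

text \<open>Summing \<open>S\<close> over the sliding blocks of length \<open>p\<close> turns
  \<open>S / n\<close> into a Birkhoff average of a bounded function, up to an error
  \<open>K / p + D p / n\<close>. So Birkhoff's theorem suffices, and the limit of the means is also
  the almost sure limit.\<close>

lemma almost_additive_limit:
 assumes "almost_additive S"
 shows "\<exists>c. (%n. (\<Sum>w\<in>words n. m w * S w) / real n) ----> c \<and>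
   (AE i in mu. (%n. S (pre i n) / real n) ----> c)"
proof -
 obtain K where K: "\<And>u v. \<bar>S (u @ v) - S u - S v\<bar> <= K"
  using assms by (auto simp: almost_additive_def)
 obtain L where L: "L >= 0" "\<And>w. \<bar>S w\<bar> <= L * len w + L"
  using almost_additive_linear_bound[OF assms] by auto
 define s where "s n i = S (pre i n)" for n i
 have [measurable]: "s n \<in> borel_measurable left_words" for n
  unfolding s_def by measurable
 have s_bd: "\<bar>s n i\<bar> <= L * real n + L" for n i
  using L(2)[of "pre i n"] by (simp add: s_def)
 have int[simp]: "integrable mu (%i. s n (shl k i))" for n k
  by (rule integrable_const_bound[of _ "L * real n + L"]) (use s_bd in auto)
 have int'[simp]: "integrable mu (s n)" for n
  by (rule integrable_const_bound[of _ "L * real n + L"]) (use s_bd in auto)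
 define E where "E n = (\<integral>i. s n i \<partial>mu) / real n" for n
 obtain D where D: "\<And>p n i. \<bar>(\<Sum>k<n. s p (shl k i)) - real p * s n i\<bar> <= K * real n + D p"
  using almost_additive_blocks[OF K] unfolding s_def by metis
 have D0: "D p >= 0" for p
 proof -
  have "\<bar>(\<Sum>k<0. s p (shl k undefined)) - real p * s 0 undefined\<bar> <= K * real (0::nat) + D p"
   by (rule D)
  thus ?thesis by simp
 qed
 have D': "\<bar>(\<Sum>k<n. s p (shl k i)) / real n / real p - s n i / real n\<bar> <= K / real p + D p / real n"
  if "p > 0" "n > 0" for p n i
 proof -
  have "(\<Sum>k<n. s p (shl k i)) / real n / real p - s n i / real n =
    ((\<Sum>k<n. s p (shl k i)) - real p * s n i) / (real n * real p)"
   using that by (simp add: field_simps)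
  also have "\<bar>...\<bar> <= (K * real n + D p) / (real n * real p)"
   using D[of p i n] that by (simp add: divide_right_mono)
  also have "... = K / real p + D p / (real n * real p)" using that by (simp add: field_simps)
  also have "D p / (real n * real p) <= D p / real n"
  proof -
   have "real n * 1 <= real n * real p" using that by (intro mult_left_mono) auto
   thus ?thesis using that D0[of p] by (intro divide_left_mono) auto
  qed
  finally show ?thesis by simp
 qed
 have DE: "\<bar>E p - E n\<bar> <= K / real p + D p / real n" if "p > 0" "n > 0" for p n
 proof -
  have "E p - E n = (\<integral>i. (\<Sum>k<n. s p (shl k i)) / real n / real p - s n i / real n \<partial>mu)"
   using that by (subst b_integral_diff)
    (auto simp: E_def b_integral_sum integral_shift)
  also have "norm ... <= (\<integral>i. norm ((\<Sum>k<n. s p (shl k i)) / real n / real p - s n i / real n) \<partial>mu)"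
   by (rule integral_norm_bound)
  also have "... <= (\<integral>i. K / real p + D p / real n \<partial>mu)"
   using D'[OF that] by (intro integral_mono) auto
  finally show ?thesis using prob_space by simp
 qed
 have ev: "EV n. K / real p + D p / real n < K / real p + e" if "e > 0" for p e
 proof -
  have "(%n. D p / real n) ----> 0" by real_asymp
  from order_tendstoD(2)[OF this that] show ?thesis by simp
 qed
 have "Cauchy E"
 proof (rule metric_CauchyI)
  fix e :: real assume "e > 0"
  have "(%p. K / real p) ----> 0" by real_asymp
  from order_tendstoD(2)[OF this, of "e/4"] \<open>e > 0\<close> have "EV p. K / real p < e/4 \<and> p > 0"
   by (intro eventually_conj eventually_gt_at_top) auto
  then obtain p where p: "K / real p < e/4" "p > 0" by (auto simp: eventually_sequentially)
  from ev[of "e/4" p] \<open>e > 0\<close> obtain N where N: "\<And>n. n >= N ==> K / real p + D p / real n < K / real p + e / 4"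
   by (auto simp: eventually_sequentially)
  have "\<bar>E p - E n\<bar> < e/2" if "n >= max 1 N" for n
  proof -
   have "n > 0" "n >= N" using that by auto
   thus ?thesis using DE[of p n] N[of n] p by linarith
  qed
  thus "\<exists>M. \<forall>m\<ge>M. \<forall>n\<ge>M. dist (E m) (E n) < e"
   by (intro exI[of _ "max 1 N"] allI impI) (smt (verit) dist_real_def field_sum_of_halves)
 qed
 then obtain c where c: "E ----> c" using Cauchy_convergent convergent_def by blast
 have Ec: "\<bar>E p - c\<bar> <= K / real p" if "p > 0" for p
 proof (rule tendsto_upperbound)
  show "((%n. \<bar>E p - E n\<bar> - D p / real n) \<longlongrightarrow> \<bar>E p - c\<bar>) sequentially"
  proof -
   have "(%n. D p / real n) ----> 0" by real_asymp
   with c have "(%n. \<bar>E p - E n\<bar> - D p / real n) ----> \<bar>E p - c\<bar> - 0" by (intro tendsto_intros)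
   thus ?thesis by simp
  qed
  show "EV n. \<bar>E p - E n\<bar> - D p / real n <= K / real p"
  proof (rule eventually_sequentiallyI[of 1])
   fix n :: nat assume "n >= 1"
   thus "\<bar>E p - E n\<bar> - D p / real n <= K / real p" using DE[OF that, of n] by simp
  qed
 qed simp
 have "AE i in mu. \<forall>p. (%n. (\<Sum>k<n. s p (shl k i)) / real n) ----> (\<integral>i. s p i \<partial>mu)"
  unfolding AE_all_countable
 proof
  show "AE i in mu. (%n. (\<Sum>k<n. s p (shl k i)) / real n) ----> (\<integral>i. s p i \<partial>mu)" for p
   by (rule birkhoff[OF _ s_bd]) measurable
 qed
 hence "AE i in mu. (%n. s n i / real n) ----> c"
 proof eventually_elim
  case (elim i)
  show ?case
  proof (rule tendstoI)
   fix e :: real assume "e > 0"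
   have "(%p. 2 * K / real p) ----> 0" by real_asymp
   from order_tendstoD(2)[OF this, of "e/2"] \<open>e > 0\<close> have "EV p. 2 * K / real p < e/2 \<and> p > 0"
    by (intro eventually_conj eventually_gt_at_top) auto
   then obtain p where p: "2 * K / real p < e/2" "p > 0" by (auto simp: eventually_sequentially)
   from elim have "(%n. (\<Sum>k<n. s p (shl k i)) / real n / real p) ----> E p"
    unfolding E_def using p by (intro tendsto_divide tendsto_const) auto
   moreover have e4: "e / 4 > 0" using \<open>e > 0\<close> by simp
   ultimately have "EV n. dist ((\<Sum>k<n. s p (shl k i)) / real n / real p) (E p) < e / 4"
    by (intro tendstoD)
   with ev[OF e4, of p] eventually_gt_at_top[of 0]
   show "EV n. dist (s n i / real n) c < e"
   proof eventually_elim
    case (elim n)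
    hence "\<bar>(\<Sum>k<n. s p (shl k i)) / real n / real p - s n i / real n\<bar> <= K / real p + D p / real n"
     using p by (intro D')
    with elim Ec[of p] p show ?case unfolding dist_real_def abs_less_iff abs_le_iff by linarith
   qed
  qed
 qed
 moreover have "E n = (\<Sum>w\<in>words n. m w * S w) / real n" for n
  by (simp add: E_def s_def sum_m_eq_integral)
 hence "E = (%n. (\<Sum>w\<in>words n. m w * S w) / real n)" by blast
 ultimately show ?thesis using c unfolding s_def by blast
qed

text \<open>Chernoff bound. The exponential moment \<open>Z n\<close> is submultiplicative up to the
  factor \<open>C * exp (t * K)\<close>, so a block length \<open>p\<close> with \<open>Z p\<close>
  small enough makes \<open>Z\<close> decay geometrically. Such a \<open>p\<close> exists because
  the block averages converge in probability.\<close>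

lemma large_deviation_upper:
 assumes "almost_additive S" and c: "AE i in mu. (%n. S (pre i n) / real n) ----> c"
  and e: "e > 0"
 shows "expsmall (%n. \<Sum>w | w \<in> words n \<and> S w > (c + e) * real n. m w)"
proof -
 define R where "R w = S w - c * len w" for w :: "'a list"
 obtain K where K: "\<And>u v. \<bar>S (u @ v) - S u - S v\<bar> <= K"
  using assms(1) by (auto simp: almost_additive_def)
 have RK: "R (u @ v) <= R u + R v + K" for u v
  using K[of u v] by (simp add: R_def algebra_simps abs_le_iff)
 obtain L0 where L0: "L0 >= 0" "\<And>w. \<bar>S w\<bar> <= L0 * len w + L0"
  using almost_additive_linear_bound[OF assms(1)] by auto
 define L where "L = 2 * L0 + \<bar>c\<bar>"
 have RL: "R w <= L * len w" if "w \<noteq> []" for w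
 proof -
  have "1 <= len w" using that by (cases w) auto
  hence "L0 * 1 <= L0 * len w" using L0 by (intro mult_left_mono) auto
  moreover have "- c * len w <= \<bar>c\<bar> * len w" by (intro mult_right_mono) auto
  ultimately show ?thesis using L0(2)[of w] by (simp add: R_def L_def algebra_simps abs_le_iff)
 qed
 have L: "L >= 0" using L0 by (simp add: L_def)
 \<comment> \<open>Splitting \<open>Z p\<close> by the event \<open>B p\<close> gives two parts of
   at most \<open>1 / (12 * C)\<close> each; with \<open>exp (t * K) <= 3\<close> the factor in the
   recursion for \<open>Z\<close> becomes \<open>1 / 2\<close>.\<close>
 define T where "T = 2 / e * ln (12 * C)"
 have CC: "ln (12 * C) > 0" using C_ge_1 by simp
 have T: "T > 0" using CC e by (simp add: T_def)
 have Te: "exp (- T * e / 2) = 1 / (12 * C)"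
  using e C_ge_1 by (simp add: T_def exp_minus inverse_eq_divide)
 define B where "B p = {i. R (pre i p) > e / 2 * real p}" for p
 have B[measurable]: "B p \<in> sets left_words" for p unfolding B_def by (rule sets_prefix)
 have "(%p. \<integral>i. indicator (B p) i \<partial>mu) ----> (\<integral>i. (0::real) \<partial>mu)"
 proof (rule integral_dominated_convergence[where w = "%_. 1"])
  show "AE i in mu. (%p. indicator (B p) i) ----> (0::real)"
   using c
  proof eventually_elim
   case (elim i)
   have "EV p. indicator (B p) i = (0::real)"
    using order_tendstoD(2)[OF elim less_add_same_cancel1[THEN iffD2, OF half_gt_zero[OF e]]] eventually_gt_at_top[of 0]
    by eventually_elim (auto simp: B_def R_def indicator_def field_simps)
   thus ?case by (rule tendsto_eventually)
  qed
 qed (auto simp: indicator_def)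
 hence Plim: "(%p. prob (B p)) ----> 0" by simp
 have "1 / (12 * C) * exp (- T * L) > 0" using C_ge_1 by simp
 from order_tendstoD(2)[OF Plim this] have "EV p. prob (B p) < 1 / (12 * C) * exp (- T * L)
   \<and> real p >= T * K \<and> p >= 1"
  using eventually_ge_at_top[of 1] eventually_ge_at_top[of "nat \<lceil>T * K\<rceil>"]
  by eventually_elim linarith
 then obtain p where p: "prob (B p) < 1 / (12 * C) * exp (- T * L)" "real p >= T * K" "p >= 1"
  by (auto simp: eventually_sequentially)
 \<comment> \<open>The parameter shrinks with the block length, so that \<open>t * K\<close> is at
   most one although the exponent over a whole block stays of order \<open>T\<close>.\<close>
 define t where "t = T / real p"
 have t: "t > 0" using T p by (simp add: t_def)
 have tp: "t * real p = T" using p by (simp add: t_def)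
 define Z where "Z n = (\<Sum>w\<in>words n. m w * exp (t * (R w - e * real n)))" for n
 have Z0: "Z n >= 0" for n by (auto simp: Z_def intro!: sum_nonneg)
 have Zadd: "Z (n + k) <= C * exp (t * K) * Z n * Z k" for n k
 proof -
  have "Z (n + k) = (\<Sum>u\<in>words n. \<Sum>v\<in>words k. m (u @ v) * exp (t * (R (u @ v) - e * real (n + k))))"
   by (simp add: Z_def sum_words_append)
  also have "... <= (\<Sum>u\<in>words n. \<Sum>v\<in>words k. (C * m u * m v) * (exp (t * K) * exp (t * (R u - e * real n)) * exp (t * (R v - e * real k))))"
  proof (intro sum_mono mult_mono m_append_le)
   fix u v
   have "t * (R (u @ v) - e * real (n + k)) <= t * (K + (R u - e * real n) + (R v - e * real k))"
    using RK[of u v] t by (intro mult_left_mono) (auto simp: algebra_simps)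
   thus "exp (t * (R (u @ v) - e * real (n + k))) <= exp (t * K) * exp (t * (R u - e * real n)) * exp (t * (R v - e * real k))"
    by (simp add: exp_add[symmetric] algebra_simps)
  qed (use C_ge_1 in auto)
  also have "... = C * exp (t * K) * Z n * Z k"
   by (simp add: Z_def sum_product sum_distrib_left sum_distrib_right mult_ac)
  finally show ?thesis .
 qed
 have Zp: "C * exp (t * K) * Z p <= 1/2"
 proof -
  have "m w * exp (t * (R w - e * real p)) <= m w * exp (- T * e / 2) + (if R w > e / 2 * real p then m w * exp (T * L) else 0)"
   if w: "w \<in> words p" for w
  proof (cases "R w > e / 2 * real p")
   case True
   have "w \<noteq> []" using w p by auto
   hence "R w <= L * real p" using RL[of w] w by simp
   hence "t * (R w - e * real p) <= t * (L * real p)" using e t by (intro mult_left_mono) (simp_all add: add_increasing2 diff_le_eq)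
   also have "... = T * L" using tp by (simp add: mult_ac)
   finally have "m w * exp (t * (R w - e * real p)) <= m w * exp (T * L)" by (intro mult_left_mono) auto
   thus ?thesis using True by (simp add: add_increasing)
  next
   case False
   hence "t * (R w - e * real p) <= t * (- (e / 2) * real p)" using t by (intro mult_left_mono) auto
   also have "... = - T * e / 2" using tp by (simp add: mult_ac)
   finally show ?thesis using False by (auto intro: mult_left_mono)
  qed
  hence "Z p <= (\<Sum>w\<in>words p. m w * exp (- T * e / 2) + (if R w > e / 2 * real p then m w * exp (T * L) else 0))"
   unfolding Z_def by (rule sum_mono)
  also have "... = exp (- T * e / 2) + prob (B p) * exp (T * L)"
  proof -
   have "prob (B p) = (\<Sum>w | w \<in> words p \<and> R w > e / 2 * real p. m w)"
    unfolding B_def by (rule measure_prefix_eq)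
   thus ?thesis
    by (simp add: sum.distrib sum_distrib_right[symmetric] sum.inter_filter[symmetric] del: in_words)
  qed
  also have "... <= 1 / (12 * C) + (1 / (12 * C) * exp (- T * L)) * exp (T * L)"
   using p(1) Te by (intro add_mono mult_right_mono) auto
  also have "... = 1 / (6 * C)" by (simp add: exp_minus)
  finally have Z: "Z p <= 1 / (6 * C)" .
  have "t * K <= 1" using p T by (simp add: t_def divide_le_eq)
  hence "exp (t * K) <= 3" using exp_le by (smt (verit) exp_le_cancel_iff)
  hence "C * exp (t * K) * Z p <= C * 3 * (1 / (6 * C))"
   using Z C_ge_1 Z0[of p] by (intro mult_mono) auto
  also have "... = 1/2" using C_ge_1 by simp
  finally show ?thesis .
 qed
 define M where "M = Max (insert 0 (Z ` {..<p}))"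
 have M: "M >= 0" by (simp add: M_def)
 have ZM: "Z n <= M * (1/2) ^ (n div p)" for n
 proof (induction n rule: less_induct)
  case (less n)
  show ?case
  proof (cases "n < p")
   case True
   thus ?thesis by (simp add: M_def)
  next
   case False
   have "Z (p + (n - p)) <= (C * exp (t * K) * Z p) * Z (n - p)"
    using Zadd[of p "n - p"] by (simp add: mult_ac)
   also have "... <= 1/2 * (M * (1/2) ^ ((n - p) div p))"
    using less.IH[of "n - p"] False p Zp Z0 by (intro mult_mono) auto
   also have "(n - p) div p = n div p - 1" using False p by (simp add: le_div_geq)
   also have "1/2 * (M * (1/2) ^ (n div p - 1)) = M * (1/2) ^ (n div p)"
   proof -
    have "n div p = Suc (n div p - 1)" using False p by (simp add: div_greater_zero_iff)
    thus ?thesis by (metis (no_types, lifting) mult.assoc mult.commute power_Suc)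
   qed
   finally show ?thesis using False by simp
  qed
 qed
 define gam where "gam = ln 2 / real p"
 have gam: "gam > 0" using p by (simp add: gam_def)
 show ?thesis
 proof (rule expsmallI[OF gam, of _ "2 * M" 0], intro always_eventually allI)
  fix n
  have "(\<Sum>w | w \<in> words n \<and> S w > (c + e) * real n. m w) <= (\<Sum>w | w \<in> words n \<and> S w > (c + e) * real n. m w * exp (t * (R w - e * real n)))"
  proof (rule sum_mono)
   fix w assume "w \<in> {w \<in> words n. S w > (c + e) * real n}"
   hence "R w - e * real n >= 0" by (auto simp: R_def algebra_simps)
   hence "1 <= exp (t * (R w - e * real n))" using t by simp
   from mult_left_mono[OF this, of "m w"] show "m w <= m w * exp (t * (R w - e * real n))" by simp
  qed
  also have "... <= Z n" unfolding Z_def by (rule sum_mono2) auto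
  also have "... <= M * (1/2) ^ (n div p)" by (rule ZM)
  also have "... <= M * (2 * dec gam n)"
  proof (rule mult_left_mono[OF _ M])
   have "real n <= real p * (real (n div p) + 1)"
   proof -
    have "n <= p * (n div p + 1)"
     using dividend_less_times_div[of p n] p by (simp add: algebra_simps)
    thus ?thesis by (metis of_nat_1 of_nat_add of_nat_le_iff of_nat_mult)
   qed
   hence "gam * real n <= ln 2 * (real (n div p) + 1)"
   proof -
    assume "real n <= real p * (real (n div p) + 1)"
    from mult_left_mono[OF this, of "ln 2 / real p"] p show ?thesis by (simp add: gam_def)
   qed
   hence "- (ln 2 * real (n div p)) <= ln 2 + - gam * real n" by (simp add: algebra_simps)
   hence "exp (- (ln 2 * real (n div p))) <= exp (ln 2 + - gam * real n)" by (simp only: exp_le_cancel_iff)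
   also have "exp (- (ln 2 * real (n div p))) = (1/2 :: real) ^ (n div p)"
    by (simp add: exp_minus exp_of_nat2_mult power_one_over inverse_eq_divide)
   finally show "(1/2 :: real) ^ (n div p) <= 2 * dec gam n" by (simp only: exp_add exp_ln_iff) simp
  qed
  finally show "(\<Sum>w | w \<in> words n \<and> S w > (c + e) * real n. m w) <= (2 * M + 0 * real n) * dec gam n"
   by simp
 qed
qed

lemma large_deviation_lower:
 assumes "almost_additive S" and c: "AE i in mu. (%n. S (pre i n) / real n) ----> c"
  and e: "e > 0"
 shows "expsmall (%n. \<Sum>w | w \<in> words n \<and> S w < (c - e) * real n. m w)"
proof -
 have "almost_additive (%w. - S w)"
  using assms(1) unfolding almost_additive_def
  by (elim exE, intro exI) (auto simp: abs_le_iff algebra_simps)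
 moreover have "AE i in mu. (%n. - S (pre i n) / real n) ----> - c"
  using c by eventually_elim (auto dest: tendsto_minus)
 ultimately have "expsmall (%n. \<Sum>w | w \<in> words n \<and> - S w > (- c + e) * real n. m w)"
  by (rule large_deviation_upper[OF _ _ e])
 moreover have "- S w > (- c + e) * real n \<longleftrightarrow> S w < (c - e) * real n" for w n
  by (auto simp: algebra_simps)
 ultimately show ?thesis by simp
qed

end


section \<open>Kolmogorov-Sinai entropy as a limit over cylinders\<close>

lemma gibbs_inequality:
 fixes p q :: "'b => real"
 assumes "finite I" and q: "\<And>b. b \<in> I ==> q b >= 0" and p: "\<And>b. b \<in> I ==> p b >= 0"
  and "sum q I = 1" and "sum p I <= 1" and pos: "\<And>b. b \<in> I ==> q b > 0 ==> p b > 0"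
 shows "- (\<Sum>b\<in>I. q b * ln (q b)) <= - (\<Sum>b\<in>I. q b * ln (p b))"
proof -
 have "(\<Sum>b\<in>I. q b * ln (p b) - q b * ln (q b)) <= (\<Sum>b\<in>I. p b - q b)"
 proof (rule sum_mono)
  fix b assume b: "b \<in> I"
  show "q b * ln (p b) - q b * ln (q b) <= p b - q b"
  proof (cases "q b = 0")
   case True
   thus ?thesis using p[OF b] by simp
  next
   case False
   hence qb: "q b > 0" using q[OF b] by simp
   with pos[OF b] have pb: "p b > 0" by simp
   have "q b * ln (p b) - q b * ln (q b) = q b * ln (p b / q b)"
    using qb pb by (simp add: ln_div algebra_simps)
   also have "... <= q b * (p b / q b - 1)"
    using qb pb by (intro mult_left_mono ln_le_minus_one) auto
   also have "... = p b - q b" using qb by (simp add: field_simps)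
   finally show ?thesis .
  qed
 qed
 thus ?thesis using assms(4,5) by (simp add: sum_subtractf)
qed

lemma fekete:
 fixes a :: "nat => real"
 assumes sub: "\<And>n k. a (n + k) <= a n + a k" and nonneg: "\<And>n. a n >= 0"
 shows "convergent (%n. a n / real n)"
proof -
 define l where "l = (INF n\<in>{1..}. a n / real n)"
 have bdd: "bdd_below ((%n. a n / real n) ` {1..})"
  by (rule bdd_belowI[of _ 0]) (use nonneg in auto)
 have mult: "a (q * n) <= real q * a n + a 0" for q n
 proof (induction q)
  case (Suc q)
  thus ?case using sub[of n "q * n"] by (simp add: algebra_simps)
 qed simp
 have "(%n. a n / real n) ----> l"
 proof (rule tendstoI)
  fix e :: real assume "e > 0"
  obtain p where p: "p >= 1" "a p / real p < l + e / 2"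
   using cINF_less_iff[OF _ bdd, of "l + e/2"] \<open>e > 0\<close> by (auto simp: l_def)
  define M where "M = Max (a ` {..<p})"
  have M: "a r <= M" if "r < p" for r using that by (simp add: M_def)
  have "(%n. (a 0 + M) / real n) ----> 0" by real_asymp
  moreover have "e / 2 > 0" using \<open>e > 0\<close> by simp
  ultimately have "EV n. (a 0 + M) / real n < e / 2" by (rule order_tendstoD)
  with eventually_ge_at_top[of 1] show "EV n. dist (a n / real n) l < e"
  proof eventually_elim
   case (elim n)
   have "a n <= a (n div p * p) + a (n mod p)" using sub[of "n div p * p" "n mod p"] by simp
   also have "... <= real (n div p) * a p + (a 0 + M)" using mult[of "n div p" p] M[of "n mod p"] p by simp
   finally have "a n <= real (n div p) * a p + (a 0 + M)" .
   moreover have "real (n div p) * a p <= real n / real p * a p"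
   proof (intro mult_right_mono nonneg)
    have "real (n div p * p) <= real n" by (intro of_nat_mono div_times_less_eq_dividend)
    thus "real (n div p) <= real n / real p" using p by (simp add: field_simps)
   qed
   ultimately have "a n / real n <= (real n / real p * a p + (a 0 + M)) / real n"
    by (intro divide_right_mono) auto
   also have "... = a p / real p + (a 0 + M) / real n" using elim by (simp add: field_simps)
   finally have "a n / real n < l + e" using p elim by linarith
   moreover have "l <= a n / real n" unfolding l_def by (rule cINF_lower[OF bdd]) (use elim in auto)
   ultimately show ?case by (simp add: dist_real_def)
  qed
 qed
 thus ?thesis by (rule convergentI)
qed

lemma sum_prod_kernel_le_1:
 fixes W :: "'a => 'b => real"
 assumes "finite P" and W: "\<And>a. (\<Sum>b\<in>P. W a b) <= 1" and W0: "\<And>a b. W a b >= 0"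
 shows "(\<Sum>l | set l \<subseteq> P \<and> length l = n. \<Prod>k<n. W (f k) (l ! k)) <= 1"
proof (induction n arbitrary: f)
 case 0
 have "{l. set l \<subseteq> P \<and> length l = 0} = {[]}" by auto
 thus ?case by simp
next
 case (Suc n)
 let ?L = "%n. {l. set l \<subseteq> P \<and> length l = n}"
 have eq: "?L (Suc n) = (%(b, l). b # l) ` (P \<times> ?L n)"
  by (auto simp: length_Suc_conv image_iff)
 have "(\<Sum>l\<in>?L (Suc n). \<Prod>k<Suc n. W (f k) (l ! k)) = (\<Sum>(b, l)\<in>P \<times> ?L n. \<Prod>k<Suc n. W (f k) ((b # l) ! k))"
  unfolding eq by (subst sum.reindex) (auto simp: inj_on_def case_prod_unfold)
 also have "... = (\<Sum>b\<in>P. W (f 0) b * (\<Sum>l\<in>?L n. \<Prod>k<n. W (f (Suc k)) (l ! k)))"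
  by (simp add: sum.cartesian_product[symmetric] prod.lessThan_Suc_shift sum_distrib_left del: prod.lessThan_Suc)
 also have "... <= (\<Sum>b\<in>P. W (f 0) b * 1)"
  by (intro sum_mono mult_left_mono Suc.IH W0)
 also have "... <= 1" using W by simp
 finally show ?case .
qed

context quasi_bernoulli
begin

text \<open>A finite measurable observable stands for a finite partition, and its itineraries for
  the members of the joins. Entropies of itineraries are compared by coding, through Gibbs'
  inequality with a suitable reference distribution, instead of by conditioning.\<close>

definition obs :: "('a left_word => 'b) => bool" where
 "obs X \<longleftrightarrow> finite (range X) \<and> (\<forall>b. {i. X i = b} \<in> sets left_words)"

definition ent :: "('a left_word => 'b) => real" where
 "ent X = - (\<Sum>b\<in>range X. prob {i. X i = b} * ln (prob {i. X i = b}))"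

definition itinerary :: "('a left_word => 'b) => nat => 'a left_word => 'b list" where
 "itinerary X n i = pre (%k. X (shl k i)) n"

lemma obs_sum_eq_integral:
 assumes "obs X"
 shows "(\<Sum>b\<in>range X. prob {i. X i = b} * g b) = (\<integral>i. g (X i) \<partial>mu)"
  and "integrable mu (%i. (g (X i) :: real))"
proof -
 have fin: "finite (range X)" and meas: "\<And>b. {i. X i = b} \<in> sets mu" using assms by (auto simp: obs_def)
 have ind: "g (X i) = (\<Sum>b\<in>range X. indicator {i. X i = b} i * g b)" for i
 proof -
  have "(\<Sum>b\<in>range X. indicator {i. X i = b} i * g b) = (\<Sum>b\<in>range X. if b = X i then g b else 0)"
   by (rule sum.cong) (auto simp: indicator_def)
  thus ?thesis using fin by simp
 qed
 have int: "integrable mu (%i. indicator {i. X i = b} i * g b)" for b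
  using meas[of b] by (intro integrable_mult_left) (simp add: emeasure_eq_measure)
 thus "integrable mu (%i. g (X i))" unfolding ind by (intro b_integrable_sum)
 have "(\<integral>i. g (X i) \<partial>mu) = (\<Sum>b\<in>range X. \<integral>i. indicator {i. X i = b} i * g b \<partial>mu)"
  unfolding ind by (rule b_integral_sum) (use int in auto)
 also have "... = (\<Sum>b\<in>range X. prob {i. X i = b} * g b)"
  using meas by (intro sum.cong) auto
 finally show "(\<Sum>b\<in>range X. prob {i. X i = b} * g b) = (\<integral>i. g (X i) \<partial>mu)" by simp
qed

lemma obs_sum_eq_1: "obs X ==> (\<Sum>b\<in>range X. prob {i. X i = b}) = 1"
 using obs_sum_eq_integral(1)[of X "%_. 1"] prob_space by simp

lemma ent_le:
 assumes X: "obs X" and "\<And>b. p b >= 0" and "sum p (range X) <= 1"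
  and "\<And>b. prob {i. X i = b} > 0 ==> p b > 0"
 shows "ent X <= - (\<Sum>b\<in>range X. prob {i. X i = b} * ln (p b))"
 unfolding ent_def by (rule gibbs_inequality) (use assms obs_sum_eq_1[OF X] in \<open>auto simp: obs_def\<close>)

lemma ent_nonneg: "ent X >= 0"
proof -
 have "(\<Sum>b\<in>range X. prob {i. X i = b} * ln (prob {i. X i = b})) <= 0"
 proof (rule sum_nonpos)
  fix b
  have "prob {i. X i = b} = 0 \<or> ln (prob {i. X i = b}) <= 0"
   using zero_less_measure_iff by (metis ln_le_zero_iff prob_le_1)
  thus "prob {i. X i = b} * ln (prob {i. X i = b}) <= 0"
   by (auto intro: mult_nonneg_nonpos)
 qed
 thus ?thesis by (simp add: ent_def)
qed

lemma obs_itinerary: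
 assumes "obs X"
 shows "obs (itinerary X n)"
proof -
 have [measurable]: "{i \<in> space left_words. X (shl k i) = b} \<in> sets left_words" for k b
 proof -
  have "{i. X i = b} \<in> sets left_words" using assms by (simp add: obs_def)
  from measurable_sets[OF shl_measurable this, of k] show ?thesis by (simp add: vimage_def)
 qed
 have "range (itinerary X n) \<subseteq> {l. set l \<subseteq> range X \<and> length l = n}"
  by (auto simp: itinerary_def)
 moreover have "finite {l. set l \<subseteq> range X \<and> length l = n}"
  using assms by (intro finite_lists_length_eq) (simp add: obs_def)
 ultimately have "finite (range (itinerary X n))" by (rule finite_subset)
 moreover have "{i. itinerary X n i = l} \<in> sets left_words" for l
 proof (cases "length l = n")
  case True
  hence "{i. itinerary X n i = l} = {i \<in> space left_words. \<forall>k<n. X (shl k i) = l ! k}"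
   by (auto simp: itinerary_def list_eq_iff_nth_eq)
  also have "... \<in> sets left_words" by measurable
  finally show ?thesis .
 next
  case False
  hence "{i. itinerary X n i = l} = {}" by (auto simp: itinerary_def)
  thus ?thesis by simp
 qed
 ultimately show ?thesis by (simp add: obs_def)
qed

lemma itinerary_add: "itinerary X (n + k) i = itinerary X n i @ itinerary X k (shl n i)"
proof -
 have "shl (n + j) i = shl j (shl n i)" for j
  by (simp add: shl_def add_ac)
 thus ?thesis
  unfolding itinerary_def map_upt_add[of "%k. X (shl k i)"] by (simp add: shl_def add_ac)
qed

lemma measure_fiber_mono:
 assumes "obs Y" and "\<And>i. X i = b ==> Y i = c"
 shows "prob {i. X i = b} <= prob {i. Y i = c}"
 by (rule finite_measure_mono) (use assms in \<open>auto simp: obs_def\<close>)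

text \<open>Gibbs' inequality with the product of the two marginals as reference distribution;
  invariance identifies the second marginal with the law of the first \<open>k\<close>
  steps.\<close>

lemma ent_itinerary_subadditive:
 assumes X: "obs X"
 shows "ent (itinerary X (n + k)) <= ent (itinerary X n) + ent (itinerary X k)"
proof -
 let ?N = "itinerary X"
 define q where "q n l = prob {i. ?N n i = l}" for n l
 note o = obs_itinerary[OF X]
 have shift: "prob {i. ?N k (shl n i) = l} = q k l" for l
  using measure_shift[of "{i. ?N k i = l}" n] o[of k] by (simp add: obs_def q_def)
 have oshift: "{i. ?N k (shl n i) = l} \<in> sets left_words" for l
  using o[of k] measurable_sets[OF shl_measurable, of "{i. ?N k i = l}" n] by (simp add: vimage_def obs_def)
 define p where "p l = q n (take n l) * q k (drop n l)" for l
 have take: "take n (?N (n + k) i) = ?N n i" and drop: "drop n (?N (n + k) i) = ?N k (shl n i)" for i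
  by (simp_all add: itinerary_add) (simp_all add: itinerary_def)
 have le1: "q (n + k) l <= q n (take n l)" for l
  unfolding q_def by (rule measure_fiber_mono[OF o]) (use take in auto)
 have le2: "q (n + k) l <= q k (drop n l)" for l
  unfolding shift[symmetric] unfolding q_def
  by (rule finite_measure_mono) (use drop oshift in auto)
 have "ent (?N (n + k)) <= - (\<Sum>l\<in>range (?N (n + k)). q (n + k) l * ln (p l))"
  unfolding q_def
 proof (rule ent_le[OF o], unfold q_def[symmetric])
  show "p l >= 0" for l by (simp add: p_def q_def)
  show "p l > 0" if "q (n + k) l > 0" for l
   using le1[of l] le2[of l] that by (auto simp: p_def)
  have "sum p (range (?N (n + k))) = (\<Sum>(a, b)\<in>(%l. (take n l, drop n l)) ` range (?N (n + k)). q n a * q k b)"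
   by (subst sum.reindex) (auto simp: p_def inj_on_def, metis append_take_drop_id)
  also have "... <= (\<Sum>(a, b)\<in>range (?N n) \<times> range (?N k). q n a * q k b)"
  proof (rule sum_mono2)
   show "finite (range (?N n) \<times> range (?N k))" using o by (simp add: obs_def)
   show "(%l. (take n l, drop n l)) ` range (?N (n + k)) \<subseteq> range (?N n) \<times> range (?N k)"
    by (auto simp: take drop)
  qed (auto simp: q_def)
  also have "... = sum (q n) (range (?N n)) * sum (q k) (range (?N k))"
   by (simp add: sum_product sum.cartesian_product)
  also have "... = 1" using obs_sum_eq_1[OF o] by (simp add: q_def)
  finally show "sum p (range (?N (n + k))) <= 1" .
 qed
 also have "(\<Sum>l\<in>range (?N (n + k)). q (n + k) l * ln (p l)) =
   (\<Sum>l\<in>range (?N (n + k)). q (n + k) l * (ln (q n (take n l)) + ln (q k (drop n l))))"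
 proof (rule sum.cong[OF refl])
  fix l
  show "q (n + k) l * ln (p l) = q (n + k) l * (ln (q n (take n l)) + ln (q k (drop n l)))"
  proof (cases "q (n + k) l = 0")
   case False
   hence "q (n + k) l > 0" by (simp add: q_def zero_less_measure_iff)
   thus ?thesis using le1[of l] le2[of l] by (simp add: p_def ln_mult)
  qed simp
 qed
 also have "... = (\<Sum>l\<in>range (?N (n + k)). q (n + k) l * ln (q n (take n l))) +
   (\<Sum>l\<in>range (?N (n + k)). q (n + k) l * ln (q k (drop n l)))"
  by (simp add: distrib_left sum.distrib)
 also have "(\<Sum>l\<in>range (?N (n + k)). q (n + k) l * ln (q n (take n l))) = (\<integral>i. ln (q n (?N n i)) \<partial>mu)"
  unfolding q_def[of "n + k"] by (subst obs_sum_eq_integral(1)[OF o]) (simp add: take)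
 also have "... = - ent (?N n)"
  unfolding ent_def q_def by (subst obs_sum_eq_integral(1)[OF o]) simp
 also have "(\<Sum>l\<in>range (?N (n + k)). q (n + k) l * ln (q k (drop n l))) = (\<integral>i. ln (q k (?N k (shl n i))) \<partial>mu)"
  unfolding q_def[of "n + k"] by (subst obs_sum_eq_integral(1)[OF o]) (simp add: drop)
 also have "... = (\<integral>i. ln (q k (?N k i)) \<partial>mu)"
  using obs_sum_eq_integral(2)[OF o, of "%l. ln (q k l)" k] integral_shift[of "%i. ln (q k (?N k i))" n]
  by (auto dest!: borel_measurable_integrable)
 also have "... = - ent (?N k)"
  unfolding ent_def q_def by (subst obs_sum_eq_integral(1)[OF o]) simp
 finally show ?thesis by simp
qed

lemma obs_prefix: "obs (%i. pre i n)"
proof -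
 have "range (%i :: 'a left_word. pre i n) \<subseteq> words n" by auto
 from finite_subset[OF this] show ?thesis unfolding obs_def using sets_prefix by simp
qed

lemma range_prefix: "range (%i. pre i n) = (words n :: 'a list set)"
proof
 show "words n \<subseteq> range (%i :: 'a left_word. pre i n)"
 proof
  fix w :: "'a list" assume "w \<in> words n"
  hence "w = pre (conc w undefined) n" by auto
  thus "w \<in> range (%i. pre i n)" by blast
 qed
qed auto

lemma m_eq_prefix: "length w = n ==> m w = prob {i. pre i n = w}"
 by (auto simp: m_def cyl_def)

lemma ent_prefix: "ent (%i. pre i n) = - (\<Sum>w\<in>words n. m w * ln (m w))"
 unfolding ent_def range_prefix by (simp add: m_eq_prefix)

text \<open>Each fibre of \<open>X\<close> is nearly an event on finitely many letters. The decoder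
  outputs a value whose approximating event occurs, so an error forces one of the finitely many
  approximations to fail.\<close>

lemma finite_decoder:
 assumes X: "obs X" and "d > 0"
 shows "\<exists>M g. range g \<subseteq> range X \<and> prob {i. X i \<noteq> g (pre i M)} <= d"
proof -
 let ?P = "range X"
 have fin: "finite ?P" and meas: "\<And>b. {i. X i = b} \<in> sets left_words" using X by (auto simp: obs_def)
 define c where "c = real (card ?P)"
 have c: "c > 0" using fin by (auto simp: c_def card_gt_0_iff)
 have "\<forall>b. \<exists>n S. prob (sym_diff {i. X i = b} {i. pre i n \<in> S}) < d / c"
  using cylinder_approximation[of mu] finite_measure_axioms meas \<open>d > 0\<close> c by auto
 then obtain n S where nS: "\<And>b. prob (sym_diff {i. X i = b} {i. pre i (n b) \<in> S b}) < d / c"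
  by metis
 define M where "M = Max (n ` ?P)"
 have M: "n b <= M" if "b \<in> ?P" for b using that fin by (simp add: M_def)
 define g where "g w = (if \<exists>b\<in>?P. take (n b) w \<in> S b then SOME b. b \<in> ?P \<and> take (n b) w \<in> S b else X undefined)" for w
 have g: "g w \<in> ?P" for w
 proof (cases "\<exists>b\<in>?P. take (n b) w \<in> S b")
  case True
  hence "\<exists>b. b \<in> ?P \<and> take (n b) w \<in> S b" by blast
  from someI_ex[OF this] True show ?thesis by (simp add: g_def)
 qed (simp add: g_def)
 have sub: "{i. X i \<noteq> g (pre i M)} \<subseteq> (\<Union>b\<in>?P. sym_diff {i. X i = b} {i. pre i (n b) \<in> S b})"
 proof
  fix i assume i: "i \<in> {i. X i \<noteq> g (pre i M)}"
  show "i \<in> (\<Union>b\<in>?P. sym_diff {i. X i = b} {i. pre i (n b) \<in> S b})"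
  proof (rule ccontr)
   assume neg: "i \<notin> (\<Union>b\<in>?P. sym_diff {i. X i = b} {i. pre i (n b) \<in> S b})"
   have *: "X i = b \<longleftrightarrow> take (n b) (pre i M) \<in> S b" if "b \<in> ?P" for b
   proof -
    have "i \<notin> sym_diff {i. X i = b} {i. pre i (n b) \<in> S b}" using neg that by blast
    hence "X i = b \<longleftrightarrow> pre i (n b) \<in> S b" by blast
    thus ?thesis by (simp only: take_map_upt[OF M[OF that]])
   qed
   have ex: "X i \<in> ?P \<and> take (n (X i)) (pre i M) \<in> S (X i)" using *[of "X i"] by simp
   hence "\<exists>b\<in>?P. take (n b) (pre i M) \<in> S b" by blast
   moreover have "(SOME b. b \<in> ?P \<and> take (n b) (pre i M) \<in> S b) = X i"
    by (rule some_equality, rule ex) (metis *)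
   ultimately have "g (pre i M) = X i" by (simp only: g_def if_True)
   with i show False by simp
  qed
 qed
 have ms: "sym_diff {i. X i = b} {i. pre i (n b) \<in> S b} \<in> sets left_words" for b
  by (intro sets.Un sets.Diff meas sets_prefix)
 have "prob {i. X i \<noteq> g (pre i M)} <= prob (\<Union>b\<in>?P. sym_diff {i. X i = b} {i. pre i (n b) \<in> S b})"
  by (rule finite_measure_mono[OF sub]) (simp only: sets_mu, rule sets.finite_UN[OF fin ms])
 also have "... <= (\<Sum>b\<in>?P. prob (sym_diff {i. X i = b} {i. pre i (n b) \<in> S b}))"
  by (rule measure_UNION_le[OF fin]) (use ms in auto)
 also have "... <= (\<Sum>b\<in>?P. d / c)" by (intro sum_mono less_imp_le nS)
 also have "... = d" using c by (simp add: c_def)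
 finally show ?thesis using g by blast
qed

text \<open>The reference distribution on itineraries reads the word, decodes its blocks and sends the
 result through a memoryless channel of error probability \<open>eta\<close>.\<close>

lemma ent_itinerary_le:
 fixes X :: "'a left_word => 'b" and g :: "'a list => 'b"
 assumes X: "obs X" and g: "range g \<subseteq> range X" and d: "prob {i. X i \<noteq> g (pre i M)} <= d"
  and eta: "0 < eta" "eta < 1"
 shows "ent (itinerary X n) <= ent (%i. pre i (n + M)) +
      real n * (d * ln (real (card (range X)) / eta) - ln (1 - eta))"
proof -
 let ?P = "range X" and ?N = "itinerary X"
 have fin: "finite ?P" using X by (simp add: obs_def)
 define c where "c = real (card ?P)"
 have c: "c >= 1" using fin by (simp add: c_def Suc_leI card_gt_0_iff)
 \<comment> \<open>Mixing in a uniform error of weight \<open>eta\<close> keeps all logarithms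
   finite: a correct decoding costs at most \<open>- ln (1 - eta)\<close>, a wrong one
   \<open>ln (c / eta)\<close>.\<close>
 define W where "W a b = (if a = b then 1 - eta else 0) + eta / c" for a b :: 'b
 have W0: "W a b > 0" for a b using eta c by (auto simp: W_def add_nonneg_pos)
 have W1: "(\<Sum>b\<in>?P. W a b) <= 1" for a
  using fin eta c by (simp add: W_def sum.distrib c_def[symmetric])
 define ch where "ch w l = (\<Prod>k<n. W (g (take M (drop k w))) (l ! k))" for w l
 define p where "p l = (\<Sum>w\<in>words (n + M). m w * ch w l)" for l
 have ch0: "ch w l > 0" for w l unfolding ch_def by (intro prod_pos W0[rule_format] ballI)
 note o = obs_itinerary[OF X]
 have pw: "p l >= m w * ch w l" if "w \<in> words (n + M)" for w l
  unfolding p_def using that ch0 by (intro member_le_sum) (auto simp: less_imp_le)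
 have ne: "words (n + M) \<noteq> ({} :: 'a list set)" using range_prefix[of "n + M"] by blast
 have p0: "p l > 0" for l
  unfolding p_def using ne ch0 m_pos by (intro sum_pos) auto
 let ?A = "%i. - ln (m (pre i (n + M)))" and ?B = "%i. - ln (W (g (pre i M)) (X i))"
 have B: "integrable mu ?B"
 proof -
  have "obs (%i. (pre i M, X i))"
  proof -
   have "range (%i. (pre i M, X i)) \<subseteq> range (%i. pre i M) \<times> range X" by auto
   moreover have "{i. (pre i M, X i) = b} = {i. pre i M = fst b} \<inter> {i. X i = snd b}" for b
    by auto
   ultimately show ?thesis using obs_prefix[of M] X unfolding obs_def
    by (auto intro: finite_subset[OF _ finite_cartesian_product])
  qed
  from obs_sum_eq_integral(2)[OF this, of "%(w, b). - ln (W (g w) b)"] show ?thesis by simp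
 qed
 have Bk: "integrable mu (%i. ?B (shl k i))" for k
 proof -
  have "integrable (distr mu mu (shl k)) ?B" using B by (simp add: distr_shift)
  moreover have "shl k \<in> measurable mu mu" by measurable
  ultimately show ?thesis by (rule integrable_distr[rotated])
 qed
 have A: "integrable mu ?A" by (rule obs_sum_eq_integral(2)[OF obs_prefix])
 have "ent (?N n) <= - (\<Sum>l\<in>range (?N n). prob {i. ?N n i = l} * ln (p l))"
 proof (rule ent_le[OF o])
  have "sum p (range (?N n)) = (\<Sum>w\<in>words (n + M). m w * (\<Sum>l\<in>range (?N n). ch w l))"
   unfolding p_def by (subst sum.swap) (simp add: sum_distrib_left)
  also have "... <= (\<Sum>w\<in>words (n + M). m w * 1)"
  proof (intro sum_mono mult_left_mono)
   fix w
   have "(\<Sum>l\<in>range (?N n). ch w l) <= (\<Sum>l | set l \<subseteq> ?P \<and> length l = n. ch w l)"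
    using fin ch0 by (intro sum_mono2 finite_lists_length_eq) (auto simp: itinerary_def less_imp_le)
   also have "... <= 1" unfolding ch_def
    by (rule sum_prod_kernel_le_1[OF fin W1]) (use W0 in \<open>auto simp: less_imp_le\<close>)
   finally show "(\<Sum>l\<in>range (?N n). ch w l) <= 1" .
  qed simp
  finally show "sum p (range (?N n)) <= 1" by simp
 qed (use p0 in \<open>auto simp: less_imp_le\<close>)
 also have "... = (\<integral>i. - ln (p (?N n i)) \<partial>mu)"
  by (simp add: obs_sum_eq_integral(1)[OF o])
 also have "... <= (\<integral>i. ?A i + (\<Sum>k<n. ?B (shl k i)) \<partial>mu)"
 proof (rule integral_mono)
  show "integrable mu (%i. - ln (p (?N n i)))"
   by (rule obs_sum_eq_integral(2)[OF o])
  show "integrable mu (%i. ?A i + (\<Sum>k<n. ?B (shl k i)))"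
   using A Bk by (intro b_integrable_add b_integrable_sum)
  fix i :: "'a left_word"
  let ?w = "pre i (n + M)"
  have ch: "ch ?w (?N n i) = (\<Prod>k<n. W (g (pre (shl k i) M)) (X (shl k i)))"
  proof -
   have "take M (drop k ?w) = pre (shl k i) M" if "k < n" for k
    using that by (intro nth_equalityI) (auto simp: shl_def)
   thus ?thesis unfolding ch_def by (intro prod.cong) (auto simp: itinerary_def)
  qed
  have "ln (m ?w * ch ?w (?N n i)) <= ln (p (?N n i))"
   using pw[of ?w "?N n i"] m_pos[of ?w] ch0[of ?w "?N n i"] by (subst ln_le_cancel_iff) (auto intro: p0)
  also have "ln (m ?w * ch ?w (?N n i)) = ln (m ?w) + ln (ch ?w (?N n i))"
   using m_pos[of ?w] ch0[of ?w "?N n i"] by (simp add: ln_mult)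
  also have "ln (ch ?w (?N n i)) = (\<Sum>k<n. ln (W (g (pre (shl k i) M)) (X (shl k i))))"
   unfolding ch using W0 by (subst ln_prod) (simp_all add: W0[THEN less_imp_neq, THEN not_sym])
  finally show "- ln (p (?N n i)) <= ?A i + (\<Sum>k<n. ?B (shl k i))"
   by (simp add: sum_negf)
 qed
 also have "... = (\<integral>i. ?A i \<partial>mu) + (\<Sum>k<n. \<integral>i. ?B (shl k i) \<partial>mu)"
  using A Bk by (simp only: b_integral_add b_integral_sum b_integrable_sum)
 also have "(\<Sum>k<n. \<integral>i. ?B (shl k i) \<partial>mu) = real n * (\<integral>i. ?B i \<partial>mu)"
  using B by (subst integral_shift) (auto dest!: borel_measurable_integrable)
 also have "(\<integral>i. ?A i \<partial>mu) = ent (%i. pre i (n + M))"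
  using obs_sum_eq_integral(1)[OF obs_prefix, of "n + M" "%w. ln (m w)"]
  unfolding ent_prefix range_prefix by (simp add: m_eq_prefix[symmetric])
 also have "(\<integral>i. ?B i \<partial>mu) <= d * ln (c / eta) - ln (1 - eta)"
 proof -
  let ?E = "{i. X i \<noteq> g (pre i M)}"
  have "{i. X i = g (pre i M)} = (\<Union>b\<in>?P. {i. X i = b} \<inter> {i. g (pre i M) = b})" by auto
  also have "... \<in> sets left_words"
   using X by (intro sets.finite_UN[OF fin] sets.Int sets_prefix) (simp add: obs_def)
  finally have "- {i. X i = g (pre i M)} \<in> sets left_words"
   by (metis Compl_eq_Diff_UNIV sets.compl_sets space_left_words)
  hence E: "?E \<in> sets mu" by (simp add: Collect_neg_eq)
  have ln0: "ln (1 - eta) <= 0" "ln (c / eta) >= 0" using eta c by (auto simp: ln_ge_zero_iff)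
  have "?B i <= - ln (1 - eta) + indicator ?E i * ln (c / eta)" for i
  proof (cases "i \<in> ?E")
   case True
   hence "?B i = ln (c / eta)" using eta c by (simp add: W_def ln_div)
   thus ?thesis using True ln0 by simp
  next
   case False
   hence "ln (1 - eta) <= ln (W (g (pre i M)) (X i))"
    using eta c by (intro ln_mono) (auto simp: W_def)
   thus ?thesis using False by simp
  qed
  hence "(\<integral>i. ?B i \<partial>mu) <= (\<integral>i. - ln (1 - eta) + indicator ?E i * ln (c / eta) \<partial>mu)"
   using E by (intro integral_mono B) (auto simp: emeasure_eq_measure)
  also have "... = - ln (1 - eta) + prob ?E * ln (c / eta)"
   using E prob_space by (subst b_integral_add) (auto simp: emeasure_eq_measure)
  also have "prob ?E * ln (c / eta) <= d * ln (c / eta)"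
   using d ln0 by (intro mult_right_mono) auto
  finally show ?thesis by simp
 qed
 finally show ?thesis using c_def by (simp add: mult_left_mono)
qed

lemma ent_inj:
 assumes "inj f"
 shows "ent (%i. f (X i)) = ent X"
proof -
 have "range (%i. f (X i)) = f ` range X" by auto
 thus ?thesis
  unfolding ent_def using assms by (simp add: sum.reindex[OF inj_on_subset[OF assms]] inj_eq)
qed

text \<open>The decoding error \<open>d\<close> must vanish before the channel error
  \<open>eta\<close>, because \<open>d\<close> is multiplied by a logarithm of
  \<open>1 / eta\<close>.\<close>

lemma ent_rate_le:
 assumes X: "obs X" and h: "(%n. ent (%i. pre i n) / real n) ----> h"
  and l: "(%n. ent (itinerary X n) / real n) ----> l"
 shows "l <= h"
proof -
 let ?c = "real (card (range X))"
 have c: "?c >= 1" using X by (simp add: obs_def Suc_leI card_gt_0_iff)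
 have 1: "l <= h + (d * ln (?c / eta) - ln (1 - eta))" if "d > 0" "0 < eta" "eta < 1" for d eta
 proof -
  obtain M g where g: "range g \<subseteq> range X" "prob {i. X i \<noteq> g (pre i M)} <= d"
   using finite_decoder[OF X \<open>d > 0\<close>] by blast
  let ?K = "d * ln (?c / eta) - ln (1 - eta)"
  have "(%n. real (n + M) / real n) ----> 1" by real_asymp
  from tendsto_mult[OF LIMSEQ_ignore_initial_segment[OF h, of M] this]
  have "(%n. ent (%i. pre i (n + M)) / real (n + M) * (real (n + M) / real n) + ?K) ----> h * 1 + ?K"
   by (intro tendsto_add tendsto_const)
  moreover have "EV n. ent (itinerary X n) / real n <=
    ent (%i. pre i (n + M)) / real (n + M) * (real (n + M) / real n) + ?K"
  proof (rule eventually_sequentiallyI[of 1])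
   fix n :: nat assume n: "n >= 1"
   have "ent (itinerary X n) / real n <= (ent (%i. pre i (n + M)) + real n * ?K) / real n"
    by (intro divide_right_mono ent_itinerary_le[OF X g that(2,3)]) auto
   also have "... = ent (%i. pre i (n + M)) / real (n + M) * (real (n + M) / real n) + ?K"
   proof -
    have "real (n + M) \<noteq> 0" "real n \<noteq> 0" using n by auto
    hence "ent (%i. pre i (n + M)) / real (n + M) * (real (n + M) / real n) = ent (%i. pre i (n + M)) / real n"
     by (metis (no_types, lifting) nonzero_eq_divide_eq times_divide_eq_right)
    with n show ?thesis by (simp only: add_divide_distrib) simp
   qed
   finally show "ent (itinerary X n) / real n <= ..." .
  qed
  ultimately show ?thesis using l by (intro tendsto_le[of sequentially _ "h + ?K" "%n. ent (itinerary X n) / real n" l]) auto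
 qed
 have 2: "l <= h - ln (1 - eta)" if "0 < eta" "eta < 1" for eta
 proof (rule tendsto_lowerbound)
  show "((%d. h + (d * ln (?c / eta) - ln (1 - eta))) \<longlongrightarrow> h - ln (1 - eta)) (at_right 0)"
   by (rule tendsto_eq_intros refl | simp)+
  show "\<forall>\<^sub>F d in at_right 0. l <= h + (d * ln (?c / eta) - ln (1 - eta))"
   using 1 that by (intro eventually_at_rightI[of 0 1]) auto
 qed simp
 show ?thesis
 proof (rule tendsto_lowerbound)
  show "((%eta. h - ln (1 - eta)) \<longlongrightarrow> h) (at_right 0)" by real_asymp
  show "\<forall>\<^sub>F eta in at_right 0. l <= h - ln (1 - eta)"
   using 2 by (intro eventually_at_rightI[of 0 1]) auto
 qed simp
qed

lemma partition_entropy_join: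
 assumes P: "finite_partition mu P" and X: "\<And>i. X i \<in> P \<and> i \<in> X i"
 shows "obs X" and "partition_entropy mu (partition_join mu right_shift P n) = ent (itinerary X n)"
proof -
 have fin: "finite P" and part: "partition_on UNIV P" and sets: "P \<subseteq> sets left_words"
  using P by (auto simp: finite_partition_def)
 have disj: "B = B'" if "B \<in> P" "B' \<in> P" "i \<in> B" "i \<in> B'" for B B' i
  using part that unfolding partition_on_def disjoint_def by blast
 have XB: "X i = B \<longleftrightarrow> i \<in> B" if "B \<in> P" for B i
  using disj[OF that, of "X i" i] X[of i] by blast
 have fibre: "{i. X i = B} = (if B \<in> P then B else {})" for B
  using XB X by auto
 show "obs X"
  unfolding obs_def fibre using fin sets finite_subset[of "range X" P] X by auto
 let ?J = "partition_join mu right_shift P n" and ?N = "itinerary X n"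
 have J: "?J = {{i. \<forall>k<n. X (shl k i) = c k} | c. \<forall>k. c k \<in> P}"
 proof -
  have "{x \<in> space mu. \<forall>k<n. shl k x \<in> c k} = {i. \<forall>k<n. X (shl k i) = c k}"
   if "\<forall>k. c k \<in> P" for c :: "nat => 'a left_word set"
   using that XB by simp
  thus ?thesis unfolding partition_join_def right_shift_funpow by (intro Collect_cong ex_cong1 iffI; elim conjE; intro conjI; simp)
 qed
 have ne: "?J - {{}} = (%l. {i. ?N i = l}) ` range ?N"
 proof (intro equalityI subsetI)
  fix B assume "B \<in> ?J - {{}}"
  then obtain c i where c: "B = {i. \<forall>k<n. X (shl k i) = c k}" "i \<in> B" unfolding J by auto
  from c(2) have "X (shl k i) = c k" if "k < n" for k using that unfolding c(1) by blast
  hence "B = {j. \<forall>k<n. X (shl k j) = X (shl k i)}" unfolding c(1) by simp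
  hence "B = {j. ?N j = ?N i}" by (simp add: itinerary_def Ball_def)
  thus "B \<in> (%l. {i. ?N i = l}) ` range ?N" by blast
 next
  fix B assume "B \<in> (%l. {i. ?N i = l}) ` range ?N"
  then obtain i where i: "B = {j. ?N j = ?N i}" by blast
  hence "B = {j. \<forall>k<n. X (shl k j) = X (shl k i)}" by (simp add: itinerary_def Ball_def)
  moreover have "\<forall>k. X (shl k i) \<in> P" using X by blast
  ultimately have "B \<in> ?J" unfolding J by (intro CollectI exI[of _ "%k. X (shl k i)"]) simp
  moreover have "i \<in> B" using i by simp
  ultimately show "B \<in> ?J - {{}}" by blast
 qed
 have "?J \<subseteq> (%l. {i. ?N i = l}) ` range ?N \<union> {{}}" using ne by blast
 moreover have "finite (range ?N)" using obs_itinerary[OF \<open>obs X\<close>, of n] by (simp add: obs_def)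
 ultimately have finJ: "finite ?J" by (meson finite.emptyI finite.insertI finite_UnI finite_imageI finite_subset)
 have "(\<Sum>B\<in>?J. prob B * ln (prob B)) = (\<Sum>B\<in>?J - {{}}. prob B * ln (prob B))"
  using finJ by (intro sum.mono_neutral_right) auto
 also have "... = (\<Sum>l\<in>range ?N. prob {i. ?N i = l} * ln (prob {i. ?N i = l}))"
  unfolding ne by (subst sum.reindex) (auto simp: inj_on_def)
 finally show "partition_entropy mu ?J = ent ?N" by (simp add: partition_entropy_def ent_def)
qed

text \<open>The partition by the letter at position \<open>0\<close> attains the supremum: its
  itineraries are the prefixes, and by \<open>ent_rate_le\<close> no finite partition has a larger
  rate.\<close>

theorem shift_entropy_limit:
 "(%n. (\<Sum>w\<in>words n. m w * ln (m w)) / real n) ----> - shift_entropy mu"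
proof -
 have "almost_additive (%w. ln (m w))" by (rule almost_additive_ln[OF m_pos C_ge_1 m_append_le m_append_ge])
 from almost_additive_limit[OF this] obtain c
  where c: "(%n. (\<Sum>w\<in>words n. m w * ln (m w)) / real n) ----> c" by blast
 have h: "(%n. ent (%i. pre i n) / real n) ----> - c"
  using tendsto_minus[OF c] by (simp add: ent_prefix)
 have conv: "\<exists>l\<le>-c. (%n. partition_entropy mu (partition_join mu right_shift P n) / real n) ----> l"
  if P: "finite_partition mu P" for P
 proof -
  have "\<forall>i. \<exists>B. B \<in> P \<and> i \<in> B" using P by (auto simp: finite_partition_def partition_on_def)
  then obtain X where X: "\<And>i. X i \<in> P \<and> i \<in> X i" by metis
  note p = partition_entropy_join[OF P X]
  have "convergent (%n. ent (itinerary X n) / real n)"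
   by (rule fekete) (use ent_itinerary_subadditive[OF p(1)] ent_nonneg in auto)
  then obtain l where l: "(%n. ent (itinerary X n) / real n) ----> l" by (auto simp: convergent_def)
  moreover have "l <= - c" by (rule ent_rate_le[OF p(1) h l])
  ultimately show ?thesis by (auto simp: p(2))
 qed
 let ?Q = "range (%k. {i :: 'a left_word. i 0 = k})"
 have Q: "finite_partition mu ?Q"
 proof -
  have "{i :: 'a left_word. i 0 = k} \<in> sets left_words" for k
   using sets_prefix[of "%w. w ! 0 = k" 1] by simp
  moreover have "{i :: 'a left_word. i 0 = k} \<noteq> {}" for k
   by (simp, rule exI[of _ "%_. k"], simp)
  ultimately show ?thesis
   by (auto simp: finite_partition_def partition_on_def disjoint_def)
 qed
 have "partition_entropy mu (partition_join mu right_shift ?Q n) = ent (%i. pre i n)" for n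
 proof -
  let ?f = "%k. {i :: 'a left_word. i 0 = k}"
  have inj: "inj ?f"
  proof (rule injI)
   fix k l :: 'a assume "?f k = ?f l"
   moreover have "(%_. k) \<in> ?f k" by simp
   ultimately have "(%_. k) \<in> ?f l" by simp
   thus "k = l" by simp
  qed
  have "partition_entropy mu (partition_join mu right_shift ?Q n) = ent (itinerary (%i. ?f (i 0)) n)"
   by (rule partition_entropy_join(2)[OF Q]) auto
  also have "itinerary (%i. ?f (i 0)) n = (%i. map ?f (pre i n))"
   by (auto simp: itinerary_def shl_def)
  also have "ent ... = ent (%i. pre i n)"
   using inj by (intro ent_inj) simp
  finally show ?thesis .
 qed
 hence Qlim: "(%n. partition_entropy mu (partition_join mu right_shift ?Q n) / real n) ----> - c"
  using h by simp
 have "ks_entropy mu right_shift = ereal (- c)"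
  unfolding ks_entropy_def
 proof (rule antisym)
  show "(SUP P\<in>{P. finite_partition mu P}. ereal (lim (%n. partition_entropy mu (partition_join mu right_shift P n) / real n))) <= ereal (- c)"
  proof (rule SUP_least, clarify)
   fix P assume "finite_partition mu P"
   from conv[OF this] obtain l where "l <= - c" "(%n. partition_entropy mu (partition_join mu right_shift P n) / real n) ----> l" by blast
   thus "ereal (lim (%n. partition_entropy mu (partition_join mu right_shift P n) / real n)) <= ereal (- c)"
    by (simp add: limI)
  qed
  show "ereal (- c) <= (SUP P\<in>{P. finite_partition mu P}. ereal (lim (%n. partition_entropy mu (partition_join mu right_shift P n) / real n)))"
   by (rule SUP_upper2[of ?Q]) (use Q Qlim in \<open>auto simp: limI\<close>)
 qed
 thus ?thesis using c by (simp add: shift_entropy_def)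
qed

end


section \<open>Singular values and distinguished directions of planar matrices\<close>

definition wedge :: "real^2 => real^2 => real" where
 "wedge u v = u $ 1 * v $ 2 - u $ 2 * v $ 1"

definition mnorm :: "real^2^2 => real" where
 "mnorm M = onorm ((*v) M)"

lemma norm_vec2: "norm (v :: real^2) = sqrt ((v $ 1)^2 + (v $ 2)^2)"
 by (simp add: norm_vec_def L2_set_def sum_2)

lemma inner_vec2: "(u :: real^2) \<bullet> v = u $ 1 * v $ 1 + u $ 2 * v $ 2"
 by (simp add: inner_vec_def sum_2)

lemma wedge_matrix: "wedge (M *v u) (M *v v) = det M * wedge u v"
 by (simp add: wedge_def matrix_vector_mult_def det_2 sum_2 algebra_simps)

lemma wedge_sq: "(wedge u v)^2 + (u \<bullet> v)^2 = (norm u)^2 * (norm v)^2"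
 by (simp add: wedge_def inner_vec2 norm_vec2 power2_eq_square algebra_simps)

lemma wedge_le: "\<bar>wedge u v\<bar> <= norm u * norm v"
proof -
 have "(wedge u v)^2 <= (norm u * norm v)^2"
  using wedge_sq[of u v] by (simp add: power_mult_distrib) (smt (verit) zero_le_power2)
 thus ?thesis using abs_le_square_iff[of "wedge u v" "norm u * norm v"] by simp
qed

lemma wedge_simps [simp]: "wedge u u = 0" "wedge 0 u = 0" "wedge u 0 = 0"
 "wedge (c *\<^sub>R u) v = c * wedge u v" "wedge u (c *\<^sub>R v) = c * wedge u v"
 "wedge (- u) v = - wedge u v" "wedge u (- v) = - wedge u v"
 by (simp_all add: wedge_def algebra_simps)

lemma wedge_add: "wedge (a + b) v = wedge a v + wedge b v" "wedge u (a + b) = wedge u a + wedge u b"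
 "wedge (a - b) v = wedge a v - wedge b v" "wedge u (a - b) = wedge u a - wedge u b"
 by (simp_all add: wedge_def algebra_simps)

lemma wedge_commute: "wedge u v = - wedge v u"
 by (simp add: wedge_def)

lemma wedge_three: "wedge v w *\<^sub>R u = wedge u w *\<^sub>R v - wedge u v *\<^sub>R w"
 by (simp add: vec_eq_iff forall_2 wedge_def algebra_simps)

text \<open>For unit vectors \<open>wedge\<close> is, up to sign, the sine of the angle between the
  lines; this is the triangle inequality for that distance.\<close>

lemma wedge_triangle:
 assumes "norm v = 1"
 shows "\<bar>wedge u w\<bar> <= \<bar>wedge u v\<bar> * norm w + norm u * \<bar>wedge v w\<bar>"
proof -
 have "wedge u w *\<^sub>R v = wedge v w *\<^sub>R u + wedge u v *\<^sub>R w"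
  unfolding wedge_three[of v w u] by simp
 hence "norm (wedge u w *\<^sub>R v) = norm (wedge v w *\<^sub>R u + wedge u v *\<^sub>R w)" by simp
 also have "... <= \<bar>wedge v w\<bar> * norm u + \<bar>wedge u v\<bar> * norm w"
  using norm_triangle_ineq[of "wedge v w *\<^sub>R u" "wedge u v *\<^sub>R w"] by simp
 finally show ?thesis using assms by (simp add: mult.commute add.commute)
qed

lemma mnorm_pos: "norm (M *v v) <= mnorm M * norm v"
 unfolding mnorm_def by (intro onorm matrix_vector_mul_bounded_linear)

lemma mnorm_nonneg [simp]: "mnorm M >= 0"
 unfolding mnorm_def by (intro onorm_pos_le matrix_vector_mul_bounded_linear)

lemma mnorm_le: "(\<And>v. norm (M *v v) <= b * norm v) ==> mnorm M <= b"
 unfolding mnorm_def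
proof (rule onorm_bound)
 assume *: "\<And>v. norm (M *v v) <= b * norm v"
 show "b >= 0" using order_trans[OF norm_ge_zero *[of "axis 1 1"]] by (simp add: norm_axis_1)
qed auto

lemma mnorm_mult: "mnorm (M ** N) <= mnorm M * mnorm N"
proof (rule mnorm_le)
 fix v
 have "norm (M ** N *v v) <= mnorm M * norm (N *v v)"
  using mnorm_pos[of M "N *v v"] by (simp add: matrix_vector_mul_assoc)
 also have "... <= mnorm M * (mnorm N * norm v)" by (intro mult_left_mono mnorm_pos mnorm_nonneg)
 finally show "norm (M ** N *v v) <= mnorm M * mnorm N * norm v" by simp
qed

lemma mnorm_attained: "\<exists>v. norm v = 1 \<and> norm (M *v v) = mnorm M"
proof -
 have "compact (sphere (0::real^2) 1)" by simp
 moreover have "sphere (0::real^2) 1 \<noteq> {}" by simp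
 moreover have "continuous_on (sphere 0 1) (%v. norm (M *v v))"
  by (intro continuous_intros linear_continuous_on matrix_vector_mul_bounded_linear)
 ultimately obtain v where v: "v \<in> sphere 0 1" "\<And>u. u \<in> sphere 0 1 ==> norm (M *v u) <= norm (M *v v)"
  using continuous_attains_sup[of "sphere (0::real^2) 1" "%v. norm (M *v v)"] by blast
 have "norm (M *v u) <= norm (M *v v) * norm u" for u
 proof (cases "u = 0")
  case False
  have "norm (M *v ((1 / norm u) *\<^sub>R u)) <= norm (M *v v)"
   using False by (intro v(2)) simp
  thus ?thesis using False by (simp add: matrix_vector_mult_scaleR field_simps)
 qed simp
 hence "mnorm M <= norm (M *v v)" by (rule mnorm_le)
 moreover have "norm (M *v v) <= mnorm M" using mnorm_pos[of M v] v(1) by simp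
 ultimately show ?thesis using v(1) by (intro exI[of _ v]) simp
qed

lemma invertible_2: "invertible (M :: real^2^2) \<longleftrightarrow> det M \<noteq> 0"
 by (rule invertible_det_nz)

lemma det_le_mnorm: "\<bar>det M\<bar> * norm v <= mnorm M * norm (M *v v)"
proof (cases "v = 0")
 case False
 define w :: "real^2" where "w = (\<chi> i. if i = 1 then - v $ 2 else v $ 1)"
 have w: "norm w = norm v" "wedge v w = (norm v)^2"
  by (simp_all add: w_def norm_vec2 wedge_def power2_eq_square add.commute)
 have "\<bar>det M\<bar> * (norm v)^2 = \<bar>wedge (M *v v) (M *v w)\<bar>"
  by (simp add: wedge_matrix w abs_mult)
 also have "... <= norm (M *v v) * norm (M *v w)" by (rule wedge_le)
 also have "... <= norm (M *v v) * (mnorm M * norm v)"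
  using mnorm_pos[of M w] w by (intro mult_left_mono) auto
 finally show ?thesis using False by (simp add: power2_eq_square mult.commute)
qed simp

lemma mnorm_gt_0: "det M \<noteq> 0 ==> mnorm M > 0"
proof -
 assume "det M \<noteq> 0"
 hence "\<bar>det M\<bar> * norm (axis 1 1 :: real^2) > 0" by simp
 hence "mnorm M \<noteq> 0" using det_le_mnorm[of M "axis 1 1"] by auto
 thus "mnorm M > 0" by (simp add: less_le)
qed

text \<open>The smaller singular value, written through the determinant: multiplicativity of
  \<open>det\<close> then reduces its behaviour under products to that of
  \<open>mnorm\<close>.\<close>

definition mconorm :: "real^2^2 => real" where
 "mconorm M = \<bar>det M\<bar> / mnorm M"

lemma mconorm_le_norm: "det M \<noteq> 0 ==> mconorm M * norm v <= norm (M *v v)"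
 using det_le_mnorm[of M v] mnorm_gt_0[of M] by (simp add: mconorm_def field_simps)

lemma mconorm_gt_0: "det M \<noteq> 0 ==> mconorm M > 0"
 using mnorm_gt_0[of M] by (simp add: mconorm_def)

text \<open>Take a maximiser \<open>a\<close> of the stretching on the circle and its rotation
  \<open>b\<close>. First-order optimality makes the images orthogonal, and the determinant then
  gives the length of the second image.\<close>

lemma singular_frame:
 assumes "det M \<noteq> 0"
 obtains a b where "norm a = 1" "norm b = 1" "a \<bullet> b = 0" "\<bar>wedge a b\<bar> = 1"
  "norm (M *v a) = mnorm M" "norm (M *v b) = mconorm M" "(M *v a) \<bullet> (M *v b) = 0"
proof -
 obtain a where a: "norm a = 1" "norm (M *v a) = mnorm M" using mnorm_attained by blast
 define b :: "real^2" where "b = (\<chi> i. if i = 1 then - a $ 2 else a $ 1)"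
 have b: "norm b = 1" "wedge a b = 1" "a \<bullet> b = 0"
  using a(1) by (simp_all add: b_def norm_vec2 wedge_def inner_vec2 power2_eq_square add.commute)
 define p where "p = (M *v a) \<bullet> (M *v b)"
 have p: "p = 0"
 proof (rule ccontr)
  assume "p \<noteq> 0"
  \<comment> \<open>A small multiple of \<open>b\<close> with the sign of \<open>p\<close>: adding
    it to \<open>a\<close> would beat the maximum.\<close>
  define e where "e = p / ((norm (M *v b))^2 + (mnorm M)^2 + 1)"
  define D where "D = (norm (M *v b))^2 + (mnorm M)^2 + 1"
  have D: "D > 0" by (simp add: D_def add_nonneg_pos)
  have "(norm (M *v (a + e *\<^sub>R b)))^2 <= (mnorm M)^2 * (norm (a + e *\<^sub>R b))^2"
   using mnorm_pos[of M "a + e *\<^sub>R b"] by (metis norm_ge_zero power_mono power_mult_distrib)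
  moreover have "(norm (a + e *\<^sub>R b))^2 = 1 + e^2"
   unfolding power2_norm_eq_inner using a b
   by (simp add: inner_add_left inner_add_right inner_commute norm_eq_1) (simp add: power2_eq_square)
  moreover have "(norm (M *v (a + e *\<^sub>R b)))^2 = (mnorm M)^2 + 2 * e * p + e^2 * (norm (M *v b))^2"
   unfolding a(2)[symmetric] p_def power2_norm_eq_inner
   by (simp add: matrix_vector_right_distrib matrix_vector_mult_scaleR inner_add_left inner_add_right
    inner_commute) (simp add: power2_eq_square algebra_simps)
  ultimately have "2 * e * p + e^2 * (norm (M *v b))^2 <= (mnorm M)^2 * e^2" by (simp add: algebra_simps)
  hence "2 * e * p <= (mnorm M)^2 * e^2" by (smt (verit) mult_nonneg_nonneg zero_le_power2)
  also have "... <= D * e^2" by (intro mult_right_mono) (auto simp: D_def)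
  also have "... = e * p" using D unfolding e_def D_def[symmetric] by (simp add: power2_eq_square)
  finally have "e * p <= 0" by simp
  moreover have "e * p = p^2 / D" by (simp add: e_def D_def power2_eq_square)
  moreover have "p^2 / D > 0" using D \<open>p \<noteq> 0\<close> by simp
  ultimately show False by simp
 qed
 have "(wedge (M *v a) (M *v b))^2 = (norm (M *v a))^2 * (norm (M *v b))^2"
  using wedge_sq[of "M *v a" "M *v b"] p by (simp add: p_def)
 hence "\<bar>det M\<bar>\<^sup>2 = (mnorm M * norm (M *v b))^2"
  unfolding wedge_matrix b(2) a(2) by (simp add: power_mult_distrib)
 hence "\<bar>det M\<bar> = mnorm M * norm (M *v b)"
  by (rule power2_eq_imp_eq) auto
 hence "norm (M *v b) = mconorm M"
  using mnorm_gt_0[OF assms] by (simp add: mconorm_def field_simps)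
 with a b p that show ?thesis by (auto simp: p_def)
qed

lemma gram_eigenvalue_iff:
 fixes M :: "real^2^2"
 shows "transpose M ** M *v v = c *\<^sub>R v \<longleftrightarrow> (\<forall>u. (M *v u) \<bullet> (M *v v) = c * (u \<bullet> v))"
proof -
 have "(M *v u) \<bullet> (M *v v) = u \<bullet> (transpose M ** M *v v)" for u
  using dot_lmul_matrix[of "M *v v" M u]
  by (simp add: matrix_vector_mul_assoc[symmetric] inner_commute del: matrix_vector_mul_assoc)
 hence "(\<forall>u. (M *v u) \<bullet> (M *v v) = c * (u \<bullet> v)) \<longleftrightarrow> (\<forall>u. u \<bullet> (transpose M ** M *v v) = u \<bullet> (c *\<^sub>R v))"
  by simp
 thus ?thesis by (metis vector_eq_ldot)
qed

lemma gram_eigenvalues: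
 assumes "det M \<noteq> 0"
 shows "gram_eigenvalues M = {(mnorm M)\<^sup>2, (mconorm M)^2}"
proof -
 obtain a b where ab: "norm a = 1" "norm b = 1" "a \<bullet> b = 0" "\<bar>wedge a b\<bar> = 1"
  "norm (M *v a) = mnorm M" "norm (M *v b) = mconorm M" "(M *v a) \<bullet> (M *v b) = 0"
  using singular_frame[OF assms] .
 have w0: "wedge a b \<noteq> 0" using ab(4) by auto
 have frame: "u = (u \<bullet> a) *\<^sub>R a + (u \<bullet> b) *\<^sub>R b" for u
 proof -
  define k where "k = wedge u b / wedge a b"
  define l where "l = wedge a u / wedge a b"
  have "wedge a b *\<^sub>R u = wedge u b *\<^sub>R a - wedge u a *\<^sub>R b" by (rule wedge_three)
  hence "u = (1 / wedge a b) *\<^sub>R (wedge u b *\<^sub>R a - wedge u a *\<^sub>R b)" using w0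
   by (metis divide_self_if scaleR_one scaleR_scaleR times_divide_eq_left mult_1)
  hence u: "u = k *\<^sub>R a + l *\<^sub>R b"
   by (simp add: k_def l_def wedge_commute[of u a] scaleR_diff_right scaleR_add_right)
  have "a \<bullet> a = 1" "b \<bullet> b = 1" "b \<bullet> a = 0" using ab by (simp_all add: norm_eq_1 inner_commute)
  hence "u \<bullet> a = k" "u \<bullet> b = l"
   unfolding u using ab(3) by (simp_all add: inner_add_left)
  thus ?thesis using u by simp
 qed
 have aa: "a \<bullet> a = 1" "b \<bullet> b = 1" "b \<bullet> a = 0" using ab by (simp_all add: norm_eq_1 inner_commute)
 have Mu: "M *v u = (u \<bullet> a) *\<^sub>R (M *v a) + (u \<bullet> b) *\<^sub>R (M *v b)" for u
  by (subst frame[of u]) (simp add: matrix_vector_right_distrib matrix_vector_mult_scaleR)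
 have MM: "(M *v u) \<bullet> (M *v v) = (u \<bullet> a) * (v \<bullet> a) * (mnorm M)^2 + (u \<bullet> b) * (v \<bullet> b) * (mconorm M)^2" for u v
  unfolding Mu[of u] Mu[of v] ab(5,6)[symmetric] power2_norm_eq_inner
  using ab(7) by (simp add: inner_add_left inner_add_right inner_commute algebra_simps)
 show ?thesis
 proof (intro equalityI subsetI)
  fix c assume "c \<in> gram_eigenvalues M"
  then obtain v where v: "v \<noteq> 0" "\<And>u. (M *v u) \<bullet> (M *v v) = c * (u \<bullet> v)"
   unfolding gram_eigenvalues_def gram_eigenvalue_iff by blast
  have "(v \<bullet> a) * (mnorm M)^2 = c * (v \<bullet> a)" using v(2)[of a] MM[of a v] aa ab(3) by (simp add: inner_commute)
  moreover have "(v \<bullet> b) * (mconorm M)^2 = c * (v \<bullet> b)" using v(2)[of b] MM[of b v] aa ab(3) by (simp add: inner_commute)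
  moreover have "v \<bullet> a \<noteq> 0 \<or> v \<bullet> b \<noteq> 0" using frame[of v] v(1) by auto
  ultimately show "c \<in> {(mnorm M)\<^sup>2, (mconorm M)^2}" by auto
 next
  fix c assume "c \<in> {(mnorm M)\<^sup>2, (mconorm M)^2}"
  moreover have "a \<noteq> 0" "b \<noteq> 0" using ab by auto
  moreover have "(M *v u) \<bullet> (M *v a) = (mnorm M)^2 * (u \<bullet> a)" "(M *v u) \<bullet> (M *v b) = (mconorm M)^2 * (u \<bullet> b)" for u
   using MM[of u a] MM[of u b] aa ab(3) by simp_all
  ultimately show "c \<in> gram_eigenvalues M"
   unfolding gram_eigenvalues_def gram_eigenvalue_iff by blast
 qed
qed

lemma mconorm_le_mnorm: "det M \<noteq> 0 ==> mconorm M <= mnorm M"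
proof -
 assume M: "det M \<noteq> 0"
 obtain v where "norm v = 1" "norm (M *v v) = mnorm M" using mnorm_attained by blast
 with mconorm_le_norm[OF M, of v] show ?thesis by simp
qed

lemma sing_val1_eq: "det M \<noteq> 0 ==> sing_val1 M = mnorm M"
 and sing_val2_eq: "det M \<noteq> 0 ==> sing_val2 M = mconorm M"
 using mconorm_le_mnorm[of M] mconorm_gt_0[of M] power_mono[of "mconorm M" "mnorm M" 2]
 by (simp_all add: sing_val1_def sing_val2_def gram_eigenvalues max_def min_def)


text \<open>Pythagoras in the singular frame: a vector is stretched by \<open>mnorm M\<close>
  through its component transversal to \<open>b\<close>, and the rest contributes at most
  \<open>mconorm M\<close> times its length.\<close>

lemma contracted_direction:
 assumes "det M \<noteq> 0"
 shows "\<exists>b. norm b = 1 \<and> norm (M *v b) = mconorm M \<and>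
  (\<forall>z. mnorm M * \<bar>wedge b z\<bar> <= norm (M *v z) \<and>
     norm (M *v z) <= mnorm M * \<bar>wedge b z\<bar> + mconorm M * norm z)"
proof -
 obtain a b where ab: "norm a = 1" "norm b = 1" "a \<bullet> b = 0" "\<bar>wedge a b\<bar> = 1"
  "norm (M *v a) = mnorm M" "norm (M *v b) = mconorm M" "(M *v a) \<bullet> (M *v b) = 0"
  using singular_frame[OF assms] .
 have "mnorm M * \<bar>wedge b z\<bar> <= norm (M *v z) \<and> norm (M *v z) <= mnorm M * \<bar>wedge b z\<bar> + mconorm M * norm z" for z
 proof -
  define k l where "k = wedge z b / wedge a b" and "l = wedge a z / wedge a b"
  have w0: "wedge a b \<noteq> 0" using ab(4) by auto
  have "wedge a b *\<^sub>R z = wedge z b *\<^sub>R a + wedge a z *\<^sub>R b"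
   using wedge_three[of a b z] by (simp add: wedge_commute[of z a])
  hence "wedge a b *\<^sub>R z = wedge a b *\<^sub>R (k *\<^sub>R a + l *\<^sub>R b)"
   using w0 by (simp add: k_def l_def scaleR_add_right)
  hence z: "z = k *\<^sub>R a + l *\<^sub>R b" using w0 by (metis scaleR_left_imp_eq)
  have k: "\<bar>k\<bar> = \<bar>wedge b z\<bar>" using ab(4) by (simp add: k_def abs_divide wedge_commute[of z b])
  have l: "\<bar>l\<bar> <= norm z" using ab(4) wedge_le[of a z] ab(1) by (simp add: l_def abs_divide)
  have Mz: "M *v z = k *\<^sub>R (M *v a) + l *\<^sub>R (M *v b)"
   unfolding z by (simp add: matrix_vector_right_distrib matrix_vector_mult_scaleR)
  have "(norm (M *v z))^2 = (k * mnorm M)^2 + (l * mconorm M)^2"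
   unfolding Mz ab(5,6)[symmetric] power_mult_distrib power2_norm_eq_inner
   using ab(7) by (simp add: inner_add_left inner_add_right inner_commute power2_eq_square)
  hence "(k * mnorm M)^2 <= (norm (M *v z))^2" by simp
  hence "\<bar>k * mnorm M\<bar> <= norm (M *v z)"
   by (metis abs_le_square_iff abs_norm_cancel)
  moreover have "norm (M *v z) <= \<bar>k\<bar> * mnorm M + \<bar>l\<bar> * mconorm M"
   unfolding Mz ab(5,6)[symmetric] by (rule order_trans[OF norm_triangle_ineq]) simp
  moreover have "\<bar>l\<bar> * mconorm M <= norm z * mconorm M"
   using l mconorm_gt_0[OF assms] by (intro mult_right_mono) auto
  ultimately show ?thesis unfolding k by (simp add: abs_mult k mult.commute)
 qed
 thus ?thesis using ab by blast
qed

lemma expanded_direction: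
 assumes "det M \<noteq> 0"
 shows "\<exists>q a. norm q = 1 \<and> norm a = 1 \<and> M *v a = mnorm M *\<^sub>R q \<and>
  (\<forall>z. \<bar>wedge q (M *v z)\<bar> <= mconorm M * norm z) \<and>
  (\<forall>z. norm (M *v z - (mnorm M * (z \<bullet> a)) *\<^sub>R q) <= mconorm M * norm z)"
proof -
 obtain a b where ab: "norm a = 1" "norm b = 1" "a \<bullet> b = 0" "\<bar>wedge a b\<bar> = 1"
  "norm (M *v a) = mnorm M" "norm (M *v b) = mconorm M" "(M *v a) \<bullet> (M *v b) = 0"
  using singular_frame[OF assms] .
 have m: "mnorm M > 0" by (rule mnorm_gt_0[OF assms])
 define q where "q = (1 / mnorm M) *\<^sub>R (M *v a)"
 have q: "norm q = 1" "M *v a = mnorm M *\<^sub>R q" using m ab(5) by (simp_all add: q_def)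
 have w: "\<bar>wedge q (M *v z)\<bar> <= mconorm M * norm z" for z
 proof -
  have "\<bar>wedge q (M *v z)\<bar> = \<bar>det M\<bar> * \<bar>wedge a z\<bar> / mnorm M"
   using m by (simp add: q_def wedge_matrix abs_mult)
  also have "... = mconorm M * \<bar>wedge a z\<bar>" by (simp add: mconorm_def)
  also have "... <= mconorm M * norm z"
   using wedge_le[of a z] ab(1) mconorm_gt_0[OF assms] by (intro mult_left_mono) auto
  finally show ?thesis .
 qed
 have "norm (M *v z - (mnorm M * (z \<bullet> a)) *\<^sub>R q) <= mconorm M * norm z" for z
 proof -
  define k l where "k = wedge z b / wedge a b" and "l = wedge a z / wedge a b"
  have w0: "wedge a b \<noteq> 0" using ab(4) by auto
  have "wedge a b *\<^sub>R z = wedge z b *\<^sub>R a + wedge a z *\<^sub>R b"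
   using wedge_three[of a b z] by (simp add: wedge_commute[of z a])
  hence "wedge a b *\<^sub>R z = wedge a b *\<^sub>R (k *\<^sub>R a + l *\<^sub>R b)"
   using w0 by (simp add: k_def l_def scaleR_add_right)
  hence z: "z = k *\<^sub>R a + l *\<^sub>R b" using w0 by (metis scaleR_left_imp_eq)
  have "z \<bullet> a = k" unfolding z using ab(1,3) by (simp add: inner_add_left norm_eq_1 inner_commute[of b])
  hence "M *v z - (mnorm M * (z \<bullet> a)) *\<^sub>R q = l *\<^sub>R (M *v b)"
   unfolding z by (simp add: matrix_vector_right_distrib matrix_vector_mult_scaleR q(2) mult.commute)
  hence "norm (M *v z - (mnorm M * (z \<bullet> a)) *\<^sub>R q) = \<bar>l\<bar> * mconorm M" by (simp add: ab(6))
  also have "\<bar>l\<bar> <= norm z" using ab(4) wedge_le[of a z] ab(1) by (simp add: l_def abs_divide)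
  finally show ?thesis using mconorm_gt_0[OF assms] by (simp add: mult.commute mult_left_mono)
 qed
 thus ?thesis using q ab w by blast
qed

section \<open>Matrix products and quasi-multiplicativity under domination\<close>

lemma word_prod_append: "word_prod A (u @ v) = word_prod A u ** word_prod A v"
 by (induction u) (simp_all add: word_prod_def matrix_mul_assoc)

lemma word_prod_Nil [simp]: "word_prod A [] = mat 1"
 and word_prod_single [simp]: "word_prod A [k] = A k"
 by (simp_all add: word_prod_def)

lemma word_prod_Cons: "word_prod A (k # w) = A k ** word_prod A w"
 by (simp add: word_prod_def)

locale matrix_family =
 fixes A :: "'k::finite => real^2^2"
 assumes det_A: "det (A k) \<noteq> 0"
begin

abbreviation P :: "'k list => real^2^2" where "P \<equiv> word_prod A"

definition a1 :: "'k list => real" where "a1 w = mnorm (P w)"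
definition a2 :: "'k list => real" where "a2 w = mconorm (P w)"
definition dt :: "'k list => real" where "dt w = \<bar>det (P w)\<bar>"
text \<open>The axis ratio of the image ellipse. It bounds by how much further letters turn the
  directions attached to \<open>w\<close>, and it is the relative width of the tubes used
  later.\<close>

definition tau :: "'k list => real" where "tau w = a2 w / a1 w"

lemma det_P: "det (P w) \<noteq> 0"
 by (induction w) (simp_all add: word_prod_Cons det_mul det_A)

lemma dt_append: "dt (u @ v) = dt u * dt v"
 by (simp add: dt_def word_prod_append det_mul abs_mult)

lemma a1_pos [simp]: "a1 w > 0" and a2_pos [simp]: "a2 w > 0" and dt_pos [simp]: "dt w > 0"
 using mnorm_gt_0[OF det_P] mconorm_gt_0[OF det_P] det_P by (simp_all add: a1_def a2_def dt_def)

lemma a1_nz [simp]: "a1 w \<noteq> 0" and a2_nz [simp]: "a2 w \<noteq> 0"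
 using a1_pos[of w] a2_pos[of w] by linarith+

lemma tau_pos [simp]: "tau w > 0" by (simp add: tau_def)

lemma tau_nz [simp]: "tau w \<noteq> 0" using tau_pos[of w] by linarith

lemma a2_eq: "a2 w = dt w / a1 w"
 by (simp add: a2_def dt_def a1_def mconorm_def)

lemma dt_eq: "dt w = a1 w * a2 w"
 by (simp add: a2_eq)

lemma tau_eq: "tau w = dt w / (a1 w)^2"
 by (simp add: tau_def a2_eq power2_eq_square)

lemma a2_le_a1: "a2 w <= a1 w"
 unfolding a1_def a2_def by (rule mconorm_le_mnorm[OF det_P])

lemma tau_le_1: "tau w <= 1"
 using a2_le_a1[of w] by (simp add: tau_def divide_le_eq_1)

lemma mnorm_mat1: "mnorm (mat 1) = 1"
proof (rule antisym)
 show "mnorm (mat 1) <= 1" by (rule mnorm_le) simp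
 show "1 <= mnorm (mat 1)" using mnorm_pos[of "mat 1" "axis 1 1"] by (simp add: norm_axis_1)
qed

lemma a1_Nil [simp]: "a1 [] = 1" and a2_Nil [simp]: "a2 [] = 1" and tau_Nil [simp]: "tau [] = 1"
 by (simp_all add: a1_def mnorm_mat1 a2_eq dt_def tau_def)

lemma a1_append_le: "a1 (u @ v) <= a1 u * a1 v"
 by (simp add: a1_def word_prod_append mnorm_mult)

lemma norm_P_le: "norm (P w *v z) <= a1 w * norm z"
 unfolding a1_def by (rule mnorm_pos)

lemma norm_P_ge: "a2 w * norm z <= norm (P w *v z)"
 unfolding a2_def by (rule mconorm_le_norm[OF det_P])

lemma P_append_mult: "P (u @ v) *v z = P u *v (P v *v z)"
 by (simp add: word_prod_append matrix_vector_mul_assoc)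

lemma a1_append_ge1: "a2 u * a1 v <= a1 (u @ v)"
proof -
 obtain z where z: "norm z = 1" "norm (P v *v z) = a1 v"
  using mnorm_attained[of "P v"] by (auto simp: a1_def)
 have "a2 u * a1 v <= norm (P (u @ v) *v z)"
  using norm_P_ge[of u "P v *v z"] z by (simp add: P_append_mult)
 also have "... <= a1 (u @ v)" using norm_P_le[of "u @ v" z] z by simp
 finally show ?thesis .
qed

lemma a1_append_ge2: "a1 u * a2 v <= a1 (u @ v)"
proof -
 obtain z where z: "norm z = 1" "norm (P u *v z) = a1 u"
  using mnorm_attained[of "P u"] by (auto simp: a1_def)
 have "invertible (P v)" using det_P by (simp add: invertible_2)
 then obtain B where B: "P v ** B = mat 1" by (auto simp: invertible_def)
 define y where "y = B *v z"
 have "P v *v y = z" unfolding y_def using B by (simp add: matrix_vector_mul_assoc)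
 hence 1: "norm (P (u @ v) *v y) = a1 u" "a2 v * norm y <= 1"
  using z norm_P_ge[of v y] by (simp_all add: P_append_mult)
 have "a1 u * a2 v <= a1 (u @ v) * norm y * a2 v"
  using 1(1) norm_P_le[of "u @ v" y] by (intro mult_right_mono) (auto intro: less_imp_le)
 also have "... = a1 (u @ v) * (a2 v * norm y)" by simp
 also have "... <= a1 (u @ v) * 1" using 1(2) by (intro mult_left_mono) (auto intro: less_imp_le)
 finally show ?thesis by simp
qed

lemma a2_append_le: "a2 (u @ v) <= a2 u * a1 v"
proof -
 have "a2 (u @ v) = dt u * dt v / a1 (u @ v)" by (simp add: a2_eq dt_append)
 also have "... <= dt u * dt v / (a1 u * a2 v)"
  by (intro divide_left_mono a1_append_ge2) (auto intro: less_imp_le)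
 also have "... = a2 u * a1 v" by (simp add: dt_eq)
 finally show ?thesis .
qed

text \<open>The determinant is multiplicative, so a norm that loses a factor \<open>g\<close> on
  concatenation leaves an axis ratio larger by at least \<open>1 / g^2\<close>.\<close>

lemma tau_append_gap:
 assumes "a1 (u @ v) <= g * (a1 u * a1 v)"
 shows "tau u * tau v <= g^2 * tau (u @ v)"
proof -
 let ?X = "(a1 u * a1 v)^2"
 have "(tau u * tau v) * ?X = dt (u @ v)" by (simp add: tau_eq dt_append power_mult_distrib)
 also have "... = tau (u @ v) * (a1 (u @ v))^2" by (simp add: tau_eq)
 also have "... <= tau (u @ v) * (g * (a1 u * a1 v))^2"
  using assms by (intro mult_left_mono power_mono) (auto intro: less_imp_le)
 also have "... = (g^2 * tau (u @ v)) * ?X" by (simp add: power_mult_distrib)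
 finally show ?thesis by (rule mult_right_le_imp_le) simp
qed

lemma a2_append_ge: "a2 u * a2 v <= a2 (u @ v)"
proof -
 obtain b where b: "norm b = 1" "norm (P (u @ v) *v b) = a2 (u @ v)"
  using contracted_direction[OF det_P, of "u @ v"] by (auto simp: a2_def)
 have "a2 u * a2 v <= a2 u * norm (P v *v b)" using norm_P_ge[of v b] b by (intro mult_left_mono) (auto intro: less_imp_le)
 also have "... <= a2 (u @ v)" using norm_P_ge[of u "P v *v b"] b by (simp add: P_append_mult)
 finally show ?thesis .
qed

lemma tau_append_ge: "tau u * tau v <= tau (u @ v)"
proof -
 have "tau u * tau v = dt (u @ v) / (a1 u * a1 v)^2" by (simp add: tau_eq dt_append power_mult_distrib)
 also have "... <= dt (u @ v) / (a1 (u @ v))^2"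
  by (intro divide_left_mono power_mono a1_append_le) (auto intro: less_imp_le)
 finally show ?thesis by (simp add: tau_eq)
qed

definition kap :: real where "kap = Min (range (%k. tau [k]))"

lemma kap: "kap > 0" "kap <= tau [k]" "kap <= 1"
proof -
 show "kap > 0" unfolding kap_def by (subst Min_gr_iff) auto
 show *: "kap <= tau [k]" for k unfolding kap_def by (intro Min_le) auto
 show "kap <= 1" using *[of undefined] tau_le_1[of "[undefined]"] by linarith
qed

lemma tau_Cons_ge: "kap * tau w <= tau (k # w)"
 using tau_append_ge[of "[k]" w] kap(2)[of k] by (simp add: mult_right_mono order_trans[rotated] less_imp_le)

lemma tau_snoc_ge: "kap * tau w <= tau (w @ [k])"
proof -
 have "kap * tau w <= tau [k] * tau w" using kap(2)[of k] by (intro mult_right_mono) (auto intro: less_imp_le)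
 thus ?thesis using tau_append_ge[of w "[k]"] by (metis mult.commute order_trans)
qed

lemma tau_ge_power: "kap ^ length w <= tau w"
proof (induction w)
 case (Cons k w)
 have "kap * kap ^ length w <= kap * tau w" using Cons kap by (intro mult_left_mono) auto
 also have "... <= tau (k # w)" by (rule tau_Cons_ge)
 finally show ?case by simp
qed simp

text \<open>Singular directions need not be unique, so one is chosen together with the estimates it
  has to satisfy; likewise for \<open>edir\<close>.\<close>

definition cdir :: "'k list => real^2" where
 "cdir w = (SOME b. norm b = 1 \<and> norm (P w *v b) = a2 w \<and>
  (\<forall>z. a1 w * \<bar>wedge b z\<bar> <= norm (P w *v z) \<and>
     norm (P w *v z) <= a1 w * \<bar>wedge b z\<bar> + a2 w * norm z))"

lemma cdir: "norm (cdir w) = 1" "norm (P w *v cdir w) = a2 w"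
 "a1 w * \<bar>wedge (cdir w) z\<bar> <= norm (P w *v z)"
 "norm (P w *v z) <= a1 w * \<bar>wedge (cdir w) z\<bar> + a2 w * norm z"
 using someI_ex[OF contracted_direction[OF det_P[of w], folded a1_def a2_def], folded cdir_def] by blast+

definition edir :: "'k list => real^2" where
 "edir w = (SOME q. \<exists>a. norm q = 1 \<and> norm a = 1 \<and> P w *v a = a1 w *\<^sub>R q \<and>
  (\<forall>z. \<bar>wedge q (P w *v z)\<bar> <= a2 w * norm z) \<and>
  (\<forall>z. norm (P w *v z - (a1 w * (z \<bullet> a)) *\<^sub>R q) <= a2 w * norm z))"

lemma edir: "norm (edir w) = 1" "\<bar>wedge (edir w) (P w *v z)\<bar> <= a2 w * norm z"
 "\<exists>a. norm a = 1 \<and> P w *v a = a1 w *\<^sub>R edir w \<and>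
  (\<forall>z. norm (P w *v z - (a1 w * (z \<bullet> a)) *\<^sub>R edir w) <= a2 w * norm z)"
 using someI_ex[OF expanded_direction[OF det_P[of w], folded a1_def a2_def], folded edir_def] by blast+

text \<open>The direction contracted by the longer product is also contracted by \<open>P w\<close>,
  up to the axis ratio of the extra letter, and whatever \<open>P w\<close> contracts at rate
  \<open>a2 w\<close> makes an angle of order \<open>tau w\<close> with
  \<open>cdir w\<close>.\<close>

lemma cdir_Cons: "\<bar>wedge (cdir w) (cdir (k # w))\<bar> <= tau w / kap"
proof -
 let ?b = "cdir (k # w)"
 have "a1 w * \<bar>wedge (cdir w) ?b\<bar> <= norm (P w *v ?b)" by (rule cdir)
 also have "a2 [k] * norm (P w *v ?b) <= a2 (k # w)"
  using norm_P_ge[of "[k]" "P w *v ?b"] P_append_mult[of "[k]" w ?b] cdir(2)[of "k # w"] by simp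
 hence "norm (P w *v ?b) <= a2 (k # w) / a2 [k]" by (simp add: field_simps)
 also have "... <= a1 [k] * a2 w / a2 [k]"
 proof (intro divide_right_mono)
  have "a2 (k # w) * a1 (k # w) = a2 [k] * a1 [k] * (a2 w * a1 w)"
   using dt_append[of "[k]" w] by (simp add: dt_eq mult_ac)
  moreover have "a2 [k] * a1 w <= a1 (k # w)" using a1_append_ge1[of "[k]" w] by simp
  hence "a2 (k # w) * (a2 [k] * a1 w) <= a2 (k # w) * a1 (k # w)"
   by (intro mult_left_mono) (auto intro: less_imp_le)
  ultimately have "a2 (k # w) * (a2 [k] * a1 w) <= (a1 [k] * a2 w) * (a2 [k] * a1 w)" by (simp add: mult_ac)
  thus "a2 (k # w) <= a1 [k] * a2 w" by (rule mult_right_le_imp_le) auto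
 qed (auto intro: less_imp_le)
 finally have "\<bar>wedge (cdir w) ?b\<bar> <= tau w / tau [k]"
  by (simp add: tau_def field_simps)
 also have "... <= tau w / kap"
  using kap by (intro divide_left_mono) (auto intro: less_imp_le)
 finally show ?thesis .
qed

lemma edir_snoc: "\<bar>wedge (edir w) (edir (w @ [k]))\<bar> <= tau w / kap"
proof -
 let ?q = "edir (w @ [k])"
 obtain a where a: "norm a = 1" "P (w @ [k]) *v a = a1 (w @ [k]) *\<^sub>R ?q" using edir(3) by blast
 have "a1 (w @ [k]) * \<bar>wedge (edir w) ?q\<bar> = \<bar>wedge (edir w) (P w *v (P [k] *v a))\<bar>"
  using a(2) by (simp add: P_append_mult abs_mult less_imp_le)
 also have "... <= a2 w * norm (P [k] *v a)" by (rule edir)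
 also have "... <= a2 w * a1 [k]" using norm_P_le[of "[k]" a] a(1) by (intro mult_left_mono) (auto intro: less_imp_le)
 finally have 1: "a1 (w @ [k]) * \<bar>wedge (edir w) ?q\<bar> <= a2 w * a1 [k]" .
 have 2: "a1 w * a2 [k] <= a1 (w @ [k])" by (rule a1_append_ge2)
 have "a1 w * a2 [k] * \<bar>wedge (edir w) ?q\<bar> <= a1 (w @ [k]) * \<bar>wedge (edir w) ?q\<bar>"
  using 2 by (intro mult_right_mono) auto
 with 1 have "\<bar>wedge (edir w) ?q\<bar> <= tau w / tau [k]"
  by (simp add: tau_def field_simps)
 also have "... <= tau w / kap"
  using kap by (intro divide_left_mono) (auto intro: less_imp_le)
 finally show ?thesis .
qed

text \<open>Together with \<open>gap_upper\<close>: the loss of norm in a product is the sine of the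
  angle between the direction into which \<open>v\<close> expands and the direction that
  \<open>u\<close> contracts, up to the two axis ratios.\<close>

lemma gap_lower: "a1 u * a1 v * \<bar>wedge (cdir u) (edir v)\<bar> <= a1 (u @ v)"
proof -
 obtain a where a: "norm a = 1" "P v *v a = a1 v *\<^sub>R edir v" using edir(3) by blast
 have "a1 u * \<bar>wedge (cdir u) (P v *v a)\<bar> <= norm (P (u @ v) *v a)"
  unfolding P_append_mult by (rule cdir)
 also have "... <= a1 (u @ v)" using norm_P_le[of "u @ v" a] a(1) by simp
 finally show ?thesis using a(2) by (simp add: abs_mult less_imp_le mult_ac)
qed

lemma gap_upper: "a1 (u @ v) <= a1 u * a1 v * (\<bar>wedge (cdir u) (edir v)\<bar> + tau u + tau v)"
proof -
 obtain a where a: "norm a = 1" "\<And>z. norm (P v *v z - (a1 v * (z \<bullet> a)) *\<^sub>R edir v) <= a2 v * norm z"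
  using edir(3)[of v] by blast
 have "norm (P (u @ v) *v z) <= (a1 u * a1 v * (\<bar>wedge (cdir u) (edir v)\<bar> + tau u + tau v)) * norm z" for z
 proof -
  define c where "c = a1 v * (z \<bullet> a)"
  have c: "\<bar>c\<bar> <= a1 v * norm z"
   using Cauchy_Schwarz_ineq2[of z a] a(1) by (simp add: c_def abs_mult less_imp_le mult_left_mono)
  have "P (u @ v) *v z = c *\<^sub>R (P u *v edir v) + P u *v (P v *v z - c *\<^sub>R edir v)"
   by (simp add: P_append_mult matrix_vector_mult_diff_distrib matrix_vector_mult_scaleR)
  hence "norm (P (u @ v) *v z) <= \<bar>c\<bar> * norm (P u *v edir v) + norm (P u *v (P v *v z - c *\<^sub>R edir v))"
   by (metis norm_scaleR norm_triangle_ineq)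
  also have "norm (P u *v (P v *v z - c *\<^sub>R edir v)) <= a1 u * (a2 v * norm z)"
   using a(2)[of z] by (intro order_trans[OF norm_P_le] mult_left_mono) (auto simp: c_def intro: less_imp_le)
  also have "\<bar>c\<bar> * norm (P u *v edir v) <= (a1 v * norm z) * (a1 u * \<bar>wedge (cdir u) (edir v)\<bar> + a2 u)"
   using cdir(4)[of u "edir v"] c edir(1)[of v] by (intro mult_mono) (auto intro!: add_nonneg_nonneg mult_nonneg_nonneg intro: less_imp_le)
  finally have "norm (P (u @ v) *v z) <= (a1 v * norm z) * (a1 u * \<bar>wedge (cdir u) (edir v)\<bar> + a2 u) + a1 u * (a2 v * norm z)"
   by simp
  also have "... = (a1 u * a1 v * (\<bar>wedge (cdir u) (edir v)\<bar> + tau u + tau v)) * norm z"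
   by (simp add: tau_def distrib_left distrib_right)
  finally show ?thesis .
 qed
 thus ?thesis unfolding a1_def[of "u @ v"] by (rule mnorm_le)
qed

end

locale dominated = matrix_family A for A :: "'k::finite => real^2^2" +
 assumes dom: "dominated_splitting A"
begin

lemma tau_decay: "\<exists>c>0. \<exists>\<beta>>0. \<forall>w. tau w <= c * dec \<beta> (length w)"
proof -
 obtain c \<beta> where c: "c > 0" "\<beta> > 0" "\<And>w. w \<noteq> [] ==> sing_val1 (P w) / sing_val2 (P w) >= c * exp (len w * \<beta>)"
  using dom unfolding dominated_splitting_def by blast
 have "tau w <= max 1 (1 / c) * dec \<beta> (length w)" for w
 proof (cases "w = []")
  case False
  have "c * exp (len w * \<beta>) <= a1 w / a2 w"
   using c(3)[OF False] by (simp add: sing_val1_eq[OF det_P] sing_val2_eq[OF det_P] a1_def a2_def)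
  hence "tau w * (c * exp (len w * \<beta>)) <= tau w * (a1 w / a2 w)"
   by (intro mult_left_mono) (auto intro: less_imp_le)
  hence "tau w * (c * exp (len w * \<beta>)) <= 1" by (simp add: tau_def)
  hence "tau w <= 1 / c * dec \<beta> (length w)"
   using c by (simp add: exp_minus field_simps)
  also have "... <= max 1 (1 / c) * dec \<beta> (length w)" by (intro mult_right_mono) auto
  finally show ?thesis .
 qed simp
 moreover have "max 1 (1 / c) > 0" by simp
 ultimately show ?thesis using c by blast
qed

text \<open>A hyperbolic-time argument for the weighted sequence \<open>s\<close>. Take the first
  \<open>j\<close> for which the maximum of \<open>s\<close> over the tail from \<open>j\<close> is
  at most \<open>eta * exp (gam * j)\<close>, and let \<open>n\<close> be where it is attained.
  Decay after \<open>n\<close> is maximality; the lower bound holds because the tail from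
  \<open>j - 1\<close> still exceeded its threshold and one step loses at most the factor
  \<open>k\<close>.\<close>

lemma record_time:
 fixes t :: "nat => real"
 assumes "t 0 = 1" and k: "0 < k" "k <= 1" and step: "\<And>l. l < L ==> k * t l <= t (Suc l)"
  and pos: "\<And>l. t l > 0" and "t L <= eta" "eta < 1" and g: "gam > 0"
 shows "\<exists>n\<le>L. t n <= eta \<and> k * exp (- gam) * eta * dec gam n <= t n \<and>
   (\<forall>l. n <= l \<and> l <= L --> t l <= t n * dec gam (l - n))"
proof -
 define s where "s l = t l * exp (gam * real l)" for l
 define M where "M j = Max (s ` {j..L})" for j
 have M_ge: "s l <= M j" if "j <= l" "l <= L" for j l
  unfolding M_def using that by (intro Max_ge) auto
 have M_in: "\<exists>l. j <= l \<and> l <= L \<and> M j = s l" if "j <= L" for j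
 proof -
  have "M j \<in> s ` {j..L}" unfolding M_def using that by (intro Max_in) auto
  thus ?thesis by auto
 qed
 define Q where "Q j \<longleftrightarrow> j <= L \<and> M j <= eta * exp (gam * real j)" for j
 have "Q L" using \<open>t L <= eta\<close> by (simp add: Q_def M_def s_def)
 define j where "j = (LEAST j. Q j)"
 have Qj: "Q j" unfolding j_def by (rule LeastI[of Q, OF \<open>Q L\<close>])
 have nQ: "\<not> Q i" if "i < j" for i using not_less_Least that by (auto simp: j_def)
 have "\<not> Q 0"
  using M_ge[of 0 0] \<open>t 0 = 1\<close> \<open>eta < 1\<close> by (auto simp: Q_def s_def)
 then obtain i where i: "j = Suc i" using Qj by (cases j) auto
 have jL: "j <= L" using Qj by (simp add: Q_def)
 have "\<not> Q i" using nQ i by simp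
 hence Mi: "M i > eta * exp (gam * real i)" using jL i by (simp add: Q_def)
 have "{i..L} = insert i {j..L}" using jL i by auto
 hence "M i = max (s i) (M j)"
  unfolding M_def using jL by (simp add: Max_insert)
 moreover have "s i <= M j / k"
 proof -
  have "k * t i <= t j" using step[of i] jL i by simp
  hence "k * t i * exp (gam * real j) <= s j" by (simp add: s_def)
  moreover have "k * s i <= k * (t i * exp (gam * real j))"
   unfolding s_def using k pos[of i] g i by (intro mult_left_mono) auto
  ultimately have "k * s i <= M j" using M_ge[of j j] jL by simp
  thus ?thesis using k by (simp add: pos_le_divide_eq mult.commute)
 qed
 moreover have "M j <= M j / k"
 proof -
  have "M j > 0" using M_ge[of j j] jL pos[of j] by (smt (verit) s_def exp_gt_zero mult_pos_pos order_refl)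
  thus ?thesis using k by (simp add: le_divide_eq mult_le_cancel_left1)
 qed
 ultimately have "eta * exp (gam * real i) < M j / k" using Mi by linarith
 hence Mj: "k * eta * exp (gam * real i) <= M j" using k by (simp add: field_simps)
 obtain n where n: "j <= n" "n <= L" "M j = s n" using M_in[OF jL] by blast
 have "t n <= eta"
 proof -
  have "s n <= eta * exp (gam * real j)" using Qj n by (simp add: Q_def)
  also have "... <= eta * exp (gam * real n)" using n g \<open>t L <= eta\<close> pos[of L] by (intro mult_left_mono) auto
  finally show ?thesis by (simp add: s_def)
 qed
 moreover have "k * exp (- gam) * eta * dec gam n <= t n"
 proof -
  have "k * eta * 1 <= k * eta * exp (gam * real i)"
   using k g \<open>t L <= eta\<close> pos[of L] by (intro mult_left_mono) auto
  with Mj n have "k * eta <= t n * exp (gam * real n)" by (simp add: s_def)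
  hence "k * eta * dec gam n <= t n" by (simp add: exp_minus field_simps)
  moreover have "exp (- gam) * (k * eta * dec gam n) <= 1 * (k * eta * dec gam n)"
   using k g \<open>t L <= eta\<close> pos[of L] by (intro mult_right_mono) auto
  ultimately show ?thesis by (simp add: mult_ac)
 qed
 moreover have "t l <= t n * dec gam (l - n)" if "n <= l" "l <= L" for l
 proof -
  have "s l <= s n" using M_ge[of j l] n that by simp
  thus ?thesis using that by (simp add: s_def exp_minus of_nat_diff exp_diff field_simps)
 qed
 ultimately show ?thesis using n by blast
qed

lemma wedge_chain:
 fixes b :: "nat => real^2"
 assumes "\<And>l. norm (b l) = 1" and "\<And>l. [|n <= l; l < L|] ==> \<bar>wedge (b l) (b (Suc l))\<bar> <= e l" and "n <= L"
 shows "\<bar>wedge (b n) (b L)\<bar> <= (\<Sum>l=n..<L. e l)"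
 using \<open>n <= L\<close> assms(2)
proof (induction L rule: dec_induct)
 case (step L)
 have "\<bar>wedge (b n) (b (Suc L))\<bar> <= \<bar>wedge (b n) (b L)\<bar> + \<bar>wedge (b L) (b (Suc L))\<bar>"
  using wedge_triangle[of "b L" "b n" "b (Suc L)"] assms(1) by simp
 thus ?case using step by (simp add: sum.atLeastLessThan_Suc) (smt (verit) less_Suc_eq)
qed simp

lemma geometric_tail:
 assumes "gam > 0" "T >= (0::real)" and "\<And>l. [|n <= l; l <= L|] ==> t l <= T * dec gam (l - n)" "n <= L"
 shows "(\<Sum>l=n..<L. t l) <= T / (1 - exp (- gam))"
proof -
 have "(\<Sum>l=n..<L. t l) <= (\<Sum>l=n..<L. T * dec gam (l - n))"
  using assms by (intro sum_mono) auto
 also have "... = (\<Sum>l<L - n. T * dec gam l)"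
  using sum.shift_bounds_nat_ivl[of "%l. T * dec gam (l - n)" 0 n "L - n"] assms(4)
  by (simp add: lessThan_atLeast0)
 also have "... = T * (\<Sum>l<L - n. exp (- gam) ^ l)"
  by (simp add: sum_distrib_left exp_of_nat_mult[symmetric] mult.commute)
 also have "... <= T * (1 / (1 - exp (- gam)))"
 proof (intro mult_left_mono)
  have "(\<Sum>l<L - n. exp (- gam) ^ l) = (1 - exp (- gam) ^ (L - n)) / (1 - exp (- gam))"
   using assms(1) by (subst sum_gp_strict) auto
  also have "... <= 1 / (1 - exp (- gam))" using assms(1) by (intro divide_right_mono) auto
  finally show "(\<Sum>l<L - n. exp (- gam) ^ l) <= 1 / (1 - exp (- gam))" .
 qed fact
 finally show ?thesis by simp
qed

text \<open>If \<open>a1 (u @ v)\<close> were much smaller than \<open>a1 u * a1 v\<close>, then cutting \<open>u\<close> and \<open>v\<close> at suitable record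
 times would give a word whose singular values are comparable although it is long.\<close>

theorem a1_almost_multiplicative: "\<exists>K\<ge>1. \<forall>u v. a1 u * a1 v <= K * a1 (u @ v)"
proof -
 obtain c \<beta> where c: "c > 0" "\<beta> > 0" "\<And>w. tau w <= c * dec \<beta> (length w)"
  using tau_decay by blast
 \<comment> \<open>Half the rate of domination: the record values may be as small as
   \<open>exp (- gam * n)\<close>, and the faster rate \<open>\<beta>\<close> for the joined word
   will contradict this unless the record times are bounded.\<close>
 define gam where "gam = \<beta> / 2"
 have gam: "gam > 0" using c by (simp add: gam_def)
 define S where "S = 1 / (kap * (1 - exp (- gam)))"
 have S: "S > 0" using kap gam by (simp add: S_def)
 define k' where "k' = kap * exp (- gam)"
 have k': "k' > 0" using kap by (simp add: k'_def)
 define C3 where "C3 = c * (3 + 2 * S)^2 / k'^2"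
 have C3: "C3 > 0" using c S k' by (simp add: C3_def zero_less_power add_pos_pos)
 define N where "N = nat \<lceil>max 0 (ln C3 / gam)\<rceil>"
 have bound: "eta >= kap ^ N" if less: "eta < 1" and gap: "a1 (u @ v) <= eta * (a1 u * a1 v)" and eta0: "eta > 0" for u v eta
 proof -
  \<comment> \<open>\<open>fu l\<close> and \<open>fv l\<close> are the \<open>l\<close> letters of
    \<open>u\<close> and of \<open>v\<close> next to the junction, so \<open>fu n @ fv m\<close> is
    a subword of \<open>u @ v\<close>.\<close>
  define fu where "fu l = drop (length u - l) u" for l
  define fv where "fv l = take l v" for l
  let ?U = "length u" and ?V = "length v"
  have full: "fu ?U = u" "fv ?V = v" "fu 0 = []" "fv 0 = []" by (simp_all add: fu_def fv_def)
  have fuS: "\<exists>k. fu (Suc l) = k # fu l" if "l < ?U" for l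
   using that unfolding fu_def by (intro exI[of _ "u ! (?U - Suc l)"]) (simp add: Cons_nth_drop_Suc[symmetric] Suc_diff_Suc)
  have fvS: "\<exists>k. fv (Suc l) = fv l @ [k]" if "l < ?V" for l
   using that unfolding fv_def by (auto simp: take_Suc_conv_app_nth)
  have "a2 u * a1 v <= eta * (a1 u * a1 v)" using a1_append_ge1[of u v] gap by linarith
  hence tu: "tau u <= eta" by (simp add: tau_def field_simps)
  have "a1 u * a2 v <= eta * (a1 u * a1 v)" using a1_append_ge2[of u v] gap by linarith
  hence tv: "tau v <= eta" by (simp add: tau_def field_simps)
  have "\<exists>n\<le>?U. tau (fu n) <= eta \<and> kap * exp (- gam) * eta * dec gam n <= tau (fu n) \<and>
   (\<forall>l. n <= l \<and> l <= ?U --> tau (fu l) <= tau (fu n) * dec gam (l - n))"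
  proof (rule record_time)
   show "kap * tau (fu l) <= tau (fu (Suc l))" if "l < ?U" for l
    using fuS[OF that] tau_Cons_ge by metis
  qed (use kap tu less gam full in auto)
  then obtain n where n: "n <= ?U" "tau (fu n) <= eta" "k' * eta * dec gam n <= tau (fu n)"
   "\<And>l. [|n <= l; l <= ?U|] ==> tau (fu l) <= tau (fu n) * dec gam (l - n)"
   unfolding k'_def by blast
  have "\<exists>n\<le>?V. tau (fv n) <= eta \<and> kap * exp (- gam) * eta * dec gam n <= tau (fv n) \<and>
   (\<forall>l. n <= l \<and> l <= ?V --> tau (fv l) <= tau (fv n) * dec gam (l - n))"
  proof (rule record_time)
   show "kap * tau (fv l) <= tau (fv (Suc l))" if "l < ?V" for l
    using fvS[OF that] tau_snoc_ge by metis
  qed (use kap tv less gam full in auto)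
  then obtain m where m: "m <= ?V" "tau (fv m) <= eta" "k' * eta * dec gam m <= tau (fv m)"
   "\<And>l. [|m <= l; l <= ?V|] ==> tau (fv l) <= tau (fv m) * dec gam (l - m)"
   unfolding k'_def by blast
  have "\<bar>wedge (cdir (fu n)) (cdir (fu ?U))\<bar> <= (\<Sum>l=n..<?U. tau (fu l) / kap)"
   by (rule wedge_chain) (use cdir(1) n(1) cdir_Cons fuS in metis)+
  also have "... = (\<Sum>l=n..<?U. tau (fu l)) / kap" by (simp add: sum_divide_distrib)
  also have "... <= (tau (fu n) / (1 - exp (- gam))) / kap"
   using kap gam n by (intro divide_right_mono geometric_tail) (auto intro: less_imp_le)
  also have "... = S * tau (fu n)" by (simp add: S_def mult.commute)
  also have "... <= S * eta" using n S by (intro mult_left_mono) auto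
  finally have 1: "\<bar>wedge (cdir (fu n)) (cdir u)\<bar> <= S * eta" by (simp add: full)
  have "\<bar>wedge (edir (fv m)) (edir (fv ?V))\<bar> <= (\<Sum>l=m..<?V. tau (fv l) / kap)"
   by (rule wedge_chain) (use edir(1) m(1) edir_snoc fvS in metis)+
  also have "... = (\<Sum>l=m..<?V. tau (fv l)) / kap" by (simp add: sum_divide_distrib)
  also have "... <= (tau (fv m) / (1 - exp (- gam))) / kap"
   using kap gam m by (intro divide_right_mono geometric_tail) (auto intro: less_imp_le)
  also have "... = S * tau (fv m)" by (simp add: S_def mult.commute)
  also have "... <= S * eta" using m S by (intro mult_left_mono) auto
  finally have 2: "\<bar>wedge (edir (fv m)) (edir v)\<bar> <= S * eta" by (simp add: full)
  have "a1 u * a1 v * \<bar>wedge (cdir u) (edir v)\<bar> <= a1 u * a1 v * eta"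
   using order_trans[OF gap_lower gap] by (simp only: mult.commute[of eta])
  hence 3: "\<bar>wedge (cdir u) (edir v)\<bar> <= eta" by (rule mult_left_le_imp_le) simp
  have "\<bar>wedge (cdir (fu n)) (edir (fv m))\<bar> <= \<bar>wedge (cdir (fu n)) (cdir u)\<bar> + \<bar>wedge (cdir u) (edir (fv m))\<bar>"
   using wedge_triangle[of "cdir u" "cdir (fu n)" "edir (fv m)"] cdir(1) edir(1) by simp
  also have "\<bar>wedge (cdir u) (edir (fv m))\<bar> <= \<bar>wedge (cdir u) (edir v)\<bar> + \<bar>wedge (edir v) (edir (fv m))\<bar>"
   using wedge_triangle[of "edir v" "cdir u" "edir (fv m)"] cdir(1) edir(1) by simp
  finally have 4: "\<bar>wedge (cdir (fu n)) (edir (fv m))\<bar> <= (1 + 2 * S) * eta"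
   using 1 2 3 wedge_commute[of "edir v" "edir (fv m)"] by (simp add: algebra_simps)
  \<comment> \<open>The cut words inherit the near-coincidence of the two directions, up to a
    multiple of \<open>eta\<close>. Hence \<open>eta^2\<close> occurs on both sides of the
    comparison below and cancels, and what remains bounds \<open>n + m\<close> independently of
    \<open>eta\<close>.\<close>
  have "a1 (fu n @ fv m) <= a1 (fu n) * a1 (fv m) * ((3 + 2 * S) * eta)"
   using 4 n(2) m(2) by (intro order_trans[OF gap_upper] mult_left_mono) (auto simp: algebra_simps intro: less_imp_le)
  hence "tau (fu n) * tau (fv m) <= ((3 + 2 * S) * eta)^2 * tau (fu n @ fv m)"
   by (intro tau_append_gap) (simp only: mult.commute)
  also have "... <= ((3 + 2 * S) * eta)^2 * (c * dec \<beta> (n + m))"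
  proof (intro mult_left_mono)
   have "length (fu n @ fv m) = n + m" using n(1) m(1) by (simp add: fu_def fv_def)
   thus "tau (fu n @ fv m) <= c * dec \<beta> (n + m)" using c(3)[of "fu n @ fv m"] by simp
  qed simp
  finally have 5: "tau (fu n) * tau (fv m) <= ((3 + 2 * S) * eta)^2 * (c * dec \<beta> (n + m))" .
  have "(k' * eta * dec gam n) * (k' * eta * dec gam m) <= tau (fu n) * tau (fv m)"
   using n m k' eta0 by (intro mult_mono) (auto intro: less_imp_le)
  also have "(k' * eta * dec gam n) * (k' * eta * dec gam m) = (k'^2 * dec gam (n + m)) * eta^2"
   by (simp add: power2_eq_square exp_add[symmetric] algebra_simps)
  finally have "(k'^2 * dec gam (n + m)) * eta^2 <= tau (fu n) * tau (fv m)" .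
  also note 5
  also have "((3 + 2 * S) * eta)^2 * (c * dec \<beta> (n + m)) = ((3 + 2 * S)^2 * (c * dec \<beta> (n + m))) * eta^2"
   by (simp add: power_mult_distrib)
  finally have "(k'^2 * dec gam (n + m)) * eta^2 <= ((3 + 2 * S)^2 * (c * dec \<beta> (n + m))) * eta^2" .
  hence "k'^2 * dec gam (n + m) <= (3 + 2 * S)^2 * (c * dec \<beta> (n + m))"
   by (rule mult_right_le_imp_le) (use eta0 in simp)
  hence "k'^2 * dec gam (n + m) * exp (\<beta> * real (n + m)) <= (3 + 2 * S)^2 * (c * dec \<beta> (n + m)) * exp (\<beta> * real (n + m))"
   by (intro mult_right_mono) auto
  also have "... = (3 + 2 * S)^2 * c * (dec \<beta> (n + m) * exp (\<beta> * real (n + m)))" by simp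
  also have "... = (3 + 2 * S)^2 * c" by (simp only: exp_add[symmetric]) simp
  also have "k'^2 * dec gam (n + m) * exp (\<beta> * real (n + m)) = k'^2 * (dec gam (n + m) * exp (\<beta> * real (n + m)))" by simp
  also have "dec gam (n + m) * exp (\<beta> * real (n + m)) = exp (gam * real (n + m))"
   by (simp only: exp_add[symmetric]) (simp add: gam_def)
  finally have "exp (gam * real (n + m)) <= C3"
   using k' by (simp add: C3_def pos_le_divide_eq mult_ac)
  hence "gam * real (n + m) <= ln C3" using C3 by (simp add: ln_ge_iff)
  hence "real (n + m) <= ln C3 / gam" using gam by (simp add: field_simps)
  hence "n <= N" unfolding N_def by linarith
  \<comment> \<open>A word of bounded length cannot have a very small axis ratio, whereas the record
    value is at most \<open>eta\<close>.\<close>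
  have "kap ^ N <= kap ^ n" using kap \<open>n <= N\<close> by (intro power_decreasing) auto
  also have "kap ^ n <= tau (fu n)" using tau_ge_power[of "fu n"] n(1) by (simp add: fu_def)
  also have "... <= eta" by (rule n)
  finally show ?thesis .
 qed
 define g where "g = kap ^ N / 2"
 have g: "0 < g" "g < kap ^ N" "g < 1" using kap power_le_one[of kap N] by (auto simp: g_def)
 have "a1 u * a1 v <= (1 / g) * a1 (u @ v)" for u v
  using bound[of g u v] g by (simp add: field_simps) (smt (verit))
 moreover have "1 / g >= 1" using g by simp
 ultimately show ?thesis by blast
qed

end


section \<open>Invariant lines and the strong stable direction\<close>

lemma wedge_eq_0_imp_scale:
 assumes "v \<noteq> 0" "wedge v w = 0"
 shows "w = ((v \<bullet> w) / (v \<bullet> v)) *\<^sub>R v"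
proof -
 have "(v \<bullet> v) *\<^sub>R w = (v \<bullet> w) *\<^sub>R v"
  using assms(2) by (simp add: vec_eq_iff forall_2 inner_vec2 wedge_def algebra_simps)
 moreover have "v \<bullet> v \<noteq> 0" using assms(1) by simp
 ultimately show ?thesis
  by (metis divide_inverse_commute left_inverse scaleR_one scaleR_scaleR)
qed

lemma line_eq_span:
 assumes L: "subspace L" and v: "v \<in> L" "v \<noteq> 0" and w: "\<And>u. u \<in> L ==> wedge v u = 0"
 shows "L = span {v}"
proof
 show "span {v} \<subseteq> L" using L v by (intro span_minimal) auto
 show "L \<subseteq> span {v}"
 proof
  fix u assume "u \<in> L"
  hence "u = ((v \<bullet> u) / (v \<bullet> v)) *\<^sub>R v" using w v by (intro wedge_eq_0_imp_scale) auto
  moreover have "((v \<bullet> u) / (v \<bullet> v)) *\<^sub>R v \<in> span {v}" by (intro span_mul span_base) simp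
  ultimately show "u \<in> span {v}" by metis
 qed
qed

lemma in_span_singleton: "u \<in> span {v} \<longleftrightarrow> (\<exists>c. u = c *\<^sub>R (v :: real^2))"
 by (auto simp: span_singleton intro: rangeI)

lemma proj_line_iff: "L \<in> proj_line \<longleftrightarrow> (\<exists>v. norm v = 1 \<and> L = span {v})"
proof
 assume "L \<in> proj_line"
 hence L: "subspace L" "dim L = 1" by (auto simp: proj_line_def)
 hence "\<not> L \<subseteq> {0}" using dim_eq_0[of L] by auto
 then obtain u where u: "u \<in> L" "u \<noteq> 0" by auto
 define v where "v = (1 / norm u) *\<^sub>R u"
 have v: "v \<in> L" "norm v = 1" using L u by (auto simp: v_def subspace_scale)
 hence "v \<noteq> 0" by auto
 have "span {v} = L"
 proof (rule subspace_dim_equal)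
  show "span {v} \<subseteq> L" using L v by (intro span_minimal) auto
  show "dim L <= dim (span {v})" using L \<open>v \<noteq> 0\<close> by (simp add: dim_span dim_eq_card_independent independent_insert)
 qed (use L in auto)
 with v show "\<exists>v. norm v = 1 \<and> L = span {v}" by blast
next
 assume "\<exists>v. norm v = 1 \<and> L = span {v}"
 then obtain v where v: "norm v = 1" "L = span {v}" by blast
 hence "v \<noteq> 0" by auto
 with v show "L \<in> proj_line" by (simp add: proj_line_def subspace_span dim_span dim_eq_card_independent independent_insert)
qed

lemma norm_on_line_span:
 assumes "norm v = 1"
 shows "norm_on_line M (span {v}) = norm (M *v v)"
proof -
 have v: "v \<in> span {v} - {0}" using assms by (auto simp: span_base)
 have *: "norm (M *v u) / norm u = norm (M *v v)" if "u \<in> span {v} - {0}" for u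
 proof -
  obtain c where "u = c *\<^sub>R v" "c \<noteq> 0" using \<open>u \<in> span {v} - {0}\<close> by (auto simp: in_span_singleton)
  thus ?thesis using assms by (simp add: matrix_vector_mult_scaleR)
 qed
 show ?thesis unfolding norm_on_line_def
 proof (rule the_equality)
  show "\<forall>u\<in>span {v} - {0}. norm (M *v u) / norm u = norm (M *v v)" using * by blast
  show "c = norm (M *v v)" if "\<forall>u\<in>span {v} - {0}. norm (M *v u) / norm u = c" for c
   using that[rule_format, OF v] *[OF v] by simp
 qed
qed

lemma line_angle_span:
 assumes "norm u = 1" "norm v = 1"
 shows "line_angle (span {u}) (span {v}) = arccos \<bar>u \<bullet> v\<bar>"
proof -
 have ne: "u \<in> span {u} - {0}" "v \<in> span {v} - {0}" using assms by (auto simp: span_base)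
 have *: "arccos (\<bar>a \<bullet> b\<bar> / (norm a * norm b)) = arccos \<bar>u \<bullet> v\<bar>" if ab: "a \<in> span {u} - {0}" "b \<in> span {v} - {0}" for a b
 proof -
  obtain c d where "a = c *\<^sub>R u" "c \<noteq> 0" "b = d *\<^sub>R v" "d \<noteq> 0" using ab by (auto simp: in_span_singleton)
  thus ?thesis using assms by (simp add: abs_mult)
 qed
 show ?thesis unfolding line_angle_def
 proof (rule the_equality)
  show "\<forall>a\<in>span {u} - {0}. \<forall>b\<in>span {v} - {0}. arccos (\<bar>a \<bullet> b\<bar> / (norm a * norm b)) = arccos \<bar>u \<bullet> v\<bar>"
   using * by blast
  show "c = arccos \<bar>u \<bullet> v\<bar>"
   if "\<forall>a\<in>span {u} - {0}. \<forall>b\<in>span {v} - {0}. arccos (\<bar>a \<bullet> b\<bar> / (norm a * norm b)) = c" for c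
   using that[rule_format, OF ne] *[OF ne] by simp
 qed
qed

text \<open>Lists stand for matrix products from left to right, so the forward product along
  \<open>j\<close> belongs to the reversed prefix. The letters of negative index in
  \<open>bw\<close> run away from the origin, as in left words.\<close>

definition fw :: "(nat => 'k) => nat => 'k list" where "fw j n = rev (pre j n)"

definition bw :: "'k two_sided => nat => 'k list" where "bw i m = pre (%l. i (- 1 - int l)) m"

lemma length_fw [simp]: "length (fw j n) = n" and length_bw [simp]: "length (bw i m) = m"
 by (simp_all add: fw_def bw_def)

lemma fw_add: "fw j (n + k) = fw (shl n j) k @ fw j n"
 unfolding fw_def map_upt_add by simp

lemma fw_Suc': "fw j (Suc n) = fw (shl 1 j) n @ [j 0]"
 using fw_add[of j 1 n] by (simp add: fw_def)

lemma forward_prod_fw: "forward_prod A i n = word_prod A (fw (%m. i (int m)) n)"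
 by (simp add: forward_prod_def fw_def rev_map)

lemma fw_conc: "length w = n ==> fw (conc (rev w) t) n = w"
 using map_conc[of "rev w" t] by (simp add: fw_def)

lemma bw_add: "bw i (m + k) = bw i m @ bw (%l. i (l - int m)) k"
 by (rule nth_equalityI) (auto simp: bw_def nth_append algebra_simps of_nat_diff)

lemma bw_shift: "bw (shift i) (Suc m) = i 0 # bw i m"
proof -
 have "[0..<Suc m] = 0 # pre Suc m" by (simp add: map_Suc_upt upt_conv_Cons)
 thus ?thesis by (simp add: bw_def shift_def comp_def algebra_simps)
qed

context dominated
begin

definition K :: real where "K = (SOME K. K >= 1 \<and> (\<forall>u v. a1 u * a1 v <= K * a1 (u @ v)))"

lemma K: "K >= 1" "a1 u * a1 v <= K * a1 (u @ v)"
 using someI_ex[OF a1_almost_multiplicative, folded K_def] by simp_all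

lemma a2_append_le_K: "a2 (u @ v) <= K * a2 u * a2 v"
proof -
 have "(a1 u * a1 v) * a2 (u @ v) <= (K * a1 (u @ v)) * a2 (u @ v)"
  using K(2)[of u v] by (intro mult_right_mono) (auto intro: less_imp_le)
 also have "... = K * dt (u @ v)" by (simp add: dt_eq)
 also have "... = K * (dt u * dt v)" by (simp add: dt_append)
 also have "... = (a1 u * a1 v) * (K * a2 u * a2 v)" by (simp add: dt_eq)
 finally show ?thesis by (rule mult_left_le_imp_le) simp
qed

lemma tau_tendsto_0:
 assumes "\<And>n. length (w n) = n"
 shows "(%n. tau (w n)) ----> 0"
proof -
 obtain c \<beta> where c: "c > 0" "\<beta> > 0" "\<And>w. tau w <= c * dec \<beta> (length w)"
  using tau_decay by blast
 have "(%n. c * dec \<beta> n) ----> 0" using c by real_asymp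
 thus ?thesis
 proof (rule tendsto_sandwich[rotated 3, OF _ ])
  show "EV n. tau (w n) <= c * dec \<beta> n" using c(3)[of "w n" for n] assms by auto
  show "EV n. 0 <= tau (w n)" by (simp add: less_imp_le)
 qed auto
qed

lemma sphere_subsequence:
 fixes v :: "nat => real^2"
 assumes "\<And>n. norm (v n) = 1"
 obtains l r where "norm l = 1" "strict_mono (r :: nat => nat)" "(%n. v (r n)) ----> l"
proof -
 have "seq_compact (sphere (0::real^2) 1)" by (simp add: compact_imp_seq_compact)
 then obtain l r where "l \<in> sphere 0 1" "strict_mono (r :: nat => nat)" "(v \<circ> r) ----> l"
  unfolding seq_compact_def using assms by (metis dist_0_norm mem_sphere)
 thus ?thesis using that by (simp add: comp_def)
qed

lemma tendsto_P: "(f \<longlongrightarrow> l) F ==> ((%x. P w *v f x) \<longlongrightarrow> P w *v l) F"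
 by (rule bounded_linear.tendsto[OF matrix_vector_mul_bounded_linear])

text \<open>Describing the line by a growth condition makes subspace property, invariance and
  uniqueness accessible without limits; existence of a nonzero vector is
  \<open>Es_vector\<close>.\<close>

definition Es :: "(nat => 'k) => (real^2) set" where
 "Es j = {v. \<exists>B. \<forall>n. norm (P (fw j n) *v v) <= B * a2 (fw j n)}"

lemma subspace_Es: "subspace (Es j)"
proof (rule subspaceI)
 show "0 \<in> Es j" by (auto simp: Es_def intro!: exI[of _ 0])
next
 fix x y assume "x \<in> Es j" "y \<in> Es j"
 then obtain B B' where "\<And>n. norm (P (fw j n) *v x) <= B * a2 (fw j n)" "\<And>n. norm (P (fw j n) *v y) <= B' * a2 (fw j n)"
  by (auto simp: Es_def)
 hence "norm (P (fw j n) *v (x + y)) <= (B + B') * a2 (fw j n)" for n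
  using norm_triangle_ineq[of "P (fw j n) *v x" "P (fw j n) *v y"]
  by (simp add: matrix_vector_right_distrib distrib_right) (meson add_mono order_trans)
 thus "x + y \<in> Es j" by (auto simp: Es_def)
next
 fix c x assume "x \<in> Es j"
 then obtain B where "\<And>n. norm (P (fw j n) *v x) <= B * a2 (fw j n)" by (auto simp: Es_def)
 hence "norm (P (fw j n) *v (c *\<^sub>R x)) <= (\<bar>c\<bar> * B) * a2 (fw j n)" for n
  by (simp add: matrix_vector_mult_scaleR mult_left_mono mult.assoc)
 thus "c *\<^sub>R x \<in> Es j" by (auto simp: Es_def)
qed

lemma wedge_le_of_contraction:
 assumes "norm (P w *v x) <= B * a2 w" "norm (P w *v y) <= B' * a2 w" "B >= 0"
 shows "\<bar>wedge x y\<bar> <= B * B' * tau w"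
proof -
 have "dt w * \<bar>wedge x y\<bar> = \<bar>wedge (P w *v x) (P w *v y)\<bar>"
  by (simp add: wedge_matrix abs_mult dt_def)
 also have "... <= (B * a2 w) * (B' * a2 w)"
  using assms by (intro order_trans[OF wedge_le] mult_mono mult_nonneg_nonneg) (auto intro: less_imp_le)
 also have "... = dt w * (B * B' * tau w)" by (simp add: dt_eq tau_def)
 finally show ?thesis by (rule mult_left_le_imp_le) simp
qed

text \<open>Two vectors contracted like \<open>a2\<close> span an area shrinking like
  \<open>a2^2\<close>, whereas the determinant is \<open>a1 * a2\<close>; so their wedge is bounded
  by a multiple of \<open>tau\<close>, which tends to zero.\<close>

lemma wedge_Es:
 assumes "x \<in> Es j" "y \<in> Es j"
 shows "wedge x y = 0"
proof -
 obtain B B' where B: "\<And>n. norm (P (fw j n) *v x) <= B * a2 (fw j n)" "\<And>n. norm (P (fw j n) *v y) <= B' * a2 (fw j n)"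
  using assms by (auto simp: Es_def)
 have "0 <= B * a2 (fw j 0)" using B(1)[of 0] norm_ge_zero order_trans by blast
 hence "B >= 0" using a2_pos[of "fw j 0"] by (simp add: zero_le_mult_iff)
 have "\<bar>wedge x y\<bar> <= B * B' * tau (fw j n)" for n
  by (rule wedge_le_of_contraction) (use B \<open>B >= 0\<close> in auto)
 moreover have "(%n. B * B' * tau (fw j n)) ----> B * B' * 0"
  by (intro tendsto_mult_left tau_tendsto_0) simp
 ultimately have "\<bar>wedge x y\<bar> <= 0" by (intro tendsto_lowerbound[of _ _ sequentially]) auto
 thus ?thesis by simp
qed

text \<open>A limit of the contracted directions of longer and longer prefixes.
  Quasi-multiplicativity passes the contraction by a long product to each shorter one with the same
  constant \<open>K\<close>.\<close>

lemma Es_vector: "\<exists>v. norm v = 1 \<and> (\<forall>n. norm (P (fw j n) *v v) <= K * a2 (fw j n))"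
proof -
 obtain v r where v: "norm v = 1" "strict_mono r" "(%n. cdir (fw j (r n))) ----> v"
  using sphere_subsequence[of "%n. cdir (fw j n)"] cdir(1) by blast
 have "norm (P (fw j k) *v v) <= K * a2 (fw j k)" for k
 proof (rule tendsto_upperbound)
  show "(%n. norm (P (fw j k) *v cdir (fw j (r n)))) ----> norm (P (fw j k) *v v)"
   by (intro tendsto_norm tendsto_P v)
  show "EV n. norm (P (fw j k) *v cdir (fw j (r n))) <= K * a2 (fw j k)"
  proof (rule eventually_sequentiallyI[of k])
   fix n assume "k <= n"
   hence "k <= r n" using seq_suble[OF v(2), of n] by simp
   hence split: "fw j (r n) = fw (shl k j) (r n - k) @ fw j k" using fw_add[of j k "r n - k"] by simp
   let ?x = "fw (shl k j) (r n - k)" and ?c = "cdir (fw j (r n))"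
   have "a2 ?x * norm (P (fw j k) *v ?c) <= norm (P (fw j (r n)) *v ?c)"
    using norm_P_ge[of ?x "P (fw j k) *v ?c"] by (simp add: split P_append_mult)
   also have "... = a2 (fw j (r n))" by (rule cdir(2))
   also have "... <= a2 ?x * (K * a2 (fw j k))" unfolding split using a2_append_le_K[of ?x "fw j k"] by (simp add: mult_ac)
   finally show "norm (P (fw j k) *v ?c) <= K * a2 (fw j k)" by (rule mult_left_le_imp_le) simp
  qed
 qed simp
 with v(1) show ?thesis by blast
qed

definition evec :: "(nat => 'k) => real^2" where
 "evec j = (SOME v. norm v = 1 \<and> (\<forall>n. norm (P (fw j n) *v v) <= K * a2 (fw j n)))"

lemma evec: "norm (evec j) = 1" "norm (P (fw j n) *v evec j) <= K * a2 (fw j n)"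
 using someI_ex[OF Es_vector[of j], folded evec_def] by simp_all

lemma evec_nz [simp]: "evec j \<noteq> 0" using evec(1)[of j] by auto

lemma Es_span: "Es j = span {evec j}"
proof -
 have "evec j \<in> Es j" using evec(2) unfolding Es_def by blast
 thus ?thesis using subspace_Es wedge_Es by (intro line_eq_span) auto
qed

lemma Es_invariant: "(%v. A (j 0) *v v) ` Es j = Es (shl 1 j)"
proof -
 have inj: "A (j 0) *v evec j \<noteq> 0"
 proof
  assume "A (j 0) *v evec j = 0"
  hence "a2 [j 0] * norm (evec j) <= 0" using norm_P_ge[of "[j 0]" "evec j"] by simp
  thus False using a2_pos[of "[j 0]"] by (simp add: evec(1) not_le[symmetric])
 qed
 have mem: "A (j 0) *v evec j \<in> Es (shl 1 j)"
 proof -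
  have "norm (P (fw (shl 1 j) n) *v (A (j 0) *v evec j)) <= (K * a1 [j 0]) * a2 (fw (shl 1 j) n)" for n
  proof -
   have "P (fw (shl 1 j) n) *v (A (j 0) *v evec j) = P (fw j (Suc n)) *v evec j"
    by (simp add: fw_Suc' P_append_mult)
   moreover have "norm (P (fw j (Suc n)) *v evec j) <= K * a2 (fw j (Suc n))" by (rule evec)
   moreover have "K * a2 (fw j (Suc n)) <= K * (a2 (fw (shl 1 j) n) * a1 [j 0])"
    unfolding fw_Suc' using K by (intro mult_left_mono a2_append_le) auto
   ultimately show ?thesis by (simp add: mult_ac)
  qed
  thus ?thesis by (auto simp: Es_def)
 qed
 have "(%v. A (j 0) *v v) ` span {evec j} = span {A (j 0) *v evec j}"
  using linear_span_image[OF matrix_vector_mul_linear, of "A (j 0)" "{evec j}"] by simp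
 also have "... = Es (shl 1 j)"
  using subspace_Es mem inj wedge_Es by (intro line_eq_span[symmetric]) auto
 finally show ?thesis by (simp add: Es_span)
qed

text \<open>Dual to \<open>Es\<close>: the past determines the line, whose vectors shrink like
  \<open>1 / a1\<close> when pulled back through \<open>m\<close> letters.\<close>

definition Ds :: "'k two_sided => (real^2) set" where
 "Ds i = {w. \<exists>B. \<forall>m z. P (bw i m) *v z = w --> a1 (bw i m) * norm z <= B}"

lemma P_inj: "P w *v x = P w *v y ==> x = y"
proof -
 assume "P w *v x = P w *v y"
 hence "P w *v (x - y) = 0" by (simp add: matrix_vector_mult_diff_distrib)
 hence "a2 w * norm (x - y) <= 0" using norm_P_ge[of w "x - y"] by simp
 thus "x = y" using a2_pos[of w] by (simp add: mult_le_0_iff)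
qed

lemma P_surj: "\<exists>z. P w *v z = x"
proof -
 have "invertible (P w)" using det_P by (simp add: invertible_2)
 then obtain B where B: "P w ** B = mat 1" by (auto simp: invertible_def)
 thus ?thesis by (intro exI[of _ "B *v x"]) (simp add: matrix_vector_mul_assoc)
qed

lemma subspace_Ds: "subspace (Ds i)"
proof (rule subspaceI)
 show "0 \<in> Ds i"
 proof -
  have "a1 (bw i m) * norm z <= 0" if "P (bw i m) *v z = 0" for m z
   using P_inj[of "bw i m" z 0] that by simp
  thus ?thesis by (auto simp: Ds_def)
 qed
next
 fix x y assume "x \<in> Ds i" "y \<in> Ds i"
 then obtain B B' where B: "\<And>m z. P (bw i m) *v z = x ==> a1 (bw i m) * norm z <= B"
   "\<And>m z. P (bw i m) *v z = y ==> a1 (bw i m) * norm z <= B'" by (auto simp: Ds_def)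
 have "a1 (bw i m) * norm z <= B + B'" if z: "P (bw i m) *v z = x + y" for m z
 proof -
  obtain z1 z2 where z12: "P (bw i m) *v z1 = x" "P (bw i m) *v z2 = y" using P_surj by metis
  hence "z = z1 + z2" using z P_inj[of "bw i m" z "z1 + z2"] by (simp add: matrix_vector_right_distrib)
  hence "a1 (bw i m) * norm z <= a1 (bw i m) * (norm z1 + norm z2)"
   by (intro mult_left_mono) (auto intro: norm_triangle_ineq less_imp_le)
  thus ?thesis using B(1)[OF z12(1)] B(2)[OF z12(2)] by (simp add: distrib_left)
 qed
 thus "x + y \<in> Ds i" by (auto simp: Ds_def)
next
 fix c x assume "x \<in> Ds i"
 then obtain B where B: "\<And>m z. P (bw i m) *v z = x ==> a1 (bw i m) * norm z <= B" by (auto simp: Ds_def)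
 have "a1 (bw i m) * norm z <= \<bar>c\<bar> * B" if z: "P (bw i m) *v z = c *\<^sub>R x" for m z
 proof -
  obtain z1 where z1: "P (bw i m) *v z1 = x" using P_surj by metis
  hence "z = c *\<^sub>R z1" using z P_inj[of "bw i m" z "c *\<^sub>R z1"] by (simp add: matrix_vector_mult_scaleR)
  thus ?thesis using mult_left_mono[OF B[OF z1], of "\<bar>c\<bar>"] by (simp add: mult_ac)
 qed
 thus "c *\<^sub>R x \<in> Ds i" by (auto simp: Ds_def)
qed

lemma wedge_Ds:
 assumes "x \<in> Ds i" "y \<in> Ds i"
 shows "wedge x y = 0"
proof -
 obtain B B' where B: "\<And>m z. P (bw i m) *v z = x ==> a1 (bw i m) * norm z <= B"
   "\<And>m z. P (bw i m) *v z = y ==> a1 (bw i m) * norm z <= B'" using assms by (auto simp: Ds_def)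
 have "\<bar>wedge x y\<bar> <= B * B' * tau (bw i m)" for m
 proof -
  let ?w = "bw i m"
  obtain z1 z2 where z12: "P ?w *v z1 = x" "P ?w *v z2 = y" using P_surj by metis
  have "\<bar>wedge x y\<bar> = dt ?w * \<bar>wedge z1 z2\<bar>" using z12 by (auto simp: wedge_matrix abs_mult dt_def)
  also have "... <= dt ?w * (norm z1 * norm z2)" by (intro mult_left_mono wedge_le) (auto intro: less_imp_le)
  also have "... = tau ?w * ((a1 ?w * norm z1) * (a1 ?w * norm z2))" by (simp add: dt_eq tau_def)
  also have "... <= tau ?w * (B * B')"
  proof (intro mult_left_mono mult_mono B z12)
   show "0 <= B" using B(1)[OF z12(1)] by (rule order_trans[rotated]) (simp add: less_imp_le)
  qed (simp_all add: less_imp_le)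
  finally show ?thesis by (simp add: mult.commute)
 qed
 moreover have "(%n. B * B' * tau (bw i n)) ----> B * B' * 0"
  by (intro tendsto_mult_left tau_tendsto_0) simp
 ultimately have "\<bar>wedge x y\<bar> <= 0" by (intro tendsto_lowerbound[of _ _ sequentially]) auto
 thus ?thesis by simp
qed

lemma a1_append_edir: "a1 (u @ v) <= a1 v * norm (P u *v edir v) + a1 u * a2 v"
proof -
 obtain a where a: "norm a = 1" "\<And>z. norm (P v *v z - (a1 v * (z \<bullet> a)) *\<^sub>R edir v) <= a2 v * norm z"
  using edir(3)[of v] by blast
 have "norm (P (u @ v) *v z) <= (a1 v * norm (P u *v edir v) + a1 u * a2 v) * norm z" for z
 proof -
  define c where "c = a1 v * (z \<bullet> a)"
  have c: "\<bar>c\<bar> <= a1 v * norm z"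
   using Cauchy_Schwarz_ineq2[of z a] a(1) by (simp add: c_def abs_mult less_imp_le mult_left_mono)
  have "P (u @ v) *v z = c *\<^sub>R (P u *v edir v) + P u *v (P v *v z - c *\<^sub>R edir v)"
   by (simp add: P_append_mult matrix_vector_mult_diff_distrib matrix_vector_mult_scaleR)
  hence "norm (P (u @ v) *v z) <= \<bar>c\<bar> * norm (P u *v edir v) + norm (P u *v (P v *v z - c *\<^sub>R edir v))"
   by (metis norm_scaleR norm_triangle_ineq)
  also have "norm (P u *v (P v *v z - c *\<^sub>R edir v)) <= a1 u * (a2 v * norm z)"
   using a(2)[of z] by (intro order_trans[OF norm_P_le] mult_left_mono) (auto simp: c_def intro: less_imp_le)
  also have "\<bar>c\<bar> * norm (P u *v edir v) <= (a1 v * norm z) * norm (P u *v edir v)"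
   using c by (intro mult_right_mono) auto
  finally show ?thesis by (simp add: algebra_simps)
 qed
 thus ?thesis unfolding a1_def[of "u @ v"] by (rule mnorm_le)
qed

text \<open>A limit of the expanded directions of longer and longer pasts. The last conclusion
  covers every word \<open>u\<close>, because quasi-multiplicativity keeps expanded directions
  uniformly away from all contracted ones.\<close>

lemma Ds_vector:
 "\<exists>w. norm w = 1 \<and> w \<in> Ds i \<and> (\<forall>u. a1 u <= K * norm (P u *v w))"
proof -
 obtain w r where w: "norm w = 1" "strict_mono r" "(%n. edir (bw i (r n))) ----> w"
  using sphere_subsequence[of "%n. edir (bw i n)"] edir(1) by blast
 have "a1 (bw i k) * norm z <= K" if z: "P (bw i k) *v z = w" for k z
 proof (rule tendsto_lowerbound)
  let ?w = "bw i k"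
  have "(%n. norm (w - edir (bw i (r n)))) ----> norm (w - w)"
   by (intro tendsto_norm tendsto_diff tendsto_const w)
  hence "(%n. K + a1 ?w * (norm (w - edir (bw i (r n))) / a2 ?w)) ----> K + a1 ?w * (norm (w - w) / a2 ?w)"
   by (intro tendsto_add tendsto_mult tendsto_divide tendsto_const) auto
  thus "(%n. K + a1 ?w * (norm (w - edir (bw i (r n))) / a2 ?w)) ----> K" by simp
  show "EV n. a1 ?w * norm z <= K + a1 ?w * (norm (w - edir (bw i (r n))) / a2 ?w)"
  proof (rule eventually_sequentiallyI[of k])
   fix n assume "k <= n"
   hence "k <= r n" using seq_suble[OF w(2), of n] by simp
   then obtain y where y: "bw i (r n) = ?w @ y" using bw_add[of i k "r n - k"] by simp
   obtain a where a: "norm a = 1" "P (?w @ y) *v a = a1 (?w @ y) *\<^sub>R edir (?w @ y)" using edir(3) by blast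
   define z' where "z' = (1 / a1 (?w @ y)) *\<^sub>R (P y *v a)"
   have Pz': "P ?w *v z' = edir (?w @ y)" using a(2) by (simp add: z'_def matrix_vector_mult_scaleR P_append_mult)
   have "a1 ?w * norm z' <= a1 ?w * (a1 y / a1 (?w @ y))"
    using norm_P_le[of y a] a(1) by (intro mult_left_mono) (auto simp: z'_def divide_right_mono less_imp_le)
   also have "... <= K" using K(2)[of ?w y] by (simp add: divide_le_eq mult.commute)
   finally have 1: "a1 ?w * norm z' <= K" .
   have "a2 ?w * norm (z - z') <= norm (w - edir (?w @ y))"
    using norm_P_ge[of ?w "z - z'"] z Pz' by (simp add: matrix_vector_mult_diff_distrib)
   hence 2: "norm (z - z') <= norm (w - edir (?w @ y)) / a2 ?w" by (simp add: field_simps)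
   have "a1 ?w * norm z <= a1 ?w * (norm z' + norm (z - z'))"
    using norm_triangle_ineq[of z' "z - z'"] by (intro mult_left_mono) (auto intro: less_imp_le)
   also have "... <= K + a1 ?w * (norm (w - edir (?w @ y)) / a2 ?w)"
    unfolding distrib_left using 1 2 by (intro add_mono mult_left_mono) (auto intro: less_imp_le)
   finally show "a1 ?w * norm z <= K + a1 ?w * (norm (w - edir (bw i (r n))) / a2 ?w)" by (simp add: y)
  qed
 qed simp
 hence "w \<in> Ds i" by (auto simp: Ds_def)
 moreover have "a1 u <= K * norm (P u *v w)" for u
 proof (rule tendsto_lowerbound)
  have "(%n. tau (bw i (r n))) ----> 0"
   using LIMSEQ_subseq_LIMSEQ[OF tau_tendsto_0[of "bw i"] w(2)] by (simp add: comp_def)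
  hence "(%n. K * (norm (P u *v edir (bw i (r n))) + a1 u * tau (bw i (r n)))) ----> K * (norm (P u *v w) + a1 u * 0)"
   by (intro tendsto_mult_left tendsto_add tendsto_norm tendsto_P w)
  thus "(%n. K * (norm (P u *v edir (bw i (r n))) + a1 u * tau (bw i (r n)))) ----> K * norm (P u *v w)" by simp
  show "EV n. a1 u <= K * (norm (P u *v edir (bw i (r n))) + a1 u * tau (bw i (r n)))"
  proof (intro always_eventually allI)
   fix n
   let ?v = "bw i (r n)"
   have "a1 u * a1 ?v <= K * a1 (u @ ?v)" by (rule K)
   also have "... <= K * (a1 ?v * norm (P u *v edir ?v) + a1 u * a2 ?v)"
    using K by (intro mult_left_mono a1_append_edir) auto
   also have "... = (K * (norm (P u *v edir ?v) + a1 u * tau ?v)) * a1 ?v" by (simp add: tau_def algebra_simps)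
   finally show "a1 u <= K * (norm (P u *v edir ?v) + a1 u * tau ?v)" by (rule mult_right_le_imp_le) simp
  qed
 qed simp
 ultimately show ?thesis using w(1) by blast
qed

lemma Ds_invariant: "(%v. A (i 0) *v v) ` Ds i = Ds (shift i)"
proof -
 obtain w where w: "norm w = 1" "w \<in> Ds i" using Ds_vector by blast
 have w0: "w \<noteq> 0" using w by auto
 have Aw0: "A (i 0) *v w \<noteq> 0" using P_inj[of "[i 0]" w 0] w0 by auto
 obtain B where B: "\<And>m z. P (bw i m) *v z = w ==> a1 (bw i m) * norm z <= B" using w by (auto simp: Ds_def)
 have "a1 (bw (shift i) m) * norm z <= max (norm (A (i 0) *v w)) (a1 [i 0] * B)"
  if z: "P (bw (shift i) m) *v z = A (i 0) *v w" for m z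
 proof (cases m)
  case 0
  thus ?thesis using z by (simp add: bw_def)
 next
  case (Suc m')
  have eq: "bw (shift i) m = [i 0] @ bw i m'" using Suc bw_shift by simp
  have "P [i 0] *v (P (bw i m') *v z) = P [i 0] *v w" using z unfolding eq P_append_mult by simp
  hence "P (bw i m') *v z = w" by (rule P_inj)
  hence 1: "a1 (bw i m') * norm z <= B" by (rule B)
  have "a1 (bw (shift i) m) * norm z <= (a1 [i 0] * a1 (bw i m')) * norm z"
   unfolding eq by (intro mult_right_mono a1_append_le) simp
  also have "... <= a1 [i 0] * B" using mult_left_mono[OF 1, of "a1 [i 0]"] by (simp add: mult.assoc less_imp_le)
  finally show ?thesis by simp
 qed
 hence mem: "A (i 0) *v w \<in> Ds (shift i)" by (auto simp: Ds_def)
 have "Ds i = span {w}" using subspace_Ds w w0 wedge_Ds by (intro line_eq_span) auto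
 hence "(%v. A (i 0) *v v) ` Ds i = span {A (i 0) *v w}"
  using linear_span_image[OF matrix_vector_mul_linear, of "A (i 0)" "{w}"] by simp
 also have "... = Ds (shift i)"
  using subspace_Ds mem Aw0 wedge_Ds by (intro line_eq_span[symmetric]) auto
 finally show ?thesis .
qed

lemma stable_splitting_exists: "stable_splitting A Ds (%i. Es (%n. i (int n)))"
 unfolding stable_splitting_def
proof (intro conjI exI[of _ K] allI K(1))
 have D: "\<exists>w. norm w = 1 \<and> Ds i = span {w} \<and> (\<forall>u. a1 u <= K * norm (P u *v w))" for i
 proof -
  obtain w where w: "norm w = 1" "w \<in> Ds i" "\<forall>u. a1 u <= K * norm (P u *v w)" using Ds_vector by blast
  moreover have "Ds i = span {w}" using subspace_Ds w wedge_Ds by (intro line_eq_span) auto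
  ultimately show ?thesis by blast
 qed
 have "Ds i \<in> proj_line" for i using D[of i] by (auto simp: proj_line_iff)
 thus "invariant_lines A Ds" by (simp add: invariant_lines_def Ds_invariant)
 have "Es j \<in> proj_line" for j using evec(1) Es_span by (auto simp: proj_line_iff)
 moreover have "(%v. A (i 0) *v v) ` Es (%n. i (int n)) = Es (%n. shift i (int n))" for i
  using Es_invariant[of "%n. i (int n)"] by (simp add: shl_def shift_def add.commute)
 ultimately show "invariant_lines A (%i. Es (%n. i (int n)))" by (simp add: invariant_lines_def)
 fix n and i :: "'k two_sided"
 let ?w = "fw (%m. i (int m)) n"
 have s: "sing_val1 (P ?w) = a1 ?w" "sing_val2 (P ?w) = a2 ?w"
  using det_P[of ?w] by (simp_all add: sing_val1_eq sing_val2_eq a1_def a2_def)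
 obtain w where w: "norm w = 1" "Ds i = span {w}" "\<forall>u. a1 u <= K * norm (P u *v w)" using D by blast
 have K0: "K > 0" using K(1) by simp
 show "sing_val1 (forward_prod A i n) / K <= norm_on_line (forward_prod A i n) (Ds i)"
  using w K0 by (simp add: s forward_prod_fw norm_on_line_span divide_le_eq mult.commute)
 have "norm (P ?w *v w) <= 1 * a1 ?w" using norm_P_le[of ?w w] w(1) by simp
 also have "... <= K * a1 ?w" using K by (intro mult_right_mono) (auto intro: less_imp_le)
 finally show "norm_on_line (forward_prod A i n) (Ds i) <= K * sing_val1 (forward_prod A i n)"
  using w by (simp add: s forward_prod_fw norm_on_line_span)
 have "a2 ?w / K <= a2 ?w / 1" using K by (intro divide_left_mono) (auto intro: less_imp_le)
 also have "... <= norm (P ?w *v evec (%n. i (int n)))" using norm_P_ge[of ?w "evec (%n. i (int n))"] by (simp add: evec(1))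
 finally show "sing_val2 (forward_prod A i n) / K <= norm_on_line (forward_prod A i n) (Es (%n. i (int n)))"
  by (simp add: s forward_prod_fw norm_on_line_span Es_span evec(1))
 show "norm_on_line (forward_prod A i n) (Es (%n. i (int n))) <= K * sing_val2 (forward_prod A i n)"
  by (simp add: s forward_prod_fw norm_on_line_span Es_span evec)
qed

lemma stable_splitting_unique:
 assumes "stable_splitting A es ess"
 shows "ess i = Es (%n. i (int n))"
proof -
 obtain K' where lines: "invariant_lines A ess" and K': "\<And>n i. norm_on_line (forward_prod A i n) (ess i) <= K' * sing_val2 (forward_prod A i n)"
  using assms by (auto simp: stable_splitting_def)
 obtain v where v: "norm v = 1" "ess i = span {v}"
  using lines unfolding invariant_lines_def proj_line_iff by blast
 have "norm (P (fw (%m. i (int m)) n) *v v) <= K' * a2 (fw (%m. i (int m)) n)" for n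
  using K'[of i n] v det_P by (simp add: forward_prod_fw norm_on_line_span sing_val2_eq a2_def)
 hence "v \<in> Es (%n. i (int n))" by (auto simp: Es_def)
 hence "Es (%n. i (int n)) = span {v}"
  using subspace_Es v wedge_Es by (intro line_eq_span) auto
 with v show ?thesis by simp
qed

text \<open>Both definite descriptions become the span of a concrete unit vector. The vector
  \<open>evec j\<close> itself is an arbitrary choice between two signs, which matters for
  measurability later.\<close>

theorem ess_line_eq: "ess_line A j = span {evec j}"
proof -
 have 1: "two_sided_ess A = (%i. Es (%n. i (int n)))"
  unfolding two_sided_ess_def
  using stable_splitting_exists stable_splitting_unique by (intro the_equality) blast+
 show ?thesis unfolding ess_line_def 1
 proof (rule the_equality)
  show "\<forall>i. (\<forall>n. i (int n) = j n) --> Es (%n. i (int n)) = span {evec j}" by (auto simp: Es_span)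
  fix L assume "\<forall>i. (\<forall>n. i (int n) = j n) --> Es (%n. i (int n)) = L"
  from this[rule_format, of "%n. j (nat n)"] show "L = span {evec j}" by (simp add: Es_span)
 qed
qed

lemma line_angle_ess: "line_angle (ess_line A i) (ess_line A j) = arccos \<bar>evec i \<bullet> evec j\<bar>"
 unfolding ess_line_eq by (rule line_angle_span) (rule evec)+

text \<open>\<open>P w\<close> carries both lines to the lines after the common prefix; it
  multiplies the wedge by the determinant \<open>a1 w * a2 w\<close> and stretches each vector by at
  least \<open>a2 w\<close>. This reduces two words to their first disagreement, where
  transversality applies.\<close>

lemma wedge_evec_prefix:
 assumes "fw i k = w" "fw j k = w"
 shows "tau w * \<bar>wedge (evec (shl k i)) (evec (shl k j))\<bar> <= \<bar>wedge (evec i) (evec j)\<bar>"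
proof -
 have inv: "\<exists>c. P (fw i k) *v evec i = c *\<^sub>R evec (shl k i)" for i
 proof -
  have "P (fw i k) *v evec i \<in> Es (shl k i)"
  proof (induction k)
   case 0
   have "shl 0 i = i" by (simp add: shl_def)
   thus ?case by (simp add: fw_def Es_span span_base)
  next
   case (Suc k)
   have "fw i (Suc k) = shl k i 0 # fw i k" by (simp add: fw_def shl_def)
   moreover have "shl 1 (shl k i) = shl (Suc k) i" by (simp add: shl_def)
   ultimately show ?case using Es_invariant[of "shl k i"] Suc
    by (auto simp: word_prod_Cons matrix_vector_mul_assoc[symmetric])
  qed
  thus ?thesis by (simp add: Es_span in_span_singleton)
 qed
 obtain c d where cd: "P w *v evec i = c *\<^sub>R evec (shl k i)" "P w *v evec j = d *\<^sub>R evec (shl k j)"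
  using inv[of i] inv[of j] assms by auto
 have c: "a2 w <= \<bar>c\<bar>" "a2 w <= \<bar>d\<bar>"
  using norm_P_ge[of w "evec i"] norm_P_ge[of w "evec j"] by (simp_all add: cd evec(1))
 let ?W = "\<bar>wedge (evec (shl k i)) (evec (shl k j))\<bar>"
 have "dt w * \<bar>wedge (evec i) (evec j)\<bar> = \<bar>c\<bar> * \<bar>d\<bar> * ?W"
  using wedge_matrix[of "P w" "evec i" "evec j"] by (simp add: dt_def cd abs_mult[symmetric] mult_ac)
 also have "... >= a2 w * a2 w * ?W"
  using c by (intro mult_right_mono mult_mono) (auto intro: less_imp_le order_trans[rotated])
 finally have "dt w * (tau w * ?W) <= dt w * \<bar>wedge (evec i) (evec j)\<bar>" by (simp add: dt_eq tau_def)
 thus ?thesis by (rule mult_left_le_imp_le) simp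
qed

lemma wedge_evec_le_tau:
 assumes "fw i k = w" "fw j k = w"
 shows "\<bar>wedge (evec i) (evec j)\<bar> <= K^2 * tau w"
 using wedge_le_of_contraction[of w "evec i" K "evec j" K] evec(2)[of i k] evec(2)[of j k] assms K(1)
 by (simp add: power2_eq_square)

end


section \<open>Gibbs measures, exponents and typical words\<close>

lemma gibbs_cyl_bound:
 assumes "gibbs_measure \<phi> mu"
 shows "\<exists>C\<ge>1. \<exists>Pr. \<forall>w i. w \<noteq> [] --> i \<in> cyl w -->
   measure mu (cyl w) <= C * exp (- len w * Pr + (\<Sum>k<length w. \<phi> (shl k i))) \<and>
   exp (- len w * Pr + (\<Sum>k<length w. \<phi> (shl k i))) <= C * measure mu (cyl w)"
proof -
 obtain C Pr where C: "C > 0" "\<And>i n. n >= 1 ==>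
   (let q = measure mu (cylinder i n) / exp (- real n * Pr + (\<Sum>k<n. \<phi> ((right_shift ^^ k) i)))
    in inverse C <= q \<and> q <= C)"
  using assms unfolding gibbs_measure_def by blast
 have *: "measure mu (cyl w) <= C * exp (- len w * Pr + (\<Sum>k<length w. \<phi> (shl k i))) \<and>
   exp (- len w * Pr + (\<Sum>k<length w. \<phi> (shl k i))) <= C * measure mu (cyl w)"
  if "w \<noteq> []" "i \<in> cyl w" for w i
 proof -
  have n: "length w >= 1" using that by (cases w) auto
  have "cylinder i (length w) = cyl w" using that by (simp add: cylinder_eq_cyl in_cyl)
  with C(2)[OF n, of i] have "inverse C <= measure mu (cyl w) / exp (- len w * Pr + (\<Sum>k<length w. \<phi> (shl k i)))"
   "measure mu (cyl w) / exp (- len w * Pr + (\<Sum>k<length w. \<phi> (shl k i))) <= C"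
   by (simp_all add: Let_def right_shift_funpow)
  thus ?thesis using C(1) by (simp add: divide_le_eq le_divide_eq inverse_eq_divide) (simp add: mult.commute divide_le_eq)
 qed
 have "measure mu (cyl w) <= max 1 C * exp (- len w * Pr + (\<Sum>k<length w. \<phi> (shl k i))) \<and>
   exp (- len w * Pr + (\<Sum>k<length w. \<phi> (shl k i))) <= max 1 C * measure mu (cyl w)"
  if "w \<noteq> []" "i \<in> cyl w" for w i
 proof -
  have "C * exp (- len w * Pr + (\<Sum>k<length w. \<phi> (shl k i))) <= max 1 C * exp (- len w * Pr + (\<Sum>k<length w. \<phi> (shl k i)))"
   "C * measure mu (cyl w) <= max 1 C * measure mu (cyl w)" by (intro mult_right_mono; simp)+
  with *[OF that] show ?thesis by linarith
 qed
 thus ?thesis by (intro exI[of _ "max 1 C"] conjI exI[of _ Pr]) auto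
qed

lemma cyl_nonempty: "\<exists>i. i \<in> cyl w"
 using cyl_conc by blast

lemma gibbs_word_measure: "gibbs_measure \<phi> mu ==> word_measure mu"
 unfolding gibbs_measure_def word_measure_def word_measure_axioms_def by blast

text \<open>The Gibbs bound holds with one constant at every point of a cylinder. Evaluated at a
  point of \<open>cyl (u @ v)\<close> and at its shift, the Birkhoff sums add up exactly, and the
  three bounds involved cost \<open>C\<close> cubed.\<close>

lemma gibbs_quasi_bernoulli:
 fixes mu :: "('k::finite) left_word measure"
 assumes g: "gibbs_measure \<phi> mu" and "ergodic_measure mu right_shift"
 shows "\<exists>C. quasi_bernoulli mu C"
proof -
 interpret word_measure mu by (rule gibbs_word_measure[OF g])
 obtain C Pr where C: "C >= 1" "\<And>w i. [|w \<noteq> []; i \<in> cyl w|] ==>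
   m w <= C * exp (- len w * Pr + (\<Sum>k<length w. \<phi> (shl k i))) \<and>
   exp (- len w * Pr + (\<Sum>k<length w. \<phi> (shl k i))) <= C * m w"
  using gibbs_cyl_bound[OF g] unfolding m_def by blast
 have m1: "m [] = 1" using prob_space by (simp add: m_def cyl_def)
 have pos: "m w > 0" for w
 proof (cases "w = []")
  case False
  obtain i where "i \<in> cyl w" using cyl_nonempty by blast
  with C(2)[OF False this] have "0 < C * m w" using exp_gt_zero less_le_trans by blast
  thus ?thesis using C(1) by (simp add: zero_less_mult_iff)
 qed (simp add: m1)
 have C2: "1 <= C * C" using C(1) mult_mono[of 1 C 1 C] by simp
 have C3: "C <= C * C * C" using C(1) mult_right_mono[OF C2, of C] by simp
 have C4: "1 <= C * C * C" using C3 C(1) by linarith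
 have "m (u @ v) <= (C * C * C) * m u * m v \<and> m u * m v <= (C * C * C) * m (u @ v)" for u v
 proof (cases "u = [] \<or> v = []")
  case True
  have "1 * m w <= (C * C * C) * m w" for w using C4 by (intro mult_right_mono) auto
  with True show ?thesis by (auto simp: m1)
 next
  case False
  obtain i where i: "i \<in> cyl (u @ v)" using cyl_nonempty by blast
  hence iu: "i \<in> cyl u" and iv: "shl (length u) i \<in> cyl v" by (simp_all add: in_cyl_append)
  define a b where "a = exp (- len u * Pr + (\<Sum>k<length u. \<phi> (shl k i)))"
   and "b = exp (- len v * Pr + (\<Sum>k<length v. \<phi> (shl k (shl (length u) i))))"
  have "(\<Sum>k<length u + length v. \<phi> (shl k i)) =
   (\<Sum>k<length u. \<phi> (shl k i)) + (\<Sum>k<length v. \<phi> (shl (k + length u) i))"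
   using sum.atLeastLessThan_concat[of 0 "length u" "length u + length v" "%k. \<phi> (shl k i)"]
    sum.shift_bounds_nat_ivl[of "%k. \<phi> (shl k i)" 0 "length u" "length v"]
   by (simp add: lessThan_atLeast0 add.commute)
  hence ab: "exp (- len ((u @ v)) * Pr + (\<Sum>k<length (u @ v). \<phi> (shl k i))) = a * b"
   by (simp add: a_def b_def exp_add[symmetric] shl_def algebra_simps)
  have 1: "m u <= C * a" "a <= C * m u" "m v <= C * b" "b <= C * m v" "m (u @ v) <= C * (a * b)" "a * b <= C * m (u @ v)"
   using C(2)[of u i] C(2)[of v "shl (length u) i"] C(2)[of "u @ v" i] False i iu iv
   unfolding ab by (auto simp: a_def b_def)
  have ab0: "a > 0" "b > 0" by (simp_all add: a_def b_def)
  have "C * (a * b) <= C * ((C * m u) * (C * m v))"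
   using 1 ab0 C(1) by (intro mult_left_mono mult_mono) auto
  moreover have "m u * m v <= (C * a) * (C * b)" using 1 ab0 C(1) by (intro mult_mono) auto
  moreover have "C * C * (a * b) <= C * C * (C * m (u @ v))" using 1 C(1) by (intro mult_left_mono) auto
  ultimately show ?thesis using 1 by (simp add: mult_ac)
 qed
 thus ?thesis using pos assms(2)
  by (intro exI[of _ "C * C * C"] quasi_bernoulli.intro quasi_bernoulli_axioms.intro) (auto intro: word_measure_axioms)
qed

text \<open>Summing over all words of a length gives the comparison of the pressures.\<close>

lemma gibbs_compare:
 fixes mu \<nu> :: "('k::finite) left_word measure"
 assumes g: "gibbs_measure \<phi> mu" "gibbs_measure \<psi> \<nu>"
  and close: "\<And>i. \<bar>\<phi> i - \<psi> i\<bar> <= e"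
 shows "\<exists>D>0. \<forall>w. measure mu (cyl w) <= D * exp (2 * e * len w) * measure \<nu> (cyl w)"
proof -
 interpret M: word_measure mu by (rule gibbs_word_measure[OF g(1)])
 interpret N: word_measure \<nu> by (rule gibbs_word_measure[OF g(2)])
 define GM where "GM Pr w i = exp (- len w * Pr + (\<Sum>k<length w. \<phi> (shl k i)))" for Pr and w :: "'k list" and i :: "'k left_word"
 define GN where "GN Pr w i = exp (- len w * Pr + (\<Sum>k<length w. \<psi> (shl k i)))" for Pr and w :: "'k list" and i :: "'k left_word"
 obtain C Pr where C: "C >= 1" "\<And>w i. [|w \<noteq> []; i \<in> cyl w|] ==> M.m w <= C * GM Pr w i \<and> GM Pr w i <= C * M.m w"
  using gibbs_cyl_bound[OF g(1)] unfolding M.m_def GM_def by blast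
 obtain C' Pr' where C': "C' >= 1" "\<And>w i. [|w \<noteq> []; i \<in> cyl w|] ==> N.m w <= C' * GN Pr' w i \<and> GN Pr' w i <= C' * N.m w"
  using gibbs_cyl_bound[OF g(2)] unfolding N.m_def GN_def by blast
 have sums: "\<bar>(\<Sum>k<n. \<phi> (shl k i)) - (\<Sum>k<n. \<psi> (shl k i))\<bar> <= real n * e" for n i
 proof -
  have "\<bar>\<Sum>k<n. \<phi> (shl k i) - \<psi> (shl k i)\<bar> <= (\<Sum>k<n. e)"
   by (rule order_trans[OF sum_abs sum_mono]) (rule close)
  thus ?thesis by (simp add: sum_subtractf)
 qed
 have GMN: "GM Pr w i <= exp (len w * (Pr' - Pr + e)) * GN Pr' w i"
  "GN Pr' w i <= exp (len w * (Pr - Pr' + e)) * GM Pr w i" for w i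
  using sums[of i "length w"] by (simp_all add: GM_def GN_def exp_add[symmetric] algebra_simps abs_le_iff)
 have rel: "M.m w <= C * C' * exp (len w * (Pr' - Pr + e)) * N.m w" "N.m w <= C' * C * exp (len w * (Pr - Pr' + e)) * M.m w"
  if "w \<noteq> []" for w
 proof -
  obtain i where i: "i \<in> cyl w" using cyl_nonempty by blast
  have "M.m w <= C * (exp (len w * (Pr' - Pr + e)) * GN Pr' w i)"
   using C(2)[OF that i] mult_left_mono[OF GMN(1)[of w i], of C] C(1) by linarith
  also have "... <= C * (exp (len w * (Pr' - Pr + e)) * (C' * N.m w))"
   using C(1) C'(2)[OF that i] by (intro mult_left_mono) auto
  finally show "M.m w <= C * C' * exp (len w * (Pr' - Pr + e)) * N.m w" by (simp add: mult_ac)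
  have "N.m w <= C' * (exp (len w * (Pr - Pr' + e)) * GM Pr w i)"
   using C'(2)[OF that i] mult_left_mono[OF GMN(2)[of w i], of C'] C'(1) by linarith
  also have "... <= C' * (exp (len w * (Pr - Pr' + e)) * (C * M.m w))"
   using C'(1) C(2)[OF that i] by (intro mult_left_mono) auto
  finally show "N.m w <= C' * C * exp (len w * (Pr - Pr' + e)) * M.m w" by (simp add: mult_ac)
 qed
 have "Pr' - Pr <= e"
 proof (rule ccontr)
  assume "\<not> Pr' - Pr <= e"
  hence d: "Pr' - Pr - e > 0" by simp
  have "real n * (Pr' - Pr - e) <= ln (C' * C)" if "n >= 1" for n
  proof -
   have "1 = (\<Sum>w\<in>words n. N.m w)" by simp
   also have "... <= (\<Sum>w\<in>words n. C' * C * exp (real n * (Pr - Pr' + e)) * M.m w)"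
   proof (rule sum_mono)
    fix w :: "'k list" assume "w \<in> words n"
    hence "w \<noteq> []" "length w = n" using that by auto
    thus "N.m w <= C' * C * exp (real n * (Pr - Pr' + e)) * M.m w" using rel(2) by auto
   qed
   also have "... = C' * C * exp (real n * (Pr - Pr' + e))" by (simp add: sum_distrib_left[symmetric])
   finally have "exp (real n * (Pr' - Pr - e)) <= C' * C"
    by (simp add: exp_minus[symmetric] exp_add[symmetric] field_simps exp_diff)
   thus ?thesis using C(1) C'(1) by (simp add: ln_ge_iff)
  qed
  moreover obtain n where "ln (C' * C) < real n * (Pr' - Pr - e)" "n >= 1"
   using reals_Archimedean3[OF d] by (metis less_imp_le less_one linorder_not_less ln_ge_zero mult_zero_left C(1) C'(1) of_nat_0 mult_ge1_I not_less_iff_gr_or_eq)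
  ultimately show False by (meson not_le)
 qed
 \<comment> \<open>Per letter, one \<open>e\<close> comes from the potentials and one from the
   pressures.\<close>
 have "M.m w <= (C * C') * exp (2 * e * len w) * N.m w" for w
 proof (cases "w = []")
  case True
  have "M.m [] = 1" "N.m [] = 1" using M.prob_space N.prob_space by (simp_all add: M.m_def N.m_def cyl_def)
  thus ?thesis using True C(1) C'(1) mult_mono[of 1 C 1 C'] by simp
 next
  case False
  have "C * C' * exp (len w * (Pr' - Pr + e)) * N.m w <= C * C' * exp (2 * e * len w) * N.m w"
   using \<open>Pr' - Pr <= e\<close> C(1) C'(1) mult_left_mono[of "Pr' - Pr + e" "2 * e" "len w"]
   by (intro mult_right_mono mult_left_mono) (auto simp: mult_ac)
  with rel(1)[OF False] show ?thesis by linarith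
 qed
 thus ?thesis using C(1) C'(1) by (intro exI[of _ "C * C'"]) (auto simp: M.m_def N.m_def)
qed

locale word_system = quasi_bernoulli mu C + dominated A
 for mu :: "('k::finite) left_word measure" and C and A :: "'k => real^2^2" +
 assumes contracting: "mnorm (A k) < 1"
begin

definition h :: real where "h = shift_entropy mu"
definition xs :: real where "xs = chi_s A mu"
definition xss :: real where "xss = chi_ss A mu"
definition chi :: real where "chi = xss - xs"

lemma aa_m: "almost_additive (%w. ln (m w))"
 by (rule almost_additive_ln[OF m_pos C_ge_1 m_append_le m_append_ge])

lemma aa_a1: "almost_additive (%w. ln (a1 w))"
proof (rule almost_additive_ln[OF a1_pos K(1) _ K(2)])
 fix u v
 have "1 * (a1 u * a1 v) <= K * (a1 u * a1 v)" using K(1) by (intro mult_right_mono) (auto intro: less_imp_le)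
 with a1_append_le[of u v] show "a1 (u @ v) <= K * a1 u * a1 v" unfolding mult.assoc by linarith
qed

lemma aa_a2: "almost_additive (%w. ln (a2 w))"
proof (rule almost_additive_ln[OF a2_pos K(1) a2_append_le_K])
 fix u v
 have "1 * a2 (u @ v) <= K * a2 (u @ v)" using K(1) by (intro mult_right_mono) (auto intro: less_imp_le)
 with a2_append_ge[of u v] show "a2 u * a2 v <= K * a2 (u @ v)" by linarith
qed

lemma AE_const_unique:
 fixes f :: "'k left_word => nat => real"
 assumes "AE i in mu. f i ----> c"
 shows "(THE c. AE i in mu. f i ----> c) = c"
proof (rule the_equality)
 fix d assume "AE i in mu. f i ----> d"
 with assms have "AE i in mu. d = c" by eventually_elim (rule LIMSEQ_unique)
 thus "d = c" by simp
qed fact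

lemma m_limit: "AE i in mu. (%n. ln (m (pre i n)) / real n) ----> - h"
proof -
 obtain c where c: "(%n. (\<Sum>w\<in>words n. m w * ln (m w)) / real n) ----> c"
   "AE i in mu. (%n. ln (m (pre i n)) / real n) ----> c"
  using almost_additive_limit[OF aa_m] by blast
 have "c = - h" using LIMSEQ_unique[OF c(1) shift_entropy_limit] by (simp add: h_def)
 with c(2) show ?thesis by simp
qed

lemma a1_limit: "AE i in mu. (%n. ln (a1 (pre i n)) / real n) ----> - xs"
proof -
 obtain c where c: "AE i in mu. (%n. ln (a1 (pre i n)) / real n) ----> c"
  using almost_additive_limit[OF aa_a1] by blast
 hence "AE i in mu. (%n. - (1 / real n) * ln (sing_val1 (P (pre i n)))) ----> - c"
  by eventually_elim (auto dest!: tendsto_minus simp: sing_val1_eq[OF det_P] a1_def)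
 hence "xs = - c" unfolding xs_def chi_s_def by (rule AE_const_unique)
 with c show ?thesis by simp
qed

lemma a2_limit: "AE i in mu. (%n. ln (a2 (pre i n)) / real n) ----> - xss"
proof -
 obtain c where c: "AE i in mu. (%n. ln (a2 (pre i n)) / real n) ----> c"
  using almost_additive_limit[OF aa_a2] by blast
 hence "AE i in mu. (%n. - (1 / real n) * ln (sing_val2 (P (pre i n)))) ----> - c"
  by eventually_elim (auto dest!: tendsto_minus simp: sing_val2_eq[OF det_P] a2_def)
 hence "xss = - c" unfolding xss_def chi_ss_def by (rule AE_const_unique)
 with c show ?thesis by simp
qed

definition msum :: "nat => ('k list => bool) => real" where
 "msum n Q = (\<Sum>w | w \<in> words n \<and> Q w. m w)"

lemma msum_nonneg: "msum n Q >= 0"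
 unfolding msum_def by (rule sum_nonneg) simp

lemma msum_mono: "(\<And>w. length w = n ==> Q w ==> R w) ==> msum n Q <= msum n R"
 unfolding msum_def by (rule sum_mono2, rule finite_subset[OF _ finite_words[of n]]) auto

lemma msum_le_1: "msum n Q <= 1"
proof -
 have "msum n Q <= sum m (words n)" unfolding msum_def by (rule sum_mono2) auto
 thus ?thesis by simp
qed

lemma msum_disj: "msum n (%w. Q w \<or> R w) <= msum n Q + msum n R"
proof -
 have "{w. w \<in> words n \<and> (Q w \<or> R w)} = {w. w \<in> words n \<and> Q w} \<union> {w. w \<in> words n \<and> R w}" by auto
 moreover have "sum m (S \<union> T) <= sum m S + sum m T" if "finite S" "finite T" for S T
  using sum.union_inter[OF that, of m] sum_nonneg[of "S \<inter> T" m] by simp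
 ultimately show ?thesis unfolding msum_def by (simp del: in_words)
qed

lemma msum_ex:
 assumes "finite I"
 shows "msum n (%w. \<exists>k\<in>I. Q k w) <= (\<Sum>k\<in>I. msum n (Q k))"
 using assms
proof (induction I)
 case (insert x I)
 have "msum n (%w. \<exists>k\<in>insert x I. Q k w) = msum n (%w. Q x w \<or> (\<exists>k\<in>I. Q k w))"
  by (simp add: msum_def)
 thus ?case using msum_disj[of n "Q x" "%w. \<exists>k\<in>I. Q k w"] insert by simp
qed (simp add: msum_def)

lemma msum_prefix_eq: "prob {i. Q (pre i n)} = msum n Q"
 by (simp add: measure_prefix_eq msum_def)

text \<open>By invariance the last \<open>k\<close> letters of a random word form a random word of
  length \<open>k\<close>. Suffixes matter because the last letters of a word govern the direction
  attached to it.\<close>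

lemma msum_suffix:
 assumes "k <= n"
 shows "msum n (%w. Q (drop (n - k) w)) = msum k Q"
proof -
 have "msum n (%w. Q (drop (n - k) w)) = (\<Sum>w\<in>words ((n - k) + k). if Q (drop (n - k) w) then m w else 0)"
  using assms by (simp add: msum_def sum.inter_filter[symmetric] del: in_words)
 also have "... = (\<Sum>u\<in>words (n - k). \<Sum>v\<in>words k. if Q v then m (u @ v) else 0)"
  unfolding sum_words_append by (intro sum.cong) auto
 also have "... = (\<Sum>v\<in>words k. if Q v then m v else 0)"
  by (subst sum.swap) (auto intro!: sum.cong simp: sum_m_left)
 also have "... = msum k Q" by (simp add: msum_def sum.inter_filter[symmetric] del: in_words)
 finally show ?thesis .
qed

lemma expsmall_suffix:
 assumes "expsmall (%n. msum n Q)" and "eta > 0"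
 shows "expsmall (%n. msum n (%w. \<exists>k. k <= n \<and> eta * real n <= real k \<and> Q (drop (n - k) w)))"
proof (rule expsmall_mono[OF expsmall_tail_sum[OF assms]], intro always_eventually allI)
 fix n
 let ?I = "{k. k <= n \<and> eta * real n <= real k}"
 have "finite ?I" by (rule finite_subset[of _ "{..n}"]) auto
 have "msum n (%w. \<exists>k. k <= n \<and> eta * real n <= real k \<and> Q (drop (n - k) w)) = msum n (%w. \<exists>k\<in>?I. Q (drop (n - k) w))"
  by (simp add: msum_def Bex_def conj_assoc)
 also have "... <= (\<Sum>k\<in>?I. msum n (%w. Q (drop (n - k) w)))" by (rule msum_ex) fact
 also have "... = (\<Sum>k\<in>?I. msum k Q)" by (intro sum.cong) (auto simp: msum_suffix)
 finally show "msum n (%w. \<exists>k. k <= n \<and> eta * real n <= real k \<and> Q (drop (n - k) w)) <= (\<Sum>k\<in>?I. msum k Q)" .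
qed

definition typical :: "real => 'k list => bool" where
 "typical e w \<longleftrightarrow> \<bar>ln (m w) + h * len w\<bar> <= e * len w \<and>
   \<bar>ln (a1 w) + xs * len w\<bar> <= e * len w \<and>
   \<bar>ln (a2 w) + xss * len w\<bar> <= e * len w"

lemma expsmall_dev:
 assumes "almost_additive S" "AE i in mu. (%n. S (pre i n) / real n) ----> - c" "e > 0"
 shows "expsmall (%n. msum n (%w. \<not> \<bar>S w + c * len w\<bar> <= e * len w))"
proof (rule expsmall_mono[OF expsmall_add[OF large_deviation_upper[OF assms] large_deviation_lower[OF assms]]],
  intro always_eventually allI)
 fix n
 have "msum n (%w. \<not> \<bar>S w + c * len w\<bar> <= e * len w) <=
  msum n (%w. S w > (- c + e) * real n \<or> S w < (- c - e) * real n)"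
  by (rule msum_mono) (auto simp: abs_le_iff algebra_simps)
 also have "... <= msum n (%w. S w > (- c + e) * real n) + msum n (%w. S w < (- c - e) * real n)"
  by (rule msum_disj)
 finally show "msum n (%w. \<not> \<bar>S w + c * len w\<bar> <= e * len w) <=
  (\<Sum>w | w \<in> words n \<and> S w > (- c + e) * real n. m w) + (\<Sum>w | w \<in> words n \<and> S w < (- c - e) * real n. m w)"
  by (simp add: msum_def)
qed

lemma expsmall_typ:
 assumes "e > 0"
 shows "expsmall (%n. msum n (%w. \<not> typical e w))"
proof (rule expsmall_mono[OF expsmall_add[OF expsmall_dev[OF aa_m m_limit assms]
   expsmall_add[OF expsmall_dev[OF aa_a1 a1_limit assms] expsmall_dev[OF aa_a2 a2_limit assms]]]],
  intro always_eventually allI)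
 fix n
 let ?Q = "%S c w. \<not> \<bar>S w + c * len w\<bar> <= e * len w"
 have "msum n (%w. \<not> typical e w) <= msum n (%w. ?Q (%w. ln (m w)) h w \<or> (?Q (%w. ln (a1 w)) xs w \<or> ?Q (%w. ln (a2 w)) xss w))"
  by (rule msum_mono) (auto simp: typical_def)
 thus "msum n (%w. \<not> typical e w) <= msum n (?Q (%w. ln (m w)) h) + (msum n (?Q (%w. ln (a1 w)) xs) + msum n (?Q (%w. ln (a2 w)) xss))"
  using msum_disj[of n "?Q (%w. ln (m w)) h" "%w. ?Q (%w. ln (a1 w)) xs w \<or> ?Q (%w. ln (a2 w)) xss w"]
   msum_disj[of n "?Q (%w. ln (a1 w)) xs" "?Q (%w. ln (a2 w)) xss"] by linarith
qed

lemma typ_bounds: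
 assumes "typical e w"
 shows "m w <= dec (h - e) (length w)" "m w >= dec (h + e) (length w)"
  "a1 w <= dec (xs - e) (length w)" "a1 w >= dec (xs + e) (length w)"
  "a2 w <= dec (xss - e) (length w)" "a2 w >= dec (xss + e) (length w)"
  "tau w <= dec (chi - 2 * e) (length w)" "tau w >= dec (chi + 2 * e) (length w)"
proof -
 have up: "x <= exp (- (c - e) * l)" and lo: "x >= exp (- (c + e) * l)"
  if "\<bar>ln x + c * l\<bar> <= e * l" "x > 0" for x c l
 proof -
  have "ln x <= - (c - e) * l" "- (c + e) * l <= ln x" using that(1) by (auto simp: abs_le_iff algebra_simps)
  hence "exp (ln x) <= exp (- (c - e) * l)" "exp (- (c + e) * l) <= exp (ln x)" by (simp_all only: exp_le_cancel_iff)
  thus "x <= exp (- (c - e) * l)" "x >= exp (- (c + e) * l)" using that(2) by simp_all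
 qed
 have t: "\<bar>ln (m w) + h * len w\<bar> <= e * len w"
  "\<bar>ln (a1 w) + xs * len w\<bar> <= e * len w"
  "\<bar>ln (a2 w) + xss * len w\<bar> <= e * len w"
  using assms by (auto simp: typical_def)
 show "m w <= dec (h - e) (length w)" "m w >= dec (h + e) (length w)"
  by (rule up[OF t(1) m_pos] lo[OF t(1) m_pos])+
 show a: "a1 w <= dec (xs - e) (length w)" "a1 w >= dec (xs + e) (length w)"
  by (rule up[OF t(2) a1_pos] lo[OF t(2) a1_pos])+
 show b: "a2 w <= dec (xss - e) (length w)" "a2 w >= dec (xss + e) (length w)"
  by (rule up[OF t(3) a2_pos] lo[OF t(3) a2_pos])+
 from a b have "a2 w / a1 w <= dec (xss - e) (length w) / dec (xs + e) (length w)"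
   "dec (xss + e) (length w) / dec (xs - e) (length w) <= a2 w / a1 w"
  by (intro frac_le; simp add: less_imp_le)+
 thus "tau w <= dec (chi - 2 * e) (length w)" "tau w >= dec (chi + 2 * e) (length w)"
  by (simp_all add: tau_def chi_def exp_diff[symmetric] algebra_simps)
qed

lemma exists_typ: "e > 0 ==> EV n. \<exists>w. length w = n \<and> typical e w"
proof -
 assume "e > 0"
 from expsmall_tendsto_0[OF expsmall_typ[OF this] msum_nonneg]
 have "EV n. msum n (%w. \<not> typical e w) < 1" by (rule order_tendstoD) simp
 thus ?thesis
 proof eventually_elim
  case (elim n)
  show ?case
  proof (rule ccontr)
   assume "\<not> ?case"
   hence "{w. w \<in> words n \<and> \<not> typical e w} = words n" by auto
   hence "msum n (%w. \<not> typical e w) = 1" unfolding msum_def by simp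
   with elim show False by simp
  qed
 qed
qed

lemma exponent_le_of_bound:
 assumes "\<And>e. e > 0 ==> EV n. dec (c + e) n <= B * dec b n"
 shows "b <= c"
proof (rule ccontr)
 assume "\<not> b <= c"
 hence d: "(b - c) / 2 > 0" by simp
 from assms[OF d] have "EV n. exp ((b - c) / 2 * real n) <= B"
 proof eventually_elim
  case (elim n)
  hence "dec (c + (b - c) / 2) n * exp (b * real n) <= B * dec b n * exp (b * real n)"
   by (intro mult_right_mono) auto
  thus ?case by (simp add: mult.assoc exp_add[symmetric] algebra_simps) (simp add: field_simps)
 qed
 moreover have "filterlim (%n. exp ((b - c) / 2 * real n)) at_top sequentially" using d by real_asymp
 hence "EV n. exp ((b - c) / 2 * real n) > B" by (simp add: filterlim_at_top_dense)
 ultimately have "EV n. False" by eventually_elim linarith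
 thus False by simp
qed

text \<open>Domination bounds \<open>tau\<close> for every word; typical words exist at every large
  length and transfer its rate to the exponents.\<close>

lemma chi_pos: "chi > 0"
proof -
 obtain c \<beta> where c: "c > 0" "\<beta> > 0" "\<And>w. tau w <= c * dec \<beta> (length w)"
  using tau_decay by blast
 have "\<beta> <= chi"
 proof (rule exponent_le_of_bound)
  fix e :: real assume "e > 0"
  hence "e / 2 > 0" by simp
  from exists_typ[OF this] show "EV n. dec (chi + e) n <= c * dec \<beta> n"
  proof eventually_elim
   case (elim n)
   then obtain w where w: "length w = n" "typical (e / 2) w" by blast
   with typ_bounds(8)[OF w(2)] c(3)[of w] show ?case by simp
  qed
 qed
 with c show ?thesis by linarith
qed

definition rho :: real where "rho = Max (range (%k. mnorm (A k)))"

lemma rho: "0 < rho" "rho < 1" "mnorm (A k) <= rho"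
proof -
 show *: "mnorm (A k) <= rho" for k unfolding rho_def by (intro Max_ge) auto
 show "rho < 1" unfolding rho_def by (subst Max_less_iff) (auto simp: contracting)
 show "0 < rho" using *[of undefined] mnorm_gt_0[OF det_A, of undefined] by linarith
qed

lemma a1_le_rho: "a1 w <= rho ^ length w"
proof (induction w)
 case (Cons k w)
 have "a1 (k # w) <= a1 [k] * a1 w" using a1_append_le[of "[k]" w] by simp
 also have "... <= rho * rho ^ length w"
  using Cons rho by (intro mult_mono) (auto simp: a1_def)
 finally show ?case by simp
qed simp

lemma xs_pos: "xs > 0"
proof -
 have "- ln rho <= xs"
 proof (rule exponent_le_of_bound)
  fix e :: real assume "e > 0"
  from exists_typ[OF this] show "EV n. dec (xs + e) n <= 1 * dec (- ln rho) n"
  proof eventually_elim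
   case (elim n)
   then obtain w where w: "length w = n" "typical e w" by blast
   have "rho ^ n = dec (- ln rho) n"
    using rho by (simp add: exp_of_nat2_mult)
   with order_trans[OF typ_bounds(4)[OF w(2)] a1_le_rho[of w]] w(1) show ?case by simp
  qed
 qed
 moreover have "ln rho < 0" using rho by simp
 ultimately show ?thesis by linarith
qed

lemma h_nonneg: "h >= 0"
proof (rule exponent_le_of_bound)
 fix e :: real assume "e > 0"
 from exists_typ[OF this] show "EV n. dec (h + e) n <= 1 * exp (- 0 * real n)"
 proof eventually_elim
  case (elim n)
  then obtain w where w: "length w = n" "typical e w" by blast
  with order_trans[OF typ_bounds(2)[OF w(2)] m_le_1[of w]] show ?case by simp
 qed
qed

lemma xss_pos: "xss > 0"
 using xs_pos chi_pos by (simp_all add: chi_def)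

end


section \<open>Fourier transforms of planar Gaussians and positive definiteness\<close>

lemma gaussian_fourier_1d:
 assumes "gam > 0"
 shows "integrable lborel (%t. exp (- gam * (t + b)^2 / 2))"
  and "(\<integral>t. iexp (t * z) * exp (- gam * (t + b)^2 / 2) \<partial>lborel) =
    complex_of_real (sqrt (2 * pi / gam) * exp (- z\<^sup>2 / (2 * gam))) * iexp (- b * z)"
proof -
 define c where "c = 1 / sqrt gam"
 have c: "c > 0" "c \<noteq> 0" using assms by (simp_all add: c_def)
 have cc: "gam * c^2 = 1" using assms by (simp add: c_def power_divide)
 have aff: "exp (- gam * ((- b + c * x) + b)^2 / 2) = sqrt (2 * pi) * std_normal_density x" for x
 proof -
  have "- gam * ((- b + c * x) + b)^2 / 2 = - (gam * c^2) * x^2 / 2" by (simp add: power_mult_distrib)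
  thus ?thesis unfolding cc by (simp add: std_normal_density_def)
 qed
 have int1: "integrable lborel (%x. sqrt (2 * pi) * std_normal_density x)"
  using integrable_std_normal_moment[of 0] by (intro integrable_mult_right) simp
 show int: "integrable lborel (%t. exp (- gam * (t + b)^2 / 2))"
  using lborel_integrable_real_affine_iff[OF c(2), of "%t. exp (- gam * (t + b)^2 / 2)" "- b"] int1
  unfolding aff by simp
 have char: "(\<integral>x. iexp (z * c * x) * complex_of_real (std_normal_density x) \<partial>lborel) = complex_of_real (exp (- (z * c)\<^sup>2 / 2))"
 proof -
  have "char std_normal_distribution (z * c) = (\<integral>x. std_normal_density x *\<^sub>R iexp (z * c * x) \<partial>lborel)"
   unfolding char_def by (subst integral_density) (auto simp: normal_density_nonneg)
  thus ?thesis by (simp add: char_std_normal_distribution scaleR_conv_of_real mult.commute)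
 qed
 have "(\<integral>t. iexp (t * z) * complex_of_real (exp (- gam * (t + b)^2 / 2)) \<partial>lborel) =
   \<bar>c\<bar> *\<^sub>R (\<integral>x. iexp ((- b + c * x) * z) * complex_of_real (exp (- gam * ((- b + c * x) + b)^2 / 2)) \<partial>lborel)"
  by (rule lborel_integral_real_affine[OF c(2)])
 also have "(\<integral>x. iexp ((- b + c * x) * z) * complex_of_real (exp (- gam * ((- b + c * x) + b)^2 / 2)) \<partial>lborel) =
   (\<integral>x. (complex_of_real (sqrt (2 * pi)) * iexp (- b * z)) * (iexp (z * c * x) * complex_of_real (std_normal_density x)) \<partial>lborel)"
  unfolding aff by (intro b_integral_cong refl) (simp add: exp_add[symmetric] algebra_simps)
 also have "... = (complex_of_real (sqrt (2 * pi)) * iexp (- b * z)) * complex_of_real (exp (- (z * c)\<^sup>2 / 2))"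
  unfolding integral_mult_right_zero char by simp
 also have "\<bar>c\<bar> *\<^sub>R ... = complex_of_real (c * sqrt (2 * pi) * exp (- (z * c)\<^sup>2 / 2)) * iexp (- b * z)"
  using c by (simp add: scaleR_conv_of_real)
 also have "c * sqrt (2 * pi) = sqrt (2 * pi / gam)" by (simp add: c_def real_sqrt_divide)
 also have "- (z * c)\<^sup>2 / 2 = - z\<^sup>2 / (2 * gam)" using assms by (simp add: c_def power_mult_distrib power_divide)
 finally show "(\<integral>t. iexp (t * z) * exp (- gam * (t + b)^2 / 2) \<partial>lborel) =
    complex_of_real (sqrt (2 * pi / gam) * exp (- z\<^sup>2 / (2 * gam))) * iexp (- b * z)" .
qed

definition qform :: "real => real => real => real \<times> real => real" where
 "qform \<alpha> \<beta> gam = (%(s, t). exp (- (\<alpha> * s^2 + 2 * \<beta> * s * t + gam * t^2) / 2))"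

lemma qform_measurable [measurable]: "qform \<alpha> \<beta> gam \<in> borel_measurable borel"
 unfolding qform_def by (simp add: borel_prod[symmetric])

lemma qform_complete:
 assumes "gam > 0"
 shows "qform \<alpha> \<beta> gam (s, t) = exp (- ((\<alpha> * gam - \<beta>\<^sup>2) / gam) * (s + 0)^2 / 2) * exp (- gam * (t + \<beta> * s / gam)^2 / 2)"
proof -
 have "\<alpha> * s^2 + 2 * \<beta> * s * t + gam * t^2 = ((\<alpha> * gam - \<beta>\<^sup>2) / gam) * s^2 + gam * (t + \<beta> * s / gam)^2"
  using assms by (simp add: power2_eq_square field_simps)
 thus ?thesis by (simp add: qform_def exp_add[symmetric] add_divide_distrib)
qed

text \<open>Completing the square in the second variable reduces this to two one-dimensional
  transforms; the resulting exponent is the inverse quadratic form.\<close>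

lemma gaussian_fourier_2d:
 assumes "gam > 0" and D: "\<alpha> * gam - \<beta>\<^sup>2 > 0"
 shows "integrable lborel (qform \<alpha> \<beta> gam)"
  and "(\<integral>xi. cos (fst xi * a + snd xi * b) * qform \<alpha> \<beta> gam xi \<partial>lborel) =
   2 * pi / sqrt (\<alpha> * gam - \<beta>\<^sup>2) * exp (- (gam * a^2 - 2 * \<beta> * a * b + \<alpha> * b^2) / (2 * (\<alpha> * gam - \<beta>\<^sup>2)))"
proof -
 let ?D = "\<alpha> * gam - \<beta>\<^sup>2"
 let ?d = "?D / gam"
 have d: "?d > 0" using assms by simp
 have eq: "qform \<alpha> \<beta> gam (s, t) = exp (- ?d * (s + 0)^2 / 2) * exp (- gam * (t + \<beta> * s / gam)^2 / 2)" for s t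
  by (rule qform_complete[OF \<open>gam > 0\<close>])
 note int_t = gaussian_fourier_1d(1)[OF \<open>gam > 0\<close>] and int_s = gaussian_fourier_1d(1)[OF d, of 0]
 have val_t: "(\<integral>t. exp (- gam * (t + c)^2 / 2) \<partial>lborel) = sqrt (2 * pi / gam)" for c
 proof -
  have "complex_of_real (\<integral>t. exp (- gam * (t + c)^2 / 2) \<partial>lborel) =
   (\<integral>t. iexp (t * 0) * complex_of_real (exp (- gam * (t + c)^2 / 2)) \<partial>lborel)"
   unfolding integral_complex_of_real[symmetric] by (simp del: of_real_exp)
  also have "... = complex_of_real (sqrt (2 * pi / gam))"
   unfolding gaussian_fourier_1d(2)[OF \<open>gam > 0\<close>, of 0 c] by simp
  finally show ?thesis by (simp only: of_real_eq_iff)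
 qed
 have "integrable (lborel \<Otimes>\<^sub>M lborel) (qform \<alpha> \<beta> gam)"
 proof (rule lborel_pair.Fubini_integrable)
  show "qform \<alpha> \<beta> gam \<in> borel_measurable (lborel \<Otimes>\<^sub>M lborel)"
   unfolding lborel_prod by simp
  have "(\<integral>t. norm (qform \<alpha> \<beta> gam (s, t)) \<partial>lborel) = exp (- ?d * (s + 0)^2 / 2) * sqrt (2 * pi / gam)" for s
  proof -
   have "(\<integral>t. norm (qform \<alpha> \<beta> gam (s, t)) \<partial>lborel) = (\<integral>t. exp (- ?d * (s + 0)^2 / 2) * exp (- gam * (t + \<beta> * s / gam)^2 / 2) \<partial>lborel)"
    unfolding eq by simp
   thus ?thesis unfolding integral_mult_right_zero val_t .
  qed
  thus "integrable lborel (%s. \<integral>t. norm (qform \<alpha> \<beta> gam (s, t)) \<partial>lborel)"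
   using integrable_mult_left[OF int_s, of "sqrt (2 * pi / gam)"] by simp
  show "AE s in lborel. integrable lborel (%t. qform \<alpha> \<beta> gam (s, t))"
   unfolding eq by (intro AE_I2 integrable_mult_right int_t)
 qed
 thus int: "integrable lborel (qform \<alpha> \<beta> gam)" by (simp add: lborel_prod)
 define F where "F xi = iexp (fst xi * a + snd xi * b) * complex_of_real (qform \<alpha> \<beta> gam xi)" for xi
 have Fm: "F \<in> borel_measurable borel"
  unfolding F_def by (intro borel_measurable_times measurable_compose[OF qform_measurable] borel_measurable_continuous_onI continuous_intros)
 have F: "integrable lborel F"
  by (rule Bochner_Integration.integrable_bound[OF int]) (use Fm in \<open>auto simp: F_def norm_mult qform_def\<close>)
 have "(\<integral>xi. F xi \<partial>lborel) = (\<integral>s. \<integral>t. F (s, t) \<partial>lborel \<partial>lborel)"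
  using lborel_pair.integral_fst'[where f = F] F by (simp add: lborel_prod)
 also have "... = (\<integral>s. complex_of_real (sqrt (2 * pi / gam) * exp (- b\<^sup>2 / (2 * gam))) *
   (iexp (s * (a - \<beta> * b / gam)) * complex_of_real (exp (- ?d * (s + 0)^2 / 2))) \<partial>lborel)"
 proof (intro b_integral_cong refl)
  fix s
  have "(\<integral>t. F (s, t) \<partial>lborel) = (\<integral>t. (iexp (s * a) * complex_of_real (exp (- ?d * (s + 0)^2 / 2))) *
   (iexp (t * b) * complex_of_real (exp (- gam * (t + \<beta> * s / gam)^2 / 2))) \<partial>lborel)"
  proof (intro b_integral_cong refl)
   fix t
   have "iexp (s * a + t * b) = iexp (s * a) * iexp (t * b)" by (simp add: exp_add[symmetric] distrib_left)
   thus "F (s, t) = (iexp (s * a) * complex_of_real (exp (- ?d * (s + 0)^2 / 2))) *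
    (iexp (t * b) * complex_of_real (exp (- gam * (t + \<beta> * s / gam)^2 / 2)))"
    unfolding F_def eq of_real_mult fst_conv snd_conv by (simp only: mult_ac)
  qed
  also have "... = (iexp (s * a) * complex_of_real (exp (- ?d * (s + 0)^2 / 2))) *
   (complex_of_real (sqrt (2 * pi / gam) * exp (- b\<^sup>2 / (2 * gam))) * iexp (- (\<beta> * s / gam) * b))"
   unfolding integral_mult_right_zero gaussian_fourier_1d(2)[OF \<open>gam > 0\<close>] ..
  also have "... = complex_of_real (sqrt (2 * pi / gam) * exp (- b\<^sup>2 / (2 * gam))) *
   ((iexp (s * a) * iexp (- (\<beta> * s / gam) * b)) * complex_of_real (exp (- ?d * (s + 0)^2 / 2)))" by (simp only: mult_ac)
  also have "iexp (s * a) * iexp (- (\<beta> * s / gam) * b) = iexp (s * (a - \<beta> * b / gam))"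
   by (simp add: exp_add[symmetric] algebra_simps)
  finally show "(\<integral>t. F (s, t) \<partial>lborel) = complex_of_real (sqrt (2 * pi / gam) * exp (- b\<^sup>2 / (2 * gam))) *
   (iexp (s * (a - \<beta> * b / gam)) * complex_of_real (exp (- ?d * (s + 0)^2 / 2)))" .
 qed
 also have "... = complex_of_real (sqrt (2 * pi / gam) * exp (- b\<^sup>2 / (2 * gam))) *
   (complex_of_real (sqrt (2 * pi / ?d) * exp (- (a - \<beta> * b / gam)\<^sup>2 / (2 * ?d))) * iexp (- 0 * (a - \<beta> * b / gam)))"
  unfolding integral_mult_right_zero gaussian_fourier_1d(2)[OF d] ..
 also have "... = complex_of_real ((sqrt (2 * pi / gam) * sqrt (2 * pi / ?d)) * (exp (- b\<^sup>2 / (2 * gam)) * exp (- (a - \<beta> * b / gam)\<^sup>2 / (2 * ?d))))"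
  by simp
 also have "sqrt (2 * pi / gam) * sqrt (2 * pi / ?d) = 2 * pi / sqrt ?D"
 proof -
  have "2 * pi / gam * (2 * pi / ?d) = (2 * pi)^2 / ?D" using assms by (simp add: power2_eq_square)
  hence "sqrt (2 * pi / gam * (2 * pi / ?d)) = sqrt ((2 * pi)^2 / ?D)" by simp
  also have "... = \<bar>2 * pi\<bar> / sqrt ?D" by (simp only: real_sqrt_divide real_sqrt_abs)
  finally have "sqrt (2 * pi / gam) * sqrt (2 * pi / ?d) = \<bar>2 * pi\<bar> / sqrt ?D" by (simp only: real_sqrt_mult)
  thus ?thesis by simp
 qed
 also have "exp (- b\<^sup>2 / (2 * gam)) * exp (- (a - \<beta> * b / gam)\<^sup>2 / (2 * ?d)) =
   exp (- (gam * a^2 - 2 * \<beta> * a * b + \<alpha> * b^2) / (2 * ?D))"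
 proof -
  have "- b\<^sup>2 / (2 * gam) + - (a - \<beta> * b / gam)\<^sup>2 / (2 * ?d) = - (gam * a^2 - 2 * \<beta> * a * b + \<alpha> * b^2) / (2 * ?D)"
   using assms by (simp add: power2_eq_square divide_simps) (simp add: algebra_simps)
  thus ?thesis by (simp only: exp_add[symmetric])
 qed
 finally have "Re (\<integral>xi. F xi \<partial>lborel) = 2 * pi / sqrt ?D * exp (- (gam * a^2 - 2 * \<beta> * a * b + \<alpha> * b^2) / (2 * ?D))"
  by simp
 moreover have "Re (\<integral>xi. F xi \<partial>lborel) = (\<integral>xi. Re (F xi) \<partial>lborel)"
  using F by (simp add: integral_Re)
 moreover have "Re (F xi) = cos (fst xi * a + snd xi * b) * qform \<alpha> \<beta> gam xi" for xi
  by (simp add: F_def Re_exp)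
 ultimately show "(\<integral>xi. cos (fst xi * a + snd xi * b) * qform \<alpha> \<beta> gam xi \<partial>lborel) =
   2 * pi / sqrt ?D * exp (- (gam * a^2 - 2 * \<beta> * a * b + \<alpha> * b^2) / (2 * ?D))" by simp
qed

text \<open>After exchanging the integrals, the integral over both copies of \<open>eta\<close> is
  the squared modulus of the Fourier transform of \<open>eta\<close>, by the addition formula for
  the cosine.\<close>

lemma positive_definite_kernel:
 fixes eta :: "(real^2) measure" and g :: "real \<times> real => real"
 assumes "finite_measure eta" and s: "sets eta = sets borel"
  and g: "integrable lborel g" "\<And>xi. g xi >= 0"
 shows "0 <= (\<integral>q. (\<integral>xi. cos (fst xi * (fst q - snd q) $ 1 + snd xi * (fst q - snd q) $ 2) * g xi \<partial>lborel) \<partial>(eta \<Otimes>\<^sub>M eta))"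
proof -
 interpret E: finite_measure eta by fact
 interpret EE: pair_sigma_finite eta eta ..
 interpret F: finite_measure "eta \<Otimes>\<^sub>M eta" by (rule finite_measure_pair_measure) fact+
 interpret S: sigma_finite_measure "lborel :: (real \<times> real) measure" by (rule sigma_finite_lborel)
 interpret SE: pair_sigma_finite "lborel :: (real \<times> real) measure" "eta \<Otimes>\<^sub>M eta" ..
 have sf: "sigma_finite_measure (eta \<Otimes>\<^sub>M eta)" ..
 have ss: "sets (eta \<Otimes>\<^sub>M eta) = sets (borel :: ((real^2) \<times> (real^2)) measure)"
  using sets_pair_measure_cong[OF s s] unfolding borel_prod .
 have sss: "sets (lborel \<Otimes>\<^sub>M (eta \<Otimes>\<^sub>M eta)) = sets (borel :: ((real \<times> real) \<times> ((real^2) \<times> (real^2))) measure)"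
  using sets_pair_measure_cong[OF sets_lborel ss] unfolding borel_prod .
 note mb = measurable_cong_sets[OF s refl] measurable_cong_sets[OF ss refl] measurable_cong_sets[OF sss refl]
 define ph where "ph xi q = fst xi * (fst q - snd q) $ 1 + snd xi * (fst q - snd q) $ 2"
  for xi :: "real \<times> real" and q :: "(real^2) \<times> (real^2)"
 have gm: "g \<in> borel_measurable borel" using g(1) by (auto dest: borel_measurable_integrable)
 have "continuous_on UNIV (%p. cos (ph (fst p) (snd p)))"
  unfolding ph_def by (intro continuous_intros)
 hence Hm: "(%p. cos (ph (fst p) (snd p)) * g (fst p)) \<in> borel_measurable borel"
  by (intro borel_measurable_times borel_measurable_continuous_onI measurable_compose[OF _ gm] borel_measurable_continuous_onI[OF continuous_on_fst[OF continuous_on_id]])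
 have cm: "(%q. cos (ph xi q)) \<in> borel_measurable borel" for xi
  unfolding ph_def by (intro borel_measurable_continuous_onI continuous_intros)
 have int: "integrable (lborel \<Otimes>\<^sub>M (eta \<Otimes>\<^sub>M eta)) (%(xi, q). cos (ph xi q) * g xi)"
 proof (rule SE.Fubini_integrable)
  show m: "(%(xi, q). cos (ph xi q) * g xi) \<in> borel_measurable (lborel \<Otimes>\<^sub>M (eta \<Otimes>\<^sub>M eta))"
   using Hm by (simp add: case_prod_unfold mb)
  have i1: "integrable (eta \<Otimes>\<^sub>M eta) (%q. cos (ph xi q))" for xi
   using cm by (intro F.integrable_const_bound[of _ 1]) (auto simp: mb)
  thus "AE xi in lborel. integrable (eta \<Otimes>\<^sub>M eta) (%q. case (xi, q) of (xi, q) => cos (ph xi q) * g xi)"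
   by (intro AE_I2) simp
  let ?M = "measure (eta \<Otimes>\<^sub>M eta) (space (eta \<Otimes>\<^sub>M eta))"
  show "integrable lborel (%xi. \<integral>q. norm (case (xi, q) of (xi, q) => cos (ph xi q) * g xi) \<partial>(eta \<Otimes>\<^sub>M eta))"
  proof (rule Bochner_Integration.integrable_bound[OF integrable_mult_right[OF g(1), of ?M]])
   show "(%xi. \<integral>q. norm (case (xi, q) of (xi, q) => cos (ph xi q) * g xi) \<partial>(eta \<Otimes>\<^sub>M eta)) \<in> borel_measurable lborel"
    using m by (intro sigma_finite_measure.borel_measurable_lebesgue_integral[OF sf]) (simp add: case_prod_unfold)
   show "AE xi in lborel. norm (\<integral>q. norm (case (xi, q) of (xi, q) => cos (ph xi q) * g xi) \<partial>(eta \<Otimes>\<^sub>M eta)) <= norm (?M * g xi)"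
   proof (intro AE_I2)
    fix xi
    have "(\<integral>q. norm (cos (ph xi q) * g xi) \<partial>(eta \<Otimes>\<^sub>M eta)) <= (\<integral>q. g xi \<partial>(eta \<Otimes>\<^sub>M eta))"
     using i1 g(2)[of xi] by (intro integral_mono integrable_norm integrable_mult_left) (auto simp: abs_mult mult_left_le_one_le)
    thus "norm (\<integral>q. norm (case (xi, q) of (xi, q) => cos (ph xi q) * g xi) \<partial>(eta \<Otimes>\<^sub>M eta)) <= norm (?M * g xi)"
     using g(2)[of xi] by (simp add: integral_nonneg_AE)
   qed
  qed
 qed
 have inner: "0 <= (\<integral>q. cos (ph xi q) \<partial>(eta \<Otimes>\<^sub>M eta))" for xi
 proof -
  define c s' where "c x = cos (fst xi * x $ 1 + snd xi * x $ 2)" and "s' x = sin (fst xi * x $ 1 + snd xi * x $ 2)" for x :: "real^2"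
  have cs: "integrable eta c" "integrable eta s'"
   unfolding c_def s'_def
   by (auto intro!: E.integrable_const_bound[of _ 1] borel_measurable_continuous_onI continuous_intros simp: mb)
  have "integrable (eta \<Otimes>\<^sub>M eta) (%(x, y). cos (ph xi (x, y)))"
   using cm by (intro F.integrable_const_bound[of _ 1]) (auto simp: mb case_prod_unfold)
  from EE.integral_fst[OF this]
  have "(\<integral>q. cos (ph xi q) \<partial>(eta \<Otimes>\<^sub>M eta)) = (\<integral>x. \<integral>y. cos (ph xi (x, y)) \<partial>eta \<partial>eta)" by (simp add: case_prod_unfold)
  also have "... = (\<integral>x. \<integral>y. c x * c y + s' x * s' y \<partial>eta \<partial>eta)"
   unfolding c_def s'_def cos_diff[symmetric] ph_def by (simp add: algebra_simps)
  also have "... = (\<integral>x. c x * (\<integral>y. c y \<partial>eta) + s' x * (\<integral>y. s' y \<partial>eta) \<partial>eta)" using cs by simp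
  also have "... = (\<integral>y. c y \<partial>eta) * (\<integral>y. c y \<partial>eta) + (\<integral>y. s' y \<partial>eta) * (\<integral>y. s' y \<partial>eta)" using cs by simp
  finally show ?thesis by simp
 qed
 have "0 <= (\<integral>xi. (\<integral>q. cos (ph xi q) \<partial>(eta \<Otimes>\<^sub>M eta)) * g xi \<partial>lborel)"
  using inner g(2) by (intro integral_nonneg_AE AE_I2) auto
 also have "... = (\<integral>xi. (\<integral>q. cos (ph xi q) * g xi \<partial>(eta \<Otimes>\<^sub>M eta)) \<partial>lborel)" by simp
 also have "... = (\<integral>q. (\<integral>xi. cos (ph xi q) * g xi \<partial>lborel) \<partial>(eta \<Otimes>\<^sub>M eta))"
  using SE.Fubini_integral[OF int] by simp
 finally show ?thesis unfolding ph_def .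
qed


section \<open>Averaged tube estimates of Kaufman and Falconer\<close>

abbreviation gj where "gj j \<equiv> exp (- (real j)\<^sup>2 / 4)"
abbreviation gk where "gk k z \<equiv> exp (- (2 ^ k * norm (z :: real^2))\<^sup>2 / 4)"
abbreviation cosp where "cosp xi z \<equiv> cos (fst xi * (z :: real^2) $ 1 + snd xi * z $ 2)"

text \<open>The constant left when a Gaussian is cut into unit layers and layer \<open>j\<close>
  carries mass of order \<open>(j + 1) powr d\<close>.\<close>

definition psm :: "real => real" where
 "psm d = (\<Sum>j. gj j * (real j + 1) powr d)"

lemma psm_summable: "summable (%j. gj j * (real j + 1) powr d)"
proof (rule summable_comparison_test_ev)
 show "EV j. norm (gj j * (real j + 1) powr d) <= exp (- 1) ^ j"
 proof -
  have "EV j. gj j * (real j + 1) powr d <= exp (- real j)"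
   by real_asymp
  thus ?thesis by eventually_elim (simp add: exp_of_nat_mult[symmetric])
 qed
 show "summable (%j. exp (- 1 :: real) ^ j)" by (intro summable_geometric) simp
qed

lemma psm_ge: "(\<Sum>j<N. gj j * (real j + 1) powr d) <= psm d"
 unfolding psm_def by (intro sum_le_suminf psm_summable) auto

lemma psm_pos: "psm d > 0"
 using psm_ge[where N = 1] by (auto intro: less_le_trans[OF zero_less_one])

lemma gaussian_layers:
 assumes "\<bar>x\<bar> < real N"
 shows "exp (- x\<^sup>2 / 4) <= (\<Sum>j<N. if \<bar>x\<bar> <= real j + 1 then gj j else 0)"
proof -
 define j where "j = nat \<lfloor>\<bar>x\<bar>\<rfloor>"
 have j: "real j <= \<bar>x\<bar>" "\<bar>x\<bar> < real j + 1" by (auto simp: j_def)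
 have "j < N" using assms j(1) by linarith
 have "(real j)^2 <= x^2" using j(1) by (metis abs_of_nonneg of_nat_0_le_iff power2_abs power_mono)
 hence "exp (- x\<^sup>2 / 4) <= (if \<bar>x\<bar> <= real j + 1 then gj j else 0)" using j by simp
 also have "... <= (\<Sum>j<N. if \<bar>x\<bar> <= real j + 1 then gj j else 0)"
  using \<open>j < N\<close> by (intro member_le_sum) auto
 finally show ?thesis .
qed

text \<open>A Frostman bound of exponent \<open>s\<close> for weighted directions, down to the scale
  \<open>rho\<close> only, since a fixed word length resolves directions no further;
  \<open>ball_mass\<close> is its counterpart for a measure in the plane.\<close>

locale direction_mass =
 fixes J :: "'i set" and c :: "'i => real" and v :: "'i => real^2" and rho L s :: real
 assumes fin: "finite J" and c0: "\<And>w. w \<in> J ==> c w >= 0" and v1: "\<And>w. w \<in> J ==> norm (v w) = 1"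
  and rho: "0 < rho" "rho <= 1" and s: "0 <= s" and L: "L >= 0"
  and mass: "\<And>th r. norm th = 1 ==> r >= rho ==> (\<Sum>w | w \<in> J \<and> \<bar>wedge (v w) th\<bar> <= r. c w) <= L * r powr s"
begin

lemma total_mass: "(\<Sum>w\<in>J. c w) <= L"
proof -
 define th :: "real^2" where "th = axis 1 1"
 have th: "norm th = 1" by (simp add: th_def norm_axis_1)
 have "\<bar>wedge (v w) th\<bar> <= 1" if "w \<in> J" for w
  using wedge_le[of "v w" th] v1[OF that] th by simp
 hence "{w. w \<in> J \<and> \<bar>wedge (v w) th\<bar> <= 1} = J" by auto
 with th show ?thesis using mass[of th 1] rho by simp
qed

text \<open>A Gaussian in the component along \<open>(a, b)\<close> sees the directions within about
  \<open>1 / R\<close> of the line orthogonal to \<open>(a, b)\<close>; the maximum cuts this angle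
  off at \<open>rho\<close>, where the mass bound ends.\<close>

lemma gaussian_mass:
 "(\<Sum>w\<in>J. c w * exp (- (a * v w $ 1 + b * v w $ 2)\<^sup>2 / 4)) <=
   psm s * L * (max rho (1 / max 1 (sqrt (a^2 + b^2)))) powr s"
proof -
 define R where "R = sqrt (a^2 + b^2)"
 define M where "M = max rho (1 / max 1 R)"
 have M: "M > 0" "M >= rho" using rho by (auto simp: M_def)
 define x where "x w = a * v w $ 1 + b * v w $ 2" for w
 obtain N :: nat where N: "\<And>w. w \<in> J ==> \<bar>x w\<bar> < real N"
 proof -
  obtain N :: nat where "Max (insert 0 ((%w. \<bar>x w\<bar>) ` J)) < real N" using reals_Archimedean2 by blast
  thus ?thesis using fin by (intro that[of N]) auto
 qed
 have layer: "(\<Sum>w | w \<in> J \<and> \<bar>x w\<bar> <= real j + 1. c w) <= L * ((real j + 1) powr s * M powr s)" for j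
 proof (cases "R <= 1")
  case True
  hence "M = 1" using rho by (simp add: M_def)
  have "(\<Sum>w | w \<in> J \<and> \<bar>x w\<bar> <= real j + 1. c w) <= (\<Sum>w\<in>J. c w)"
   using fin c0 by (intro sum_mono2) auto
  also have "... <= L * 1" using total_mass by simp
  also have "... <= L * (real j + 1) powr s" using s L by (intro mult_left_mono ge_one_powr_ge_zero) auto
  finally show ?thesis using \<open>M = 1\<close> by simp
 next
  case False
  define th :: "real^2" where "th = (\<chi> i. if i = 1 then - b / R else a / R)"
  have R0: "R > 0" using False by simp
  have R2: "R^2 = a^2 + b^2" by (simp add: R_def)
  have "norm th = 1"
   using R0 by (simp add: th_def norm_vec2 power_divide add_divide_distrib[symmetric] add.commute R2[symmetric])
  have "wedge (v w) th = x w / R" for w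
   by (simp add: wedge_def th_def x_def add_divide_distrib mult.commute)
  hence "{w. w \<in> J \<and> \<bar>x w\<bar> <= real j + 1} \<subseteq> {w. w \<in> J \<and> \<bar>wedge (v w) th\<bar> <= (real j + 1) * M}"
  proof (intro Collect_mono impI conjI; elim conjE)
   fix w assume w: "w \<in> J" "\<bar>x w\<bar> <= real j + 1" and eq: "\<And>w. wedge (v w) th = x w / R"
   have "\<bar>wedge (v w) th\<bar> <= (real j + 1) * (1 / R)" unfolding eq using w R0 by (simp add: abs_divide divide_right_mono)
   also have "... <= (real j + 1) * M" using False by (intro mult_left_mono) (auto simp: M_def)
   finally show "\<bar>wedge (v w) th\<bar> <= (real j + 1) * M" .
  qed
  hence "(\<Sum>w | w \<in> J \<and> \<bar>x w\<bar> <= real j + 1. c w) <= (\<Sum>w | w \<in> J \<and> \<bar>wedge (v w) th\<bar> <= (real j + 1) * M. c w)"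
   using fin c0 by (intro sum_mono2) auto
  also have "... <= L * ((real j + 1) * M) powr s"
  proof (rule mass)
   have "1 * rho <= (real j + 1) * M" using M rho by (intro mult_mono) auto
   thus "rho <= (real j + 1) * M" by simp
  qed fact
  also have "((real j + 1) * M) powr s = (real j + 1) powr s * M powr s" by (rule powr_mult)
  finally show ?thesis .
 qed
 have "(\<Sum>w\<in>J. c w * exp (- (x w)\<^sup>2 / 4)) <=
   (\<Sum>w\<in>J. c w * (\<Sum>j<N. if \<bar>x w\<bar> <= real j + 1 then gj j else 0))"
  by (intro sum_mono mult_left_mono gaussian_layers N c0)
 also have "... = (\<Sum>j<N. \<Sum>w\<in>J. if \<bar>x w\<bar> <= real j + 1 then gj j * c w else 0)"
  unfolding sum_distrib_left by (subst sum.swap) (intro sum.cong refl, simp)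
 also have "... = (\<Sum>j<N. gj j * (\<Sum>w | w \<in> J \<and> \<bar>x w\<bar> <= real j + 1. c w))"
  using fin by (simp add: sum_distrib_left sum.inter_filter[symmetric])
 also have "... <= (\<Sum>j<N. gj j * (L * ((real j + 1) powr s * M powr s)))"
  by (intro sum_mono mult_left_mono layer) auto
 also have "... = (\<Sum>j<N. gj j * (real j + 1) powr s) * (L * M powr s)"
  unfolding sum_distrib_right by (intro sum.cong refl) (simp only: mult_ac)
 also have "... <= psm s * (L * M powr s)" using L by (intro mult_right_mono psm_ge) auto
 finally show ?thesis by (simp add: x_def M_def R_def mult_ac)
qed

end

locale ball_mass =
 fixes eta :: "(real^2) measure" and rho R D d :: real
 assumes fin_eta: "finite_measure eta" and sets_eta: "sets eta = sets borel"
  and rho0: "0 < rho" "rho <= 1" and d0: "0 <= d" and D0: "D >= 0" and R0: "R > 0"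
  and mass1: "measure eta UNIV <= 1"
  and supp: "AE x in eta. norm x <= R"
  and ball: "\<And>x r. r >= rho ==> measure eta (cball x r) <= D * r powr d"
begin

sublocale E: finite_measure eta by (rule fin_eta)

lemma space_eta [simp]: "space eta = UNIV"
 using sets_eq_imp_space_eq[OF sets_eta] by simp

lemma borel_eta: "borel_measurable eta = (borel_measurable borel :: (real^2 => real) set)"
 by (rule measurable_cong_sets[OF sets_eta refl])

lemma ball_energy:
 assumes k: "2 ^ k * rho <= 4" and x: "norm x <= R"
 shows "(\<integral>y. gk k (x - y) \<partial>eta) <= psm d * D * 4 powr d * (1 / 2 ^ k) powr d"
proof -
 let ?S = "%j. {y. 2 ^ k * norm (x - y) <= real j + 1}"
 obtain N :: nat where N: "2 ^ k * (2 * R) < real N" using reals_Archimedean2 by blast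
 have cb: "measure eta (?S j) <= D * ((real j + 1) powr d * (4 powr d * (1 / 2 ^ k) powr d))" for j
 proof -
  have r: "rho <= (real j + 1) * (4 * (1 / 2 ^ k))"
  proof -
   have "rho <= 1 * (4 * (1 / 2 ^ k))" using k by (simp add: field_simps)
   also have "... <= (real j + 1) * (4 * (1 / 2 ^ k))" by (intro mult_right_mono) auto
   finally show ?thesis .
  qed
  have "(?S j) \<subseteq> cball x ((real j + 1) * (4 * (1 / 2 ^ k)))"
  proof
   fix y assume "y \<in> (?S j)"
   hence "norm (x - y) <= (real j + 1) * (1 / 2 ^ k)" by (simp add: field_simps)
   also have "... <= (real j + 1) * (4 * (1 / 2 ^ k))" by (intro mult_left_mono) (auto simp: divide_right_mono)
   finally show "y \<in> cball x ((real j + 1) * (4 * (1 / 2 ^ k)))" by (simp add: dist_norm)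
  qed
  hence "measure eta (?S j) <= measure eta (cball x ((real j + 1) * (4 * (1 / 2 ^ k))))"
   by (intro E.finite_measure_mono) (simp_all add: sets_eta)
  also have "... <= D * ((real j + 1) * (4 * (1 / 2 ^ k))) powr d" by (rule ball[OF r])
  also have "((real j + 1) * (4 * (1 / 2 ^ k))) powr d = (real j + 1) powr d * (4 powr d * (1 / 2 ^ k) powr d)"
   by (simp only: powr_mult)
  finally show ?thesis .
 qed
 have meas: "(?S j) \<in> sets eta" for j
 proof -
  have "closed (?S j)" by (intro closed_Collect_le continuous_intros)
  thus ?thesis by (simp add: sets_eta)
 qed
 have ind: "(if \<bar>2 ^ k * norm (x - y)\<bar> <= real j + 1 then gj j else 0) =
   gj j * indicator (?S j) y" for y j by auto
 have int: "integrable eta (%y. gk k (x - y))"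
  by (rule E.integrable_const_bound[of _ 1]) (auto simp: borel_eta intro!: borel_measurable_continuous_onI continuous_intros)
 have int2: "integrable eta (%y. gj j * indicator (?S j) y)" for j
  using meas by (intro integrable_mult_right) (simp add: E.emeasure_eq_measure)
 have "(\<integral>y. gk k (x - y) \<partial>eta) <=
  (\<integral>y. (\<Sum>j<N. gj j * indicator (?S j) y) \<partial>eta)"
 proof (rule integral_mono_AE[OF int])
  show "integrable eta (%y. \<Sum>j<N. gj j * indicator (?S j) y)"
   using int2 by (intro b_integrable_sum)
  show "AE y in eta. gk k (x - y) <=
   (\<Sum>j<N. gj j * indicator (?S j) y)"
   using supp
  proof eventually_elim
   case (elim y)
   have "norm (x - y) <= 2 * R" using norm_triangle_ineq4[of x y] x elim by linarith
   hence "2 ^ k * norm (x - y) <= 2 ^ k * (2 * R)" by (intro mult_left_mono) auto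
   hence "\<bar>2 ^ k * norm (x - y)\<bar> < real N" using N by (simp only: abs_mult abs_norm_cancel power_abs abs_numeral)
   from gaussian_layers[OF this] show ?case unfolding ind .
  qed
 qed
 also have "... = (\<Sum>j<N. gj j * measure eta (?S j))"
  using int2 meas by (subst b_integral_sum) auto
 also have "... <= (\<Sum>j<N. gj j * (D * ((real j + 1) powr d * (4 powr d * (1 / 2 ^ k) powr d))))"
  by (intro sum_mono mult_left_mono cb) auto
 also have "... = (\<Sum>j<N. gj j * (real j + 1) powr d) * (D * 4 powr d * (1 / 2 ^ k) powr d)"
  unfolding sum_distrib_right by (intro sum.cong refl) (simp only: mult_ac)
 also have "... <= psm d * (D * 4 powr d * (1 / 2 ^ k) powr d)"
  using D0 by (intro mult_right_mono psm_ge) auto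
 finally show ?thesis by (simp add: mult_ac)
qed

end

locale slices = direction_mass + ball_mass
begin

abbreviation tube :: "'a => ((real^2) \<times> (real^2)) set" where
 "tube w \<equiv> {q. \<bar>wedge (v w) (fst q - snd q)\<bar> <= rho}"
abbreviation slice where "slice w x \<equiv> {y. \<bar>wedge (v w) (x - y)\<bar> <= rho}"
abbreviation eta2 where "eta2 \<equiv> eta \<Otimes>\<^sub>M eta"

interpretation EE: pair_sigma_finite eta eta ..

interpretation F: finite_measure eta2
 by (rule finite_measure_pair_measure) (rule fin_eta)+

lemma sets_pair: "sets eta2 = sets (borel :: ((real^2) \<times> (real^2)) measure)"
 using sets_pair_measure_cong[OF sets_eta sets_eta] unfolding borel_prod .

lemma borel_pair: "borel_measurable eta2 = (borel_measurable borel :: ((real^2) \<times> (real^2) => real) set)"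
 by (rule measurable_cong_sets[OF sets_pair refl])

lemma tube_sets: "tube w \<in> sets eta2"
proof -
 have "closed (tube w)" unfolding wedge_def by (intro closed_Collect_le continuous_intros)
 thus ?thesis by (simp add: sets_pair)
qed

lemma supp_pair: "AE q in eta2. norm (fst q) <= R \<and> norm (snd q) <= R"
proof -
 have "AE x in eta. AE y in eta. norm (fst (x, y)) <= R \<and> norm (snd (x, y)) <= R"
  using supp by (auto elim!: eventually_mono)
 moreover have "closed {q :: (real^2) \<times> (real^2). norm (fst q) <= R \<and> norm (snd q) <= R}"
  by (intro closed_Collect_conj closed_Collect_le continuous_intros)
 hence "{q \<in> space eta2. norm (fst q) <= R \<and> norm (snd q) <= R} \<in> sets eta2"
  by (simp add: sets_pair space_pair_measure)
 ultimately show ?thesis by (intro EE.AE_pair_measure) auto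
qed

lemma energy_pair:
 assumes k: "2 ^ k * rho <= 4"
 shows "(\<integral>q. gk k (fst q - snd q) \<partial>eta2) <= psm d * D * 4 powr d * (1 / 2 ^ k) powr d"
  and "integrable eta2 (%q. gk k (fst q - snd q))"
proof -
 let ?B = "psm d * D * 4 powr d * (1 / 2 ^ k) powr d"
 have B0: "?B >= 0" using psm_pos[of d] D0 by auto
 show int: "integrable eta2 (%q. gk k (fst q - snd q))"
  by (rule F.integrable_const_bound[of _ 1]) (auto simp: borel_pair intro!: borel_measurable_continuous_onI continuous_intros)
 have "(\<integral>q. gk k (fst q - snd q) \<partial>eta2) =
   (\<integral>x. \<integral>y. gk k (x - y) \<partial>eta \<partial>eta)"
  using EE.integral_fst'[OF int] by simp
 also have "... <= (\<integral>x. ?B \<partial>eta)"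
 proof (rule integral_mono_AE)
  show "integrable eta (%x. \<integral>y. gk k (x - y) \<partial>eta)"
   using EE.integrable_fst'[OF int] by simp
  show "AE x in eta. (\<integral>y. gk k (x - y) \<partial>eta) <= ?B"
   using supp by eventually_elim (rule ball_energy[OF k])
 qed auto
 also have "... <= ?B" using mass1 B0 mult_right_mono[OF mass1, of ?B] by simp
 finally show "(\<integral>q. gk k (fst q - snd q) \<partial>eta2) <= ?B" .
qed

lemma section_sets: "(slice w x) \<in> sets eta"
proof -
 have "closed (slice w x)" unfolding wedge_def by (intro closed_Collect_le continuous_intros)
 thus ?thesis by (simp add: sets_eta)
qed

lemma tube_fubini:
 shows "integrable eta (%x. measure eta (slice w x))"
  and "measure eta2 (tube w) = (\<integral>x. measure eta (slice w x) \<partial>eta)"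
proof -
 have ti: "integrable eta2 (indicator (tube w) :: _ => real)"
  using tube_sets[of w] by (simp add: F.emeasure_eq_measure)
 have sect: "(\<integral>y. indicator (tube w) (x, y) \<partial>eta) = measure eta (slice w x)" for x
 proof -
  have "indicator (tube w) (x, y) = (indicator (slice w x) y :: real)" for y
   by (simp add: indicator_def)
  thus ?thesis using section_sets[of w x] by simp
 qed
 show "measure eta2 (tube w) = (\<integral>x. measure eta (slice w x) \<partial>eta)"
  using EE.integral_fst'[OF ti] tube_sets[of w] unfolding sect by simp
 show "integrable eta (%x. measure eta (slice w x))"
  using EE.integrable_fst'[OF ti] unfolding sect .
qed

lemma tube_markov:
 assumes "a > 0"
 shows "{x. a <= measure eta (slice w x)} \<in> sets borel"
  and "measure eta {x. a <= measure eta (slice w x)} <= measure eta2 (tube w) / a"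
proof -
 have "(%x. measure eta (slice w x)) \<in> borel_measurable borel"
  using borel_measurable_integrable[OF tube_fubini(1)] unfolding borel_eta .
 thus "{x. a <= measure eta (slice w x)} \<in> sets borel" by measurable
 show "measure eta {x. a <= measure eta (slice w x)} <= measure eta2 (tube w) / a"
  using integral_Markov_inequality_measure[OF tube_fubini(1)[of w], of "{}" a] assms by (simp add: tube_fubini(2))
qed

lemma energy_le:
 "(\<Sum>w\<in>J. c w * measure eta2 (tube w)) <= U"
 if "\<And>x. norm x <= R ==> (\<Sum>w\<in>J. c w * measure eta (slice w x)) <= U" "U >= 0" for U
proof -
 have "(\<Sum>w\<in>J. c w * measure eta2 (tube w)) = (\<integral>x. (\<Sum>w\<in>J. c w * measure eta (slice w x)) \<partial>eta)"
  unfolding tube_fubini(2) using tube_fubini(1) by (subst b_integral_sum) auto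
 also have "... <= (\<integral>x. U \<partial>eta)"
  using tube_fubini(1) that supp by (intro integral_mono_AE) (auto elim!: eventually_mono)
 also have "... <= U" using mass1 mult_right_mono[OF mass1 that(2)] by simp
 finally show ?thesis .
qed

text \<open>Kaufman's argument: two points at distance \<open>t\<close> project to within \<open>rho\<close> of each other only for
 directions in an arc of size \<open>rho / t\<close>.\<close>

lemma tube_sum_eq_integral:
 shows "(\<Sum>w\<in>J. c w * measure eta (slice w x)) =
   (\<integral>y. (\<Sum>w\<in>J. if \<bar>wedge (v w) (x - y)\<bar> <= rho then c w else 0) \<partial>eta)"
 and "integrable eta (%y. \<Sum>w\<in>J. if \<bar>wedge (v w) (x - y)\<bar> <= rho then c w else 0)"
proof -
 have ind: "(if \<bar>wedge (v w) (x - y)\<bar> <= rho then c w else 0) = c w * indicator (slice w x) y" for w y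
  by (simp add: indicator_def)
 have int: "integrable eta (%y. c w * indicator (slice w x) y)" for w
  using section_sets[of w x] by (intro integrable_mult_right) (simp add: E.emeasure_eq_measure)
 show "integrable eta (%y. \<Sum>w\<in>J. if \<bar>wedge (v w) (x - y)\<bar> <= rho then c w else 0)"
  unfolding ind by (intro b_integrable_sum int)
 show "(\<Sum>w\<in>J. c w * measure eta (slice w x)) =
   (\<integral>y. (\<Sum>w\<in>J. if \<bar>wedge (v w) (x - y)\<bar> <= rho then c w else 0) \<partial>eta)"
  unfolding ind using section_sets by (subst b_integral_sum[OF int]) simp
qed

lemma kaufman:
 assumes N: "2 * R < rho * 2 ^ N"
 shows "(\<Sum>w\<in>J. c w * measure eta2 (tube w)) <=
  L * D * 2 powr d * (2 * R + 1) powr (d + s) * (real N + 1) * rho powr min d s"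
proof (rule energy_le)
 let ?Q = "2 * R + 1"
 let ?V = "2 powr d * ?Q powr (d + s) * rho powr min d s"
 show "L * D * 2 powr d * ?Q powr (d + s) * (real N + 1) * rho powr min d s >= 0" using L D0 by simp
 fix x :: "real^2" assume x: "norm x <= R"
 define G where "G z = (\<Sum>w\<in>J. if \<bar>wedge (v w) z\<bar> <= rho then c w else 0)" for z
 have Q1: "?Q >= 1" using R0 by simp
 \<comment> \<open>Normalising \<open>z\<close> turns the width \<open>rho\<close> into an arc of
   size \<open>rho / norm z\<close>. The factor \<open>2 * R + 1\<close> keeps the arc at least
   \<open>rho\<close>, as the mass bound demands.\<close>
 have G_le: "G z <= L * (?Q * (1 / 2 ^ k)) powr s" if z: "rho * 2 ^ k <= norm z" "norm z <= 2 * R" for z k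
 proof -
  have z0: "norm z > 0" using z rho by (smt (verit) mult_pos_pos zero_less_power)
  define th where "th = (1 / norm z) *\<^sub>R z"
  have "norm th = 1" using z0 by (simp add: th_def)
  have "rho * norm z <= rho * ?Q" using z(2) rho by (intro mult_left_mono) auto
  hence "?Q * rho / norm z >= rho" using z0 by (simp only: pos_le_divide_eq mult.commute)
  have "rho / norm z <= 1 * rho / norm z" by simp
  also have "... <= ?Q * rho / norm z" using Q1 rho z0 by (intro divide_right_mono mult_right_mono) auto
  finally have sub: "{w. w \<in> J \<and> \<bar>wedge (v w) z\<bar> <= rho} \<subseteq> {w. w \<in> J \<and> \<bar>wedge (v w) th\<bar> <= ?Q * rho / norm z}"
   using z0 by (auto simp: th_def divide_le_eq pos_le_divide_eq abs_mult)
  have "G z = (\<Sum>w | w \<in> J \<and> \<bar>wedge (v w) z\<bar> <= rho. c w)" using fin by (simp add: G_def sum.inter_filter)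
  also have "... <= (\<Sum>w | w \<in> J \<and> \<bar>wedge (v w) th\<bar> <= ?Q * rho / norm z. c w)"
   using fin c0 sub by (intro sum_mono2) auto
  also have "... <= L * (?Q * rho / norm z) powr s" by (rule mass) fact+
  also have "... <= L * (?Q * (1 / 2 ^ k)) powr s"
  proof (intro mult_left_mono powr_mono2 s L)
   have "rho / norm z <= 1 / 2 ^ k" using z(1) z0 by (simp add: divide_le_eq pos_le_divide_eq mult.commute)
   hence "?Q * (rho / norm z) <= ?Q * (1 / 2 ^ k)" using Q1 by (intro mult_left_mono) auto
   thus "?Q * rho / norm z <= ?Q * (1 / 2 ^ k)" by simp
  qed (use Q1 rho z0 in auto)
  finally show ?thesis .
 qed
 have Gtot: "G z <= L" for z
 proof -
  have "G z <= (\<Sum>w\<in>J. c w)" unfolding G_def using c0 by (intro sum_mono) auto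
  thus ?thesis using total_mass by simp
 qed
 \<comment> \<open>Annuli outside the support get weight zero, so that the radii met below are
   bounded in terms of \<open>R\<close>.\<close>
 define T where "T k = (if rho * 2 ^ k <= 2 * R then L * (?Q * (1 / 2 ^ k)) powr s else 0)" for k :: nat
 have T0: "T k >= 0" for k using L by (simp add: T_def)
 have pt: "G z <= L * indicator (cball 0 rho) z + (\<Sum>k<N. T k * indicator (cball 0 (rho * 2 ^ Suc k)) z)"
  if z: "norm z <= 2 * R" for z
 proof (cases "norm z <= rho")
  case True
  have "0 <= (\<Sum>k<N. T k * indicator (cball 0 (rho * 2 ^ Suc k)) z)" using T0 by (intro sum_nonneg) auto
  thus ?thesis using True Gtot[of z] by simp
 next
  case False
  define k where "k = (LEAST k. norm z < rho * 2 ^ Suc k)"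
  have ex: "norm z < rho * 2 ^ Suc N" proof -
   have "rho * 2 ^ N <= rho * 2 ^ Suc N" using rho by (intro mult_left_mono power_increasing) auto
   thus ?thesis using z N by linarith
  qed
  have k1: "norm z < rho * 2 ^ Suc k" unfolding k_def by (rule LeastI[of "%k. norm z < rho * 2 ^ Suc k", OF ex])
  have k2: "rho * 2 ^ k <= norm z"
  proof (cases k)
   case (Suc k')
   hence "\<not> norm z < rho * 2 ^ Suc k'" using not_less_Least[of k' "%k. norm z < rho * 2 ^ Suc k"] by (simp add: k_def)
   with Suc show ?thesis by simp
  qed (use False in simp)
  have "rho * 2 ^ k < rho * 2 ^ N" using k2 z N by linarith
  hence kN: "k < N" using rho by simp
  have "G z <= T k" using G_le[OF k2 z] k2 z by (simp add: T_def)
  also have "... = T k * indicator (cball 0 (rho * 2 ^ Suc k)) z" using k1 by simp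
  also have "... <= (\<Sum>k<N. T k * indicator (cball 0 (rho * 2 ^ Suc k)) z)"
   using kN T0 by (intro member_le_sum) auto
  finally show ?thesis using L by (simp add: add_increasing)
 qed
 have cbm: "measure eta (cball x r) <= D * r powr d" if "r >= rho" for r by (rule ball[OF that])
 have ind: "indicator (cball 0 r) (x - y) = (indicator (cball x r) y :: real)" for r y
  by (simp add: indicator_def dist_norm norm_minus_commute)
 have ic: "integrable eta (indicator (cball x r) :: _ => real)" for r
  by (simp add: E.emeasure_eq_measure sets_eta)
 have "(\<Sum>w\<in>J. c w * measure eta (slice w x)) = (\<integral>y. G (x - y) \<partial>eta)"
  unfolding G_def by (rule tube_sum_eq_integral)
 also have "... <= (\<integral>y. L * indicator (cball x rho) y + (\<Sum>k<N. T k * indicator (cball x (rho * 2 ^ Suc k)) y) \<partial>eta)"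
 proof (rule integral_mono_AE)
  show "integrable eta (%y. G (x - y))" unfolding G_def by (rule tube_sum_eq_integral(2))
  show "integrable eta (%y. L * indicator (cball x rho) y + (\<Sum>k<N. T k * indicator (cball x (rho * 2 ^ Suc k)) y))"
   using ic by (intro b_integrable_add b_integrable_sum integrable_mult_right)
  show "AE y in eta. G (x - y) <= L * indicator (cball x rho) y + (\<Sum>k<N. T k * indicator (cball x (rho * 2 ^ Suc k)) y)"
   using supp
  proof eventually_elim
   case (elim y)
   have "norm (x - y) <= 2 * R" using norm_triangle_ineq4[of x y] x elim by linarith
   from pt[OF this] show ?case unfolding ind .
  qed
 qed
 also have "... = L * measure eta (cball x rho) + (\<Sum>k<N. T k * measure eta (cball x (rho * 2 ^ Suc k)))"
   proof -
  have "(\<integral>y. T k * indicator (cball x (rho * 2 ^ Suc k)) y \<partial>eta) = T k * measure eta (cball x (rho * 2 ^ Suc k))" for k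
   by (simp add: sets_eta del: power_Suc)
  moreover have "(\<integral>y. L * indicator (cball x rho) y \<partial>eta) = L * measure eta (cball x rho)" by (simp add: sets_eta)
  moreover have "integrable eta (%y. a * indicator (cball x r) y :: real)" for a r
   using ic[of r] by (rule integrable_mult_right)
  ultimately show ?thesis
   by (simp only: b_integral_add b_integral_sum b_integrable_sum)
 qed
 also have "... <= L * D * ?V + (\<Sum>k<N. L * D * ?V)"
 proof (intro add_mono sum_mono)
  have one: "1 <= 2 powr d * ?Q powr (d + s)"
   using ge_one_powr_ge_zero[of 2 d] ge_one_powr_ge_zero[OF Q1, of "d + s"] d0 s
    mult_mono[of 1 "2 powr d" 1 "?Q powr (d + s)"] by simp
  have "rho powr d <= rho powr min d s" using rho by (intro powr_mono') auto
  also have "... <= (2 powr d * ?Q powr (d + s)) * rho powr min d s"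
   using mult_right_mono[OF one, of "rho powr min d s"] by simp
  finally have "L * (D * rho powr d) <= L * (D * ?V)" using L D0 by (intro mult_left_mono) auto
  moreover have "L * measure eta (cball x rho) <= L * (D * rho powr d)" using L cbm[of rho] by (intro mult_left_mono) auto
  ultimately show "L * measure eta (cball x rho) <= L * D * ?V" by (simp add: mult_ac)
  fix k assume "k \<in> {..<N}"
  show "T k * measure eta (cball x (rho * 2 ^ Suc k)) <= L * D * ?V"
  proof (cases "rho * 2 ^ k <= 2 * R")
   case True
   have rr: "rho <= rho * 2 ^ Suc k" using rho mult_left_mono[of 1 "2 ^ Suc k" rho] one_le_power[of "2::real" "Suc k"] by simp
   define p where "p = (2::real) ^ k"
   have p: "p >= 1" by (simp add: p_def)
   have "(?Q * (1 / p)) powr s * (rho * (2 * p)) powr d = 2 powr d * ?Q powr s * (rho powr d * (p powr d * (1 / p) powr s))"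
    by (simp only: powr_mult mult_ac)
   also have "p powr d * (1 / p) powr s = p powr (d - s)"
    using p by (simp add: powr_divide powr_diff)
   \<comment> \<open>The dyadic terms vary geometrically with \<open>d - s\<close>: the smallest
     scale dominates if \<open>d <= s\<close>, the largest otherwise. This is the origin of the
     exponent \<open>min d s\<close>.\<close>
   also have "rho powr d * p powr (d - s) <= ?Q powr d * rho powr min d s"
   proof (cases "d <= s")
    case True
    hence "p powr (d - s) <= 1" using p powr_mono[of "d - s" 0 p] by simp
    moreover have "1 <= ?Q powr d" using Q1 d0 by (intro ge_one_powr_ge_zero) auto
    ultimately have "rho powr d * p powr (d - s) <= rho powr d * ?Q powr d" by (intro mult_left_mono) auto
    thus ?thesis using True by (simp add: mult.commute)
   next
    case False
    have pQ: "p <= ?Q / rho" using \<open>rho * 2 ^ k <= 2 * R\<close> rho by (simp add: p_def pos_le_divide_eq mult.commute)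
    have "rho powr d * p powr (d - s) <= rho powr d * (?Q / rho) powr (d - s)"
     using False p pQ by (intro mult_left_mono powr_mono2) auto
    also have "... = ?Q powr (d - s) * (rho powr d / rho powr (d - s))" using rho Q1 by (simp add: powr_divide)
    also have "rho powr d / rho powr (d - s) = rho powr s" using rho by (simp add: powr_diff[symmetric])
    also have "?Q powr (d - s) * rho powr s <= ?Q powr d * rho powr s"
     using Q1 s by (intro mult_right_mono powr_mono) auto
    finally show ?thesis using False by simp
   qed
   finally have le: "(?Q * (1 / p)) powr s * (rho * (2 * p)) powr d <= 2 powr d * ?Q powr s * (?Q powr d * rho powr min d s)"
    by (simp add: mult_left_mono)
   have "T k * measure eta (cball x (rho * 2 ^ Suc k)) <= T k * (D * (rho * 2 ^ Suc k) powr d)"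
    by (intro mult_left_mono cbm rr T0)
   also have "... = L * D * ((?Q * (1 / p)) powr s * (rho * (2 * p)) powr d)"
    using True by (simp add: T_def p_def)
   also have "... <= L * D * (2 powr d * ?Q powr s * (?Q powr d * rho powr min d s))"
    using le L D0 by (intro mult_left_mono) auto
   also have "... = L * D * ?V" by (simp add: powr_add)
   finally show ?thesis .
  qed (use L D0 in \<open>simp add: T_def\<close>)
 qed
 also have "... = L * D * 2 powr d * ?Q powr (d + s) * (real N + 1) * rho powr min d s"
  by (simp add: algebra_simps)
 finally show "(\<Sum>w\<in>J. c w * measure eta (slice w x)) <=
   L * D * 2 powr d * ?Q powr (d + s) * (real N + 1) * rho powr min d s" .
qed

text \<open>The frequency side of a Gaussian tube kernel of width \<open>rho\<close> across
  \<open>v w\<close> and width one along it; \<open>iform k\<close> belongs in the same way to an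
  isotropic kernel at scale \<open>1 / 2 ^ k\<close>.\<close>

definition vform :: "'a => real \<times> real => real" where
 "vform w = qform (rho^2 * (v w $ 2)^2 + (v w $ 1)^2) ((1 - rho\<^sup>2) * v w $ 1 * v w $ 2) (rho^2 * (v w $ 1)^2 + (v w $ 2)^2)"

definition iform :: "nat => real \<times> real => real" where
 "iform k = qform (1 / (2 * 4 ^ k)) 0 (1 / (2 * 4 ^ k))"

lemma vform_transform:
 assumes w: "w \<in> J"
 shows "integrable lborel (vform w)"
  and "(\<integral>xi. cosp xi z * vform w xi \<partial>lborel) =
   2 * pi / rho * exp (- ((wedge (v w) z)^2 / rho^2 + (z \<bullet> v w)^2) / 2)"
proof -
 let ?a = "v w $ 1" and ?b = "v w $ 2"
 have ab: "?a\<^sup>2 + ?b\<^sup>2 = 1"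
 proof -
  have "(norm (v w))^2 = 1" using v1[OF w] by simp
  thus ?thesis by (simp add: norm_vec2)
 qed
 let ?A = "rho^2 * ?b\<^sup>2 + ?a\<^sup>2" and ?B = "(1 - rho\<^sup>2) * ?a * ?b" and ?C = "rho^2 * ?a\<^sup>2 + ?b\<^sup>2"
 have "?A * ?C - ?B\<^sup>2 = rho^2 * (?a\<^sup>2 + ?b\<^sup>2)^2" by (simp add: power2_eq_square algebra_simps)
 hence det: "?A * ?C - ?B\<^sup>2 = rho^2" by (simp add: ab)
 have "rho^2 * (?a\<^sup>2 + ?b\<^sup>2) <= ?C" using rho by (simp add: distrib_left mult_left_le_one_le power_le_one)
 hence C: "?C > 0" using rho by (simp add: ab) (smt (verit) zero_less_power)
 have D: "?A * ?C - ?B\<^sup>2 > 0" unfolding det using rho by simp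
 show "integrable lborel (vform w)" unfolding vform_def by (rule gaussian_fourier_2d(1)[OF C D])
 have "?C * (z $ 1)^2 - 2 * ?B * z $ 1 * z $ 2 + ?A * (z $ 2)^2 = (wedge (v w) z)^2 + rho^2 * (z \<bullet> v w)^2"
  by (simp add: wedge_def inner_vec2 power2_eq_square algebra_simps)
 hence e: "- (?C * (z $ 1)^2 - 2 * ?B * z $ 1 * z $ 2 + ?A * (z $ 2)^2) / (2 * rho^2) =
   - ((wedge (v w) z)^2 / rho^2 + (z \<bullet> v w)^2) / 2"
  using rho by (simp add: field_simps)
 show "(\<integral>xi. cosp xi z * vform w xi \<partial>lborel) =
   2 * pi / rho * exp (- ((wedge (v w) z)^2 / rho^2 + (z \<bullet> v w)^2) / 2)"
  unfolding vform_def gaussian_fourier_2d(2)[OF C D] unfolding det e using rho by simp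
qed

lemma iform_transform:
 shows "integrable lborel (iform k)"
  and "(\<integral>xi. cosp xi z * iform k xi \<partial>lborel) = 4 * pi * 4 ^ k * exp (- (2 ^ k * norm (z :: real^2))\<^sup>2)"
proof -
 let ?A = "1 / (2 * 4 ^ k) :: real"
 have C: "?A > 0" by simp
 have D: "?A * ?A - 0\<^sup>2 > 0" by simp
 show "integrable lborel (iform k)" unfolding iform_def by (rule gaussian_fourier_2d(1)[OF C D])
 have sq: "sqrt (?A * ?A - 0\<^sup>2) = ?A" by (simp only: power_zero_numeral diff_zero real_sqrt_abs2) simp
 have "- (?A * (z $ 1)^2 - 2 * 0 * z $ 1 * z $ 2 + ?A * (z $ 2)^2) / (2 * (?A * ?A - 0\<^sup>2)) = - (2 ^ k * norm z)\<^sup>2"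
  by (simp add: norm_vec2 power_mult_distrib power_even_eq[symmetric] field_simps) (simp add: power_mult[symmetric] mult.commute[of k] power_mult)
 thus "(\<integral>xi. cosp xi z * iform k xi \<partial>lborel) = 4 * pi * 4 ^ k * exp (- (2 ^ k * norm z)\<^sup>2)"
  unfolding iform_def gaussian_fourier_2d(2)[OF C D] sq by simp
qed

text \<open>Part of the exponent is spent on an isotropic cutoff at frequencies of order
  \<open>1 / rho\<close>, the rest on confinement to the line orthogonal to
  \<open>v w\<close>.\<close>

lemma vform_le:
 assumes w: "w \<in> J"
 shows "vform w (a, b) <= exp (- (rho^2 * (a^2 + b^2)) / 4) * exp (- (a * v w $ 1 + b * v w $ 2)\<^sup>2 / 4)"
proof -
 let ?x = "v w $ 1" and ?y = "v w $ 2"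
 have xy: "?x\<^sup>2 + ?y\<^sup>2 = 1"
 proof -
  have "(norm (v w))^2 = 1" using v1[OF w] by simp
  thus ?thesis by (simp add: norm_vec2)
 qed
 let ?p = "a * ?y - b * ?x" and ?q = "a * ?x + b * ?y"
 have pq: "?p\<^sup>2 + ?q\<^sup>2 = a^2 + b^2"
 proof -
  have "?p\<^sup>2 + ?q\<^sup>2 = (a^2 + b^2) * (?x\<^sup>2 + ?y\<^sup>2)" by (simp add: power2_eq_square algebra_simps)
  thus ?thesis by (simp add: xy)
 qed
 have "(rho^2 * ?y\<^sup>2 + ?x\<^sup>2) * a^2 + 2 * ((1 - rho\<^sup>2) * ?x * ?y) * a * b + (rho^2 * ?x\<^sup>2 + ?y\<^sup>2) * b^2 = rho^2 * ?p\<^sup>2 + ?q\<^sup>2"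
  by (simp add: power2_eq_square algebra_simps)
 hence "vform w (a, b) = exp (- (rho^2 * ?p\<^sup>2 + ?q\<^sup>2) / 2)" by (simp add: vform_def qform_def)
 also have "... <= exp (- (rho^2 * (a^2 + b^2)) / 4 + - ?q\<^sup>2 / 4)"
 proof -
  define X Y Z where "X = rho^2 * ?q\<^sup>2" and "Y = rho^2 * ?p\<^sup>2" and "Z = ?q\<^sup>2"
  have "X <= 1 * Z" unfolding X_def Z_def using rho by (intro mult_right_mono power_le_one) auto
  moreover have "0 <= Y" by (simp add: Y_def)
  ultimately have "- (Y + Z) / 2 <= - (Y + X) / 4 + - Z / 4" by (simp add: field_simps)
  hence "- (rho^2 * ?p\<^sup>2 + ?q\<^sup>2) / 2 <= - (rho^2 * (?p\<^sup>2 + ?q\<^sup>2)) / 4 + - ?q\<^sup>2 / 4"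
   by (simp only: X_def Y_def Z_def distrib_left)
  thus ?thesis unfolding pq by simp
 qed
 finally show ?thesis by (simp only: exp_add)
qed

text \<open>At a frequency of modulus \<open>r\<close> a single level suffices, the least
  \<open>k\<close> with \<open>r <= 2 ^ k\<close>. Frequencies beyond \<open>2 ^ k1\<close> are left
  to the level \<open>k1\<close>, which decays no faster than the cutoff in
  \<open>vform_le\<close>.\<close>

lemma vform_dominated:
 assumes k1: "2 <= 2 ^ k1 * rho" "2 ^ k1 * rho <= 4"
 shows "(\<Sum>w\<in>J. c w * vform w xi) <= psm s * L * 4 powr s * exp (1 / 4) * (\<Sum>k\<le>k1. (1 / 2 ^ k) powr s * iform k xi)"
proof -
 obtain a b where xi: "xi = (a, b)" by (cases xi)
 define r where "r = sqrt (a^2 + b^2)"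
 have r2: "a^2 + b^2 = r^2" and r0: "r >= 0" by (simp_all add: r_def)
 define M where "M = max rho (1 / max 1 r)"
 have M0: "M > 0" using rho by (simp add: M_def)
 have iform: "iform k xi = exp (- r\<^sup>2 / (4 * 4 ^ k))" for k
  by (simp add: iform_def qform_def xi r2[symmetric] field_simps)
 have key: "exp (- (rho^2 * r^2) / 4) * M powr s <= 4 powr s * exp (1 / 4) * ((1 / 2 ^ k) powr s * iform k xi)"
  if "M <= 4 * (1 / 2 ^ k)" "exp (- (rho^2 * r^2) / 4) <= exp (1 / 4) * iform k xi" for k
 proof -
  have "M powr s <= (4 * (1 / 2 ^ k)) powr s" using that(1) M0 s by (intro powr_mono2) auto
  also have "... = 4 powr s * (1 / 2 ^ k) powr s" by (rule powr_mult)
  finally have "exp (- (rho^2 * r^2) / 4) * M powr s <= (exp (1 / 4) * iform k xi) * (4 powr s * (1 / 2 ^ k) powr s)"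
   using that(2) by (intro mult_mono) (auto simp: iform)
  thus ?thesis by (simp only: mult_ac)
 qed
 have "\<exists>k\<le>k1. M <= 4 * (1 / 2 ^ k) \<and> exp (- (rho^2 * r^2) / 4) <= exp (1 / 4) * iform k xi"
 proof (cases "r <= 2 ^ k1")
  case False
  have "rho <= 4 * (1 / 2 ^ k1)" using k1(2) by (simp add: field_simps)
  moreover have "1 / max 1 r <= 4 * (1 / 2 ^ k1)"
  proof -
   have "1 / max 1 r <= 1 / 2 ^ k1" using False by (intro divide_left_mono) auto
   also have "... <= 4 * (1 / 2 ^ k1)" by (simp add: divide_right_mono)
   finally show ?thesis .
  qed
  ultimately have "M <= 4 * (1 / 2 ^ k1)" by (simp only: M_def max.bounded_iff)
  moreover have "exp (- (rho^2 * r^2) / 4) <= exp (1 / 4) * iform k1 xi"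
  proof -
   have "1 <= (2 ^ k1 * rho)^2" using k1(1) by (intro one_le_power) auto
   also have "... = 4 ^ k1 * rho^2" by (simp add: power_mult_distrib power_even_eq[symmetric] power_mult[symmetric] mult.commute[of k1]) (simp add: power_mult)
   finally have "1 / 4 ^ k1 <= rho^2" by (simp add: divide_le_eq mult.commute)
   hence "r^2 * (1 / 4 ^ k1) <= r^2 * rho^2" by (intro mult_left_mono) auto
   hence "- (rho^2 * r^2) / 4 <= 1 / 4 + - r\<^sup>2 / (4 * 4 ^ k1)" by (simp add: mult.commute)
   thus ?thesis unfolding iform by (simp only: exp_add[symmetric] exp_le_cancel_iff)
  qed
  ultimately show ?thesis by blast
 next
  case True
  define k where "k = (LEAST k. r <= 2 ^ k)"
  have rk: "r <= 2 ^ k" unfolding k_def by (rule LeastI[of "%k. r <= 2 ^ k", OF True])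
  have kk: "k <= k1" unfolding k_def by (rule Least_le[of "%k. r <= 2 ^ k", OF True])
  have "rho <= 4 * (1 / 2 ^ k1)" using k1(2) by (simp add: field_simps)
  also have "... <= 4 * (1 / 2 ^ k)" using kk by (simp add: power_increasing divide_left_mono)
  finally have "rho <= 4 * (1 / 2 ^ k)" .
  moreover have "1 / max 1 r <= 4 * (1 / 2 ^ k)"
  proof (cases k)
   case (Suc k')
   hence "\<not> r <= 2 ^ k'" using not_less_Least[of k' "%k. r <= 2 ^ k"] by (simp add: k_def)
   hence "1 / max 1 r <= 1 / 2 ^ k'" by (intro divide_left_mono) auto
   thus ?thesis using Suc by (simp add: field_simps)
  next
   case 0
   have "1 / max 1 r <= 1" by simp
   also have "1 <= 4 * (1 / 2 ^ k :: real)" using 0 by simp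
   finally show ?thesis .
  qed
  ultimately have "M <= 4 * (1 / 2 ^ k)" by (simp only: M_def max.bounded_iff)
  moreover have "exp (- (rho^2 * r^2) / 4) <= exp (1 / 4) * iform k xi"
  proof -
   have "r^2 <= (2 ^ k)^2" using rk r0 by (intro power_mono) auto
   also have "(2 ^ k :: real)^2 = 4 ^ k" by (simp add: power_even_eq[symmetric] power_mult[symmetric] mult.commute[of k]) (simp add: power_mult)
   finally have "r^2 / (4 * 4 ^ k) <= 1 / 4" by (simp add: divide_le_eq)
   moreover have "0 <= rho^2 * r^2" by simp
   ultimately have "- (rho^2 * r^2) / 4 <= 1 / 4 + - r\<^sup>2 / (4 * 4 ^ k)" by linarith
   thus ?thesis unfolding iform by (simp only: exp_add[symmetric] exp_le_cancel_iff)
  qed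
  ultimately show ?thesis using kk by blast
 qed
 then obtain k where k: "k <= k1" "M <= 4 * (1 / 2 ^ k)" "exp (- (rho^2 * r^2) / 4) <= exp (1 / 4) * iform k xi" by blast
 have "(\<Sum>w\<in>J. c w * vform w xi) <= (\<Sum>w\<in>J. c w * (exp (- (rho^2 * r^2) / 4) * exp (- (a * v w $ 1 + b * v w $ 2)\<^sup>2 / 4)))"
  unfolding xi r2[symmetric] by (intro sum_mono mult_left_mono vform_le c0)
 also have "... = exp (- (rho^2 * r^2) / 4) * (\<Sum>w\<in>J. c w * exp (- (a * v w $ 1 + b * v w $ 2)\<^sup>2 / 4))"
  unfolding sum_distrib_left by (intro sum.cong refl) (simp only: mult_ac)
 also have "... <= exp (- (rho^2 * r^2) / 4) * (psm s * L * M powr s)"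
  using gaussian_mass[of a b] by (intro mult_left_mono) (auto simp: M_def r_def)
 also have "... = (psm s * L) * (exp (- (rho^2 * r^2) / 4) * M powr s)" by (simp only: mult_ac)
 also have "... <= (psm s * L) * (4 powr s * exp (1 / 4) * ((1 / 2 ^ k) powr s * iform k xi))"
  using key[OF k(2,3)] psm_pos[of s] L by (intro mult_left_mono) auto
 also have "(1 / 2 ^ k) powr s * iform k xi <= (\<Sum>k\<le>k1. (1 / 2 ^ k) powr s * iform k xi)"
  using k(1) by (intro member_le_sum) (auto simp: iform)
 finally show ?thesis using psm_pos[of s] L by (simp add: mult_left_mono mult.assoc)
qed

text \<open>Falconer's argument: in frequency space the tube kernels are Gaussians around the lines
 dual to the directions, so their average decays like \<open>|xi|^(- s)\<close>.\<close>

lemma falconer: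
 assumes k1: "2 <= 2 ^ k1 * rho" "2 ^ k1 * rho <= 4" and ds: "d + s >= 2"
 shows "(\<Sum>w\<in>J. c w * measure eta2 (tube w)) <=
  L * D * (2 * exp (1 / 2 + 2 * R^2) * psm s * 4 powr s * exp (1 / 4) * psm d * 4 powr d) * (real k1 + 1) * rho"
proof -
 define B where "B = psm s * L * 4 powr s * exp (1 / 4)"
 have B0: "B >= 0" using psm_pos[of s] L by (simp add: B_def)
 \<comment> \<open>Nonnegative by domination, so its transform is a positive definite kernel:
   integrated against \<open>eta\<close> twice, the tube kernels are bounded by the isotropic
   ones.\<close>
 define g where "g xi = B * (\<Sum>k\<le>k1. (1 / 2 ^ k) powr s * iform k xi) - (\<Sum>w\<in>J. c w * vform w xi)" for xi
 have g0: "g xi >= 0" for xi using vform_dominated[OF k1, of xi] by (simp add: g_def B_def)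
 have gi: "integrable lborel g"
  unfolding g_def using vform_transform(1) iform_transform(1)
  by (intro b_integrable_diff integrable_mult_right b_integrable_sum)
 define Vk where "Vk w z = 2 * pi / rho * exp (- ((wedge (v w) z)^2 / rho^2 + (z \<bullet> v w)^2) / 2)" for w z
 define Ik where "Ik k z = 4 * pi * 4 ^ k * exp (- (2 ^ k * norm z)\<^sup>2)" for k and z :: "real^2"
 have cosint: "integrable lborel (%xi. cosp xi z * f xi)"
  if "integrable lborel f" for f :: "real \<times> real => real" and z :: "real^2"
 proof (rule Bochner_Integration.integrable_bound[OF that])
  have "(%xi. cosp xi z) \<in> borel_measurable (borel :: (real \<times> real) measure)"
   by (intro borel_measurable_continuous_onI continuous_intros)
  thus "(%xi. cosp xi z * f xi) \<in> borel_measurable lborel"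
   using borel_measurable_integrable[OF that] by (intro borel_measurable_times) simp_all
 qed (auto simp: abs_mult mult_left_le_one_le)
 have trans: "(\<integral>xi. cosp xi z * g xi \<partial>lborel) =
   B * (\<Sum>k\<le>k1. (1 / 2 ^ k) powr s * Ik k z) - (\<Sum>w\<in>J. c w * Vk w z)" for z
 proof -
  have "(\<integral>xi. cosp xi z * g xi \<partial>lborel) =
   (\<integral>xi. B * (\<Sum>k\<le>k1. (1 / 2 ^ k) powr s * (cosp xi z * iform k xi)) -
    (\<Sum>w\<in>J. c w * (cosp xi z * vform w xi)) \<partial>lborel)"
   by (intro b_integral_cong refl) (simp add: g_def right_diff_distrib sum_distrib_left sum_distrib_right mult_ac)
  also have "... = B * (\<Sum>k\<le>k1. (1 / 2 ^ k) powr s * (\<integral>xi. cosp xi z * iform k xi \<partial>lborel)) -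
    (\<Sum>w\<in>J. c w * (\<integral>xi. cosp xi z * vform w xi \<partial>lborel))"
   using cosint[OF iform_transform(1)] cosint[OF vform_transform(1)]
   by (subst b_integral_diff) (simp_all add: b_integral_sum)
  also have "... = B * (\<Sum>k\<le>k1. (1 / 2 ^ k) powr s * Ik k z) - (\<Sum>w\<in>J. c w * Vk w z)"
   unfolding iform_transform(2) Ik_def Vk_def by (simp add: vform_transform(2))
  finally show ?thesis .
 qed
 have Ikm: "integrable eta2 (%q. Ik k (fst q - snd q))" for k
  by (rule F.integrable_const_bound[of _ "4 * pi * 4 ^ k"])
   (auto simp: Ik_def borel_pair intro!: borel_measurable_continuous_onI continuous_intros)
 have Vkm: "integrable eta2 (%q. Vk w (fst q - snd q))" for w
 proof (rule F.integrable_const_bound[of _ "2 * pi / rho"])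
  have "Vk w z <= 2 * pi / rho * 1" for z
  proof -
   have "0 <= (wedge (v w) z)^2 / rho^2 + (z \<bullet> v w)^2" by (intro add_nonneg_nonneg divide_nonneg_nonneg) auto
   thus ?thesis unfolding Vk_def using rho by (intro mult_left_mono) (auto simp del: minus_add_distrib)
  qed
  moreover have "Vk w z >= 0" for z :: "real^2" using rho by (simp add: Vk_def)
  ultimately show "AE q in eta2. norm (Vk w (fst q - snd q)) <= 2 * pi / rho" by simp
  show "(%q. Vk w (fst q - snd q)) \<in> borel_measurable eta2"
   unfolding Vk_def wedge_def borel_pair using rho by (intro borel_measurable_continuous_onI continuous_intros) auto
 qed
 have "0 <= (\<integral>q. B * (\<Sum>k\<le>k1. (1 / 2 ^ k) powr s * Ik k (fst q - snd q)) - (\<Sum>w\<in>J. c w * Vk w (fst q - snd q)) \<partial>eta2)"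
  using positive_definite_kernel[OF fin_eta sets_eta gi g0] unfolding trans .
 also have "... = B * (\<Sum>k\<le>k1. (1 / 2 ^ k) powr s * (\<integral>q. Ik k (fst q - snd q) \<partial>eta2)) -
   (\<Sum>w\<in>J. c w * (\<integral>q. Vk w (fst q - snd q) \<partial>eta2))"
  using Ikm Vkm by (subst b_integral_diff) (simp_all add: b_integral_sum)
 finally have main: "(\<Sum>w\<in>J. c w * (\<integral>q. Vk w (fst q - snd q) \<partial>eta2)) <=
   B * (\<Sum>k\<le>k1. (1 / 2 ^ k) powr s * (\<integral>q. Ik k (fst q - snd q) \<partial>eta2))" by simp
 \<comment> \<open>Level \<open>k\<close> costs \<open>4 ^ k\<close> for the normalisation and gains
   the power \<open>d + s\<close> of \<open>1 / 2 ^ k\<close>; here \<open>d + s >= 2\<close> makes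
   every level contribute a bounded amount.\<close>
 have Ile: "(1 / 2 ^ k) powr s * (\<integral>q. Ik k (fst q - snd q) \<partial>eta2) <= 4 * pi * (psm d * D * 4 powr d)" if k: "k <= k1" for k
 proof -
  define p where "p = (1 / 2 ^ k :: real)"
  have p: "p > 0" "p <= 1" by (simp_all add: p_def)
  have pk: "4 ^ k = 1 / p^2" by (simp add: p_def power_divide power_even_eq[symmetric] power_mult[symmetric] mult.commute[of k]) (simp add: power_mult)
  have "2 ^ k * rho <= 2 ^ k1 * rho" using k rho by (intro mult_right_mono power_increasing) auto
  hence k4: "2 ^ k * rho <= 4" using k1(2) by linarith
  have "(\<integral>q. Ik k (fst q - snd q) \<partial>eta2) <= (\<integral>q. 4 * pi * 4 ^ k * gk k (fst q - snd q) \<partial>eta2)"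
   using energy_pair(2)[OF k4] by (intro integral_mono Ikm integrable_mult_right) (auto simp: Ik_def)
  also have "... <= 4 * pi * 4 ^ k * (psm d * D * 4 powr d * p powr d)"
   using energy_pair(1)[OF k4] unfolding p_def by (simp add: mult_left_mono)
  finally have "p powr s * (\<integral>q. Ik k (fst q - snd q) \<partial>eta2) <= p powr s * (4 * pi * (1 / p^2) * (psm d * D * 4 powr d * p powr d))"
   unfolding pk by (intro mult_left_mono) auto
  also have "... = 4 * pi * (psm d * D * 4 powr d) * (p powr (d + s) / p^2)" by (simp add: powr_add mult_ac)
  also have "... <= 4 * pi * (psm d * D * 4 powr d) * 1"
  proof (intro mult_left_mono)
   have "p powr (d + s) <= p powr 2" using p ds by (intro powr_mono') auto
   thus "p powr (d + s) / p^2 <= 1" using p by (simp add: divide_le_eq_1)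
  qed (use psm_pos[of d] D0 in auto)
  finally show ?thesis by (simp add: p_def)
 qed
 have "B * (\<Sum>k\<le>k1. (1 / 2 ^ k) powr s * (\<integral>q. Ik k (fst q - snd q) \<partial>eta2)) <= B * (\<Sum>k\<le>k1. 4 * pi * (psm d * D * 4 powr d))"
  by (intro mult_left_mono sum_mono Ile B0) auto
 with main have main2: "(\<Sum>w\<in>J. c w * (\<integral>q. Vk w (fst q - snd q) \<partial>eta2)) <= B * ((real k1 + 1) * (4 * pi * (psm d * D * 4 powr d)))"
  by (simp add: add.commute)
 \<comment> \<open>On the tube and the support the exponent of the kernel is at most
   \<open>1 / 2\<close> across and \<open>(2 * R)^2 / 2\<close> along the direction, so this factor
   lifts the normalised kernel above one.\<close>
 let ?e = "exp (1 / 2 + 2 * R^2)"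
 have tube_le: "measure eta2 (tube w) <= ?e * (rho / (2 * pi)) * (\<integral>q. Vk w (fst q - snd q) \<partial>eta2)"
  if w: "w \<in> J" for w
 proof -
  have "measure eta2 (tube w) = (\<integral>q. indicator (tube w) q \<partial>eta2)" using tube_sets[of w] by simp
  also have "... <= (\<integral>q. ?e * (rho / (2 * pi)) * Vk w (fst q - snd q) \<partial>eta2)"
  proof (rule integral_mono_AE)
   show "integrable eta2 (indicator (tube w) :: _ => real)" using tube_sets[of w] by (simp add: F.emeasure_eq_measure)
   show "integrable eta2 (%q. ?e * (rho / (2 * pi)) * Vk w (fst q - snd q))" by (intro integrable_mult_right Vkm)
   show "AE q in eta2. indicator (tube w) q <= ?e * (rho / (2 * pi)) * Vk w (fst q - snd q)"
    using supp_pair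
   proof eventually_elim
    case (elim q)
    let ?z = "fst q - snd q"
    have eq: "?e * (rho / (2 * pi)) * Vk w ?z = exp (1 / 2 + 2 * R^2 + - ((wedge (v w) ?z)^2 / rho^2 + (?z \<bullet> v w)^2) / 2)"
     using rho by (simp add: Vk_def exp_add)
    show ?case
    proof (cases "q \<in> tube w")
     case True
     have "\<bar>?z \<bullet> v w\<bar> <= norm ?z * norm (v w)" by (rule Cauchy_Schwarz_ineq2)
     also have "... <= 2 * R" using norm_triangle_ineq4[of "fst q" "snd q"] elim v1[OF w] by simp
     finally have "(?z \<bullet> v w)^2 <= (2 * R)^2" by (metis abs_ge_zero power2_abs power_mono)
     moreover have "(wedge (v w) ?z)^2 <= rho^2" using True by (metis (mono_tags, lifting) abs_ge_zero mem_Collect_eq power2_abs power_mono)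
     hence "(wedge (v w) ?z)^2 / rho^2 <= 1" using rho by simp
     moreover have "0 <= 1 / 2 + 2 * R^2 + - (X + Y) / 2" if "X <= 1" "Y <= (2 * R)^2" for X Y
      using that by (simp add: power_mult_distrib field_simps)
     ultimately have "0 <= 1 / 2 + 2 * R^2 + - ((wedge (v w) ?z)^2 / rho^2 + (?z \<bullet> v w)^2) / 2" by blast
     hence "1 <= exp (1 / 2 + 2 * R^2 + - ((wedge (v w) ?z)^2 / rho^2 + (?z \<bullet> v w)^2) / 2)" by simp
     thus ?thesis unfolding eq using True by simp
    qed (unfold eq, simp)
   qed
  qed
  finally show ?thesis by simp
 qed
 have "(\<Sum>w\<in>J. c w * measure eta2 (tube w)) <= (\<Sum>w\<in>J. c w * (?e * (rho / (2 * pi)) * (\<integral>q. Vk w (fst q - snd q) \<partial>eta2)))"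
  by (intro sum_mono mult_left_mono tube_le c0)
 also have "... = ?e * (rho / (2 * pi)) * (\<Sum>w\<in>J. c w * (\<integral>q. Vk w (fst q - snd q) \<partial>eta2))"
  unfolding sum_distrib_left by (intro sum.cong refl) (simp only: mult_ac)
 also have "... <= ?e * (rho / (2 * pi)) * (B * ((real k1 + 1) * (4 * pi * (psm d * D * 4 powr d))))"
  using rho main2 by (intro mult_left_mono) auto
 also have "... = L * D * (2 * ?e * psm s * 4 powr s * exp (1 / 4) * psm d * 4 powr d) * (real k1 + 1) * rho"
  by (simp add: B_def)
 finally show ?thesis .
qed

end


section \<open>The affine system: attractor, separation and cylinder directions\<close>

lemma compact_invariant_subset:
 fixes f :: "'k => 'a::metric_space => 'a"
 assumes X: "X = (\<Union>k. f k ` X)" "bounded X" and Y: "Y = (\<Union>k. f k ` Y)" "closed Y" "bounded Y" "Y \<noteq> {}"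
  and r: "0 <= r" "r < 1" and lip: "\<And>k x y. dist (f k x) (f k y) <= r * dist x y"
 shows "X \<subseteq> Y"
proof
 obtain b where b: "\<And>x y. x \<in> X ==> y \<in> Y ==> dist x y <= b"
 proof -
  have "bounded (X \<union> Y)" using X Y by simp
  thus ?thesis by (intro that[of "diameter (X \<union> Y)"]) (auto intro!: diameter_bounded_bound)
 qed
 \<comment> \<open>Following a point of \<open>X\<close> back through \<open>n\<close> maps and
   returning with a point of \<open>Y\<close> along the same maps contracts their distance
   \<open>n\<close> times.\<close>
 have close: "\<exists>y\<in>Y. dist x y <= r ^ n * b" if "x \<in> X" for x n
  using that
 proof (induction n arbitrary: x)
  case 0
  thus ?case using b Y(4) by auto
 next
  case (Suc n)
  obtain k x' where x: "x' \<in> X" "x = f k x'" using Suc.prems by (subst (asm) X(1)) auto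
  obtain y where y: "y \<in> Y" "dist x' y <= r ^ n * b" using Suc.IH[OF x(1)] by blast
  have "dist x (f k y) <= r * (r ^ n * b)" using lip[of k x' y] mult_left_mono[OF y(2) r(1)] x(2) by simp
  moreover have "f k y \<in> Y" using y(1) by (subst Y(1)) blast
  ultimately show ?case by (auto simp: mult.assoc)
 qed
 fix x assume x: "x \<in> X"
 have "(%n. r ^ n * b) ----> 0 * b" using r by (intro tendsto_mult LIMSEQ_power_zero tendsto_const) auto
 hence "\<exists>y\<in>Y. dist y x < e" if "e > 0" for e
 proof -
  have "EV n. r ^ n * b < e" using \<open>_ ----> 0 * b\<close> that by (intro order_tendstoD(2)) auto
  then obtain n where "r ^ n * b < e" by (meson eventually_sequentially order_refl)
  with close[OF x, of n] show ?thesis by (metis dist_commute le_less_trans)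
 qed
 hence "x \<in> closure Y" by (auto simp: closure_approachable)
 with Y(2) show "x \<in> Y" by simp
qed

locale affine_system = word_system mu C A
 for mu :: "('k::finite) left_word measure" and C and A :: "'k => real^2^2" +
 fixes t :: "'k => real^2"
 assumes sep: "strong_separation (affine_ifs A t)"
begin

abbreviation f :: "'k => real^2 => real^2" where "f \<equiv> affine_ifs A t"
abbreviation F :: "'k list => real^2 => real^2" where "F w \<equiv> foldr f w"
abbreviation pr :: "'k left_word => real^2" where "pr \<equiv> natural_projection f"

lemma F_diff: "F w x - F w y = P w *v (x - y)"
proof (induction w)
 case (Cons k w)
 hence "A k *v (F w x - F w y) = A k *v (P w *v (x - y))" by simp
 moreover have "f k x - f k y = A k *v (x - y)" for x y by (simp add: affine_ifs_def matrix_vector_mult_diff_distrib)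
 ultimately show ?case by (simp add: word_prod_Cons matrix_vector_mul_assoc)
qed simp

lemma F_eq: "F w x = P w *v x + F w 0"
 using F_diff[of w x 0] by (simp add: algebra_simps)

lemma continuous_F: "continuous_on X (F w)"
proof -
 define c where "c = F w 0"
 have "F w = (%x. P w *v x + c)" unfolding c_def using F_eq by blast
 moreover have "continuous_on X (%x. P w *v x + c)" by (intro continuous_intros matrix_vector_mult_linear_continuous_on)
 ultimately show ?thesis by (simp only:)
qed

text \<open>A radius for which every map of the system sends the ball about the origin into
  itself.\<close>

definition B :: real where "B = (Max (range (%k. norm (t k))) + 1) / (1 - rho)"

lemma B_pos: "B > 0"
proof -
 have "0 <= norm (t undefined)" "norm (t undefined) <= Max (range (%k. norm (t k)))" by (auto intro!: Max_ge)
 hence "0 < Max (range (%k. norm (t k))) + 1" by linarith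
 thus ?thesis using rho(2) unfolding B_def by (intro divide_pos_pos) auto
qed

lemma norm_F: "norm x <= B ==> norm (F w x) <= B"
proof (induction w)
 case (Cons k w)
 have "norm (F (k # w) x) <= norm (A k *v F w x) + norm (t k)" by (simp add: affine_ifs_def norm_triangle_ineq)
 also have "norm (A k *v F w x) <= mnorm (A k) * norm (F w x)" by (rule mnorm_pos)
 also have "... <= rho * B" using Cons rho(1) rho(3)[of k] by (intro mult_mono) auto
 also have "norm (t k) <= Max (range (%k. norm (t k)))" by (intro Max_ge) auto
 also have "rho * B + Max (range (%k. norm (t k))) <= B"
 proof -
  have "Max (range (%k. norm (t k))) + 1 = (1 - rho) * B" using rho(2) by (simp add: B_def)
  thus ?thesis by (simp add: left_diff_distrib)
 qed
 finally show ?case by simp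
qed simp

lemma pr_tendsto: "(%n. F (pre i n) 0) ----> pr i"
proof -
 have "Cauchy (%n. F (pre i n) 0)"
 proof (unfold Cauchy_altdef2, intro allI impI)
  fix e :: real assume e: "e > 0"
  have "(%n. rho ^ n * B) ----> 0 * B" using rho by (intro tendsto_mult LIMSEQ_power_zero tendsto_const) auto
  hence "EV n. rho ^ n * B < e" using e by (intro order_tendstoD(2)) auto
  then obtain N where N: "rho ^ N * B < e" by (meson eventually_sequentially order_refl)
  have "dist (F (pre i n) 0) (F (pre i N) 0) < e" if "n >= N" for n
  proof -
   let ?y = "F (pre (shl N i) (n - N)) 0"
   have "F (pre i n) 0 = F (pre i N) ?y" using that map_upt_add[of i N "n - N"] by simp
   hence "dist (F (pre i n) 0) (F (pre i N) 0) = norm (P (pre i N) *v ?y)"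
    using F_diff[of "pre i N" ?y 0] by (simp add: dist_norm)
   also have "... <= rho ^ N * B"
    using norm_P_le[of "pre i N" ?y] mult_mono[OF a1_le_rho[of "pre i N"] norm_F[of 0 "pre (shl N i) (n - N)"]] B_pos rho
    by simp
   finally show ?thesis using N by simp
  qed
  thus "\<exists>N. \<forall>n\<ge>N. dist (F (pre i n) 0) (F (pre i N) 0) < e" by blast
 qed
 thus ?thesis unfolding natural_projection_def by (simp add: Cauchy_convergent_iff convergent_LIMSEQ_iff)
qed

lemma norm_pr: "norm (pr i) <= B"
 using Lim_norm_ubound[OF _ pr_tendsto[of i], of B] norm_F[of 0] B_pos by simp

lemma pr_measurable [measurable]: "pr \<in> borel_measurable left_words"
proof (rule borel_measurable_LIMSEQ_metric)
 show "(%i. F (pre i n) 0) \<in> borel_measurable left_words" for n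
  by (rule measurable_compose[OF prefix_measurable]) simp
qed (rule pr_tendsto)

lemma pr_conc: "pr (conc w j) = F w (pr j)"
proof (rule LIMSEQ_unique)
 have "(%n. F (pre (conc w j) (length w + n)) 0) ----> pr (conc w j)"
  using LIMSEQ_ignore_initial_segment[OF pr_tendsto[of "conc w j"], of "length w"] by (simp add: add.commute)
 thus "(%n. F w (F (pre j n) 0)) ----> pr (conc w j)" unfolding map_upt_add by simp
 show "(%n. F w (F (pre j n) 0)) ----> F w (pr j)"
  using continuous_F[of UNIV w] pr_tendsto[of j] by (intro isCont_tendsto_compose[of _ "F w"]) (auto simp: continuous_on_eq_continuous_at)
qed

lemma pr_prefix: "pr i = F (pre i n) (pr (shl n i))"
 using pr_conc[of "pre i n" "shl n i"] by (simp add: conc_drop)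

lemma pr_diff:
 assumes "i \<in> cyl w" "j \<in> cyl w"
 shows "pr i - pr j = P w *v (pr (shl (length w) i) - pr (shl (length w) j))"
 using pr_prefix[of i "length w"] pr_prefix[of j "length w"] assms F_diff by (simp add: in_cyl)

lemma range_pr: "range pr = (\<Union>k. f k ` range pr)"
proof (intro equalityI subsetI)
 fix x assume "x \<in> range pr"
 then obtain i where "x = pr i" by blast
 thus "x \<in> (\<Union>k. f k ` range pr)" using pr_prefix[of i 1] by auto
next
 fix x assume "x \<in> (\<Union>k. f k ` range pr)"
 then obtain k i where "x = f k (pr i)" by blast
 hence "x = pr (conc [k] i)" by (simp add: pr_conc)
 thus "x \<in> range pr" by blast
qed

text \<open>The closure of the coded points is compact and invariant;
  \<open>compact_invariant_subset\<close>, used in both directions, shows that it is the only such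
  set, which justifies the definite description.\<close>

lemma attractor_eq: "attractor f = closure (range pr)"
proof -
 let ?L = "closure (range pr)"
 have bdd: "bounded (range pr)" using norm_pr by (auto simp: bounded_iff)
 hence comp: "compact ?L" by simp
 have cont: "continuous_on X (f k)" for X k using continuous_F[of X "[k]"] by simp
 have inv: "?L = (\<Union>k. f k ` ?L)"
 proof
  have "closed (f k ` ?L)" for k by (intro compact_imp_closed compact_continuous_image cont comp)
  hence "closed (\<Union>k. f k ` ?L)" by (intro closed_UN) auto
  moreover have "range pr \<subseteq> (\<Union>k. f k ` ?L)"
  proof -
   have "(\<Union>k. f k ` range pr) \<subseteq> (\<Union>k. f k ` ?L)" by (rule UN_mono[OF order_refl], rule image_mono, rule closure_subset)
   thus ?thesis unfolding range_pr[symmetric] .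
  qed
  ultimately show "?L \<subseteq> (\<Union>k. f k ` ?L)" by (intro closure_minimal)
  have "f k ` range pr \<subseteq> ?L" for k
  proof -
   have "f k ` range pr \<subseteq> range pr" by (subst (2) range_pr) auto
   thus ?thesis using closure_subset by (rule order_trans)
  qed
  thus "(\<Union>k. f k ` ?L) \<subseteq> ?L" by (intro UN_least image_closure_subset cont closed_closure) auto
 qed
 have lip: "dist (f k x) (f k y) <= rho * dist x y" for k x y
 proof -
  have "norm (f k x - f k y) <= mnorm (A k) * norm (x - y)" using F_diff[of "[k]" x y] mnorm_pos[of "A k" "x - y"] by simp
  also have "... <= rho * norm (x - y)" using rho by (intro mult_right_mono) auto
  finally show ?thesis by (simp add: dist_norm)
 qed
 show ?thesis unfolding attractor_def
 proof (rule the_equality)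
  have L: "?L \<noteq> {}" "bounded ?L" using bdd by auto
  show "?L \<noteq> {} \<and> compact ?L \<and> ?L = (\<Union>k. f k ` ?L)" by (intro conjI L comp inv)
  fix X assume "X \<noteq> {} \<and> compact X \<and> X = (\<Union>k. f k ` X)"
  hence X: "X \<noteq> {}" "compact X" "X = (\<Union>k. f k ` X)" by blast+
  note b = compact_imp_bounded[OF X(2)] compact_imp_closed[OF X(2)]
  have "X \<subseteq> ?L"
   by (rule compact_invariant_subset[OF X(3) b(1) inv closed_closure L(2,1) less_imp_le[OF rho(1)] rho(2) lip])
  moreover have "?L \<subseteq> X"
   by (rule compact_invariant_subset[OF inv L(2) X(3) b(2,1) X(1) less_imp_le[OF rho(1)] rho(2) lip])
  ultimately show "X = ?L" by (rule equalityI)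
 qed
qed

lemma first_letter_separation: "\<exists>d>0. \<forall>i j. i 0 \<noteq> j 0 --> d <= norm (pr i - pr j)"
proof -
 let ?L = "attractor f"
 have comp: "compact (f k ` ?L)" for k
 proof (rule compact_continuous_image)
  show "continuous_on ?L (f k)" using continuous_F[of _ "[k]"] by simp
  show "compact ?L" unfolding attractor_eq using norm_pr by (auto simp: bounded_iff)
 qed
 have "\<exists>d>0. \<forall>x\<in>f k ` ?L. \<forall>y\<in>f l ` ?L. d <= dist x y" if "k \<noteq> l" for k l
  using separate_compact_closed[OF comp[of k] compact_imp_closed[OF comp[of l]]] sep that by (simp add: strong_separation_def)
 then obtain d where d: "\<And>k l. k \<noteq> l ==> d k l > 0 \<and> (\<forall>x\<in>f k ` ?L. \<forall>y\<in>f l ` ?L. d k l <= dist x y)" by metis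
 define D where "D = Min (insert 1 ((%(k, l). d k l) ` {(k, l). k \<noteq> l}))"
 have "D > 0" unfolding D_def using d by (subst Min_gr_iff) auto
 moreover have "D <= norm (pr i - pr j)" if "i 0 \<noteq> j 0" for i j
 proof -
  have "pr i \<in> f (i 0) ` ?L" for i
   using pr_prefix[of i 1] closure_subset[of "range pr"] by (auto simp: attractor_eq intro!: imageI)
  hence "d (i 0) (j 0) <= dist (pr i) (pr j)" using d[OF that] by blast
  moreover have "D <= d (i 0) (j 0)" unfolding D_def using that by (intro Min_le) auto
  ultimately show ?thesis by (simp add: dist_norm)
 qed
 ultimately show ?thesis by blast
qed

definition gap :: real where "gap = (SOME d. d > 0 \<and> (\<forall>i j. i 0 \<noteq> j 0 --> d <= norm (pr i - pr j)))"

lemma gap: "gap > 0" "i 0 \<noteq> j 0 ==> gap <= norm (pr i - pr j)"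
 using someI_ex[OF first_letter_separation] unfolding gap_def by blast+

lemma a1_le_1: "a1 w <= 1"
 using a1_le_rho[of w] power_le_one[of rho "length w"] rho by simp

text \<open>At the first differing letter the two pieces are \<open>gap\<close> apart. The common
  prefix shrinks this by no more than its own \<open>a2\<close>, which is at least
  \<open>a2 w\<close> because the remaining maps contract.\<close>

lemma separation:
 assumes "i \<in> cyl w" "norm (pr i - pr j) < gap * a2 w"
 shows "j \<in> cyl w"
proof (rule ccontr)
 assume "j \<notin> cyl w"
 hence "\<exists>k<length w. j k \<noteq> i k" using assms(1) unfolding in_cyl list_eq_iff_nth_eq by auto
 define k where "k = (LEAST k. k < length w \<and> j k \<noteq> i k)"
 have k: "k < length w" "j k \<noteq> i k" using LeastI_ex[OF \<open>\<exists>k<length w. j k \<noteq> i k\<close>] by (auto simp: k_def)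
 have "j l = i l" if "l < k" for l using not_less_Least[of l "%k. k < length w \<and> j k \<noteq> i k"] that k(1) by (auto simp: k_def)
 hence pre: "pre j k = pre i k" by simp
 let ?u = "pre i k" and ?v = "pre (shl k i) (length w - k)"
 have w: "w = ?u @ ?v" using assms(1) k(1) map_upt_add[of i k "length w - k"] by (simp add: in_cyl)
 have "gap <= norm (pr (shl k i) - pr (shl k j))"
  using k(2) by (intro gap) (auto simp: shl_def)
 hence "a2 ?u * gap <= a2 ?u * norm (pr (shl k i) - pr (shl k j))" by (intro mult_left_mono) (auto intro: less_imp_le)
 also have "... <= norm (pr i - pr j)" using norm_P_ge pr_diff[of i ?u j] pre by (simp add: in_cyl)
 also have "a2 w <= a2 ?u"
 proof -
  have "a2 w <= a2 ?u * a1 ?v" by (subst w) (rule a2_append_le)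
  also have "... <= a2 ?u * 1" using a1_le_1 by (intro mult_left_mono) (auto intro: less_imp_le)
  finally show ?thesis by simp
 qed
 hence "gap * a2 w <= a2 ?u * gap" using gap(1) by (simp add: mult.commute)
 ultimately show False using assms(2) by linarith
qed

text \<open>The strong stable line of a right word beginning with \<open>w\<close> reversed, so that
  the forward product along it is \<open>P w\<close>. The letters beyond are arbitrary, as they move
  the line by at most the order of \<open>tau w\<close>. Unlike \<open>cdir w\<close>, this line is
  subject to transversality.\<close>

definition dir :: "'k list => real^2" where "dir w = evec (conc (rev w) (%_. undefined))"

lemma dir: "norm (dir w) = 1" "norm (P w *v dir w) <= K * a2 w"
 using evec[of "conc (rev w) (%_. undefined)"] fw_conc[OF refl, of w "%_. undefined"] by (metis dir_def)+

lemma wedge_dir_le: "a1 w * \<bar>wedge z (dir w)\<bar> <= K * norm (P w *v z)"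
proof -
 have "a1 w * a2 w * \<bar>wedge z (dir w)\<bar> = \<bar>wedge (P w *v z) (P w *v dir w)\<bar>"
  unfolding wedge_matrix abs_mult dt_eq[symmetric] by (simp add: dt_def)
 also have "... <= norm (P w *v z) * norm (P w *v dir w)" by (rule wedge_le)
 also have "... <= norm (P w *v z) * (K * a2 w)" by (intro mult_left_mono dir) auto
 finally have "a2 w * (a1 w * \<bar>wedge z (dir w)\<bar>) <= a2 w * (K * norm (P w *v z))" by (simp only: mult_ac)
 thus ?thesis using a2_pos[of w] by (simp only: mult_le_cancel_left_pos)
qed

end


section \<open>From ball and direction bounds to tubes\<close>

lemma exp_half_le_power: "exp (real N / 2) <= 2 ^ N"
proof -
 have "exp (real N / 2) <= exp (real N * ln 2)" 
  using mult_left_mono[of "1 / 2" "ln 2" "real N"] ln2_ge_two_thirds by simp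
 also have "... = 2 ^ N" by (simp add: exp_of_nat_mult)
 finally show ?thesis .
qed

context affine_system
begin

text \<open>The good set depends on \<open>n\<close>, since large deviations exclude bad behaviour
  length by length; all radii down to \<open>exp (- n)\<close> are included so that the bound can
  feed the tube estimates.\<close>

definition ball_bound :: "real => real => (nat => 'k left_word set) => bool" where
 "ball_bound e d H \<longleftrightarrow> (\<forall>n. H n \<in> sets left_words) \<and> expsmall (%n. prob (- H n)) \<and>
   (EV n. \<forall>x r. exp (- real n) <= r --> r <= 1 -->
    prob (H n \<inter> {i. norm (pr i - x) <= r}) <= exp (e * real n) * r powr d)"

definition ball_regular :: "real => bool" where "ball_regular d \<longleftrightarrow> (\<forall>e>0. \<exists>H. ball_bound e d H)"

lemma ball_boundD:
 assumes "ball_bound e d H"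
 shows "H n \<in> sets left_words" "expsmall (%n. prob (- H n))"
  "EV n. \<forall>x r. exp (- real n) <= r --> r <= 1 -->
    prob (H n \<inter> {i. norm (pr i - x) <= r}) <= exp (e * real n) * r powr d"
 using assms unfolding ball_bound_def by blast+

definition direction_bound :: "real => real => ('k list => bool) => bool" where
 "direction_bound e s J \<longleftrightarrow> expsmall (%n. msum n (%w. \<not> J w)) \<and>
   (EV n. \<forall>th r. norm th = 1 --> dec chi n <= r --> r <= 1 -->
    msum n (%w. J w \<and> \<bar>wedge (dir w) th\<bar> <= r) <= exp (e * real n) * r powr s)"

definition direction_regular :: "real => bool" where "direction_regular s \<longleftrightarrow> (\<forall>e>0. \<exists>J. direction_bound e s J)"

text \<open>The width \<open>exp (- chi * n)\<close> replaces \<open>tau w\<close>: it agrees with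
  it up to a small rate for typical words and is common to all words of one length, as averaging
  over them requires.\<close>

definition tube :: "nat => 'k list => 'k left_word => 'k left_word set" where
 "tube n w x = {y. \<bar>wedge (dir w) (pr x - pr y)\<bar> <= dec chi n}"

text \<open>The exceptional sum weights pairs of a word and a point by the product measure.
  \<open>measure_cyl_shift_le\<close> turns it into a statement about points in the cylinder of
  \<open>w\<close>.\<close>

definition tube_regular :: "real => bool" where
 "tube_regular D \<longleftrightarrow> (\<forall>e>0. \<exists>H B. (\<forall>n. H n \<in> sets left_words) \<and> (\<forall>w. B w \<in> sets left_words) \<and>
   expsmall (%n. \<Sum>w\<in>words n. m w * prob (B w)) \<and>
   (\<forall>n w x. length w = n --> x \<notin> B w -->
    x \<in> H n \<and> prob (H n \<inter> tube n w x) <= exp ((e - chi * D) * real n)))"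

definition proj_measure :: "'k left_word set => (real^2) measure" where
 "proj_measure H = distr (restrict_space mu H) borel pr"

lemma proj_measure:
 assumes H: "H \<in> sets left_words"
 shows "finite_measure (proj_measure H)" "sets (proj_measure H) = sets borel"
  and "S \<in> sets borel ==> measure (proj_measure H) S = prob (H \<inter> pr -` S)"
  and "AE x in proj_measure H. norm x <= B"
proof -
 have pm: "pr \<in> measurable (restrict_space mu H) borel" by (rule measurable_restrict_space1) measurable
 have Hs: "H \<inter> space mu \<in> sets mu" using H by simp
 interpret R: finite_measure "restrict_space mu H" by (rule finite_measure_restrict_space) (use H in auto)
 show "finite_measure (proj_measure H)" unfolding proj_measure_def by (rule R.finite_measure_distr[OF pm])
 show "sets (proj_measure H) = sets borel" by (simp add: proj_measure_def)
 show "measure (proj_measure H) S = prob (H \<inter> pr -` S)" if "S \<in> sets borel" for S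
  unfolding proj_measure_def measure_distr[OF pm that]
  by (subst measure_restrict_space[OF Hs]) (auto simp: space_restrict_space Int_commute)
 have "{x :: real^2. norm x <= B} \<in> sets borel" by measurable
 thus "AE x in proj_measure H. norm x <= B" unfolding proj_measure_def by (subst AE_distr_iff[OF pm]) (simp_all add: norm_pr)
qed

text \<open>Markov's inequality for the tube mass, averaged over words and points: Kaufman's and
  Falconer's estimates both bound this average through \<open>tb\<close>. The two regularity
  constants cost \<open>exp (e / 4 * n)\<close> each, and the threshold \<open>t n\<close> leaves
  room for both.\<close>

lemma tube_regularI:
 assumes P: "ball_regular d" and Q: "direction_regular s" and ds: "0 <= d" "0 <= s"
  and tb: "\<And>n L E J v c eta. slices (J :: 'k list set) c v (dec chi n) L s eta B E d ==>
   (\<Sum>w\<in>J. c w * measure (eta \<Otimes>\<^sub>M eta) {q. \<bar>wedge (v w) (fst q - snd q)\<bar> <= dec chi n})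
    <= L * E * ((a + b * real n) * dec (chi * D) n)"
 shows "tube_regular D"
 unfolding tube_regular_def
proof (intro allI impI)
 fix e :: real assume e: "e > 0"
 \<comment> \<open>Ball bounds of index \<open>n\<close> reach down to \<open>exp (- n)\<close>, but
   tubes have width \<open>exp (- chi * n)\<close>; the index \<open>q * n\<close> reaches far
   enough.\<close>
 obtain q :: nat where q: "chi <= real q" using real_arch_simple by blast
 have q0: "real q > 0" using chi_pos q by linarith
 have "e / (4 * real q) > 0" using e q0 by simp
 from P[unfolded ball_regular_def, rule_format, OF this] obtain H0 where "ball_bound (e / (4 * real q)) d H0" by blast
 note H0 = ball_boundD[OF this]
 have "e / 4 > 0" using e by simp
 from Q[unfolded direction_regular_def, rule_format, OF this] obtain J where "direction_bound (e / 4) s J" by blast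
 note J = this[unfolded direction_bound_def, THEN conjunct1] this[unfolded direction_bound_def, THEN conjunct2]
 define H where "H n = H0 (q * n)" for n
 have Hs [measurable]: "H n \<in> sets left_words" for n by (simp add: H_def H0)
 have Hc: "expsmall (%n. prob (- H n))" unfolding H_def
  by (rule expsmall_reindex[OF H0(2) q0, of 0]) simp
 have Hb: "EV n. \<forall>x r. dec chi n <= r --> r <= 1 -->
    prob (H n \<inter> {i. norm (pr i - x) <= r}) <= exp (e / 4 * real n) * r powr d"
 proof -
  have "filterlim (%n. q * n) sequentially sequentially" 
   using q0 by (intro mult_nat_left_at_top) simp
  from eventually_compose_filterlim[OF H0(3) this] show ?thesis
  proof eventually_elim
   case (elim n)
   have "exp (- real (q * n)) <= dec chi n" using mult_right_mono[OF q, of "real n"] by simp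
   moreover have "exp (e / (4 * real q) * real (q * n)) = exp (e / 4 * real n)" using q0 by simp
   ultimately show ?case using elim unfolding H_def by (metis (no_types, lifting) order.trans)
  qed
 qed
 define t where "t n = exp ((e - chi * D) * real n)" for n
 define X where "X w = - H (length w) \<union> {x \<in> H (length w). t (length w) <= prob (H (length w) \<inter> tube (length w) w x)}" for w
 \<comment> \<open>Words outside \<open>J\<close> count as entirely bad. Measurability of
   \<open>X w\<close> is established for large lengths; elsewhere the whole space is a safe
   value.\<close>
 define Bd where "Bd w = (if J w \<and> X w \<in> sets left_words then X w else UNIV)" for w
 have main: "EV n. (\<Sum>w\<in>words n. m w * prob (Bd w)) <=
   prob (- H n) + (msum n (%w. \<not> J w) + (a + b * real n) * dec (e / 2) n)"
  using Hb J(2)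
 proof eventually_elim
  case (elim n)
  let ?rho = "dec chi n" and ?L = "exp (e / 4 * real n)" and ?eta = "proj_measure (H n)"
  have L1: "?L >= 1" using e by simp
  have big: "1 <= ?L * r powr u" if "r > 1" "u >= 0" for r u
   using mult_mono[OF L1 ge_one_powr_ge_zero[of r u]] that by simp
  have eta: "measure ?eta S = prob (H n \<inter> pr -` S)" if "S \<in> sets borel" for S
   using proj_measure(3)[OF Hs that] .
  interpret S: slices "{w \<in> words n. J w}" m dir ?rho ?L s ?eta B ?L d
  proof (intro slices.intro direction_mass.intro ball_mass.intro)
   show "?rho <= 1" using chi_pos by simp
   show "finite {w \<in> words n. J w}" by (simp del: in_words)
   fix th :: "real^2" and r :: real assume th: "norm th = 1" and r: "?rho <= r"
   have "(\<Sum>w | w \<in> {w \<in> words n. J w} \<and> \<bar>wedge (dir w) th\<bar> <= r. m w) = msum n (%w. J w \<and> \<bar>wedge (dir w) th\<bar> <= r)"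
    by (simp add: msum_def conj_assoc)
   also have "... <= ?L * r powr s"
   proof (cases "r <= 1")
    case True
    thus ?thesis using elim(2) th r by blast
   next
    case False
    thus ?thesis using msum_le_1[of n "%w. J w \<and> \<bar>wedge (dir w) th\<bar> <= r"] big[of r s] ds by linarith
   qed
   finally show "(\<Sum>w | w \<in> {w \<in> words n. J w} \<and> \<bar>wedge (dir w) th\<bar> <= r. m w) <= ?L * r powr s" .
  next
   show "finite_measure ?eta" "sets ?eta = sets borel" "AE x in ?eta. norm x <= B" by (rule proj_measure[OF Hs])+
   show "measure ?eta UNIV <= 1" by (simp add: eta)
   fix x :: "real^2" and r :: real assume r: "?rho <= r"
   have "pr -` cball x r = {i. norm (pr i - x) <= r}" by (auto simp: dist_norm norm_minus_commute)
   hence eq: "measure ?eta (cball x r) = prob (H n \<inter> {i. norm (pr i - x) <= r})" by (simp add: eta)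
   show "measure ?eta (cball x r) <= ?L * r powr d"
   proof (cases "r <= 1")
    case True
    thus ?thesis using elim(1) r unfolding eq by blast
   next
    case False
    thus ?thesis using prob_le_1[of "H n \<inter> {i. norm (pr i - x) <= r}"] big[of r d] ds unfolding eq by linarith
   qed
  qed (use ds B_pos chi_pos dir(1) in auto)
  have t0: "t n > 0" by (simp add: t_def)
  have sec: "measure ?eta {y. \<bar>wedge (dir w) (z - y)\<bar> <= ?rho} = prob (H n \<inter> {y. \<bar>wedge (dir w) (z - pr y)\<bar> <= ?rho})" for w z
   using S.section_sets[of w z] unfolding proj_measure(2)[OF Hs] by (subst eta) (auto simp: vimage_def)
  have Xb: "X w \<in> sets left_words \<and> prob (X w) <= prob (- H n) + measure (?eta \<Otimes>\<^sub>M ?eta) (S.tube w) / t n" if w: "length w = n" for w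
  proof -
   let ?Z = "{x. t n <= measure ?eta {y. \<bar>wedge (dir w) (x - y)\<bar> <= ?rho}}"
   note Z = S.tube_markov[OF t0, of w]
   have Xe: "X w = - H n \<union> (H n \<inter> pr -` ?Z)" unfolding X_def w tube_def vimage_def sec by auto
   have cH: "- H n \<in> sets left_words" using sets.compl_sets[OF Hs[of n]] by (simp add: Compl_eq_Diff_UNIV)
   have "pr -` ?Z \<in> sets left_words" using measurable_sets[OF pr_measurable Z(1)] by (simp only: space_left_words Int_UNIV_right)
   hence HZ: "H n \<inter> pr -` ?Z \<in> sets left_words" by (rule sets.Int[OF Hs])
   hence "X w \<in> sets left_words" unfolding Xe by (rule sets.Un[OF cH])
   moreover have "prob (X w) <= prob (- H n) + prob (H n \<inter> pr -` ?Z)"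
    unfolding Xe by (rule measure_Un_le; simp only: sets_mu cH HZ)
   moreover have "prob (H n \<inter> pr -` ?Z) = measure ?eta ?Z" by (rule eta[OF Z(1), symmetric])
   ultimately show ?thesis using Z(2) by linarith
  qed
  have "(\<Sum>w\<in>words n. m w * prob (Bd w)) <= (\<Sum>w\<in>words n. m w * prob (- H n) +
    ((if \<not> J w then m w else 0) + (if J w then m w * measure (?eta \<Otimes>\<^sub>M ?eta) (S.tube w) else 0) / t n))"
  proof (rule sum_mono)
   fix w :: "'k list" assume "w \<in> words n"
   hence w: "length w = n" by simp
   show "m w * prob (Bd w) <= m w * prob (- H n) +
    ((if \<not> J w then m w else 0) + (if J w then m w * measure (?eta \<Otimes>\<^sub>M ?eta) (S.tube w) else 0) / t n)"
   proof (cases "J w")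
    case True
    have "m w * prob (X w) <= m w * (prob (- H n) + measure (?eta \<Otimes>\<^sub>M ?eta) (S.tube w) / t n)"
     using Xb[OF w] by (intro mult_left_mono) auto
    thus ?thesis using True Xb[OF w] by (simp add: Bd_def distrib_left)
   next
    case False
    thus ?thesis using mult_left_mono[OF prob_le_1[of UNIV] m_nonneg[of w]] by (simp add: Bd_def add_increasing)
   qed
  qed
  also have "... = prob (- H n) + (msum n (%w. \<not> J w) + (\<Sum>w\<in>{w \<in> words n. J w}. m w * measure (?eta \<Otimes>\<^sub>M ?eta) (S.tube w)) / t n)"
   by (simp add: sum.distrib sum_distrib_right[symmetric] sum_divide_distrib[symmetric] msum_def sum.inter_filter[symmetric] del: in_words)
  also have "(\<Sum>w\<in>{w \<in> words n. J w}. m w * measure (?eta \<Otimes>\<^sub>M ?eta) (S.tube w)) / t n <=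
    ?L * ?L * ((a + b * real n) * dec (chi * D) n) / t n"
   using t0 by (intro divide_right_mono tb S.slices_axioms) auto
  also have "... = (a + b * real n) * (?L * ?L * dec (chi * D) n / t n)" by simp
  also have "?L * ?L * dec (chi * D) n / t n = dec (e / 2) n"
   unfolding t_def exp_diff[symmetric] exp_add[symmetric] by (simp add: algebra_simps)
  finally show ?case by simp
 qed
 have "expsmall (%n. \<Sum>w\<in>words n. m w * prob (Bd w))"
  by (rule expsmall_mono[OF _ main], intro expsmall_add Hc J(1), rule expsmallI[of "e / 2" _ a b]) (use e in auto)
 moreover have "\<forall>n w x. length w = n --> x \<notin> Bd w --> x \<in> H n \<and> prob (H n \<inter> tube n w x) <= exp ((e - chi * D) * real n)"
  by (auto simp: Bd_def X_def t_def split: if_splits)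
 moreover have "\<forall>w. Bd w \<in> sets left_words" using sets.top[of "left_words :: 'k left_word measure"] by (simp add: Bd_def)
 ultimately show "\<exists>H B. (\<forall>n. H n \<in> sets left_words) \<and> (\<forall>w. B w \<in> sets left_words) \<and>
   expsmall (%n. \<Sum>w\<in>words n. m w * prob (B w)) \<and>
   (\<forall>n w x. length w = n --> x \<notin> B w --> x \<in> H n \<and> prob (H n \<inter> tube n w x) <= exp ((e - chi * D) * real n))"
  using Hs by blast
qed

lemma tube_regular_min:
 assumes P: "ball_regular d" and Q: "direction_regular s" and ds: "0 <= d" "0 <= s"
 shows "tube_regular (min d s)"
proof (rule tube_regularI[OF P Q ds])
 let ?c = "2 powr d * (2 * B + 1) powr (d + s)"
 fix n L E and J :: "'k list set" and v c eta
 assume "slices J c v (dec chi n) L s eta B E d"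
 then interpret S: slices J c v "dec chi n" L s eta B E d .
 \<comment> \<open>Enough dyadic scales to lead from the tube width to the diameter
   \<open>2 * B\<close>; by \<open>exp_half_le_power\<close> a number linear in \<open>n\<close>
   suffices.\<close>
 define N where "N = nat \<lceil>2 * (chi * real n + 2 * B)\<rceil>"
 have pos: "0 <= 2 * (chi * real n + 2 * B)" using chi_pos B_pos by simp
 hence N: "2 * (chi * real n + 2 * B) <= real N" "real N <= 2 * (chi * real n + 2 * B) + 1"
  unfolding N_def by linarith+
 have "2 * B < exp (2 * B)" using exp_ge_add_one_self[of "2 * B"] by linarith
 also have "... <= exp (- chi * real n + real N / 2)" using N by simp
 also have "... <= dec chi n * 2 ^ N" unfolding exp_add by (intro mult_left_mono exp_half_le_power) auto
 finally have "(\<Sum>w\<in>J. c w * measure (eta \<Otimes>\<^sub>M eta) (S.tube w)) <=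
   L * E * 2 powr d * (2 * B + 1) powr (d + s) * (real N + 1) * dec chi n powr min d s"
  by (rule S.kaufman)
 also have "... = L * E * (?c * (real N + 1) * dec (chi * min d s) n)"
  by (simp add: exp_powr_real mult_ac)
 also have "... <= L * E * ((?c * (4 * B + 2) + ?c * (2 * chi) * real n) * dec (chi * min d s) n)"
 proof (intro mult_left_mono mult_right_mono)
  have "?c * (real N + 1) <= ?c * (4 * B + 2 + 2 * chi * real n)" using N(2) by (intro mult_left_mono) auto
  thus "?c * (real N + 1) <= ?c * (4 * B + 2) + ?c * (2 * chi) * real n" by (simp add: algebra_simps)
 qed (use S.L S.D0 in auto)
 finally show "(\<Sum>w\<in>J. c w * measure (eta \<Otimes>\<^sub>M eta) (S.tube w)) <=
  L * E * ((?c * (4 * B + 2) + ?c * (2 * chi) * real n) * dec (chi * min d s) n)" .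
qed

lemma tube_regular_1:
 assumes P: "ball_regular d" and Q: "direction_regular s" and ds: "0 <= d" "0 <= s" and ds2: "d + s >= 2"
 shows "tube_regular 1"
proof (rule tube_regularI[OF P Q ds])
 let ?c = "2 * exp (1 / 2 + 2 * B^2) * psm s * 4 powr s * exp (1 / 4) * psm d * 4 powr d"
 fix n L E and J :: "'k list set" and v c eta
 assume "slices J c v (dec chi n) L s eta B E d"
 then interpret S: slices J c v "dec chi n" L s eta B E d .
 have c0: "?c >= 0" using psm_pos[of s] psm_pos[of d] by simp
 let ?rho = "dec chi n"
 have "\<exists>k. 2 <= 2 ^ k * ?rho"
 proof -
  obtain k where "2 / ?rho < 2 ^ k" using real_arch_pow[of 2 "2 / ?rho"] by auto
  thus ?thesis by (intro exI[of _ k]) (simp add: pos_divide_less_eq less_imp_le)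
 qed
 define k where "k = (LEAST k. 2 <= 2 ^ k * ?rho)"
 have k1: "2 <= 2 ^ k * ?rho" unfolding k_def by (rule LeastI_ex) fact
 have k2: "2 ^ k * ?rho <= 4"
 proof (cases k)
  case 0
  thus ?thesis using S.rho(2) by (simp del: exp_le_one_iff)
 next
  case (Suc l)
  hence "\<not> 2 <= 2 ^ l * ?rho" using not_less_Least[of l "%k. 2 <= 2 ^ k * ?rho"] by (simp add: k_def)
  thus ?thesis using Suc by simp
 qed
 have "exp (real k / 2 - chi * real n) <= 2 ^ k * ?rho"
  using mult_right_mono[OF exp_half_le_power[of k], of ?rho] by (simp add: exp_add[symmetric])
 also have "... <= 4" by (rule k2)
 also have "(4::real) <= exp 3" using exp_ge_add_one_self[of "3::real"] by simp
 finally have kn: "real k + 1 <= 7 + 2 * chi * real n" by simp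
 have "(\<Sum>w\<in>J. c w * measure (eta \<Otimes>\<^sub>M eta) (S.tube w)) <= L * E * ?c * (real k + 1) * ?rho"
  by (rule S.falconer[OF k1 k2 ds2])
 also have "... = L * E * (?c * (real k + 1) * ?rho)" by simp
 also have "... <= L * E * ((?c * 7 + ?c * (2 * chi) * real n) * ?rho)"
 proof (intro mult_left_mono mult_right_mono)
  have "?c * (real k + 1) <= ?c * (7 + 2 * chi * real n)" using kn c0 by (rule mult_left_mono)
  thus "?c * (real k + 1) <= ?c * 7 + ?c * (2 * chi) * real n" by (simp add: algebra_simps)
 qed (use S.L S.D0 in auto)
 finally show "(\<Sum>w\<in>J. c w * measure (eta \<Otimes>\<^sub>M eta) (S.tube w)) <=
  L * E * ((?c * 7 + ?c * (2 * chi) * real n) * dec (chi * 1) n)" by simp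
qed

end


section \<open>From tubes back to balls: the improvement step\<close>

lemma powr_weaken:
 fixes r :: real
 assumes "exp (- a) <= r" "r <= 1" "d - de <= d'" "de >= 0"
 shows "r powr d' <= exp (de * a) * r powr d"
proof -
 have r0: "r > 0" using assms(1) exp_gt_zero less_le_trans by blast
 have ln: "- a <= ln r" using assms(1) r0 by (simp add: ln_ge_iff)
 have "r powr d' <= r powr (d - de)" using assms r0 by (intro powr_mono') auto
 also have "... = exp (- de * ln r) * r powr d" using r0 by (simp add: powr_def exp_add[symmetric] left_diff_distrib)
 also have "... <= exp (de * a) * r powr d" using mult_left_mono[OF ln assms(4)] by (intro mult_right_mono) auto
 finally show ?thesis .
qed

text \<open>Monotonicity fills the gaps between the scales \<open>exp (- a * k)\<close>. Radii above
  the first controlled scale get the trivial bound one, which costs the factor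
  \<open>exp (b * (y0 + 1))\<close>.\<close>

lemma scale_interpolation:
 fixes F :: "real => real"
 assumes ab: "a > 0" "b >= 0" and mono: "\<And>r r'. r <= r' ==> F r <= F r'" and le1: "\<And>r. F r <= 1"
  and scale: "\<And>k. y0 <= real k ==> real k <= y1 ==> F (dec a k) <= dec b k"
  and r: "exp (- a * y1) <= r" "r <= 1" and y0: "y0 >= 0"
 shows "F r <= exp (b * (y0 + 1)) * r powr (b / a)"
proof -
 have r0: "r > 0" using r(1) exp_gt_zero less_le_trans by blast
 define y where "y = - ln r / a"
 have ry: "r = exp (- a * y)" using ab r0 by (simp add: y_def)
 have y: "0 <= y" using ab r(2) r0 by (simp add: y_def divide_nonpos_pos)
 have y1: "y <= y1" using r(1) ab unfolding ry by simp
 have pw: "r powr (b / a) = exp (- b * y)" using ab unfolding ry by (simp add: exp_powr_real)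
 define k where "k = nat \<lfloor>y\<rfloor>"
 have k: "real k <= y" "y < real k + 1" using y by (simp_all add: k_def)
 have "F r <= exp (b * (y0 + 1) + - b * y)"
 proof (cases "y0 <= real k")
  case True
  have "F r <= F (dec a k)" unfolding ry using k ab by (intro mono) simp
  also have "... <= dec b k" using True k(1) y1 by (intro scale) auto
  also have "... <= exp (b * (y0 + 1) + - b * y)"
   using mult_left_mono[of y "real k + 1" b] mult_nonneg_nonneg[OF ab(2) y0] k ab by (simp add: algebra_simps)
  finally show ?thesis .
 next
  case False
  hence "b * y <= b * (y0 + 1)" using k ab by (intro mult_left_mono) auto
  hence "1 <= exp (b * (y0 + 1) + - b * y)" by simp
  thus ?thesis using le1[of r] by linarith
 qed
 thus ?thesis unfolding pw exp_add .
qed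

context affine_system
begin

lemma ball_sets: "{i. norm (pr i - x) <= r} \<in> sets left_words"
 using measurable_sets[OF pr_measurable, of "cball x r"] by (simp add: vimage_def dist_norm norm_minus_commute)

lemma tube_sets: "tube n w x \<in> sets left_words"
proof -
 have "closed {y. \<bar>wedge (dir w) (pr x - y)\<bar> <= dec chi n}" unfolding wedge_def by (intro closed_Collect_le continuous_intros)
 from measurable_sets[OF pr_measurable borel_closed[OF this]] show ?thesis by (simp add: vimage_def tube_def)
qed

text \<open>One scale per length suffices. The radii down to \<open>exp (- n)\<close> are reached by
  lengths from \<open>eta * n\<close> to \<open>q0 * n\<close>, whose exceptional sets are removed
  together. Shorter lengths would spoil exponential smallness, so the large radii get the trivial
  bound, at a cost below \<open>exp (e * n)\<close>.\<close>

lemma ball_regularI: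
 assumes ab: "a > 0" "b >= 0" and G: "\<And>n. G n \<in> sets left_words" "expsmall (%n. prob (- G n))"
  and single: "EV n. \<forall>x. prob (G n \<inter> {i. norm (pr i - x) <= dec a n}) <= dec b n"
 shows "ball_regular (b / a)"
 unfolding ball_regular_def
proof (intro allI impI)
 fix e :: real assume e: "e > 0"
 obtain q0 :: nat where "1 / a <= real q0" using real_arch_simple by blast
 hence q: "1 <= a * real q0" using ab by (simp add: divide_le_eq mult.commute)
 hence q1: "real q0 > 0" using ab by (cases "q0 = 0") auto
 define eta where "eta = e / (2 * (b + 1))"
 have eta: "eta > 0" "b * eta <= e / 2" using e ab by (simp_all add: eta_def field_simps)
 define I where "I n = {k. k <= q0 * n \<and> eta / real q0 * real (q0 * n) <= real k}" for n
 have I: "finite (I n)" "k \<in> I n \<longleftrightarrow> k <= q0 * n \<and> eta * real n <= real k" for n k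
  using q1 by (auto simp: I_def intro: finite_subset[of _ "{..q0 * n}"])
 define H where "H n = UNIV - (\<Union>k\<in>I n. - G k)" for n
 have cG: "- G k \<in> sets left_words" for k using sets.compl_sets[OF G(1)[of k]] by (simp add: Compl_eq_Diff_UNIV)
 have un: "(\<Union>k\<in>I n. - G k) \<in> sets left_words" for n by (intro sets.finite_UN I cG)
 have Hs: "H n \<in> sets left_words" for n using sets.compl_sets[OF un[of n]] by (simp add: H_def)
 have tail: "expsmall (%n. \<Sum>k\<in>I n. prob (- G k))"
  unfolding I_def by (rule expsmall_reindex[OF expsmall_tail_sum[OF G(2)] q1, where b = 0]) (use eta q1 in auto)
 have "expsmall (%n. prob (- H n))"
 proof (rule expsmall_mono[OF tail], intro always_eventually allI)
  fix n
  have "- H n = (\<Union>k\<in>I n. - G k)" by (auto simp: H_def)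
  thus "prob (- H n) <= (\<Sum>k\<in>I n. prob (- G k))" using measure_UNION_le[of "I n" "%k. - G k" mu] I(1) cG by simp
 qed
 moreover obtain n0 where n0: "\<And>n x. n >= n0 ==> prob (G n \<inter> {i. norm (pr i - x) <= dec a n}) <= dec b n"
  using single unfolding eventually_sequentially by blast
 have "EV n. real n0 <= eta * real n" and "EV n. b <= e / 2 * real n"
  using eta e by real_asymp+
 hence "EV n. \<forall>x r. exp (- real n) <= r --> r <= 1 -->
    prob (H n \<inter> {i. norm (pr i - x) <= r}) <= exp (e * real n) * r powr (b / a)"
 proof eventually_elim
  case (elim n)
  show ?case
  proof (intro allI impI)
   fix x r assume r: "exp (- real n) <= r" "r <= 1"
   have "prob (H n \<inter> {i. norm (pr i - x) <= r}) <= exp (b * (eta * real n + 1)) * r powr (b / a)"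
   proof (rule scale_interpolation[OF ab, where ?y1.0 = "real q0 * real n"])
    show "prob (H n \<inter> {i. norm (pr i - x) <= r}) <= prob (H n \<inter> {i. norm (pr i - x) <= r'})" if "r <= r'" for r r'
     using that by (intro finite_measure_mono) (auto intro!: sets.Int Hs ball_sets)
    fix k assume k: "eta * real n <= real k" "real k <= real q0 * real n"
    hence "k \<in> I n" using I(2) by (simp flip: of_nat_mult)
    hence "prob (H n \<inter> {i. norm (pr i - x) <= dec a k}) <= prob (G k \<inter> {i. norm (pr i - x) <= dec a k})"
     by (intro finite_measure_mono) (auto simp: H_def intro!: sets.Int G ball_sets)
    also have "... <= dec b k" using elim(1) k(1) by (intro n0) linarith
    finally show "prob (H n \<inter> {i. norm (pr i - x) <= dec a k}) <= dec b k" .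
   next
    have "exp (- a * (real q0 * real n)) <= exp (- real n)" using mult_right_mono[OF q, of "real n"] by (simp add: mult_ac)
    with r show "exp (- a * (real q0 * real n)) <= r" by linarith
   qed (use r eta in auto)
   also have "... <= exp (e * real n) * r powr (b / a)"
   proof (intro mult_right_mono)
    have "b * eta * real n <= e / 2 * real n" using eta by (intro mult_right_mono) auto
    hence "b * (eta * real n + 1) <= e * real n" using elim(2) by (simp add: distrib_left mult.assoc)
    thus "exp (b * (eta * real n + 1)) <= exp (e * real n)" by simp
   qed simp
   finally show "prob (H n \<inter> {i. norm (pr i - x) <= r}) <= exp (e * real n) * r powr (b / a)" .
  qed
 qed
 ultimately show "\<exists>H. ball_bound e (b / a) H" unfolding ball_bound_def using Hs by blast
qed

lemma ball_regular_closed: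
 assumes "\<And>de. de > 0 ==> \<exists>d'\<ge>d - de. ball_regular d'"
 shows "ball_regular d"
 unfolding ball_regular_def
proof (intro allI impI)
 fix e :: real assume e: "e > 0"
 hence e2: "e / 2 > 0" by simp
 obtain d' where d': "d' >= d - e / 2" "ball_regular d'" using assms[OF e2] by blast
 obtain H where "ball_bound (e / 2) d' H" using d'(2) e2 unfolding ball_regular_def by blast
 note H = ball_boundD[OF this]
 have le: "exp (e / 2 * real n) * r powr d' <= exp (e * real n) * r powr d" if r: "exp (- real n) <= r" "r <= 1" for n r
 proof -
  have "exp (e / 2 * real n) * r powr d' <= exp (e / 2 * real n) * (exp (e / 2 * real n) * r powr d)"
   using r d'(1) e by (intro mult_left_mono powr_weaken) auto
  thus ?thesis unfolding mult.assoc[symmetric] exp_add[symmetric] by simp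
 qed
 have "EV n. \<forall>x r. exp (- real n) <= r --> r <= 1 -->
    prob (H n \<inter> {i. norm (pr i - x) <= r}) <= exp (e * real n) * r powr d"
  using H(3) by eventually_elim (meson le order_trans)
 with H(1,2) show "\<exists>H. ball_bound e d H" unfolding ball_bound_def by blast
qed

lemma ball_regular_mono: "ball_regular d ==> d' <= d ==> ball_regular d'"
 by (rule ball_regular_closed, rule exI[of _ d]) auto

lemma ball_regular_0: "ball_regular 0"
proof -
 have "expsmall (%n. 0)" by (rule expsmallI[of 1 _ 0 0]) auto
 hence "ball_regular (0 / 1)" by (intro ball_regularI[where G = "%_. UNIV"]) (auto simp: sets.top[of left_words, simplified])
 thus ?thesis by simp
qed

text \<open>The preimage under the affine map of a ball of radius below \<open>a2 w\<close> lies in a tube around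
 the direction contracted by \<open>P w\<close>; strong separation makes the ball see only one cylinder.\<close>

lemma ball_in_tube:
 assumes w: "typical e (pre i n)" and ij: "norm (pr i - pr j) <= 2 * dec (xss + 2 * e) n"
  and n: "2 * dec e n < gap" "2 * K * dec e n <= 1"
 shows "j \<in> cyl (pre i n)" "shl n j \<in> tube n (pre i n) (shl n i)"
proof -
 let ?w = "pre i n" and ?r = "dec (xss + 2 * e) n"
 have i: "i \<in> cyl ?w" by (simp add: in_cyl)
 have "2 * ?r = (2 * dec e n) * dec (xss + e) n" by (simp add: exp_add[symmetric] algebra_simps)
 also have "... < gap * dec (xss + e) n" using n(1) by (intro mult_strict_right_mono) auto
 also have "... <= gap * a2 ?w" using typ_bounds(6)[OF w] gap(1) by (intro mult_left_mono) auto
 finally show j: "j \<in> cyl ?w" using ij by (intro separation[OF i]) linarith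
 let ?z = "pr (shl n i) - pr (shl n j)"
 have "a1 ?w * \<bar>wedge ?z (dir ?w)\<bar> <= K * norm (P ?w *v ?z)" by (rule wedge_dir_le)
 also have "P ?w *v ?z = pr i - pr j" using pr_diff[OF i j] by simp
 also have "K * norm (pr i - pr j) <= K * (2 * ?r)" using ij K(1) by (intro mult_left_mono) auto
 also have "K * (2 * ?r) = (2 * K * dec e n) * (dec (xs + e) n * dec chi n)"
  by (simp add: exp_add[symmetric] chi_def algebra_simps)
 also have "... <= 1 * (dec (xs + e) n * dec chi n)" using n(2) by (intro mult_right_mono) auto
 also have "... <= a1 ?w * dec chi n" using typ_bounds(4)[OF w] by (simp add: mult_right_mono)
 finally have "\<bar>wedge ?z (dir ?w)\<bar> <= dec chi n" using a1_pos[of ?w] by (simp only: mult_le_cancel_left_pos)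
 thus "shl n j \<in> tube n ?w (shl n i)" unfolding tube_def wedge_commute[of "dir ?w"] by simp
qed

text \<open>A ball of radius slightly below \<open>a2 w\<close> sees one cylinder, of mass about
  \<open>exp (- h * n)\<close>, and inside it one tube, of relative mass about
  \<open>exp (- chi * D * n)\<close>; the quasi-Bernoulli bound multiplies the two.\<close>

lemma ball_regular_of_tube:
 assumes T: "tube_regular D" and D: "D >= 0"
 shows "ball_regular ((h + chi * D) / xss)"
proof (cases "h + chi * D = 0")
 case True
 thus ?thesis using ball_regular_0 by simp
next
 case False
 let ?b = "h + chi * D"
 have b: "?b > 0" using False h_nonneg chi_pos D by (simp add: less_le)
 show ?thesis
 proof (rule ball_regular_closed)
  fix de :: real assume de: "de > 0"
  have "((%e. (?b - 3 * e) / (xss + 2 * e)) \<longlongrightarrow> (?b - 3 * 0) / (xss + 2 * 0)) (at_right 0)"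
   using xss_pos by (intro tendsto_intros) auto
  hence "\<forall>\<^sub>F e in at_right 0. (?b - 3 * e) / (xss + 2 * e) > ?b / xss - de" using de by (intro order_tendstoD(1)) auto
  moreover have "\<forall>\<^sub>F e in at_right 0. e < ?b / 3" using b by (intro order_tendstoD(2)[OF tendsto_ident_at]) auto
  moreover have "\<forall>\<^sub>F e in at_right (0::real). e > 0" by (rule eventually_at_right_less)
  ultimately have "\<forall>\<^sub>F e in at_right 0. (?b - 3 * e) / (xss + 2 * e) > ?b / xss - de \<and> e < ?b / 3 \<and> e > 0" by eventually_elim auto
  then obtain e where e: "(?b - 3 * e) / (xss + 2 * e) > ?b / xss - de" "e < ?b / 3" "e > 0"
   using eventually_happens'[OF trivial_limit_at_right_real] by blast
  obtain H Bd where H: "\<And>n. H n \<in> sets left_words" "\<And>w. Bd w \<in> sets left_words"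
   "expsmall (%n. \<Sum>w\<in>words n. m w * prob (Bd w))"
   "\<And>n w x. length w = n ==> x \<notin> Bd w ==> x \<in> H n \<and> prob (H n \<inter> tube n w x) <= exp ((e - chi * D) * real n)"
   using T e(3) unfolding tube_regular_def by blast
  let ?Y = "%w. {i \<in> cyl w. shl (length w) i \<in> Bd w}"
  define N where "N n = {i. \<not> typical e (pre i n)} \<union> (\<Union>w\<in>words n. ?Y w)" for n
  have Y: "?Y w \<in> sets left_words" for w
  proof -
   have "shl (length w) -` Bd w \<in> sets left_words" using measurable_sets[OF shl_measurable H(2)[of w]] by simp
   from sets.Int[OF sets_cyl[of w] this] show ?thesis by (simp add: Collect_conj_eq vimage_def)
  qed
  hence UY: "(\<Union>w\<in>words n. ?Y w) \<in> sets left_words" for n by (intro sets.finite_UN finite_words)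
  have pre: "{i. \<not> typical e (pre i n)} \<in> sets left_words" for n by (rule sets_prefix)
  have Ns: "N n \<in> sets left_words" for n unfolding N_def by (intro sets.Un pre UY)
  have cN: "expsmall (%n. prob (- (- N n)))"
  proof (rule expsmall_mono[OF expsmall_add[OF expsmall_typ[OF e(3)] expsmall_cmult[OF H(3), of C]]], use C_ge_1 in simp, intro always_eventually allI)
   fix n
   have "prob (N n) <= prob {i. \<not> typical e (pre i n)} + prob (\<Union>w\<in>words n. ?Y w)"
    unfolding N_def by (rule measure_Un_le; simp only: sets_mu pre UY)
   also have "prob (\<Union>w\<in>words n. ?Y w) <= (\<Sum>w\<in>words n. prob (?Y w))"
    by (rule measure_UNION_le) (use Y in auto)
   also have "... <= (\<Sum>w\<in>words n. C * m w * prob (Bd w))" by (intro sum_mono measure_cyl_shift_le H)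
   finally show "prob (- (- N n)) <= msum n (%w. \<not> typical e w) + C * (\<Sum>w\<in>words n. m w * prob (Bd w))"
    by (simp add: msum_prefix_eq[of "%w. \<not> typical e w" n] sum_distrib_left mult.assoc)
  qed
  have cNs: "- N n \<in> sets left_words" for n using sets.compl_sets[OF Ns[of n]] by (simp add: Compl_eq_Diff_UNIV)
  have z: "(%n. a * dec e n) ----> 0" for a :: real using e(3) by real_asymp
  have "EV n. 2 * dec e n < gap" using gap(1) by (intro order_tendstoD(2)[OF z])
  moreover have "EV n. 2 * K * dec e n < 1" by (intro order_tendstoD(2)[OF z]) simp
  hence "EV n. 2 * K * dec e n <= 1" by (rule eventually_mono) simp
  moreover have "EV n. C <= exp (e * real n)" using e(3) by real_asymp
  ultimately have "EV n. \<forall>x. prob (- N n \<inter> {i. norm (pr i - x) <= dec (xss + 2 * e) n}) <= dec (?b - 3 * e) n"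
  proof eventually_elim
   case (elim n)
   show ?case
   proof
    fix x
    let ?S = "- N n \<inter> {i. norm (pr i - x) <= dec (xss + 2 * e) n}"
    show "prob ?S <= dec (?b - 3 * e) n"
    proof (cases "?S = {}")
     case False
     \<comment> \<open>The centre \<open>x\<close> need not be a coded point, so the tube is centred
       at a good point of the ball instead; this accounts for the doubled radius in
       \<open>ball_in_tube\<close>.\<close>
     then obtain i where i: "i \<in> ?S" by blast
     let ?w = "pre i n"
     have ty: "typical e ?w" using i by (simp add: N_def)
     have nB: "shl n j \<notin> Bd ?w" if "j \<in> - N n" "j \<in> cyl ?w" for j
      using that by (auto simp: N_def)
     note si = H(4)[OF _ nB, of n i]
     have "?S \<subseteq> {j \<in> cyl ?w. shl (length ?w) j \<in> H n \<inter> tube n ?w (shl n i)}"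
     proof
      fix j assume j: "j \<in> ?S"
      have "norm (pr i - pr j) <= norm (pr i - x) + norm (pr j - x)" using norm_triangle_ineq4[of "pr i - x" "pr j - x"] by simp
      also have "... <= 2 * dec (xss + 2 * e) n" using i j by simp
      finally have ij: "norm (pr i - pr j) <= 2 * dec (xss + 2 * e) n" .
      note bt = ball_in_tube[OF ty ij elim(1,2)]
      have "shl n j \<in> H n" using H(4)[OF _ nB[OF _ bt(1)]] j by simp
      with bt show "j \<in> {j \<in> cyl ?w. shl (length ?w) j \<in> H n \<inter> tube n ?w (shl n i)}" by simp
     qed
     hence "prob ?S <= prob {j \<in> cyl ?w. shl (length ?w) j \<in> H n \<inter> tube n ?w (shl n i)}"
     proof (rule finite_measure_mono)
      have HT: "H n \<inter> tube n ?w (shl n i) \<in> sets left_words" by (intro sets.Int H tube_sets)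
      have "shl (length ?w) -` (H n \<inter> tube n ?w (shl n i)) \<in> sets left_words"
       using measurable_sets[OF shl_measurable HT, of "length ?w"] by (simp only: space_left_words Int_UNIV_right)
      from sets.Int[OF sets_cyl[of ?w] this] show "{j \<in> cyl ?w. shl (length ?w) j \<in> H n \<inter> tube n ?w (shl n i)} \<in> sets mu"
       unfolding sets_mu by (simp only: Collect_conj_eq vimage_def Collect_mem_eq)
     qed
     also have "... <= C * m ?w * prob (H n \<inter> tube n ?w (shl n i))" by (intro measure_cyl_shift_le sets.Int H tube_sets)
     also have "... <= exp (e * real n) * dec (h - e) n * exp ((e - chi * D) * real n)"
      using elim(3) typ_bounds(1)[OF ty] H(4)[OF _ nB, of n i] i C_ge_1 by (intro mult_mono) (auto simp: in_cyl)
     also have "... = dec (?b - 3 * e) n" by (simp add: exp_add[symmetric] algebra_simps)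
     finally show ?thesis .
    qed simp
   qed
  qed
  hence "ball_regular ((?b - 3 * e) / (xss + 2 * e))"
   using e xss_pos by (intro ball_regularI[where G = "%n. - N n", OF _ _ cNs cN]) auto
  thus "\<exists>d'\<ge>?b / xss - de. ball_regular d'" using e(1) by (intro exI[of _ "(?b - 3 * e) / (xss + 2 * e)"]) simp
 qed
qed

text \<open>The map \<open>D \<mapsto> (h + chi * D) / xss\<close> has slope less than one and fixed point \<open>h / xs\<close>, so a
 supremum below the claimed value could be improved.\<close>

lemma ball_regular_dimension:
 assumes Q: "direction_regular (min 1 (h / chi))"
  and cond: "h / chi >= min 1 (h / xs) \<or> h / chi + 2 * (h / xss) > 2"
 shows "ball_regular (min (h / xs) (1 + (h - xs) / xss))"
proof -
 define d0 where "d0 = min (h / xs) (1 + (h - xs) / xss)"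
 define s where "s = min 1 (h / chi)"
 define S where "S = {d. 0 <= d \<and> d <= d0 \<and> ball_regular d}"
 have f1: "1 + (h - xs) / xss = (h + chi * 1) / xss" using xss_pos by (simp add: chi_def field_simps)
 have d00: "d0 >= 0" unfolding d0_def f1 using h_nonneg xs_pos xss_pos chi_pos by simp
 have s0: "s >= 0" using h_nonneg chi_pos by (simp add: s_def)
 have S: "S \<noteq> {}" "bdd_above S" using ball_regular_0 d00 by (auto simp: S_def bdd_above_def)
 define d where "d = Sup S"
 have "0 \<in> S" using ball_regular_0 d00 by (simp add: S_def)
 hence d_ge: "d >= 0" unfolding d_def using S by (intro cSup_upper) auto
 have d_le: "d <= d0" unfolding d_def using S by (intro cSup_least) (auto simp: S_def)
 have reg: "ball_regular d"
 proof (rule ball_regular_closed)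
  fix de :: real assume "de > 0"
  hence "d - de < Sup S" by (simp add: d_def)
  then obtain d' where "d' \<in> S" "d - de < d'" using less_cSup_iff[OF S] by blast
  thus "\<exists>d'\<ge>d - de. ball_regular d'" by (intro exI[of _ d']) (auto simp: S_def)
 qed
 have "d = d0"
 proof (rule ccontr)
  assume "d \<noteq> d0"
  with d_le have lt: "d < d0" by simp
  \<comment> \<open>\<open>d\<close> is the supremum and lies below \<open>d0\<close>, so no tube
    exponent may produce a larger ball exponent.\<close>
  have step: "(h + chi * D) / xss <= d" if "tube_regular D" "D >= 0" for D
  proof -
   have "0 <= (h + chi * D) / xss" using h_nonneg chi_pos xss_pos that by simp
   hence "min d0 ((h + chi * D) / xss) \<in> S"
    using ball_regular_mono[OF ball_regular_of_tube[OF that], of "min d0 ((h + chi * D) / xss)"] d00 by (simp add: S_def)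
   hence "min d0 ((h + chi * D) / xss) <= d" unfolding d_def by (rule cSup_upper) (rule S)
   thus ?thesis using lt by simp
  qed
  have no1: "\<not> tube_regular 1" using step[of 1] lt unfolding d0_def f1 by auto
  note tr = tube_regular_min[OF reg Q[folded s_def] d_ge s0]
  \<comment> \<open>Otherwise Kaufman's exponent is \<open>d\<close> itself, and \<open>step\<close>
    would place \<open>d\<close> at or above the fixed point \<open>h / xs\<close>.\<close>
  have sd: "s < d"
  proof (rule ccontr)
   assume "\<not> s < d"
   hence "(h + chi * d) / xss <= d" using step[OF tr] d_ge by (simp add: min_def split: if_splits)
   hence "h <= d * xs" using xss_pos by (simp add: divide_le_eq chi_def algebra_simps)
   hence "h / xs <= d" using xs_pos by (simp add: divide_le_eq)
   thus False using lt by (simp add: d0_def)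
  qed
  hence trs: "tube_regular s" using tr by (simp add: min_def split: if_splits)
  hence s1: "s = h / chi" "h / chi < 1" using no1 by (auto simp: s_def min_def split: if_splits)
  \<comment> \<open>Kaufman's exponent is now \<open>s = h / chi\<close>, which improves the ball
    exponent to \<open>2 * h / xss\<close>. The second alternative of the hypothesis thereby forces
    \<open>d + s >= 2\<close>, which is Falconer's condition.\<close>
  have "(h + h) / xss <= d" using step[OF trs s0] chi_pos unfolding s1(1) by simp
  moreover have "\<not> h / chi >= min 1 (h / xs)" using s1 sd lt by (auto simp: d0_def min_def split: if_splits)
  ultimately have "d + s >= 2" using cond by (simp add: s1 add_divide_distrib)
  from tube_regular_1[OF reg Q[folded s_def] d_ge s0 this] no1 show False by simp
 qed
 with reg show ?thesis by (simp add: d0_def)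
qed

end


section \<open>Hausdorff dimension: mass distribution and coverings\<close>

lemma le_exp_iff_mult:
 fixes x y :: real
 shows "x * exp (- y) <= 1 \<longleftrightarrow> x <= exp y"
proof -
 have "x * exp (- y) <= 1 \<longleftrightarrow> x * exp (- y) * exp y <= 1 * exp y" by (simp only: mult_le_cancel_right_pos exp_gt_zero)
 also have "x * exp (- y) * exp y = x * (exp (- y) * exp y)" by (rule mult.assoc)
 also have "exp (- y) * exp y = 1" unfolding exp_add[symmetric] by simp
 finally show ?thesis by (simp only: mult_1_left mult_1_right)
qed

text \<open>Each covering set lies in a ball about one of its points with its diameter as radius.
  Sets of diameter zero may occur, so the ball bound is first extended to radius zero by letting
  \<open>r\<close> decrease to it.\<close>

lemma mass_distribution:
 fixes \<nu> :: "'a::metric_space measure"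
 assumes fin: "finite_measure \<nu>" and sets: "sets \<nu> = sets borel" and E: "measure \<nu> E > 0"
  and c: "c > 0" and de: "de > 0" and s: "s > 0"
  and ball: "\<And>x r. 0 < r ==> r <= de ==> measure \<nu> (cball x r) <= c * r powr s"
 shows "hausdorff_measure s E \<noteq> 0"
proof -
 interpret finite_measure \<nu> by fact
 have ball0: "measure \<nu> (cball x r) <= c * r powr s" if "0 <= r" "r <= de" for x r
 proof (cases "r = 0")
  case True
  have "((%r. c * r powr s) \<longlongrightarrow> c * 0) (at_right 0)"
   using s by (intro tendsto_mult tendsto_const) (auto intro!: tendsto_eq_intros eventually_mono[OF eventually_at_right_less])
  moreover have "\<forall>\<^sub>F r in at_right 0. measure \<nu> (cball x 0) <= c * r powr s"
  proof -
   have "\<forall>\<^sub>F r in at_right (0::real). r > 0" "\<forall>\<^sub>F r in at_right 0. r < de"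
    using de by (auto intro: eventually_at_right_less order_tendstoD(2)[OF tendsto_ident_at])
   thus ?thesis
   proof eventually_elim
    case (elim r)
    have "measure \<nu> (cball x 0) <= measure \<nu> (cball x r)" using elim by (intro finite_measure_mono) (auto simp: sets)
    thus ?case using ball[of r x] elim by linarith
   qed
  qed
  ultimately have "measure \<nu> (cball x 0) <= c * 0" by (rule tendsto_lowerbound) (rule trivial_limit_at_right_real)
  thus ?thesis using True by simp
 qed (use that ball[of r x] in auto)
 have "ennreal (measure \<nu> E / c) <= (\<Sum>n. ennreal (diameter (V n) powr s))"
  if V: "E \<subseteq> (\<Union>n. V n)" "\<And>n. bounded (V n) \<and> diameter (V n) <= de" for V :: "nat => 'a set"
 proof -
  define W where "W n = (if V n = {} then {} else cball (SOME x. x \<in> V n) (diameter (V n)))" for n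
  have W: "V n \<subseteq> W n" "W n \<in> sets \<nu>" "measure \<nu> (W n) <= c * diameter (V n) powr s" for n
  proof -
   show "W n \<in> sets \<nu>" by (simp add: W_def sets)
   show "V n \<subseteq> W n"
   proof
    fix y assume y: "y \<in> V n"
    hence "(SOME x. x \<in> V n) \<in> V n" by (rule someI)
    thus "y \<in> W n" using y V(2)[of n] diameter_bounded_bound[of "V n" "SOME x. x \<in> V n" y] by (auto simp: W_def)
   qed
   show "measure \<nu> (W n) <= c * diameter (V n) powr s"
    using ball0[of "diameter (V n)"] diameter_ge_0[of "V n"] V(2)[of n] c by (simp add: W_def)
  qed
  have "E \<subseteq> (\<Union>n. W n)" using V(1) W(1) by blast
  hence "emeasure \<nu> E <= emeasure \<nu> (\<Union>n. W n)" using W(2) by (intro emeasure_mono) auto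
  also have "... <= (\<Sum>n. emeasure \<nu> (W n))" using W(2) by (intro emeasure_subadditive_countably) auto
  also have "... <= (\<Sum>n. ennreal c * ennreal (diameter (V n) powr s))"
  proof (intro suminf_le summableI)
   fix n
   show "emeasure \<nu> (W n) <= ennreal c * ennreal (diameter (V n) powr s)"
    using W(3)[of n] c by (simp add: emeasure_eq_measure ennreal_mult[symmetric] ennreal_leI)
  qed
  also have "... = ennreal c * (\<Sum>n. ennreal (diameter (V n) powr s))" by (rule ennreal_suminf_cmult)
  finally have "ennreal (1 / c) * emeasure \<nu> E <= ennreal (1 / c) * (ennreal c * (\<Sum>n. ennreal (diameter (V n) powr s)))"
   by (rule mult_left_mono) simp
  also have "... = (\<Sum>n. ennreal (diameter (V n) powr s))"
   using c by (simp add: mult.assoc[symmetric] ennreal_mult[symmetric])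
  finally show ?thesis using c by (simp add: emeasure_eq_measure ennreal_mult[symmetric])
 qed
 hence "ennreal (measure \<nu> E / c) <= hausdorff_measure s E"
  unfolding hausdorff_measure_def using de by (intro SUP_upper2[of de] INF_greatest) auto
 moreover have "ennreal (measure \<nu> E / c) > 0" using E c by simp
 ultimately show ?thesis by auto
qed

text \<open>The tails of the summable series are the costs of ever finer coverings. The finite
  families are flattened into one sequence by the pairing function, after padding with empty
  sets.\<close>

lemma hausdorff_measure_limsup_zero:
 fixes E :: "'a::metric_space set"
 assumes E: "\<And>N. E \<subseteq> (\<Union>n\<in>{N..}. \<Union>(V n))" and V: "\<And>n. finite (V n)" "\<And>n X. X \<in> V n ==> bounded X \<and> diameter X <= l n"
  and l: "l ----> 0" and sm: "summable (%n. real (card (V n)) * l n powr s)" and s: "s > 0"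
 shows "hausdorff_measure s E = 0"
proof -
 have small: "(INF V\<in>{V :: nat => 'a set. E \<subseteq> (\<Union>n. V n) \<and> (\<forall>n. bounded (V n) \<and> diameter (V n) <= de)}.
    \<Sum>n. ennreal (diameter (V n) powr s)) <= 0 + ennreal e" if de: "de > 0" and e: "e > 0" for de e
 proof -
  obtain N1 where N1: "\<And>n. n >= N1 ==> l n < de" using order_tendstoD(2)[OF l de] unfolding eventually_sequentially by blast
  obtain N2 where N2: "\<And>n. n >= N2 ==> (\<Sum>k. real (card (V (k + n))) * l (k + n) powr s) < e"
   using order_tendstoD(2)[OF suminf_exist_split2[OF sm] e] unfolding eventually_sequentially by blast
  define N where "N = max N1 N2"
  have "\<exists>f. bij_betw f {0..<card (V n)} (V n)" for n using ex_bij_betw_nat_finite[OF V(1)] by blast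
  then obtain f where f: "\<And>n. bij_betw (f n) {0..<card (V n)} (V n)" by metis
  define W where "W = (%(n, q). if q < card (V (n + N)) then f (n + N) q else {})"
  have W: "W (n, q) = {} \<or> q < card (V (n + N)) \<and> W (n, q) \<in> V (n + N)" for n q
   using bij_betwE[OF f[of "n + N"]] by (auto simp: W_def)
  have sum: "(\<Sum>q. ennreal (diameter (W (n, q)) powr s)) <= ennreal (real (card (V (n + N))) * l (n + N) powr s)" for n
  proof -
   have "(\<Sum>q. ennreal (diameter (W (n, q)) powr s)) = (\<Sum>q<card (V (n + N)). ennreal (diameter (W (n, q)) powr s))"
    by (rule suminf_finite) (auto simp: W_def)
   also have "... <= (\<Sum>q<card (V (n + N)). ennreal (l (n + N) powr s))"
   proof (intro sum_mono ennreal_leI powr_mono2)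
    fix q assume "q \<in> {..<card (V (n + N))}"
    hence "W (n, q) \<in> V (n + N)" using bij_betwE[OF f[of "n + N"]] by (auto simp: W_def)
    from V(2)[OF this] show "diameter (W (n, q)) <= l (n + N)" "0 <= diameter (W (n, q))" by (auto intro: diameter_ge_0)
   qed (use s in simp)
   also have "... = ennreal (real (card (V (n + N))) * l (n + N) powr s)" by (simp add: ennreal_mult ennreal_of_nat_eq_real_of_nat)
   finally show ?thesis .
  qed
  have "(INF V\<in>{V :: nat => 'a set. E \<subseteq> (\<Union>n. V n) \<and> (\<forall>n. bounded (V n) \<and> diameter (V n) <= de)}.
    \<Sum>n. ennreal (diameter (V n) powr s)) <= (\<Sum>i. ennreal (diameter (W (prod_decode i)) powr s))"
  proof (rule INF_lower2[of "%i. W (prod_decode i)"])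
   have cov: "E \<subseteq> (\<Union>i. W (prod_decode i))"
   proof
    fix x assume "x \<in> E"
    then obtain n X where n: "n >= N" "X \<in> V n" "x \<in> X" using E[of N] by blast
    then obtain q where "q < card (V n)" "f n q = X" using bij_betw_imp_surj_on[OF f[of n]] by (metis atLeastLessThan_iff imageE)
    hence "x \<in> W (prod_decode (prod_encode (n - N, q)))" using n by (simp add: W_def)
    thus "x \<in> (\<Union>i. W (prod_decode i))" by blast
   qed
   have "bounded (W (n, q)) \<and> diameter (W (n, q)) <= de" for n q
   proof -
    have "l (n + N) < de" by (rule N1) (simp add: N_def)
    thus ?thesis using W[of n q] V(2)[of "W (n, q)" "n + N"] de by auto
   qed
   hence "bounded (W z) \<and> diameter (W z) <= de" for z by (cases z) blast
   with cov show "(%i. W (prod_decode i)) \<in> {V. E \<subseteq> (\<Union>n. V n) \<and> (\<forall>n. bounded (V n) \<and> diameter (V n) <= de)}" by simp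
  qed (rule order_refl)
  also have "... = (\<Sum>n. \<Sum>q. ennreal (diameter (W (n, q)) powr s))"
   by (rule suminf_ennreal_2dimen[of "%n. \<Sum>q. ennreal (diameter (W (n, q)) powr s)" "%z. ennreal (diameter (W z) powr s)", OF refl])
  also have "... <= (\<Sum>n. ennreal (real (card (V (n + N))) * l (n + N) powr s))" by (intro suminf_le sum summableI)
  also have "... = ennreal (\<Sum>n. real (card (V (n + N))) * l (n + N) powr s)"
   by (rule suminf_ennreal2) (use summable_ignore_initial_segment[OF sm, of N] in simp_all)
  also have "... <= ennreal e" using N2[of N] by (intro ennreal_leI) (simp add: N_def less_imp_le)
  finally show ?thesis by simp
 qed
 hence "(INF V\<in>{V :: nat => 'a set. E \<subseteq> (\<Union>n. V n) \<and> (\<forall>n. bounded (V n) \<and> diameter (V n) <= de)}.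
    \<Sum>n. ennreal (diameter (V n) powr s)) <= 0" if "de > 0" for de
  by (rule ennreal_le_epsilon) (use that in auto)
 hence "hausdorff_measure s E <= 0" unfolding hausdorff_measure_def by (intro SUP_least) auto
 thus ?thesis by simp
qed

context affine_system
begin

abbreviation pr_measure :: "(real^2) measure" where "pr_measure \<equiv> distr mu borel pr"

text \<open>By Borel-Cantelli almost every point lies in all but finitely many \<open>H n\<close>.
  Some tail intersection \<open>G N\<close> therefore meets the preimage of \<open>E\<close> in
  positive measure, and on it the ball bound holds at every small radius.\<close>

lemma dim_lower:
 assumes reg: "ball_regular d"
 shows "ereal d <= hausdorff_dim_measure pr_measure"
 unfolding hausdorff_dim_measure_def hausdorff_dim_def
proof (intro INF_greatest, clarsimp)
 fix E :: "(real^2) set" and s :: real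
 assume E: "E \<in> sets borel" "emeasure pr_measure E = 1" and s: "0 < s" "hausdorff_measure s E = 0"
 have pm: "pr \<in> measurable mu borel" by measurable
 have Es: "pr -` E \<in> sets left_words" using measurable_sets[OF pr_measurable E(1)] by simp
 have "prob (pr -` E) = 1" using E(2) unfolding emeasure_distr[OF pm E(1)] by (simp add: emeasure_eq_measure)
 hence AE_E: "AE i in mu. pr i \<in> E" using prob_eq_1[of "pr -` E"] Es by simp
 show "d <= s"
 proof (rule ccontr)
  assume "\<not> d <= s"
  hence e: "d - s > 0" by simp
  \<comment> \<open>With tolerance \<open>d - s\<close> and \<open>n\<close> about
    \<open>- ln r\<close>, the factor \<open>exp ((d - s) * n)\<close> turns \<open>r powr d\<close>
    into \<open>r powr s\<close>.\<close>
  from reg[unfolded ball_regular_def, rule_format, OF this] obtain H where "ball_bound (d - s) d H" by blast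
  note H = ball_boundD[OF this]
  obtain n0 where n0: "\<And>n x r. n >= n0 ==> exp (- real n) <= r ==> r <= 1 ==>
    prob (H n \<inter> {i. norm (pr i - x) <= r}) <= exp ((d - s) * real n) * r powr d"
   using H(3) unfolding eventually_sequentially by blast
  define G where "G N = (\<Inter>n\<in>{N..}. H n)" for N
  have G: "G N \<in> sets left_words" for N unfolding G_def by (intro sets.countable_INT) (use H in auto)
  have cH: "- H n \<in> sets left_words" for n using sets.compl_sets[OF H(1)[of n]] by (simp add: Compl_eq_Diff_UNIV)
  have "AE i in mu. EV n. i \<in> space mu - (- H n)"
   by (rule borel_cantelli_AE1) (use cH H(2) in \<open>auto intro: expsmall_summable simp: emeasure_eq_measure\<close>)
  hence "AE i in mu. \<exists>N\<ge>n0. i \<in> G N"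
  proof eventually_elim
   case (elim i)
   then obtain N where "\<And>n. n >= N ==> i \<in> H n" by (auto simp: eventually_sequentially)
   thus ?case by (intro exI[of _ "max N n0"]) (auto simp: G_def)
  qed
  have "\<exists>N\<ge>n0. prob (G N \<inter> pr -` E) > 0"
  proof (rule ccontr)
   assume "\<not> ?thesis"
   hence "prob (G N \<inter> pr -` E) = 0" if "N >= n0" for N using that by (metis measure_nonneg order_le_less)
   hence "AE i in mu. N >= n0 --> i \<notin> G N \<inter> pr -` E" for N
    using AE_iff_measurable[OF sets.Int[OF G[of N] Es, folded sets_mu], of "%i. i \<notin> G N \<inter> pr -` E"] by (auto simp: emeasure_eq_measure)
   hence "AE i in mu. \<forall>N. N >= n0 --> i \<notin> G N \<inter> pr -` E" by (simp add: AE_all_countable)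
   with \<open>AE i in mu. \<exists>N\<ge>n0. i \<in> G N\<close> AE_E have "AE i in mu. False" by eventually_elim auto
   thus False by simp
  qed
  then obtain N where N: "N >= n0" "prob (G N \<inter> pr -` E) > 0" by blast
  note pmG = proj_measure[OF G[of N]]
  have "hausdorff_measure s E \<noteq> 0"
  proof (rule mass_distribution[OF pmG(1,2) _ exp_gt_zero[of "d - s"] exp_gt_zero[of "- real N"] s(1)])
   show "measure (proj_measure (G N)) E > 0" using N(2) E(1) by (simp add: pmG)
   fix x :: "real^2" and r :: real assume r: "0 < r" "r <= exp (- real N)"
   define n where "n = nat \<lceil>- ln r\<rceil>"
   have lr: "- ln r >= real N" using ln_mono[OF r(2) r(1)] by simp
   hence n: "- ln r <= real n" "real n <= - ln r + 1" unfolding n_def by linarith+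
   hence nN: "n >= N" using lr by linarith
   have "exp (- real n) <= exp (ln r)" using n(1) by simp
   hence er: "exp (- real n) <= r" using r(1) by simp
   have r1: "r <= 1" using r(2) by (rule order_trans) simp
   have "pr -` cball x r = {i. norm (pr i - x) <= r}" by (auto simp: dist_norm norm_minus_commute)
   hence "measure (proj_measure (G N)) (cball x r) = prob (G N \<inter> {i. norm (pr i - x) <= r})" by (simp add: pmG)
   also have "... <= prob (H n \<inter> {i. norm (pr i - x) <= r})"
    using nN by (intro finite_measure_mono) (auto simp: G_def intro!: sets.Int H ball_sets)
   also have "... <= exp ((d - s) * real n) * r powr d" using nN N(1) er r1 by (intro n0) auto
   also have "... <= exp ((d - s) * (- ln r + 1)) * r powr d" using n(2) e by (intro mult_right_mono) (auto simp: mult_left_mono)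
   also have "... = exp (d - s) * r powr s" using r(1) by (simp add: powr_def exp_add[symmetric] algebra_simps)
   finally show "measure (proj_measure (G N)) (cball x r) <= exp (d - s) * r powr s" .
  qed
  with s(2) show False by simp
 qed
qed

lemma card_typical: "real (card {w \<in> words n. typical e w}) <= exp ((h + e) * real n)"
proof -
 have "real (card {w \<in> words n. typical e w}) * dec (h + e) n = (\<Sum>w | w \<in> words n \<and> typical e w. dec (h + e) n)" by simp
 also have "... <= (\<Sum>w | w \<in> words n \<and> typical e w. m w)" using typ_bounds(2) by (intro sum_mono) auto
 also have "... <= 1" using msum_le_1[of n "typical e"] by (simp add: msum_def)
 finally show ?thesis unfolding mult_minus_left le_exp_iff_mult .
qed

text \<open>Almost every point has typical prefixes from some length on, hence lies in the limsup of
  the covers of typical cylinders. There are about \<open>exp (h * n)\<close> of these, each covered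
  by about \<open>exp (a * n)\<close> pieces of size about \<open>exp (- b * n)\<close>.\<close>

lemma dim_upper:
 assumes e: "e > 0" and s: "s > 0" and b: "b > 0" "h + e + a < s * b" and l0: "l0 > 0"
  and V: "\<And>w. finite (V w)" "\<And>w X. X \<in> V w ==> compact X" "\<And>w. F w ` cball 0 B \<subseteq> \<Union>(V w)"
  and ty: "\<And>w. typical e w ==> real (card (V w)) <= c * exp (a * len w)"
   "\<And>w X. typical e w ==> X \<in> V w ==> diameter X <= l0 * dec b (length w)"
 shows "hausdorff_dim_measure pr_measure <= ereal s"
proof -
 define T where "T n = {w \<in> words n. typical e w}" for n
 define W where "W n = (\<Union>w\<in>T n. V w)" for n
 define E where "E = (\<Inter>N. \<Union>n\<in>{N..}. \<Union>(W n))"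
 have T: "finite (T n)" for n by (simp add: T_def del: in_words)
 have W: "finite (W n)" for n using T V(1) by (simp add: W_def)
 have "X \<in> sets borel" if "X \<in> W n" for X n using that V(2) by (metis UN_E W_def borel_closed compact_imp_closed)
 hence "\<Union>(W n) \<in> sets borel" for n using W by (intro sets.finite_Union) auto
 hence Eb: "E \<in> sets borel" unfolding E_def by (intro sets.countable_INT sets.countable_UN'') auto
 have cW: "real (card (W n)) <= c * exp ((h + e + a) * real n)" for n
 proof -
  have "real (card (W n)) <= real (\<Sum>w\<in>T n. card (V w))" unfolding W_def using card_UN_le[OF T] by (simp only: of_nat_le_iff)
  also have "... <= (\<Sum>w\<in>T n. c * exp (a * real n))" unfolding of_nat_sum using ty(1) by (intro sum_mono) (auto simp: T_def)
  also have "... = real (card (T n)) * (c * exp (a * real n))" by simp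
  also have "... <= exp ((h + e) * real n) * (c * exp (a * real n))"
  proof (cases "T n = {}")
   case False
   then obtain w where "length w = n" "typical e w" by (auto simp: T_def)
   hence "0 <= c * exp (a * real n)" using ty(1)[of w] by (auto intro: order_trans[OF of_nat_0_le_iff])
   thus ?thesis using card_typical by (intro mult_right_mono) (auto simp: T_def)
  next
   case True
   have "0 <= c"
   proof -
    obtain n where "\<exists>w. length w = n \<and> typical e w" using eventually_happens[OF exists_typ[OF e]] by auto
    then obtain w where "typical e w" by blast
    hence "0 <= c * exp (a * len w)" using ty(1)[of w] by (auto intro: order_trans[OF of_nat_0_le_iff])
    thus ?thesis by (simp add: zero_le_mult_iff)
   qed
   with True show ?thesis by simp
  qed
  also have "... = c * (exp ((h + e) * real n) * exp (a * real n))" by simp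
  also have "exp ((h + e) * real n) * exp (a * real n) = exp ((h + e + a) * real n)" unfolding exp_add[symmetric] by (simp only: distrib_right)
  finally show ?thesis .
 qed
 have "hausdorff_measure s E = 0"
 proof (rule hausdorff_measure_limsup_zero[of _ W "%n. l0 * dec b n"])
  show "E \<subseteq> (\<Union>n\<in>{N..}. \<Union>(W n))" for N unfolding E_def by (rule INF_lower) simp
  show "bounded X \<and> diameter X <= l0 * dec b n" if "X \<in> W n" for X n
   using that V(2) ty(2) by (auto simp: W_def T_def intro: compact_imp_bounded)
  show "(%n. l0 * dec b n) ----> 0" using b(1) by real_asymp
  have "expsmall (%n. real (card (W n)) * (l0 * dec b n) powr s)"
  proof (rule expsmallI[of "s * b - (h + e + a)" _ "c * l0 powr s" 0], use b in simp, intro always_eventually allI)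
   fix n
   have "real (card (W n)) * (l0 * dec b n) powr s <= c * exp ((h + e + a) * real n) * (l0 powr s * exp (- b * real n * s))"
    using cW[of n] by (simp only: powr_mult exp_powr_real) (intro mult_right_mono; simp)
   also have "... = c * l0 powr s * (exp ((h + e + a) * real n) * exp (- b * real n * s))" by (simp only: mult_ac)
   also have "exp ((h + e + a) * real n) * exp (- b * real n * s) = dec (s * b - (h + e + a)) n"
    unfolding exp_add[symmetric] by (simp add: algebra_simps)
   finally show "real (card (W n)) * (l0 * dec b n) powr s <= (c * l0 powr s + 0 * real n) * dec (s * b - (h + e + a)) n" by simp
  qed
  thus "summable (%n. real (card (W n)) * (l0 * dec b n) powr s)" by (rule expsmall_summable) simp
 qed (use W s in auto)
 moreover have "emeasure pr_measure E = 1"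
 proof -
  have pm: "pr \<in> measurable mu borel" by measurable
  have pre: "{i. \<not> typical e (pre i n)} \<in> sets left_words" for n by (rule sets_prefix)
  have "summable (%n. prob {i. \<not> typical e (pre i n)})"
   unfolding msum_prefix_eq[of "%w. \<not> typical e w"] by (intro expsmall_summable expsmall_typ e msum_nonneg)
  hence "AE i in mu. EV n. i \<in> space mu - {i. \<not> typical e (pre i n)}"
   by (intro borel_cantelli_AE1) (auto simp: pre emeasure_eq_measure)
  hence "AE i in mu. pr i \<in> E"
  proof eventually_elim
   case (elim i)
   then obtain N where N: "\<And>n. n >= N ==> typical e (pre i n)" by (auto simp: eventually_sequentially)
   have "pr i \<in> \<Union>(W n)" if "n >= N" for n
   proof -
    have "pr i \<in> F (pre i n) ` cball 0 B" using pr_prefix[of i n] norm_pr by auto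
    hence "pr i \<in> \<Union>(V (pre i n))" using V(3) by blast
    moreover have "pre i n \<in> T n" using N[OF that] by (simp add: T_def)
    ultimately show ?thesis by (auto simp: W_def)
   qed
   hence "\<exists>n\<ge>M. pr i \<in> \<Union>(W n)" for M by (intro exI[of _ "max M N"]) auto
   thus ?case unfolding E_def by blast
  qed
  moreover have Es: "pr -` E \<in> sets left_words" using measurable_sets[OF pr_measurable Eb] by simp
  ultimately have "prob (pr -` E) = 1" using prob_eq_1[of "pr -` E"] by simp
  thus ?thesis unfolding emeasure_distr[OF pm Eb] by (simp add: emeasure_eq_measure)
 qed
 ultimately show ?thesis unfolding hausdorff_dim_measure_def hausdorff_dim_def
  using Eb s by (intro INF_lower2[of E] INF_lower) auto
qed

lemma diameter_F:
 assumes "X \<subseteq> cball 0 B" "\<And>x y. x \<in> X ==> y \<in> X ==> norm (P w *v (x - y)) <= l" "l >= 0"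
 shows "diameter (F w ` X) <= l"
 using assms F_diff by (intro diameter_le) (auto simp: dist_norm)

lemma dim_upper_1:
 assumes s: "s > h / xs" "s > 0"
 shows "hausdorff_dim_measure pr_measure <= ereal s"
proof -
 define e where "e = min (xs / 2) ((s * xs - h) / (2 * (1 + s)))"
 have hs: "h < s * xs" using s(1) xs_pos by (simp add: divide_less_eq)
 have e: "e > 0" "e <= xs / 2" using hs s xs_pos unfolding e_def by (simp, intro min.cobounded1)
 have "(1 + s) * e <= (1 + s) * ((s * xs - h) / (2 * (1 + s)))" using s by (intro mult_left_mono) (auto simp: e_def)
 also have "... = (s * xs - h) / 2" using s by (simp add: field_simps)
 finally have c: "h + e + 0 < s * (xs - e)" using hs by (simp add: algebra_simps)
 show ?thesis
 proof (rule dim_upper[where V = "%w. {F w ` cball 0 B}" and ?l0.0 = "2 * B" and c = 1, OF e(1) s(2) _ c])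
  show "compact X" if "X \<in> {F w ` cball 0 B}" for w X
   using that continuous_F by (auto intro!: compact_continuous_image)
  fix w X assume w: "typical e w" and X: "X \<in> {F w ` cball 0 B}"
  have p1: "norm (P w *v (x - y)) <= 2 * B * a1 w" if "x \<in> cball 0 B" "y \<in> cball 0 B" for x y
  proof -
   have "norm (x - y) <= 2 * B" using norm_triangle_ineq4[of x y] that by simp
   hence "a1 w * norm (x - y) <= a1 w * (2 * B)" by (intro mult_left_mono) (auto intro: less_imp_le)
   thus ?thesis unfolding mult.commute[of "2 * B" "a1 w"] using norm_P_le[of w "x - y"] by linarith
  qed
  have "2 * B * a1 w <= 2 * B * dec (xs - e) (length w)" using B_pos by (intro mult_left_mono typ_bounds(3)[OF w]) auto
  note order_trans[OF p1 this]
  hence "diameter (F w ` cball 0 B) <= 2 * B * dec (xs - e) (length w)"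
   using B_pos by (intro diameter_F) auto
  thus "diameter X <= 2 * B * dec (xs - e) (length w)" using X by simp
 qed (use e xs_pos B_pos in auto)
qed

text \<open>The ball is cut into about \<open>1 / tau w\<close> strips of width \<open>tau w\<close>
  parallel to \<open>cdir w\<close>; the image of each strip has diameter of the order of the
  shorter axis \<open>a2 w\<close>.\<close>

lemma dim_upper_2:
 assumes s: "s > 1 + (h - xs) / xss" "s > 0"
 shows "hausdorff_dim_measure pr_measure <= ereal s"
proof -
 \<comment> \<open>\<open>(3 + s) * e\<close> is to be at most half the slack: one \<open>e\<close>
   for the number of cylinders, two for \<open>tau\<close>, and \<open>s\<close> times one for the
   diameters. The cap keeps \<open>xss - e\<close> positive.\<close>
 define e where "e = min (xss / 2) ((s * xss - h - chi) / (2 * (3 + s)))"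
 have hs: "h + chi < s * xss" using s(1) xss_pos by (simp add: field_simps chi_def)
 have e: "e > 0" "e <= xss / 2" using hs s xss_pos unfolding e_def by (simp, intro min.cobounded1)
 have "(3 + s) * e <= (3 + s) * ((s * xss - h - chi) / (2 * (3 + s)))" using s by (intro mult_left_mono) (auto simp: e_def)
 also have "... = (s * xss - h - chi) / 2" using s by (simp add: field_simps)
 finally have c: "h + e + (chi + 2 * e) < s * (xss - e)" using hs by (simp add: algebra_simps)
 define S where "S w k = cball 0 B \<inter> {z. real_of_int k * tau w <= wedge (cdir w) z \<and> wedge (cdir w) z <= (real_of_int k + 1) * tau w}" for w k
 define I where "I w = {- \<lceil>B / tau w\<rceil> - 1..\<lceil>B / tau w\<rceil>}" for w
 show ?thesis
 proof (rule dim_upper[where V = "%w. (%k. F w ` S w k) ` I w" and ?l0.0 = "2 * B + 1" and c = "2 * B + 4", OF e(1) s(2) _ c])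
  have "closed {z. real_of_int k * tau w <= wedge (cdir w) z \<and> wedge (cdir w) z <= (real_of_int k + 1) * tau w}" for w k
   unfolding wedge_def by (intro closed_Collect_conj closed_Collect_le continuous_intros)
  hence "compact (S w k)" for w k unfolding S_def by (intro compact_Int_closed) auto
  thus "compact X" if "X \<in> (%k. F w ` S w k) ` I w" for w X
   using that continuous_F by (auto intro!: compact_continuous_image)
  show "F w ` cball 0 B \<subseteq> \<Union>((%k. F w ` S w k) ` I w)" for w
  proof -
   have "\<exists>k\<in>I w. z \<in> S w k" if z: "z \<in> cball 0 B" for z
   proof (rule bexI[of _ "\<lfloor>wedge (cdir w) z / tau w\<rfloor>"])
    have fl: "real_of_int \<lfloor>x / tau w\<rfloor> * tau w <= x" "x <= (real_of_int \<lfloor>x / tau w\<rfloor> + 1) * tau w" for x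
     using tau_pos[of w] by (auto simp flip: pos_le_divide_eq pos_divide_le_eq intro: less_imp_le real_of_int_floor_add_one_gt)
    thus "z \<in> S w \<lfloor>wedge (cdir w) z / tau w\<rfloor>" using z by (simp add: S_def)
    have "\<bar>wedge (cdir w) z\<bar> <= B" using wedge_le[of "cdir w" z] cdir(1)[of w] z by simp
    hence "\<bar>wedge (cdir w) z / tau w\<bar> <= B / tau w" by (simp add: abs_divide abs_of_pos[OF tau_pos] divide_right_mono less_imp_le[OF tau_pos])
    thus "\<lfloor>wedge (cdir w) z / tau w\<rfloor> \<in> I w" unfolding I_def abs_le_iff atLeastAtMost_iff by linarith
   qed
   thus ?thesis by blast
  qed
  fix w assume w: "typical e w"
  have "real (card ((%k. F w ` S w k) ` I w)) <= real (card (I w))" using card_image_le[of "I w"] by (simp add: I_def)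
  also have "... <= 2 * (B / tau w) + 4"
  proof -
   have "0 <= B / tau w" using B_pos tau_pos[of w] by (intro divide_nonneg_pos) auto
   thus ?thesis unfolding I_def card_atLeastAtMost_int by linarith
  qed
  also have "... <= (2 * B + 4) * (1 / tau w)" using tau_le_1[of w] tau_pos[of w] by (simp add: field_simps)
  also have "1 / tau w <= exp ((chi + 2 * e) * len w)"
   unfolding le_exp_iff_mult[symmetric] using typ_bounds(8)[OF w, unfolded mult_minus_left]
   by (simp only: times_divide_eq_left mult_1_left divide_le_eq_1_pos[OF tau_pos])
  finally show "real (card ((%k. F w ` S w k) ` I w)) <= (2 * B + 4) * exp ((chi + 2 * e) * len w)" using B_pos by (simp add: mult_left_mono)
  fix X assume "X \<in> (%k. F w ` S w k) ` I w"
  then obtain k where X: "X = F w ` S w k" by blast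
  have p1: "norm (P w *v (x - y)) <= (2 * B + 1) * a2 w" if "x \<in> S w k" "y \<in> S w k" for x y
  proof -
   have "norm (x - y) <= 2 * B" using norm_triangle_ineq4[of x y] that by (simp add: S_def)
   moreover have "\<bar>wedge (cdir w) (x - y)\<bar> <= tau w" using that by (simp add: S_def wedge_add abs_le_iff algebra_simps)
   ultimately have "a1 w * \<bar>wedge (cdir w) (x - y)\<bar> + a2 w * norm (x - y) <= a1 w * tau w + a2 w * (2 * B)"
    by (intro add_mono mult_left_mono) (auto intro: less_imp_le)
   thus ?thesis using cdir(4)[of w "x - y"] by (simp add: tau_def algebra_simps)
  qed
  have "(2 * B + 1) * a2 w <= (2 * B + 1) * dec (xss - e) (length w)" using B_pos by (intro mult_left_mono typ_bounds(5)[OF w]) auto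
  note order_trans[OF p1 this]
  hence "diameter (F w ` S w k) <= (2 * B + 1) * dec (xss - e) (length w)"
   using B_pos by (intro diameter_F) (auto simp: S_def)
  thus "diameter X <= (2 * B + 1) * dec (xss - e) (length w)" using X by simp
 qed (use e xss_pos B_pos in \<open>auto simp: I_def\<close>)
qed

theorem dimension_formula:
 assumes Q: "direction_regular (min 1 (h / chi))"
  and cond: "h / chi >= min 1 (h / xs) \<or> h / chi + 2 * (h / xss) > 2"
 shows "hausdorff_dim_measure pr_measure = ereal (min (h / xs) (1 + (h - xs) / xss))"
proof (rule antisym)
 show "ereal (min (h / xs) (1 + (h - xs) / xss)) <= hausdorff_dim_measure pr_measure"
  by (rule dim_lower[OF ball_regular_dimension[OF Q cond]])
 let ?d = "min (h / xs) (1 + (h - xs) / xss)"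
 have "1 + (h - xs) / xss = (h + chi) / xss" using xss_pos by (simp add: chi_def field_simps)
 hence d0: "?d >= 0" using h_nonneg xs_pos chi_pos xss_pos by simp
 show "hausdorff_dim_measure pr_measure <= ereal ?d"
 proof (rule ereal_le_epsilon2)
  fix e :: real assume e: "e > 0"
  hence "?d + e > 0" "?d + e > h / xs \<or> ?d + e > 1 + (h - xs) / xss" using d0 by linarith+
  thus "hausdorff_dim_measure pr_measure <= ereal ?d + ereal e" unfolding plus_ereal.simps using dim_upper_1[of "?d + e"] dim_upper_2[of "?d + e"] by blast
 qed
qed

end


section \<open>Directions: from one scale to all scales, and dependence on the matrices\<close>

context affine_system
begin

text \<open>Reversal turns a common suffix into a common prefix of the right words that define the
  two directions.\<close>

lemma wedge_dir_suffix:
 assumes "length v = k" "length w = n" "drop (n - k) w = v" "k <= n"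
 shows "\<bar>wedge (dir v) (dir w)\<bar> <= K^2 * tau v"
proof -
 have w: "w = take (n - k) w @ v" using assms by (metis append_take_drop_id)
 have "fw (conc (rev w) (%_. undefined)) k = v"
  by (subst w) (simp add: conc_append fw_conc[OF assms(1)])
 moreover have "fw (conc (rev v) (%_. undefined)) k = v" by (rule fw_conc[OF assms(1)])
 ultimately show ?thesis unfolding dir_def by (intro wedge_evec_le_tau)
qed

text \<open>At scale \<open>exp (- c * k)\<close> the direction of \<open>w\<close> may be replaced
  by that of its last \<open>k\<close> letters, and these are distributed like words of length
  \<open>k\<close>. So one scale per length gives all radii. The replacement error has rate close to
  \<open>chi\<close>, hence the need for \<open>c < chi\<close>.\<close>

lemma direction_regularI:
 assumes cg: "0 < c" "c < chi" "g >= 0" and J: "expsmall (%n. msum n (%w. \<not> J w))"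
  and single: "EV n. \<forall>th. norm th = 1 -->
    msum n (%w. J w \<and> \<bar>wedge (dir w) th\<bar> <= 2 * dec c n) <= dec g n"
 shows "direction_regular (g / chi)"
 unfolding direction_regular_def
proof (intro allI impI)
 fix e :: real assume e: "e > 0"
 \<comment> \<open>Since \<open>chi - 2 * e1 = c + 2 * e1\<close>, the error from passing to a
   suffix decays strictly faster than \<open>exp (- c * k)\<close> and fits into the doubled
   radius.\<close>
 define e1 where "e1 = (chi - c) / 4"
 have e1: "e1 > 0" using cg by (simp add: e1_def)
 define eta where "eta = min 1 (e / (2 * (g + 1)))"
 have eta: "eta > 0" "eta <= 1" using e cg by (simp_all add: eta_def)
 have "g * eta <= g * (e / (2 * (g + 1)))" using cg by (intro mult_left_mono) (auto simp: eta_def)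
 also have "... <= e / 2" using e cg by (simp add: field_simps)
 finally have etag: "g * eta <= e / 2" .
 let ?Q = "%w. J w \<and> typical e1 w"
 define G where "G w = (\<forall>k\<le>length w. eta * len w <= real k --> ?Q (drop (length w - k) w))" for w
 have "expsmall (%n. msum n (%w. \<not> ?Q w))"
 proof (rule expsmall_mono[OF expsmall_add[OF J expsmall_typ[OF e1]]], intro always_eventually allI)
  fix n
  have "msum n (%w. \<not> ?Q w) <= msum n (%w. \<not> J w \<or> \<not> typical e1 w)" by (rule msum_mono) auto
  also have "... <= msum n (%w. \<not> J w) + msum n (%w. \<not> typical e1 w)" by (rule msum_disj)
  finally show "msum n (%w. \<not> ?Q w) <= msum n (%w. \<not> J w) + msum n (%w. \<not> typical e1 w)" .
 qed
 from expsmall_suffix[OF this eta(1)] have "expsmall (%n. msum n (%w. \<not> G w))"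
  by (rule expsmall_mono) (auto intro!: always_eventually msum_mono simp: G_def)
 moreover have "(%n. a * dec (2 * e1) n) ----> 0" for a :: real using e1 by real_asymp
 hence "EV n. K\<^sup>2 * dec (2 * e1) n < 1" by (rule order_tendstoD) simp
 with single have "EV n. K\<^sup>2 * dec (2 * e1) n < 1 \<and> (\<forall>th. norm th = 1 -->
    msum n (%w. J w \<and> \<bar>wedge (dir w) th\<bar> <= 2 * dec c n) <= dec g n)" by eventually_elim blast
 then obtain n0 where n0: "\<And>n. n >= n0 ==> K\<^sup>2 * dec (2 * e1) n < 1"
   "\<And>n th. n >= n0 ==> norm th = 1 ==> msum n (%w. J w \<and> \<bar>wedge (dir w) th\<bar> <= 2 * dec c n) <= dec g n"
  unfolding eventually_sequentially by blast
 have "EV n. real n0 <= eta * real n" and "EV n. g <= e / 2 * real n"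
  using eta e by real_asymp+
 hence "EV n. \<forall>th r. norm th = 1 --> dec chi n <= r --> r <= 1 -->
    msum n (%w. G w \<and> \<bar>wedge (dir w) th\<bar> <= r) <= exp (e * real n) * r powr (g / chi)"
 proof eventually_elim
  case (elim n)
  show ?case
  proof (intro allI impI)
   fix th :: "real^2" and r :: real assume th: "norm th = 1" and r: "dec chi n <= r" "r <= 1"
   let ?F = "%r. msum n (%w. G w \<and> \<bar>wedge (dir w) th\<bar> <= r)"
   have mono: "?F r <= ?F r'" if "r <= r'" for r r' by (rule msum_mono) (use that in auto)
   have scale: "?F (dec c k) <= dec g k" if k: "eta * real n <= real k" "real k <= real n" for k
   proof -
    have kn: "k <= n" "k >= n0" using k elim(1) by auto
    let ?R = "%v. J v \<and> \<bar>wedge (dir v) th\<bar> <= 2 * dec c k"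
    have "?F (dec c k) <= msum n (%w. ?R (drop (n - k) w))"
    proof (rule msum_mono)
     fix w assume w: "length w = n" "G w \<and> \<bar>wedge (dir w) th\<bar> <= dec c k"
     let ?v = "drop (n - k) w"
     have lv: "length ?v = k" using w kn by simp
     have v: "J ?v" "typical e1 ?v" using w k(1) kn(1) by (auto simp: G_def)
     have "tau ?v <= dec (chi - 2 * e1) k" using typ_bounds(7)[OF v(2)] lv by simp
     also have "chi - 2 * e1 = c + 2 * e1" by (simp add: e1_def field_simps)
     also have "dec (c + 2 * e1) k = dec (2 * e1) k * dec c k" by (simp add: exp_add[symmetric] algebra_simps)
     finally have "K^2 * tau ?v <= (K^2 * dec (2 * e1) k) * dec c k"
      by (simp only: mult.assoc) (intro mult_left_mono; simp)
     also have "... <= 1 * dec c k" using n0(1)[OF kn(2)] by (intro mult_right_mono) auto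
     finally have "\<bar>wedge (dir ?v) (dir w)\<bar> <= dec c k" using wedge_dir_suffix[OF lv w(1) refl kn(1)] by linarith
     hence "\<bar>wedge (dir ?v) th\<bar> <= 2 * dec c k" using wedge_triangle[of "dir w" "dir ?v" th] w(2) th dir(1) by simp
     with v show "?R ?v" by simp
    qed
    also have "... = msum k ?R" by (rule msum_suffix[OF kn(1)])
    also have "... <= dec g k" by (rule n0(2)[OF kn(2) th])
    finally show ?thesis .
   qed
   show "?F r <= exp (e * real n) * r powr (g / chi)"
   proof (cases "dec c n <= r")
    case True
    have "?F r <= exp (g * (eta * real n + 1)) * r powr (g / c)"
     by (rule scale_interpolation[OF cg(1,3) mono msum_le_1 scale True r(2)]) (use eta in auto)
    also have "... <= exp (e * real n) * r powr (g / chi)"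
    proof (intro mult_mono)
     have "g * eta * real n <= e / 2 * real n" using etag by (intro mult_right_mono) auto
     hence "g * (eta * real n + 1) <= e * real n" using elim(2) by (simp add: distrib_left mult.assoc)
     thus "exp (g * (eta * real n + 1)) <= exp (e * real n)" by simp
     have "r > 0" using True exp_gt_zero less_le_trans by blast
     moreover have "g / chi <= g / c" using cg by (intro divide_left_mono) auto
     ultimately show "r powr (g / c) <= r powr (g / chi)" using r by (intro powr_mono') auto
    qed auto
    finally show ?thesis .
   next
    case False
    \<comment> \<open>Radii between \<open>exp (- chi * n)\<close> and \<open>exp (- c * n)\<close>
      are finer than any controlled scale; monotonicity here is what lowers the exponent from
      \<open>g / c\<close> to \<open>g / chi\<close>.\<close>
    hence "?F r <= ?F (dec c n)" by (intro mono) simp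
    also have "... <= dec g n" using mult_right_mono[OF eta(2), of "real n"] by (intro scale) auto
    also have "... = dec chi n powr (g / chi)" using chi_pos by (simp add: exp_powr_real)
    also have "... <= r powr (g / chi)" using r cg chi_pos by (intro powr_mono2) auto
    also have "... <= exp (e * real n) * r powr (g / chi)" using e by (simp add: mult_le_cancel_right1)
    finally show ?thesis .
   qed
  qed
 qed
 ultimately show "\<exists>J. direction_bound e (g / chi) J" unfolding direction_bound_def by blast
qed

lemma direction_regular_closed:
 assumes "\<And>de. de > 0 ==> \<exists>s'\<ge>s - de. direction_regular s'"
 shows "direction_regular s"
 unfolding direction_regular_def
proof (intro allI impI)
 fix e :: real assume e: "e > 0"
 define de where "de = e / (2 * chi)"
 have de: "de > 0" "de * chi = e / 2" using e chi_pos by (simp_all add: de_def)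
 obtain s' where s': "s - de <= s'" "direction_regular s'" using assms[OF de(1)] by blast
 obtain J where J: "direction_bound (e / 2) s' J"
  using s'(2) half_gt_zero[OF e] unfolding direction_regular_def by blast
 have le: "exp (e / 2 * real n) * r powr s' <= exp (e * real n) * r powr s" if r: "dec chi n <= r" "r <= 1" for n r
 proof -
  have "r powr s' <= exp (de * (chi * real n)) * r powr s" using r s'(1) de(1) by (intro powr_weaken) auto
  hence "exp (e / 2 * real n) * r powr s' <= exp (e / 2 * real n) * (exp (e / 2 * real n) * r powr s)"
   using de(2) by (intro mult_left_mono) (auto simp: mult.assoc[symmetric])
  thus ?thesis unfolding mult.assoc[symmetric] exp_add[symmetric] by simp
 qed
 have "EV n. \<forall>th r. norm th = 1 --> dec chi n <= r --> r <= 1 -->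
    msum n (%w. J w \<and> \<bar>wedge (dir w) th\<bar> <= r) <= exp (e * real n) * r powr s"
  using J[unfolded direction_bound_def, THEN conjunct2] by eventually_elim (meson le order_trans)
 with J show "\<exists>J. direction_bound e s J" unfolding direction_bound_def by blast
qed

end

context dominated
begin

text \<open>The strong stable vector turned by a right angle. Being transversal to the contracted
  line it grows like \<open>a1\<close>, so its image is a convenient normalisation.\<close>

definition nvec :: "(nat => 'k) => real^2" where
 "nvec j = (\<chi> i. if i = 1 then - (evec j $ 2) else evec j $ 1)"

text \<open>Normalised by its Hilbert--Schmidt norm, \<open>P (fw j k)\<close> sees in the limit only the component
 transversal to the contracted direction; this expresses the strong stable line through limits of
 continuous functions of the matrices.\<close>

lemma wedge_evec_limit:
 "(%k. (norm (P (fw j k) *v z))\<^sup>2 / ((norm (P (fw j k) *v axis 1 1))^2 + (norm (P (fw j k) *v axis 2 1))^2))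
   ----> (wedge (evec j) z)\<^sup>2"
proof -
 define N where "N k = norm (P (fw j k) *v nvec j)" for k
 have n1: "(evec j $ 1)^2 + (evec j $ 2)^2 = 1"
  using evec(1)[of j] by (simp add: norm_vec2)
 hence wn: "wedge (nvec j) (evec j) = - 1" by (simp add: wedge_def nvec_def power2_eq_square) 
 have N: "a1 (fw j k) <= K * N k" for k
 proof -
  let ?w = "fw j k"
  have "a1 ?w * a2 ?w = \<bar>wedge (P ?w *v nvec j) (P ?w *v evec j)\<bar>"
   unfolding wedge_matrix wn abs_mult dt_eq[symmetric] by (simp add: dt_def)
  also have "... <= N k * (K * a2 ?w)" unfolding N_def by (rule order_trans[OF wedge_le]) (intro mult_left_mono evec; simp)
  finally have "a2 ?w * a1 ?w <= a2 ?w * (K * N k)" by (simp only: mult_ac)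
  thus ?thesis using a2_pos[of ?w] by (simp only: mult_le_cancel_left_pos)
 qed
 have Np: "N k > 0" for k using less_le_trans[OF a1_pos N, of k] K(1) by (simp add: zero_less_mult_iff)
 have lim: "(%k. norm (P (fw j k) *v z) / N k) ----> \<bar>wedge (evec j) z\<bar>" for z
 proof (rule tendsto_dist_iff[THEN iffD2], rule tendsto_0_le[where K = 1])
  define al where "al = z \<bullet> evec j"
  define be where "be = wedge (evec j) z"
  have dec: "z = al *\<^sub>R evec j + be *\<^sub>R nvec j"
  proof -
   have "al *\<^sub>R evec j + be *\<^sub>R nvec j = ((evec j $ 1)^2 + (evec j $ 2)^2) *\<^sub>R z"
    by (simp add: vec_eq_iff forall_2 al_def be_def wedge_def nvec_def inner_vec2 power2_eq_square algebra_simps)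
   thus ?thesis by (simp add: n1)
  qed
  show "(%k. \<bar>al\<bar> * K^2 * tau (fw j k)) ----> 0"
   by (rule tendsto_eq_intros refl tau_tendsto_0)+ simp_all
  show "EV k. norm (dist (norm (P (fw j k) *v z) / N k) \<bar>wedge (evec j) z\<bar>) <= norm (\<bar>al\<bar> * K^2 * tau (fw j k)) * 1"
  proof (intro always_eventually allI)
   fix k
   let ?w = "fw j k"
   have "P ?w *v z = al *\<^sub>R (P ?w *v evec j) + be *\<^sub>R (P ?w *v nvec j)"
    by (subst dec) (simp add: matrix_vector_right_distrib vector_scaleR_matrix_ac scaleR_matrix_vector_assoc[symmetric] matrix_vector_mult_scaleR)
   hence "\<bar>norm (P ?w *v z) - norm (be *\<^sub>R (P ?w *v nvec j))\<bar> <= norm (al *\<^sub>R (P ?w *v evec j))"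
    by (metis add_diff_cancel_right' norm_triangle_ineq3)
   also have "... <= \<bar>al\<bar> * (K * a2 ?w)" by (simp add: mult_left_mono evec)
   also have "a2 ?w = tau ?w * a1 ?w" by (simp add: tau_def)
   also have "\<bar>al\<bar> * (K * (tau ?w * a1 ?w)) <= \<bar>al\<bar> * (K * (tau ?w * (K * N k)))"
    using K(1) by (intro mult_left_mono N) (auto intro: less_imp_le)
   finally have "\<bar>norm (P ?w *v z) - \<bar>be\<bar> * N k\<bar> / N k <= \<bar>al\<bar> * (K * (tau ?w * (K * N k))) / N k"
    using Np[of k] by (intro divide_right_mono) (auto simp: N_def)
   also have "... = \<bar>al\<bar> * K^2 * tau ?w" using Np[of k] by (simp add: power2_eq_square)
   also have "\<bar>norm (P ?w *v z) - \<bar>be\<bar> * N k\<bar> / N k = \<bar>norm (P ?w *v z) / N k - \<bar>be\<bar>\<bar>"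
    proof -
     have "norm (P ?w *v z) / N k - \<bar>be\<bar> = (norm (P ?w *v z) - \<bar>be\<bar> * N k) / N k" using Np[of k] by (simp add: diff_divide_distrib)
     thus ?thesis using Np[of k] by (simp only: abs_divide abs_of_pos)
    qed
   finally show "norm (dist (norm (P ?w *v z) / N k) \<bar>wedge (evec j) z\<bar>) <= norm (\<bar>al\<bar> * K^2 * tau ?w) * 1"
    by (simp add: dist_real_def be_def)
  qed
 qed
 let ?R = "%z k. norm (P (fw j k) *v z) / N k"
 have den: "\<bar>wedge (evec j) (axis 1 1)\<bar>\<^sup>2 + \<bar>wedge (evec j) (axis 2 1)\<bar>\<^sup>2 = 1" using n1 by (simp add: wedge_def axis_def)
 have "(%k. (?R z k)\<^sup>2 / ((?R (axis 1 1) k)^2 + (?R (axis 2 1) k)^2)) ---->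
   \<bar>wedge (evec j) z\<bar>\<^sup>2 / (\<bar>wedge (evec j) (axis 1 1)\<bar>\<^sup>2 + \<bar>wedge (evec j) (axis 2 1)\<bar>\<^sup>2)"
  using den by (intro tendsto_divide tendsto_power tendsto_add lim) linarith
 moreover have "(?R z k)^2 / ((?R (axis 1 1) k)^2 + (?R (axis 2 1) k)^2) =
   (norm (P (fw j k) *v z))^2 / ((norm (P (fw j k) *v axis 1 1))^2 + (norm (P (fw j k) *v axis 2 1))^2)" for k
  using Np[of k] by (simp add: power_divide add_divide_distrib[symmetric])
 ultimately show ?thesis unfolding den by simp
qed

text \<open>The sign of \<open>evec\<close> is arbitrary, so it is the squares of its wedges that
  arise as limits of continuous functions of the matrices. Polarisation recovers the mixed products
  from the squares at three vectors.\<close>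

lemma wedge_sq_eq:
 "(wedge (evec i) (evec j))^2 =
   (let q = %j z. (wedge (evec j) z)\<^sup>2; x = axis 1 1; y = axis 2 1 in
   q i y * q j x + q i x * q j y - (q i x + q i y - q i (x + y)) * (q j x + q j y - q j (x + y)) / 2)"
 by (simp add: Let_def wedge_def axis_def power2_eq_square algebra_simps)

lemma line_angle_less:
 assumes "0 < r" "r <= 1"
 shows "line_angle (ess_line A i) (ess_line A j) < arcsin r \<longleftrightarrow> \<bar>wedge (evec i) (evec j)\<bar> < r"
proof -
 let ?x = "\<bar>evec i \<bullet> evec j\<bar>" and ?s = "\<bar>wedge (evec i) (evec j)\<bar>"
 have sq: "?s\<^sup>2 + ?x\<^sup>2 = 1" using wedge_sq[of "evec i" "evec j"] evec(1) by simp
 have x: "0 <= ?x" "?x <= 1" using Cauchy_Schwarz_ineq2[of "evec i" "evec j"] evec(1) by simp_all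
 have s: "?s <= 1" using wedge_le[of "evec i" "evec j"] evec(1) by simp
 have "sin (arccos ?x) = ?s" using x sq by (simp add: sin_arccos_abs[of ?x, simplified] real_sqrt_unique)
 moreover have "0 <= arccos ?x" "arccos ?x <= pi / 2" using x arccos_le_pi2[of ?x] arccos_lbound[of ?x] by auto
 ultimately have "arccos ?x = arcsin ?s" using arcsin_sin[of "arccos ?x"] by simp
 thus ?thesis unfolding line_angle_ess using assms s by (simp add: arcsin_less_mono)
qed

end


section \<open>The second moment over pairs of words\<close>

context word_system
begin

lemma suffix_sum:
 assumes "k <= n"
 shows "(\<Sum>u\<in>words n. m u * f (drop (n - k) u)) = (\<Sum>w\<in>words k. m w * (f w :: real))"
proof -
 have "(\<Sum>u\<in>words n. m u * f (drop (n - k) u)) = (\<Sum>u\<in>words ((n - k) + k). m u * f (drop (n - k) u))" using assms by simp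
 also have "... = (\<Sum>u\<in>words (n - k). \<Sum>v\<in>words k. m (u @ v) * f v)"
  unfolding sum_words_append by (intro sum.cong) auto
 also have "... = (\<Sum>v\<in>words k. m v * f v)"
  by (subst sum.swap) (simp add: sum_distrib_right[symmetric] sum_m_left)
 finally show ?thesis .
qed

text \<open>Pairs are grouped by their longest common suffix \<open>w\<close>, of length
  \<open>k\<close>. Given \<open>u\<close>, the matching \<open>v\<close> have mass
  \<open>m w\<close>, so level \<open>k\<close> costs \<open>exp (- c * n)\<close> times the mean of
  \<open>m w / tau w\<close>, about \<open>exp ((chi - h) * k)\<close>. The extreme levels
  \<open>k = 0\<close> and \<open>k = n\<close> give the two terms of the minimum.\<close>

lemma pair_sum:
 assumes e: "e > 0" "0 < eta" "eta <= 1" "eta * (- ln kap) <= e" and c: "c <= chi" and LB: "L >= 0" "B >= 0"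
  and G: "\<And>w k. length w = n ==> G w ==> k <= n ==> eta * real n <= real k ==> typical e (drop (n - k) w)"
  and b: "\<And>u v. b u v <= L"
  and b2: "\<And>u v k. length u = n ==> length v = n ==> k < n ==> drop (n - k) u = drop (n - k) v ==>
   u ! (n - k - 1) \<noteq> v ! (n - k - 1) ==> b u v <= B * exp (e * real k) * dec c n / tau (drop (n - k) u)"
 shows "(\<Sum>u | u \<in> words n \<and> G u. \<Sum>v | v \<in> words n \<and> G v. m u * m v * b u v) <=
   (L + B * real n) * dec (min c (h - (chi - c)) - 4 * e) n"
proof -
 let ?k = "min c (h - (chi - c))"
 let ?G = "{u. u \<in> words n \<and> G u}"
 define X where "X w = B * exp (e * real n) * dec c n / tau w" for w
 have X0: "X w >= 0" for w unfolding X_def using LB tau_pos[of w] by (intro divide_nonneg_pos) auto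
 \<comment> \<open>Typicality is required of long suffixes only. For short ones the crude bound
   \<open>tau w >= kap ^ k\<close> loses at most \<open>exp (e * n)\<close>, by the assumption
   relating \<open>eta\<close> to \<open>kap\<close>.\<close>
 define good where "good k w = (eta * real n <= real k --> typical e w)" for k w
 define f where "f k u v = (if drop (n - k) v = drop (n - k) u \<and> good k (drop (n - k) u) then X (drop (n - k) u) else 0)" for k u v
 have f0: "f k u v >= 0" for k u v using X0 by (simp add: f_def)
 have pt: "m u * m v * b u v <= (if v = u then L * m u * m u else 0) + (\<Sum>k<n. m u * (m v * f k u v))"
  if u: "u \<in> ?G" and v: "v \<in> ?G" for u v
 proof (cases "u = v")
  case True
  have "0 <= (\<Sum>k<n. m u * (m v * f k u v))" by (intro sum_nonneg mult_nonneg_nonneg f0) auto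
  moreover have "m u * m v * b u v <= m u * m v * L" using b by (intro mult_left_mono) auto
  ultimately show ?thesis using True by (simp add: mult_ac)
 next
  case False
  have l: "length u = n" "length v = n" using u v by auto
  \<comment> \<open>The least \<open>k\<close> for which one more letter from the end reveals a
    difference, so that exactly the last \<open>k\<close> letters agree.\<close>
  define k where "k = (LEAST k. drop (n - Suc k) u \<noteq> drop (n - Suc k) v)"
  have ex: "drop (n - Suc n) u \<noteq> drop (n - Suc n) v" using False by simp
  have k1: "drop (n - Suc k) u \<noteq> drop (n - Suc k) v" unfolding k_def by (rule LeastI[of "%k. drop (n - Suc k) u \<noteq> drop (n - Suc k) v", OF ex])
  have k2: "drop (n - k) u = drop (n - k) v"
  proof (cases k)
   case (Suc k')
   thus ?thesis using not_less_Least[of k' "%k. drop (n - Suc k) u \<noteq> drop (n - Suc k) v"] by (simp add: k_def)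
  qed (simp add: l)
  have kn: "k < n"
  proof (rule ccontr)
   assume "\<not> k < n"
   hence "n - Suc k = n - k" by simp
   with k1 k2 show False by simp
  qed
  have "u ! (n - k - 1) \<noteq> v ! (n - k - 1)"
  proof
   assume "u ! (n - k - 1) = v ! (n - k - 1)"
   moreover have "drop (n - Suc k) x = x ! (n - k - 1) # drop (n - k) x" if "length x = n" for x :: "'k list"
    using that kn Cons_nth_drop_Suc[of "n - Suc k" x] by (simp add: Suc_diff_Suc)
   ultimately show False using k1 k2 l by simp
  qed
  from b2[OF l kn k2 this] have "b u v <= B * exp (e * real k) * dec c n / tau (drop (n - k) u)" .
  also have "... <= X (drop (n - k) u)" unfolding X_def using LB e kn by (intro divide_right_mono mult_right_mono mult_left_mono) (auto intro: less_imp_le)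
  also have "... = f k u v" using G[of u k] u kn l k2 by (simp add: f_def good_def)
  finally have "m u * (m v * b u v) <= m u * (m v * f k u v)" by (intro mult_left_mono) auto
  also have "... <= (\<Sum>k<n. m u * (m v * f k u v))" using kn by (intro member_le_sum mult_nonneg_nonneg f0) auto
  finally show ?thesis using False by (simp add: mult.assoc)
 qed
 have Xm: "good k w ==> X w * m w <= B * dec (?k - 4 * e) n" if w: "length w = k" and k: "k < n" for k w
 proof -
  assume g: "good k w"
  have "m w / tau w <= exp ((c - ?k + 3 * e) * real n)"
  proof (cases "eta * real n <= real k")
   case True
   hence ty: "typical e w" using g by (simp add: good_def)
   have "m w / tau w <= dec (h - e) k / dec (chi + 2 * e) k"
    using typ_bounds(1,8)[OF ty] w by (intro frac_le) auto
   also have "... = exp ((chi - h) * real k + 3 * e * real k)" by (simp add: exp_diff[symmetric] algebra_simps)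
   also have "... <= exp ((c - ?k) * real n + 3 * e * real n)"
   proof -
    have "(chi - h) * real k <= (c - ?k) * real k" by (intro mult_right_mono) auto
    also have "... <= (c - ?k) * real n" using k by (intro mult_left_mono) auto
    finally show ?thesis using k e by (simp add: add_mono)
   qed
   finally show ?thesis by (simp add: distrib_right)
  next
   case False
   have kp: "kap ^ k = exp (- (real k * (- ln kap)))" using kap(1) by (simp add: exp_of_nat_mult)
   have "real k * (- ln kap) <= eta * real n * (- ln kap)" using False kap by (intro mult_right_mono) auto
   also have "... <= e * real n" using mult_right_mono[OF e(4), of "real n"] by (simp add: mult_ac)
   finally have "exp (- (e * real n)) <= kap ^ k" unfolding kp by simp
   hence "exp (- (e * real n)) <= tau w" using tau_ge_power[of w] w by simp
   hence "m w / tau w <= 1 / exp (- (e * real n))" by (intro frac_le) auto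
   also have "... <= exp ((c - ?k + 3 * e) * real n)"
   proof -
    have "e * real n <= (c - ?k + 3 * e) * real n" using e by (intro mult_right_mono) auto
    thus ?thesis by (simp only: exp_minus divide_inverse inverse_inverse_eq mult_1_left exp_le_cancel_iff)
   qed
   finally show ?thesis .
  qed
  hence "B * exp (e * real n) * dec c n * (m w / tau w) <= B * exp (e * real n) * dec c n * exp ((c - ?k + 3 * e) * real n)"
   using LB by (intro mult_left_mono) auto
  also have "... = B * dec (?k - 4 * e) n" by (simp only: mult.assoc exp_add[symmetric]) (simp add: algebra_simps)
  finally show ?thesis by (simp add: X_def)
 qed
 have level: "(\<Sum>u\<in>words n. \<Sum>v\<in>words n. m u * (m v * f k u v)) <= B * dec (?k - 4 * e) n" if k: "k < n" for k
 proof -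
  have inner: "(\<Sum>v\<in>words n. m v * f k u v) = (if good k (drop (n - k) u) then X (drop (n - k) u) * m (drop (n - k) u) else 0)" if "length u = n" for u
  proof -
   let ?w = "drop (n - k) u"
   have "(\<Sum>v\<in>words n. m v * f k u v) = (\<Sum>v\<in>words k. m v * (if v = ?w \<and> good k ?w then X ?w else 0))"
    using suffix_sum[of k n "%v. if v = ?w \<and> good k ?w then X ?w else 0"] k by (simp add: f_def)
   also have "... = (\<Sum>v\<in>words k. if v = ?w then (if good k ?w then X ?w * m ?w else 0) else 0)" by (intro sum.cong) auto
   finally show ?thesis using that k by (simp add: sum.delta)
  qed
  have "(\<Sum>u\<in>words n. \<Sum>v\<in>words n. m u * (m v * f k u v)) = (\<Sum>u\<in>words n. m u * (if good k (drop (n - k) u) then X (drop (n - k) u) * m (drop (n - k) u) else 0))"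
   unfolding sum_distrib_left[symmetric] using inner by (intro sum.cong) auto
  also have "... = (\<Sum>w\<in>words k. m w * (if good k w then X w * m w else 0))"
   using suffix_sum[of k n "%w. if good k w then X w * m w else 0"] k by simp
  also have "... <= (\<Sum>w\<in>words k. m w * (B * dec (?k - 4 * e) n))"
   using Xm k LB by (intro sum_mono mult_left_mono) auto
  finally show ?thesis by (simp add: sum_distrib_right[symmetric])
 qed
 have fin: "finite ?G" by (rule finite_subset[OF _ finite_words[of n]]) auto
 have "(\<Sum>u\<in>?G. \<Sum>v\<in>?G. m u * m v * b u v) <= (\<Sum>u\<in>?G. \<Sum>v\<in>?G. (if v = u then L * m u * m u else 0) + (\<Sum>k<n. m u * (m v * f k u v)))"
  by (intro sum_mono pt)
 also have "... = (\<Sum>u\<in>?G. L * m u * m u) + (\<Sum>u\<in>?G. \<Sum>v\<in>?G. \<Sum>k<n. m u * (m v * f k u v))"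
  using fin by (simp add: sum.distrib sum.delta)
 also have "(\<Sum>u\<in>?G. L * m u * m u) <= L * dec (?k - 4 * e) n"
 proof -
  have "m u <= dec (?k - 4 * e) n" if "u \<in> ?G" for u
  proof -
   have "eta * real n <= real n" using mult_right_mono[OF e(3), of "real n"] by simp
   hence "typical e u" using G[of u n] that by simp
   hence "m u <= dec (h - e) n" using typ_bounds(1)[of e u] that by simp
   also have "... <= dec (?k - 4 * e) n"
   proof -
    have "(?k - 4 * e) * real n <= (h - e) * real n" using c e by (intro mult_right_mono) auto
    thus ?thesis by (simp only: mult_minus_left exp_le_cancel_iff neg_le_iff_le)
   qed
   finally show ?thesis .
  qed
  hence "(\<Sum>u\<in>?G. L * m u * m u) <= (\<Sum>u\<in>?G. L * m u * dec (?k - 4 * e) n)"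
   using LB by (intro sum_mono mult_left_mono) auto
  also have "... = msum n G * (L * dec (?k - 4 * e) n)" by (simp add: msum_def sum_distrib_left sum_distrib_right mult_ac)
  also have "... <= 1 * (L * dec (?k - 4 * e) n)" using LB msum_le_1 by (intro mult_right_mono) auto
  finally show ?thesis by simp
 qed
 also have "(\<Sum>u\<in>?G. \<Sum>v\<in>?G. \<Sum>k<n. m u * (m v * f k u v)) <= (\<Sum>u\<in>words n. \<Sum>v\<in>words n. \<Sum>k<n. m u * (m v * f k u v))"
  by (intro order_trans[OF sum_mono[OF sum_mono2] sum_mono2] sum_nonneg mult_nonneg_nonneg f0) auto
 also have "... = (\<Sum>k<n. \<Sum>u\<in>words n. \<Sum>v\<in>words n. m u * (m v * f k u v))"
  by (simp only: sum.swap[of _ _ "{..<n}"])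
 also have "... <= (\<Sum>k<n. B * dec (?k - 4 * e) n)" by (intro sum_mono level) auto
 finally show ?thesis by (simp add: distrib_right mult_ac)
qed

end

section \<open>Transversality and almost every parameter\<close>

lemma arcsin_le:
 assumes "0 <= x" "x <= 1 / 2"
 shows "arcsin x <= 2 * x"
proof (cases "x = 0")
 case False
 let ?t = "arcsin x"
 have t: "0 < ?t" "?t <= pi / 2" using False assms arcsin_less_mono[of 0 x] arcsin_bounded[of x] by auto
 obtain z where z: "0 < z" "z < ?t" "sin ?t - sin 0 = (?t - 0) * cos z"
  using MVT2[of 0 ?t sin cos] t by (auto intro: DERIV_sin)
 have "x^2 <= (1 / 2)^2" using assms by (intro power_mono) auto
 hence "(1 / 2)^2 <= 1 - x\<^sup>2" by (simp add: power2_eq_square)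
 hence "1 / 2 <= sqrt (1 - x\<^sup>2)" by (rule real_le_rsqrt)
 also have "... = cos ?t" using assms by (simp add: cos_arcsin)
 also have "... <= cos z" using z t by (intro cos_monotone_0_pi_le) auto
 finally have "?t * (1 / 2) <= ?t * cos z" using t by (intro mult_left_mono) auto
 also have "... = x" using z(3) assms by simp
 finally show ?thesis by simp
qed simp

lemma continuous_on_word_prod:
 assumes "\<And>k. continuous_on S (%p. A p k)"
 shows "continuous_on S (%p. word_prod (A p) w)"
proof (induction w)
 case (Cons k w)
 have "continuous_on S (%p. A p k ** word_prod (A p) w)"
  unfolding matrix_matrix_mult_def by (intro continuous_on_vec_lambda continuous_intros assms Cons)
 thus ?case by (simp add: word_prod_Cons)
qed simp

lemma mnorm_diff: "mnorm M <= mnorm N + (\<Sum>i\<in>UNIV. \<Sum>j\<in>UNIV. \<bar>(M - N) $ i $ j\<bar>)"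
proof (rule mnorm_le)
 fix v
 have "norm (M *v v) <= norm (N *v v) + norm ((M - N) *v v)"
  using norm_triangle_ineq[of "N *v v" "(M - N) *v v"] by (simp add: matrix_vector_mult_diff_rdistrib)
 also have "... <= mnorm N * norm v + mnorm (M - N) * norm v" by (intro add_mono mnorm_pos)
 also have "mnorm (M - N) <= (\<Sum>i\<in>UNIV. \<Sum>j\<in>UNIV. \<bar>(M - N) $ i $ j\<bar>)" unfolding mnorm_def by (rule onorm_le_matrix_component_sum)
 finally show "norm (M *v v) <= (mnorm N + (\<Sum>i\<in>UNIV. \<Sum>j\<in>UNIV. \<bar>(M - N) $ i $ j\<bar>)) * norm v"
  by (simp add: distrib_right mult_right_mono)
qed

lemma eventually_mnorm_le:
 assumes "(M \<longlongrightarrow> N) F" "mnorm N < b"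
 shows "\<forall>\<^sub>F p in F. mnorm (M p) <= b"
proof -
 have "((%p. mnorm N + (\<Sum>i\<in>UNIV. \<Sum>j\<in>UNIV. \<bar>(M p - N) $ i $ j\<bar>)) \<longlongrightarrow> mnorm N + (\<Sum>i\<in>UNIV. \<Sum>j\<in>UNIV. \<bar>(N - N) $ i $ j\<bar>)) F"
  by (intro tendsto_intros assms)
 hence "\<forall>\<^sub>F p in F. mnorm N + (\<Sum>i\<in>UNIV. \<Sum>j\<in>UNIV. \<bar>(M p - N) $ i $ j\<bar>) < b" using assms(2) by (intro order_tendstoD(2)) auto
 thus ?thesis by eventually_elim (use mnorm_diff in \<open>fastforce intro: less_imp_le le_less_trans\<close>)
qed


locale affine_family =
 fixes U :: "(real^'d) set" and A :: "real^'d => 'k::finite => real^2^2" and t :: "real^'d => 'k => real^2"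
  and \<phi> :: "real^'d => 'k left_word => real" and mu :: "real^'d => 'k left_word measure" and C :: "real^'d => real"
  and T :: real
 assumes U: "open U" "bounded U"
  and sys: "p \<in> U ==> affine_system (mu p) (C p) (A p) (t p)"
  and cont: "continuous_on U (%p. A p k)"
  and gibbs: "p \<in> U ==> gibbs_measure (\<phi> p) (mu p)"
  and ucp: "uniformly_continuously_parametrized U \<phi>"
  and T: "T > 0"
  and transversal: "[|i 0 \<noteq> j 0; r > 0|] ==> emeasure lebesgue {p\<in>U. line_angle (ess_line (A p) i) (ess_line (A p) j) < r} <= ennreal (T * r)"
begin

abbreviation ev :: "real^'d => (nat => 'k) => real^2" where "ev p \<equiv> dominated.evec (A p)"
abbreviation dr :: "real^'d => 'k list => real^2" where "dr p \<equiv> affine_system.dir (A p)"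
abbreviation tau :: "real^'d => 'k list => real" where "tau p \<equiv> matrix_family.tau (A p)"
abbreviation m :: "real^'d => 'k list => real" where "m p \<equiv> word_measure.m (mu p)"
abbreviation msum :: "real^'d => nat => ('k list => bool) => real" where "msum p \<equiv> word_system.msum (mu p)"

lemma dr_eq: "p \<in> U ==> dr p w = ev p (conc (rev w) (%_. undefined))"
 by (rule affine_system.dir_def[OF sys])

lemma near: "p0 \<in> U ==> (\<forall>\<^sub>F p in at p0 within U. Q p) ==> Q p0 ==> \<exists>de>0. \<forall>p\<in>U. dist p p0 < de --> Q p"
 unfolding eventually_at by (metis)

text \<open>Continuity controls the finitely many words of length at most \<open>q\<close>, and
  longer words are cut into blocks of length \<open>q\<close>. A block costs the fixed factor
  \<open>D\<close>, which is at most \<open>exp (e * q)\<close> once \<open>q\<close> is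
  large.\<close>

lemma a1_compare:
 assumes p0: "p0 \<in> U" and e: "e > 0"
 shows "\<exists>de>0. \<exists>D>0. \<forall>p\<in>U. dist p p0 < de --> (\<forall>w. matrix_family.a1 (A p) w <= D * exp (e * len w) * matrix_family.a1 (A p0) w)"
proof -
 interpret P0: affine_system "mu p0" "C p0" "A p0" "t p0" by (rule sys[OF p0])
 \<comment> \<open>\<open>exp 1\<close> pays for perturbing a short product, \<open>P0.K\<close> for
   splitting the norm of the unperturbed one.\<close>
 define D where "D = exp 1 * P0.K"
 have D: "D >= exp 1" using P0.K(1) by (simp add: D_def)
 obtain q :: nat where q: "ln D / e < real q" using reals_Archimedean2 by blast
 have D1: "ln D >= 1" using D by (simp add: ln_ge_iff less_le_trans[OF exp_gt_zero])
 have D0: "D > 0" using less_le_trans[OF exp_gt_zero D] .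
 have "0 < ln D / e" using D1 e by simp
 hence q0: "real q > 0" using q by linarith
 have qe: "D <= exp (e * real q)"
 proof -
  have "ln D <= e * real q" using q e by (simp add: divide_less_eq mult.commute)
  hence "exp (ln D) <= exp (e * real q)" by simp
  thus ?thesis using less_le_trans[OF exp_gt_zero D] by simp
 qed
 have "\<forall>\<^sub>F p in at p0 within U. mnorm (word_prod (A p) w) <= exp 1 * P0.a1 w" for w
 proof (rule eventually_mnorm_le)
  show "((%p. word_prod (A p) w) \<longlongrightarrow> word_prod (A p0) w) (at p0 within U)"
   using continuous_on_word_prod[of U A w, OF cont] p0 by (simp add: continuous_on)
  show "mnorm (word_prod (A p0) w) < exp 1 * P0.a1 w" using P0.a1_pos[of w] by (simp add: P0.a1_def)
 qed
 hence evw: "\<forall>\<^sub>F p in at p0 within U. \<forall>w\<in>(\<Union>n\<le>q. words n). mnorm (word_prod (A p) w) <= exp 1 * P0.a1 w"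
  by (intro eventually_ball_finite) auto
 have "\<forall>w\<in>(\<Union>n\<le>q. words n). mnorm (word_prod (A p0) w) <= exp 1 * P0.a1 w" using P0.a1_pos by (simp add: P0.a1_def)
 from near[OF p0 evw this] obtain de where d: "de > 0" "\<forall>p\<in>U. dist p p0 < de --> (\<forall>w\<in>(\<Union>n\<le>q. words n). mnorm (word_prod (A p) w) <= exp 1 * P0.a1 w)"
  by blast
 have de: "de > 0" "\<And>p w. p \<in> U ==> dist p p0 < de ==> length w <= q ==> mnorm (word_prod (A p) w) <= exp 1 * P0.a1 w"
  using d by auto
 have "matrix_family.a1 (A p) w <= D * exp (e * len w) * P0.a1 w" if p: "p \<in> U" "dist p p0 < de" for p w
 proof -
  interpret P: affine_system "mu p" "C p" "A p" "t p" by (rule sys[OF p(1)])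
  have le: "P.a1 w <= exp 1 * P0.a1 w" if "length w <= q" for w using de(2)[OF p that] by (simp add: P.a1_def)
  show ?thesis
  proof (induction w rule: length_induct)
   case (1 w)
   show ?case
   proof (cases "length w <= q")
    case True
    have "exp 1 * 1 <= D * exp (e * len w)" using D D0 e by (intro mult_mono) auto
    hence "exp 1 * P0.a1 w <= D * exp (e * len w) * P0.a1 w" by (intro mult_right_mono) (auto intro: less_imp_le)
    thus ?thesis using le[OF True] by linarith
   next
    case False
    define u v where "u = take q w" and "v = drop q w"
    have w: "w = u @ v" "length u = q" "len w = real q + len v" using False by (auto simp: u_def v_def)
    have IH: "P.a1 v <= D * exp (e * len v) * P0.a1 v" using 1 w q0 by simp
    have "P.a1 w <= P.a1 u * P.a1 v" unfolding w(1) by (rule P.a1_append_le)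
    also have "... <= (exp 1 * P0.a1 u) * (D * exp (e * len v) * P0.a1 v)"
     using IH w(2) D0 by (intro mult_mono le) (auto intro: less_imp_le)
    also have "... = (exp 1 * D * exp (e * len v)) * (P0.a1 u * P0.a1 v)" by simp
    also have "... <= (exp 1 * D * exp (e * len v)) * (P0.K * P0.a1 w)"
     unfolding w(1) using D D0 by (intro mult_left_mono P0.K) auto
    also have "... = D * (D * exp (e * len v)) * P0.a1 w" by (simp add: D_def)
    also have "... <= D * (exp (e * real q) * exp (e * len v)) * P0.a1 w"
     using qe less_le_trans[OF exp_gt_zero D] by (intro mult_right_mono mult_left_mono) (auto intro: less_imp_le)
    also have "exp (e * real q) * exp (e * len v) = exp (e * len w)" unfolding w(3) by (simp add: distrib_left exp_add)
    finally show ?thesis .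
   qed
  qed
 qed
 thus ?thesis using de(1) less_le_trans[OF exp_gt_zero D] by blast
qed

text \<open>\<open>tau\<close> is the determinant over the squared norm: one third of
  \<open>e\<close> goes to the determinants, compared letter by letter, and two thirds to the square
  of the norm.\<close>

lemma tau_compare:
 assumes p0: "p0 \<in> U" and e: "e > 0"
 shows "\<exists>de>0. \<exists>D>0. \<forall>p\<in>U. dist p p0 < de --> (\<forall>w. tau p0 w <= D * exp (e * len w) * tau p w)"
proof -
 interpret P0: affine_system "mu p0" "C p0" "A p0" "t p0" by (rule sys[OF p0])
 have "e / 3 > 0" using e by simp
 from a1_compare[OF p0 this] obtain de1 D where 1: "de1 > 0" "D > 0"
  "\<And>p w. p \<in> U ==> dist p p0 < de1 ==> matrix_family.a1 (A p) w <= D * exp (e / 3 * len w) * P0.a1 w" by blast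
 have "\<forall>\<^sub>F p in at p0 within U. \<bar>det (A p0 k)\<bar> < exp (e / 3) * \<bar>det (A p k)\<bar>" for k
 proof (rule order_tendstoD(1))
  have "((%p. A p k) \<longlongrightarrow> A p0 k) (at p0 within U)" using cont p0 by (simp add: continuous_on)
  thus "((%p. exp (e / 3) * \<bar>det (A p k)\<bar>) \<longlongrightarrow> exp (e / 3) * \<bar>det (A p0 k)\<bar>) (at p0 within U)"
   unfolding det_2 by (intro tendsto_intros)
  show "\<bar>det (A p0 k)\<bar> < exp (e / 3) * \<bar>det (A p0 k)\<bar>" using P0.det_A[of k] e by simp
 qed
 from eventually_mono[OF this less_imp_le]
 have "\<forall>\<^sub>F p in at p0 within U. \<bar>det (A p0 k)\<bar> <= exp (e / 3) * \<bar>det (A p k)\<bar>" for k .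
 hence evd: "\<forall>\<^sub>F p in at p0 within U. \<forall>k. \<bar>det (A p0 k)\<bar> <= exp (e / 3) * \<bar>det (A p k)\<bar>"
  by (rule eventually_all_finite)
 have "\<forall>k. \<bar>det (A p0 k)\<bar> <= exp (e / 3) * \<bar>det (A p0 k)\<bar>" using e by (simp add: mult_le_cancel_right1)
 from near[OF p0 evd this] obtain de2 where 2: "de2 > 0" "\<And>p k. p \<in> U ==> dist p p0 < de2 ==> \<bar>det (A p0 k)\<bar> <= exp (e / 3) * \<bar>det (A p k)\<bar>"
  by blast
 have "tau p0 w <= D^2 * exp (e * len w) * tau p w" if p: "p \<in> U" "dist p p0 < min de1 de2" for p w
 proof -
  interpret P: affine_system "mu p" "C p" "A p" "t p" by (rule sys[OF p(1)])
  let ?x = "exp (e / 3 * len w)"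
  have dt: "P0.dt w <= ?x * P.dt w"
  proof (induction w)
   case Nil
   show ?case by (simp add: P0.dt_def P.dt_def)
  next
   case (Cons k w)
   have "P0.dt (k # w) = \<bar>det (A p0 k)\<bar> * P0.dt w" using P0.dt_append[of "[k]" w] by (simp add: P0.dt_def)
   also have "... <= (exp (e / 3) * \<bar>det (A p k)\<bar>) * (exp (e / 3 * len w) * P.dt w)"
    using 2(2)[of p k] p Cons by (intro mult_mono) (auto intro: less_imp_le)
   also have "... = exp (e / 3 * len ((k # w))) * P.dt (k # w)"
    using P.dt_append[of "[k]" w] by (simp add: P.dt_def distrib_left exp_add)
   finally show ?case .
  qed
  have "P.a1 w <= D * ?x * P0.a1 w" using 1(3)[of p w] p by simp
  hence "(P.a1 w)^2 <= (D * ?x * P0.a1 w)^2" by (intro power_mono) (auto intro: less_imp_le)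
  hence "P0.dt w / (P0.a1 w)^2 <= (?x * P.dt w) * ((D * ?x)^2 / (P.a1 w)^2)"
  proof -
   assume a: "(P.a1 w)^2 <= (D * ?x * P0.a1 w)^2"
   have "1 / (P0.a1 w)^2 <= (D * ?x)^2 / (P.a1 w)^2"
    using a P0.a1_pos[of w] P.a1_pos[of w] by (simp add: field_simps power_mult_distrib)
   hence "P0.dt w * (1 / (P0.a1 w)^2) <= (?x * P.dt w) * ((D * ?x)^2 / (P.a1 w)^2)"
    using dt by (intro mult_mono) (auto intro: less_imp_le mult_nonneg_nonneg)
   thus ?thesis by simp
  qed
  also have "... = D^2 * (?x * ?x * ?x) * P.tau w" by (simp add: P.tau_eq power2_eq_square)
  also have "?x * ?x * ?x = exp (e * len w)" unfolding exp_add[symmetric] by simp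
  finally show ?thesis by (simp add: P0.tau_eq)
 qed
 thus ?thesis using 1 2 by (intro exI[of _ "min de1 de2"] conjI exI[of _ "D^2"]) auto
qed

text \<open>The squares of the wedges are pointwise limits of functions continuous on
  \<open>U\<close> and zero outside it; \<open>wedge_sq_eq\<close> builds the required wedge from
  them.\<close>

lemma wedge_measurable: "{p \<in> U. Q \<bar>wedge (ev p i) (ev p j)\<bar>} \<in> sets borel" if "{x. Q x} \<in> sets borel"
proof -
 define q where "q j z p = (if p \<in> U then (wedge (ev p j) z)\<^sup>2 else 0)" for j z p
 have [measurable]: "q j z \<in> borel_measurable borel" for j z
 proof (rule borel_measurable_LIMSEQ_real)
  let ?N = "%p k z. norm (word_prod (A p) (fw j k) *v z)"
  let ?f = "%k p. (?N p k z)\<^sup>2 / ((?N p k (axis 1 1))^2 + (?N p k (axis 2 1))^2)"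
  show "(%k. if p \<in> U then ?f k p else 0) ----> q j z p" for p
  proof (cases "p \<in> U")
   case True
   interpret P: affine_system "mu p" "C p" "A p" "t p" by (rule sys[OF True])
   show ?thesis using P.wedge_evec_limit[of j z] True by (simp add: q_def)
  qed (simp add: q_def)
  have Nc: "continuous_on U (%p. ?N p k z)" for k z
   unfolding matrix_vector_mult_def by (intro continuous_on_norm continuous_on_vec_lambda continuous_intros continuous_on_word_prod cont)
  have Nm: "(%p. if p \<in> U then ?N p k z else 0) \<in> borel_measurable borel" for k z
   using borel_measurable_continuous_on_if[OF borel_open[OF U(1)] Nc continuous_on_const] by simp
  have "(%p. (if p \<in> U then ?N p k z else 0)\<^sup>2 / ((if p \<in> U then ?N p k (axis 1 1) else 0)^2 + (if p \<in> U then ?N p k (axis 2 1) else 0)^2)) \<in> borel_measurable borel" for k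
   by (intro borel_measurable_divide borel_measurable_power borel_measurable_add Nm)
  also have "(%p. (if p \<in> U then ?N p k z else 0)\<^sup>2 / ((if p \<in> U then ?N p k (axis 1 1) else 0)^2 + (if p \<in> U then ?N p k (axis 2 1) else 0)^2)) = (%p. if p \<in> U then ?f k p else 0)" for k
   by auto
  finally show "(%p. if p \<in> U then ?f k p else 0) \<in> borel_measurable borel" for k .
 qed
 define W where "W p = sqrt (q i (axis 2 1) p * q j (axis 1 1) p + q i (axis 1 1) p * q j (axis 2 1) p
  - (q i (axis 1 1) p + q i (axis 2 1) p - q i (axis 1 1 + axis 2 1) p) * (q j (axis 1 1) p + q j (axis 2 1) p - q j (axis 1 1 + axis 2 1) p) / 2)" for p
 have Wm: "W \<in> borel_measurable borel" unfolding W_def by measurable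
 have "{p \<in> U. Q \<bar>wedge (ev p i) (ev p j)\<bar>} = U \<inter> W -` {x. Q x}"
 proof -
  have "\<bar>wedge (ev p i) (ev p j)\<bar> = W p" if "p \<in> U" for p
  proof -
   interpret P: affine_system "mu p" "C p" "A p" "t p" by (rule sys[OF that])
   have "W p = sqrt ((wedge (ev p i) (ev p j))^2)" unfolding P.wedge_sq_eq Let_def W_def q_def using that by simp
   thus ?thesis by simp
  qed
  thus ?thesis by auto
 qed
 moreover have "W -` {x. Q x} \<in> sets borel" using measurable_sets[OF Wm that] by simp
 ultimately show ?thesis using borel_open[OF U(1)] by auto
qed

lemma emeasure_U: "emeasure lborel U < \<infinity>"
 using emeasure_bounded_finite[OF U(2)] by simp

lemma U_fm: "U \<in> fmeasurable lborel"
 using U(1) emeasure_U by (intro fmeasurableI) auto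

text \<open>Transversality speaks of angles, the estimates of sines, and \<open>arcsin\<close> at
  most doubles arguments up to \<open>1 / 2\<close>. Radii above \<open>1 / 4\<close> are covered by
  the volume of \<open>U\<close>, which is the other summand of the constant.\<close>

lemma transversal_wedge: "\<exists>B\<ge>0. \<forall>i j r. i 0 \<noteq> j 0 --> r > 0 --> measure lborel {p \<in> U. \<bar>wedge (ev p i) (ev p j)\<bar> <= r} <= B * r"
proof -
 let ?B = "4 * measure lborel U + 4 * T"
 have "measure lborel {p \<in> U. \<bar>wedge (ev p i) (ev p j)\<bar> <= r} <= ?B * r" if ij: "i 0 \<noteq> j 0" and r: "r > 0" for i j r
 proof (cases "r <= 1 / 4")
  case True
  have sets: "{p \<in> U. \<bar>wedge (ev p i) (ev p j)\<bar> < 2 * r} \<in> sets borel" by (rule wedge_measurable) simp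
  have "measure lborel {p \<in> U. \<bar>wedge (ev p i) (ev p j)\<bar> <= r} <= measure lborel {p \<in> U. \<bar>wedge (ev p i) (ev p j)\<bar> < 2 * r}"
  proof (rule measure_mono_fmeasurable)
   show "{p \<in> U. \<bar>wedge (ev p i) (ev p j)\<bar> <= r} \<in> sets lborel" using wedge_measurable[of "%x. x <= r"] by simp
   show "{p \<in> U. \<bar>wedge (ev p i) (ev p j)\<bar> < 2 * r} \<in> fmeasurable lborel"
    by (rule fmeasurableI2[OF U_fm]) (use sets in auto)
  qed (use r in auto)
  also have "{p \<in> U. \<bar>wedge (ev p i) (ev p j)\<bar> < 2 * r} = {p \<in> U. line_angle (ess_line (A p) i) (ess_line (A p) j) < arcsin (2 * r)}"
  proof -
   have "line_angle (ess_line (A p) i) (ess_line (A p) j) < arcsin (2 * r) \<longleftrightarrow> \<bar>wedge (ev p i) (ev p j)\<bar> < 2 * r" if "p \<in> U" for p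
   proof -
    interpret P: affine_system "mu p" "C p" "A p" "t p" by (rule sys[OF that])
    show ?thesis using r True by (intro P.line_angle_less) auto
   qed
   thus ?thesis by auto
  qed
  finally have *: "measure lborel {p \<in> U. \<bar>wedge (ev p i) (ev p j)\<bar> <= r} <= measure lborel {p \<in> U. line_angle (ess_line (A p) i) (ess_line (A p) j) < arcsin (2 * r)}" (is "_ <= measure lborel ?S") .
  have S: "?S \<in> sets borel"
   using sets unfolding \<open>{p \<in> U. \<bar>wedge (ev p i) (ev p j)\<bar> < 2 * r} = ?S\<close> .
  have a0: "0 < arcsin (2 * r)" using r True arcsin_less_mono[of 0 "2 * r"] by simp
  have "emeasure lborel ?S <= ennreal (T * arcsin (2 * r))" using transversal[of i j, OF ij a0] S by simp
  hence "measure lborel ?S <= T * arcsin (2 * r)" using T a0 by (simp add: measure_def enn2real_leI)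
  also have "... <= T * (2 * (2 * r))" using T r True by (intro mult_left_mono arcsin_le) auto
  finally show ?thesis 
   using * mult_nonneg_nonneg[OF measure_nonneg[of lborel U] less_imp_le[OF r]] unfolding distrib_right by linarith
 next
  case False
  have "measure lborel {p \<in> U. \<bar>wedge (ev p i) (ev p j)\<bar> <= r} <= measure lborel U"
   using wedge_measurable[of "%x. x <= r"] by (intro measure_mono_fmeasurable[OF _ _ U_fm]) auto
  also have "... * 1 <= measure lborel U * (4 * r)" using False by (intro mult_left_mono) auto
  finally show ?thesis using T r by (simp add: distrib_right add_increasing2)
 qed
 thus ?thesis using T by (intro exI[of _ ?B]) auto
qed

text \<open>The factor two in the radius leaves room for replacing a word by its suffix in
  \<open>direction_regularI\<close>.\<close>

definition scale_regular :: "real => real => real^'d => bool" where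
 "scale_regular c g p \<longleftrightarrow> (\<exists>J. expsmall (%n. msum p n (%w. \<not> J w)) \<and>
  (EV n. \<forall>th. norm th = 1 -->
    msum p n (%w. J w \<and> \<bar>wedge (dr p w) th\<bar> <= 2 * dec c n) <= dec g n))"

end


context affine_family
begin

text \<open>Second moment method. Words are weighted by \<open>mu p0\<close>, and the mass of pairs
  with close directions is integrated over parameters near \<open>p0\<close>, where transversality
  makes it small. Markov and Borel-Cantelli give smallness at almost every such parameter
  \<open>p\<close>, and \<open>gibbs_compare\<close> then replaces \<open>mu p0\<close> by
  \<open>mu p\<close>.\<close>

lemma local_scale_regular:
 assumes p0: "p0 \<in> U" and c: "0 < c" "c <= word_system.chi (mu p0) (A p0)" and g: "g < c"
  "g < word_system.h (mu p0) - (word_system.chi (mu p0) (A p0) - c)"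
 shows "\<exists>de>0. AE p in lborel. p \<in> U --> dist p p0 < de --> scale_regular c g p"
proof -
 interpret P0: affine_system "mu p0" "C p0" "A p0" "t p0" by (rule sys[OF p0])
 \<comment> \<open>An eighth of the slack: \<open>pair_sum\<close> takes four \<open>e\<close>,
   Markov's inequality in the parameter and then in the word one each, and the last two pay for the
   change of measure.\<close>
 define e where "e = (min c (P0.h - (P0.chi - c)) - g) / 8"
 have e: "e > 0" "min c (P0.h - (P0.chi - c)) - 4 * e = g + 4 * e" using g by (auto simp: e_def field_simps)
 define eta where "eta = min 1 (e / (1 - ln P0.kap))"
 have kap: "- ln P0.kap >= 0" using P0.kap(1) P0.kap(3) by simp
 have eta: "0 < eta" "eta <= 1" using e(1) kap by (auto simp: eta_def)
 have "eta * (- ln P0.kap) <= e / (1 - ln P0.kap) * (1 - ln P0.kap)"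
  using kap e(1) by (intro mult_mono) (auto simp: eta_def)
 hence etae: "eta * (- ln P0.kap) <= e" using kap by simp
 define G where "G w = (\<forall>k\<le>length w. eta * len w <= real k --> P0.typical e (drop (length w - k) w))" for w
 have "expsmall (%n. msum p0 n (%w. \<not> G w))"
  by (rule expsmall_mono[OF P0.expsmall_suffix[OF P0.expsmall_typ[OF e(1)] eta(1)]])
   (auto intro!: always_eventually P0.msum_mono simp: G_def)
 then obtain gam where gam: "gam > 0" "EV n. msum p0 n (%w. \<not> G w) <= dec gam n"
  unfolding expsmall_def by blast
 \<comment> \<open>Small against both rates, so that the factor \<open>exp (2 * e' * n)\<close> of
   the change of measure preserves exponential smallness.\<close>
 define e' where "e' = min gam e / 4"
 have e': "e' > 0" "4 * e' <= gam" "4 * e' <= e" using gam e by (auto simp: e'_def)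
 obtain de1 D where 1: "de1 > 0" "D > 0" "\<And>p w. p \<in> U ==> dist p p0 < de1 ==> tau p0 w <= D * exp (e * len w) * tau p w"
  using tau_compare[OF p0 e(1)] by blast
 obtain de2 where 2: "de2 > 0" "\<And>p i. p \<in> U ==> norm (p - p0) < de2 ==> \<bar>\<phi> p i - \<phi> p0 i\<bar> < e'"
  using ucp p0 e'(1) unfolding uniformly_continuously_parametrized_def by blast
 define de where "de = min de1 de2"
 define V where "V = U \<inter> ball p0 de"
 obtain B0 where B0: "B0 >= 0" "\<And>i j r. i 0 \<noteq> j 0 ==> r > 0 ==> measure lborel {p \<in> U. \<bar>wedge (ev p i) (ev p j)\<bar> <= r} <= B0 * r"
  using transversal_wedge by blast
 define E where "E n u v = {p \<in> V. \<bar>wedge (dr p u) (dr p v)\<bar> <= 4 * dec c n}" for n u v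
 have Vs: "V \<in> sets borel" unfolding V_def using U(1) by (intro sets.Int borel_open) auto
 have Es: "E n u v \<in> sets borel" for n u v
 proof -
  have "E n u v = V \<inter> {p \<in> U. \<bar>wedge (ev p (conc (rev u) (%_. undefined))) (ev p (conc (rev v) (%_. undefined)))\<bar> <= 4 * dec c n}"
   using dr_eq by (auto simp: E_def V_def)
  thus ?thesis using Vs wedge_measurable[of "%x. x <= 4 * dec c n"] by simp
 qed
 have fm: "S \<in> fmeasurable lborel" if "S \<subseteq> U" "S \<in> sets borel" for S using that by (intro fmeasurableI2[OF U_fm]) auto
 have EU: "E n u v \<subseteq> U" for n u v unfolding E_def V_def by blast
 have Ef: "E n u v \<in> fmeasurable lborel" for n u v by (rule fm[OF EU Es])
 define L where "L = measure lborel U"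
 define B where "B = 4 * D * B0"
 have LB: "L >= 0" "B >= 0" using B0 1 by (auto simp: L_def B_def)
 have pairs: "(\<Sum>u | u \<in> words n \<and> G u. \<Sum>v | v \<in> words n \<and> G v. m p0 u * m p0 v * measure lborel (E n u v)) <=
   (L + B * real n) * dec (g + 4 * e) n" for n
  unfolding e(2)[symmetric]
 proof (rule P0.pair_sum[OF e(1) eta etae c(2) LB])
  show "P0.typical e (drop (n - k) w)" if "length w = n" "G w" "k <= n" "eta * real n <= real k" for w k
   using that by (auto simp: G_def)
  show "measure lborel (E n u v) <= L" for u v
   unfolding L_def by (rule measure_mono_fmeasurable[OF EU _ U_fm]) (simp add: Es)
  fix u v :: "'k list" and k assume l: "length u = n" "length v = n" and k: "k < n" "drop (n - k) u = drop (n - k) v"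
   and ne: "u ! (n - k - 1) \<noteq> v ! (n - k - 1)"
  let ?w = "drop (n - k) u"
  let ?i = "%u :: 'k list. conc (rev u) (%_. undefined)"
  have fwu: "fw (?i u) k = ?w" "fw (?i v) k = ?w"
  proof -
   have *: "length x = n ==> fw (?i x) k = drop (n - k) x" for x :: "'k list"
   proof -
    assume that: "length x = n"
    have "rev x = rev (drop (n - k) x) @ rev (take (n - k) x)" by (metis append_take_drop_id rev_append)
    moreover have "length (drop (n - k) x) = k" using that k by simp
    ultimately show ?thesis using fw_conc[of "drop (n - k) x" k] by (simp add: conc_append)
   qed
   show "fw (?i u) k = ?w" "fw (?i v) k = ?w" using *[of u] *[of v] l k(2) by simp_all
  qed
  have d0: "length x = n ==> shl k (?i x) 0 = x ! (n - k - 1)" for x :: "'k list"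
   using k(1) by (simp add: shl_def conc_def rev_nth)
  define r where "r = 4 * D * exp (e * real k) * dec c n / tau p0 ?w"
  have r: "r > 0" using 1(2) P0.tau_pos by (simp add: r_def)
  \<comment> \<open>The radius must not depend on the parameter, so \<open>tau\<close> at
    \<open>p\<close> is traded for \<open>tau\<close> at \<open>p0\<close> before transversality is
    applied to the words beyond the common suffix.\<close>
  have "E n u v \<subseteq> {p \<in> U. \<bar>wedge (ev p (shl k (?i u))) (ev p (shl k (?i v)))\<bar> <= r}"
  proof
   fix p assume p: "p \<in> E n u v"
   hence pU: "p \<in> U" "dist p p0 < de1" by (auto simp: E_def V_def de_def dist_commute)
   interpret P: affine_system "mu p" "C p" "A p" "t p" by (rule sys[OF pU(1)])
   let ?W = "\<bar>wedge (P.evec (shl k (?i u))) (P.evec (shl k (?i v)))\<bar>"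
   have "tau p0 ?w * ?W <= (D * exp (e * real k) * P.tau ?w) * ?W"
    using 1(3)[OF pU, of ?w] l k by (intro mult_right_mono) auto
   also have "... = (D * exp (e * real k)) * (P.tau ?w * ?W)" by simp
   also have "... <= (D * exp (e * real k)) * (4 * dec c n)"
    using P.wedge_evec_prefix[OF fwu] p 1(2) by (intro mult_left_mono) (auto simp: E_def P.dir_def)
   finally have "?W <= r" using P0.tau_pos[of ?w] by (simp add: r_def pos_le_divide_eq mult_ac)
   with pU show "p \<in> {p \<in> U. \<bar>wedge (ev p (shl k (?i u))) (ev p (shl k (?i v)))\<bar> <= r}" by simp
  qed
  hence "measure lborel (E n u v) <= measure lborel {p \<in> U. \<bar>wedge (ev p (shl k (?i u))) (ev p (shl k (?i v)))\<bar> <= r}"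
   using Es[of n u v] wedge_measurable[of "%x. x <= r"] by (intro measure_mono_fmeasurable fm) auto
  also have "... <= B0 * r" using ne d0[of u] d0[of v] l by (intro B0(2) r) auto
  finally show "measure lborel (E n u v) <= B * exp (e * real k) * dec c n / tau p0 ?w"
   by (simp add: B_def r_def mult_ac)
 qed
 define S where "S n p = (\<Sum>u | u \<in> words n \<and> G u. \<Sum>v | v \<in> words n \<and> G v. m p0 u * m p0 v * indicator (E n u v) p)" for n p
 have Si: "integrable lborel (S n)" for n
  unfolding S_def using Ef by (intro b_integrable_sum integrable_mult_right) (auto simp: fmeasurable_def)
 have "integral\<^sup>L lborel (S n) = (\<Sum>u | u \<in> words n \<and> G u. \<Sum>v | v \<in> words n \<and> G v. m p0 u * m p0 v * measure lborel (E n u v))" for n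
 proof -
  have ii: "integrable lborel (%p. m p0 u * m p0 v * indicator (E n u v) p)" for u v
   using Ef by (intro integrable_mult_right) (auto simp: fmeasurable_def)
  have "integral\<^sup>L lborel (%p. m p0 u * m p0 v * indicator (E n u v) p) = m p0 u * m p0 v * measure lborel (E n u v)" for u v
   using Es[of n u v] by simp
  thus ?thesis unfolding S_def
   by (simp only: b_integral_sum b_integrable_sum ii)
 qed
 with pairs have ints: "integral\<^sup>L lborel (S n) <= (L + B * real n) * dec (g + 4 * e) n" for n by simp
 have S0: "S n p >= 0" for n p unfolding S_def by (intro sum_nonneg mult_nonneg_nonneg) auto
 define X where "X n = {p. dec (g + 3 * e) n <= S n p}" for n
 have Sm: "S n \<in> borel_measurable borel" for n using borel_measurable_integrable[OF Si[of n]] by simp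
 have Xs: "X n \<in> sets borel" for n unfolding X_def using Sm[of n] by measurable
 have XM: "measure lborel (X n) <= (L + B * real n) * dec e n" "emeasure lborel (X n) < \<infinity>" for n
 proof -
  have "measure lborel (X n) <= integral\<^sup>L lborel (S n) / dec (g + 3 * e) n"
   using integral_Markov_inequality_measure[OF Si[of n], of "{}" "dec (g + 3 * e) n"] S0 by (simp add: X_def)
  also have "... <= (L + B * real n) * dec (g + 4 * e) n / dec (g + 3 * e) n" by (intro divide_right_mono ints) simp
  also have "... = (L + B * real n) * dec e n"
   unfolding times_divide_eq_right[symmetric] exp_diff[symmetric] by (simp add: algebra_simps)
  finally show "measure lborel (X n) <= (L + B * real n) * dec e n" .
  have "emeasure lborel (X n) <= ennreal (1 / dec (g + 3 * e) n * integral\<^sup>L lborel (S n))"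
   using integral_Markov_inequality[OF Si[of n], of "dec (g + 3 * e) n"] S0 by (simp add: X_def)
  thus "emeasure lborel (X n) < \<infinity>" by (rule le_less_trans) simp
 qed
 have "expsmall (%n. measure lborel (X n))"
  by (rule expsmallI[OF e(1), where a = L and b = B]) (intro always_eventually allI XM)
 hence "AE p in lborel. EV n. p \<in> space lborel - X n"
  using Xs XM by (intro borel_cantelli_AE1 expsmall_summable) auto
 hence "AE p in lborel. p \<in> U --> dist p p0 < de --> scale_regular c g p"
 proof eventually_elim
  case (elim p)
  show ?case
  proof (intro impI)
   assume p: "p \<in> U" "dist p p0 < de"
   hence pV: "p \<in> V" by (simp add: V_def dist_commute)
   interpret P: affine_system "mu p" "C p" "A p" "t p" by (rule sys[OF p(1)])
   have "norm (p - p0) < de2" using p(2) by (simp add: de_def dist_norm)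
   hence "\<bar>\<phi> p i - \<phi> p0 i\<bar> <= e'" for i using 2(2)[OF p(1), of i] by simp
   from gibbs_compare[OF gibbs[OF p(1)] gibbs[OF p0] this] obtain Dg where Dg: "Dg > 0"
    "\<And>w. P.m w <= Dg * exp (2 * e' * len w) * P0.m w" by (auto simp: P.m_def P0.m_def)
   have ms: "P.msum n Q <= Dg * exp (2 * e' * real n) * P0.msum n Q" for n Q
   proof -
    have "P.msum n Q <= (\<Sum>w | w \<in> words n \<and> Q w. Dg * exp (2 * e' * real n) * P0.m w)"
     unfolding P.msum_def using Dg(2) by (intro sum_mono) auto
    thus ?thesis by (simp add: P0.msum_def sum_distrib_left)
   qed
   define gs where "gs w = P0.msum (length w) (%v. G v \<and> \<bar>wedge (P.dir w) (P.dir v)\<bar> <= 4 * dec c (length w))" for w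
   have gs0: "gs w >= 0" for w unfolding gs_def by (rule P0.msum_nonneg)
   have Sgs: "S n p = (\<Sum>u | u \<in> words n \<and> G u. P0.m u * gs u)" for n
    unfolding S_def
   proof (intro sum.cong refl)
    fix u assume "u \<in> {u. u \<in> words n \<and> G u}"
    hence u: "length u = n" by simp
    have fin: "finite {v. v \<in> words n \<and> G v}" by (rule finite_subset[OF _ finite_words[of n]]) auto
    have "(\<Sum>v | v \<in> words n \<and> G v. P0.m u * P0.m v * indicator (E n u v) p) =
      (\<Sum>v | v \<in> words n \<and> G v. P0.m u * (if \<bar>wedge (P.dir u) (P.dir v)\<bar> <= 4 * dec c n then P0.m v else 0))"
     using pV by (intro sum.cong) (auto simp: E_def indicator_def)
    also have "... = P0.m u * gs u"
    proof -
     have "{v. v \<in> words n \<and> G v \<and> \<bar>wedge (P.dir u) (P.dir v)\<bar> <= 4 * dec c n} =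
      {v \<in> {v. v \<in> words n \<and> G v}. \<bar>wedge (P.dir u) (P.dir v)\<bar> <= 4 * dec c n}" by blast
     thus ?thesis unfolding gs_def u P0.msum_def sum_distrib_left[symmetric] by (simp only: sum.inter_filter[OF fin])
    qed
    finally show "(\<Sum>v | v \<in> words n \<and> G v. P0.m u * P0.m v * indicator (E n u v) p) = P0.m u * gs u" .
   qed
   define J where "J w = (G w \<and> gs w < dec (g + 2 * e) (length w))" for w
   have bad: "EV n. P.msum n (%w. \<not> J w) <= (2 * Dg + 0 * real n) * dec (2 * e') n"
    using elim gam(2)
   proof eventually_elim
    case (elim n)
    let ?t = "dec (g + 2 * e) n"
    have fin: "finite {v. v \<in> words n \<and> G v}" by (rule finite_subset[OF _ finite_words[of n]]) auto
    have "P0.msum n (%w. G w \<and> ?t <= gs w) * ?t = (\<Sum>u | u \<in> words n \<and> G u \<and> ?t <= gs u. P0.m u * ?t)"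
     by (simp add: P0.msum_def sum_distrib_right)
    also have "... <= (\<Sum>u | u \<in> words n \<and> G u \<and> ?t <= gs u. P0.m u * gs u)" by (intro sum_mono mult_left_mono) auto
    also have "... <= S n p" unfolding Sgs using fin gs0 by (intro sum_mono2) auto
    also have "... <= dec (g + 3 * e) n" using elim(1) by (simp add: X_def)
    also have "... = dec e n * ?t" by (simp add: exp_add[symmetric] algebra_simps)
    finally have s1: "P0.msum n (%w. G w \<and> ?t <= gs w) <= dec e n" by (simp only: mult_le_cancel_right_pos exp_gt_zero)
    have "P0.msum n (%w. \<not> J w) <= P0.msum n (%w. \<not> G w \<or> (G w \<and> ?t <= gs w))"
     by (rule P0.msum_mono) (auto simp: J_def not_less)
    also have "... <= P0.msum n (%w. \<not> G w) + P0.msum n (%w. G w \<and> ?t <= gs w)" by (rule P0.msum_disj)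
    also have "... <= dec (4 * e') n + dec (4 * e') n"
    proof (intro add_mono)
     show "P0.msum n (%w. \<not> G w) <= dec (4 * e') n"
      by (rule order_trans[OF elim(2)]) (use mult_right_mono[OF e'(2), of "real n"] in simp)
     show "P0.msum n (%w. G w \<and> ?t <= gs w) <= dec (4 * e') n"
      by (rule order_trans[OF s1]) (use mult_right_mono[OF e'(3), of "real n"] in simp)
    qed
    finally have "Dg * exp (2 * e' * real n) * P0.msum n (%w. \<not> J w) <= Dg * exp (2 * e' * real n) * (2 * dec (4 * e') n)"
     using Dg(1) by (intro mult_left_mono) auto
    also have "... = 2 * Dg * (exp (2 * e' * real n) * dec (4 * e') n)" by simp
    also have "exp (2 * e' * real n) * dec (4 * e') n = dec (2 * e') n" unfolding exp_add[symmetric] by simp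
    finally show ?case using ms[of n "%w. \<not> J w"] by simp
   qed
   have Jsmall: "expsmall (%n. P.msum n (%w. \<not> J w))" using e'(1) by (intro expsmallI[OF _ bad]) simp
   have "(%n. Dg * dec (2 * e - 2 * e') n) ----> 0" using e'(1,3) by real_asymp
   hence "EV n. Dg * dec (2 * e - 2 * e') n < 1" by (rule order_tendstoD) simp
   hence "EV n. \<forall>th. norm th = 1 -->
     P.msum n (%w. J w \<and> \<bar>wedge (P.dir w) th\<bar> <= 2 * dec c n) <= dec g n"
   proof eventually_elim
    case (elim n)
    show ?case
    proof (intro allI impI)
     fix th :: "real^2" assume th: "norm th = 1"
     let ?Q = "%w. J w \<and> \<bar>wedge (P.dir w) th\<bar> <= 2 * dec c n"
     have "P0.msum n ?Q <= dec (g + 2 * e) n"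
     \<comment> \<open>If the arc contains the direction of some word \<open>u\<close> in
       \<open>J\<close>, all its other words have directions within \<open>4 * dec c n\<close> of
       that one, so \<open>gs u\<close> bounds the mass of the arc. This explains the radius used
       for pairs.\<close>
     proof (cases "\<exists>u. length u = n \<and> ?Q u")
      case True
      then obtain u where u: "length u = n" "?Q u" by blast
      have "P0.msum n ?Q <= gs u" unfolding gs_def u(1)
      proof (rule P0.msum_mono)
       fix w assume "length w = n" and w: "?Q w"
       have "\<bar>wedge th (P.dir w)\<bar> <= 2 * dec c n" using w by (subst wedge_commute) simp
       thus "G w \<and> \<bar>wedge (P.dir u) (P.dir w)\<bar> <= 4 * dec c n"
        using wedge_triangle[OF th, of "P.dir u" "P.dir w"] u w P.dir(1) by (simp add: J_def)
      qed
      thus ?thesis using u by (simp add: J_def)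
     next
      case False
      hence "{w. w \<in> words n \<and> ?Q w} = {}" by auto
      hence "P0.msum n ?Q = 0" unfolding P0.msum_def by (simp only: sum.empty)
      thus ?thesis by simp
     qed
     hence "Dg * exp (2 * e' * real n) * P0.msum n ?Q <= Dg * exp (2 * e' * real n) * dec (g + 2 * e) n"
      using Dg(1) by (intro mult_left_mono) auto
     also have "... = (Dg * dec (2 * e - 2 * e') n) * dec g n" by (simp add: exp_add[symmetric] algebra_simps)
     also have "... <= 1 * dec g n" using elim by (intro mult_right_mono) auto
     finally show "P.msum n ?Q <= dec g n" using ms[of n ?Q] by simp
    qed
   qed
   with Jsmall show "scale_regular c g p" unfolding scale_regular_def by blast
  qed
 qed
 moreover have "de > 0" using 1 2 by (simp add: de_def)
 ultimately show ?thesis by blast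
qed

text \<open>The null set of \<open>local_scale_regular\<close> depends on the base point, but a set
  that is negligible near each of its points is negligible. Keeping \<open>c\<close> and
  \<open>g\<close> fixed while the exponents vary with \<open>p\<close> allows countably many pairs
  to be treated at once.\<close>

lemma negligible_irregular:
 "negligible {p \<in> U. 0 < c \<and> c <= word_system.chi (mu p) (A p) \<and> g < c \<and>
   g < word_system.h (mu p) - (word_system.chi (mu p) (A p) - c) \<and> \<not> scale_regular c g p}" (is "negligible ?N")
 unfolding locally_negligible_alt[of ?N]
proof
 fix p0 assume p0: "p0 \<in> ?N"
 then obtain de where de: "de > 0" "AE p in lborel. p \<in> U --> dist p p0 < de --> scale_regular c g p"
  using local_scale_regular[of p0 c g] by blast
 from AE_completion[OF this(2)] obtain Z where Z: "Z \<in> null_sets lebesgue"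
  "{p. \<not> (p \<in> U --> dist p p0 < de --> scale_regular c g p)} \<subseteq> Z"
  unfolding eventually_ae_filter by auto
 have "negligible (?N \<inter> ball p0 de)"
  by (rule negligible_subset[of Z]) (use Z in \<open>auto simp: negligible_iff_null_sets dist_commute\<close>)
 moreover have "openin (top_of_set ?N) (?N \<inter> ball p0 de)" by (rule openin_open_Int) simp
 ultimately show "\<exists>V. openin (top_of_set ?N) V \<and> p0 \<in> V \<and> negligible V" using p0 de(1) by (intro exI[of _ "?N \<inter> ball p0 de"]) simp
qed

text \<open>Rational \<open>c\<close> slightly below \<open>chi\<close> and \<open>g\<close>
  slightly below \<open>min chi h\<close> are chosen after the parameter, so that only countably
  many null sets have been discarded.\<close>

lemma AE_direction_regular:
 "AE p in lebesgue. p \<in> U --> affine_system.direction_regular (mu p) (A p)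
   (min 1 (word_system.h (mu p) / word_system.chi (mu p) (A p)))"
proof -
 have "AE p in lebesgue. \<forall>c g :: rat. \<not> (p \<in> U \<and> 0 < real_of_rat c \<and> real_of_rat c <= word_system.chi (mu p) (A p) \<and> real_of_rat g < real_of_rat c \<and>
   real_of_rat g < word_system.h (mu p) - (word_system.chi (mu p) (A p) - real_of_rat c) \<and> \<not> scale_regular (real_of_rat c) (real_of_rat g) p)"
  unfolding AE_all_countable
 proof (intro allI)
  fix c g :: rat
  show "AE p in lebesgue. \<not> (p \<in> U \<and> 0 < real_of_rat c \<and> real_of_rat c <= word_system.chi (mu p) (A p) \<and> real_of_rat g < real_of_rat c \<and>
   real_of_rat g < word_system.h (mu p) - (word_system.chi (mu p) (A p) - real_of_rat c) \<and> \<not> scale_regular (real_of_rat c) (real_of_rat g) p)"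
   using AE_not_in[OF negligible_irregular[of "real_of_rat c" "real_of_rat g", unfolded negligible_iff_null_sets]] by simp
 qed
 thus ?thesis
 proof eventually_elim
  case (elim p)
  show ?case
  proof
   assume p: "p \<in> U"
   interpret P: affine_system "mu p" "C p" "A p" "t p" by (rule sys[OF p])
   show "P.direction_regular (min 1 (P.h / P.chi))"
   \<comment> \<open>For zero entropy the exponent is zero and the bound by the total mass suffices;
     positive entropy leaves room for a nonnegative \<open>g\<close>.\<close>
   proof (cases "P.h = 0")
    case True
    have "expsmall (%n. 0)" by (rule expsmallI[of 1 _ 0 0]) auto
    hence "P.direction_regular 0" unfolding P.direction_regular_def P.direction_bound_def
    proof (intro allI impI exI[of _ "%_. True"] conjI always_eventually)
     show "expsmall (%n. P.msum n (%w. \<not> True))" if "expsmall (%n. 0)" using that by (simp add: P.msum_def)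
     fix e :: real and n th and r :: real assume e: "e > 0" and r: "dec P.chi n <= r"
     have "r > 0" using r exp_gt_zero less_le_trans by blast
     hence "1 <= exp (e * real n) * r powr 0" using e by simp
     with P.msum_le_1 show "P.msum n (%w. True \<and> \<bar>wedge (P.dir w) th\<bar> <= r) <= exp (e * real n) * r powr 0" by (rule order_trans)
    qed
    thus ?thesis using True by simp
   next
    case False
    hence h: "P.h > 0" using P.h_nonneg by simp
    show ?thesis
    proof (rule P.direction_regular_closed)
     fix de :: real assume de: "de > 0"
     let ?m = "min P.chi P.h"
     \<comment> \<open>\<open>2 * x <= de * chi\<close> gives \<open>g / chi\<close> the required
       precision, and \<open>4 * x <= min chi h\<close> keeps \<open>c\<close> positive,
       \<open>g\<close> nonnegative and both strict inequalities for \<open>g\<close> valid.\<close>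
     define x where "x = min (de * P.chi / 2) (?m / 4)"
     have x: "x > 0" "2 * x <= de * P.chi" "4 * x <= ?m" using de h P.chi_pos by (auto simp: x_def)
     obtain c where c: "P.chi - x < real_of_rat c" "real_of_rat c < P.chi" using of_rat_dense[of "P.chi - x" P.chi] x by auto
     obtain g where g: "?m - 2 * x < real_of_rat g" "real_of_rat g < ?m - x" using of_rat_dense[of "?m - 2 * x" "?m - x"] x by auto
     have x4: "4 * x <= P.chi" "4 * x <= P.h" "?m <= P.chi" "?m <= P.h" using x(3) by simp_all
     have cp: "0 < real_of_rat c" using c(1) x4 x(1) by linarith
     have gp: "0 <= real_of_rat g" using g(1) x by linarith
     have gc: "real_of_rat g < real_of_rat c" using g(2) x4 c(1) by linarith
     have gh: "real_of_rat g < P.h - (P.chi - real_of_rat c)" using g(2) x4 c(1) by linarith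
     from elim[rule_format, of c g] have "scale_regular (real_of_rat c) (real_of_rat g) p" using p cp less_imp_le[OF c(2)] gc gh by blast
     then obtain J where J: "expsmall (%n. P.msum n (%w. \<not> J w))"
      "EV n. \<forall>th. norm th = 1 --> P.msum n (%w. J w \<and> \<bar>wedge (P.dir w) th\<bar> <= 2 * exp (- real_of_rat c * real n)) <= exp (- real_of_rat g * real n)"
      unfolding scale_regular_def by blast
     have "P.direction_regular (real_of_rat g / P.chi)"
      by (rule P.direction_regularI[OF cp c(2) gp J])
     moreover have "min 1 (P.h / P.chi) - de <= real_of_rat g / P.chi"
     proof -
      have "(min 1 (P.h / P.chi) - de) * P.chi = ?m - de * P.chi" using P.chi_pos by (simp add: left_diff_distrib min_def field_simps)
      also have "... <= real_of_rat g" using g x by linarith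
      finally show ?thesis using P.chi_pos by (simp add: pos_le_divide_eq)
     qed
     ultimately show "\<exists>s'\<ge>min 1 (P.h / P.chi) - de. P.direction_regular s'" by blast
    qed
   qed
  qed
 qed
qed

end

theorem theorem4p2:
  fixes U :: "(real^'d) set"
    and A :: "real^'d \<Rightarrow> 'k::finite \<Rightarrow> real^2^2"
    and t :: "real^'d \<Rightarrow> 'k \<Rightarrow> real^2"
    and \<phi> :: "real^'d \<Rightarrow> 'k left_word \<Rightarrow> real"
    and \<mu> :: "real^'d \<Rightarrow> 'k left_word measure"
  assumes "open U" and "bounded U"
    and "\<And>p k. p \<in> U \<Longrightarrow> invertible (A p k)"
    and "\<And>p k. p \<in> U \<Longrightarrow> onorm (\<lambda>v. A p k *v v) < 1"
    and "\<And>p. p \<in> U \<Longrightarrow> strong_separation (affine_ifs (A p) (t p))"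
    and "strong_stable_transversality U A"
    and "\<And>p. p \<in> U \<Longrightarrow> hoelder_continuous (\<phi> p)"
    and "uniformly_continuously_parametrized U \<phi>"
    and "\<And>p. p \<in> U \<Longrightarrow> gibbs_measure (\<phi> p) (\<mu> p)"
    and "\<And>p. p \<in> U \<Longrightarrow> ergodic_measure (\<mu> p) right_shift"
    and "\<And>p. p \<in> U \<Longrightarrow>
           (let h = shift_entropy (\<mu> p);
                chis = chi_s (A p) (\<mu> p);
                chiss = chi_ss (A p) (\<mu> p)
            in h / (chiss - chis) \<ge> min 1 (h / chis) \<or> h / (chiss - chis) + 2 * (h / chiss) > 2)"
  shows "AE p in lebesgue. p \<in> U \<longrightarrow>
           (let h = shift_entropy (\<mu> p);
                chis = chi_s (A p) (\<mu> p);
                chiss = chi_ss (A p) (\<mu> p)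
            in hausdorff_dim_measure
                 (distr (\<mu> p) borel (natural_projection (affine_ifs (A p) (t p))))
               = ereal (min (h / chis) (1 + (h - chis) / chiss)))"
proof -
  have UC: "U \<subseteq> closure U" by (rule closure_subset)
  obtain V where V: "closure U \<subseteq> V" "\<And>k. continuous_on V (\<lambda>p. A p k)"
    using assms(6) unfolding strong_stable_transversality_def by blast
  have dom: "\<And>p. p \<in> U \<Longrightarrow> dominated_splitting (A p)"
    using assms(6) UC unfolding strong_stable_transversality_def by blast
  obtain T where T: "T > 0" "\<And>i j r. \<lbrakk>i 0 \<noteq> j 0; r > 0\<rbrakk> \<Longrightarrow>
      emeasure lebesgue {p\<in>U. line_angle (ess_line (A p) i) (ess_line (A p) j) < r} \<le> ennreal (T * r)"
    using assms(6) unfolding strong_stable_transversality_def by blast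
  have "\<exists>c. quasi_bernoulli (\<mu> p) c" if "p \<in> U" for p
    using gibbs_quasi_bernoulli[OF assms(9)[OF that] assms(10)[OF that]] .
  then obtain C where C: "\<And>p. p \<in> U \<Longrightarrow> quasi_bernoulli (\<mu> p) (C p)" by metis
  have sys: "affine_system (\<mu> p) (C p) (A p) (t p)" if p: "p \<in> U" for p
  proof -
    interpret quasi_bernoulli "\<mu> p" "C p" by (rule C[OF p])
    interpret dominated "A p"
      by unfold_locales (use assms(3)[OF p] dom[OF p] in \<open>auto simp: invertible_2\<close>)
    show ?thesis by unfold_locales (use assms(4)[OF p] assms(5)[OF p] in \<open>auto simp: mnorm_def\<close>)
  qed
  have contU: "continuous_on U (\<lambda>p. A p k)" for k using V(2) by (rule continuous_on_subset) (use V(1) UC in blast)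
  interpret affine_family U A t \<phi> \<mu> C T
    by (rule affine_family.intro[OF assms(1,2) sys contU assms(9,8) T])
  show ?thesis using AE_direction_regular
  proof eventually_elim
    case (elim p)
    show ?case
    proof
      assume p: "p \<in> U"
      interpret P: affine_system "\<mu> p" "C p" "A p" "t p" by (rule sys[OF p])
      have "P.h / P.chi \<ge> min 1 (P.h / P.xs) \<or> P.h / P.chi + 2 * (P.h / P.xss) > 2"
        using assms(11)[OF p] by (simp add: Let_def P.chi_def P.h_def P.xs_def P.xss_def)
      from P.dimension_formula[OF elim[rule_format, OF p] this]
      show "let h = shift_entropy (\<mu> p); chis = chi_s (A p) (\<mu> p); chiss = chi_ss (A p) (\<mu> p)
            in hausdorff_dim_measure (distr (\<mu> p) borel (natural_projection (affine_ifs (A p) (t p))))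
               = ereal (min (h / chis) (1 + (h - chis) / chiss))"
        by (simp add: Let_def P.h_def P.xs_def P.xss_def)
    qed
  qed
qed

end
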